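(* Let $0<p<\infty$, and let $s>1/4$ if $p\le4$ and $s>1/2-1/p$ if $p>4$. Let $R_s(x)=\sum_{n=1}^\infty n^{-2s}e^{2\pi i n^2x}$ and $S_{s,p}(\ell)=\int_{\mathbb T}|R_s(x+\ell)-R_s(x)|^p\,dx$. Then for all sufficiently small $\ell>0$ (implicit constants depending on $s,p$ but not $\ell$): \begin{itemize} \item if $s<5/4$: $S_{s,p}(\ell)^{1/p}\simeq\ell^{s-1/4}$ for $p<4$; $S_{s,4}(\ell)^{1/4}\simeq\ell^{s-1/4}\log(\ell^{-1})^{1/4}$; $S_{s,p}(\ell)^{1/p}\simeq\ell^{s+1/p-1/2}$ for $p>4$; \item if $s=5/4$: $S_{5/4,p}(\ell)^{1/p}\simeq\ell\log(\ell^{-1})^{1/2}$ for $p<4$; $S_{5/4,p}(\ell)^{1/p}\simeq\ell^{3/4+1/p}$ for $p>4$; and $\ell\log(\ell^{-1})^{1/2}\lesssim S_{5/4,4}(\ell)^{1/4}\lesssim\ell\log(\ell^{-1})^{3/4}$; \item if $5/4<s<3/2$: $S_{s,p}(\ell)^{1/p}\simeq\ell$ for $p<2/(3-2s)$; $S_{s,p}(\ell)^{1/p}\simeq\ell^{s+1/p-1/2}$ for $p>2/(3-2s)$; for $p=2/(3-2s)$, $\ell\lesssim S_{s,p}(\ell)^{1/p}\lesssim\ell\log(\ell^{-1})^{1/2}$, and moreover if $p=2/(3-2s)$ is an even integer then $\ell\log(\ell^{-1})^{1/p}\lesssim S_{s,p}(\ell)^{1/p}\lesssim\ell\log(\ell^{-1})^{1/2}$;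 \item if $s\ge3/2$: $S_{s,p}(\ell)^{1/p}\simeq\ell$ for all $p>0$. \end{itemize}
   Context: $\mathbb T=\mathbb R/\mathbb Z$. For $s\le1/2$, $R_s$ is understood as the limit in $L^p(\mathbb T)$ of its partial sums. *)

theory Defs
  imports "HOL-Analysis.Analysis"
begin

definition Rs_partial :: "real \<Rightarrow> nat \<Rightarrow> real \<Rightarrow> complex" where
  "Rs_partial \<sigma> N x = sum (\<lambda>n. complex_of_real (real n powr (- (2*\<sigma>))) * cis (2*pi*(real n)^2 * x)) {1..N}"

text \<open>f is an L^p([0,1]) limit of the partial sums (T = R/Z identified with [0,1)).\<close>
definition is_Rs :: "real \<Rightarrow> real \<Rightarrow> (real \<Rightarrow> complex) \<Rightarrow> bool" where
  "is_Rs \<sigma> p f \<longleftrightarrow> f \<in> borel_measurable lborel \<and>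
     ((\<lambda>N. \<integral>\<^sup>+ x\<in>{0..1}. ennreal (cmod (f x - Rs_partial \<sigma> N x) powr p) \<partial>lborel)
        \<longlongrightarrow> 0) sequentially"

definition Rs :: "real \<Rightarrow> real \<Rightarrow> real \<Rightarrow> complex" where
  "Rs \<sigma> p = (SOME f. is_Rs \<sigma> p f)"

definition S_sp :: "real \<Rightarrow> real \<Rightarrow> real \<Rightarrow> real" where
  "S_sp \<sigma> p l = (LINT x:{0..1}|lborel. cmod (Rs \<sigma> p (frac (x + l)) - Rs \<sigma> p x) powr p)"

definition lesssim0 :: "(real \<Rightarrow> real) \<Rightarrow> (real \<Rightarrow> real) \<Rightarrow> bool" where
  "lesssim0 f g \<longleftrightarrow> (\<exists>C>0. \<forall>\<^sub>F l in at_right 0. f l \<le> C * g l)"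

definition simeq0 :: "(real \<Rightarrow> real) \<Rightarrow> (real \<Rightarrow> real) \<Rightarrow> bool" where
  "simeq0 f g \<longleftrightarrow> lesssim0 f g \<and> lesssim0 g f"

end

theory Submission
  imports Defs
begin

text \<open>
  Since \<open>e(n\<^sup>2(x+\<ell>)) - e(n\<^sup>2x) = 2\<i> sin(\<pi>n\<^sup>2\<ell>) e(n\<^sup>2(x+\<ell>/2))\<close>, the increment of \<open>R\<^sub>s\<close> has, up to a translation,
  the real coefficients \<open>n\<^sup>-\<^sup>2\<^sup>s sin(\<pi>n\<^sup>2\<ell>)\<close>. They behave like \<open>\<ell>n\<^sup>2\<^sup>-\<^sup>2\<^sup>s\<close> for \<open>n \<le> N = \<ell>\<^sup>-\<^sup>1\<^sup>/\<^sup>2\<close> and like \<open>n\<^sup>-\<^sup>2\<^sup>s\<close> beyond.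

  Upper bounds. Weyl differencing with a piecewise linear cut-off of length \<open>L\<close> loses no logarithm and gives
  \<open>|S(x)|\<^sup>2 \<lesssim> L\<^sup>2 / (q(1 + L\<^sup>2|x - a/q|))\<close> with \<open>q \<le> 8L\<close>. Integrating over all \<open>a/q\<close> bounds the \<open>p\<close>-norm by
  \<open>L\<^sup>1\<^sup>/\<^sup>2\<close> for \<open>2 < p < 4\<close>, by \<open>L\<^sup>1\<^sup>/\<^sup>2 (log L)\<^sup>1\<^sup>/\<^sup>4\<close> for \<open>p = 4\<close> and by \<open>L\<^sup>1\<^sup>-\<^sup>2\<^sup>/\<^sup>p\<close> for \<open>p > 4\<close>. Sharp cut-offs
  and power weights follow by summation by parts, and the dyadic blocks add up geometrically, except when all
  blocks \<open>n \<le> N\<close> have the same size: there one needs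
  \<open>\<parallel>\<Sum>f\<^sub>j\<parallel>\<^sub>p\<^sup>2 \<lesssim> \<Sum>\<parallel>f\<^sub>j\<parallel>\<^sub>p\<^sup>2\<close>, which holds because \<open>\<integral>|F|\<^sup>p\<^sup>-\<^sup>2 \<langle>F, f\<^sub>j\<rangle>\<close> is small, by integration by parts, when \<open>F\<close>
  collects the lower frequencies.

  Lower bounds. Parseval (interpolated against the 3-norm when \<open>p < 2\<close>) covers \<open>p < 4\<close>, and testing against a Fejer
  kernel of order \<open>1/\<ell>\<close> covers \<open>p > 4\<close>. At \<open>p = 4\<close> the logarithm comes from the solutions of
  \<open>n\<^sub>1\<^sup>2 + n\<^sub>2\<^sup>2 = n\<^sub>3\<^sup>2 + n\<^sub>4\<^sup>2\<close>, and at an even critical exponent \<open>p = 2k\<close> from the Fourier coefficients of the \<open>k\<close>-th power in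
  the dyadic ranges of frequencies: there is no cancellation, since the coefficients involved are positive.
\<close>

section \<open>Norms of continuous functions on the unit interval\<close>

text \<open>Every estimate is made for a partial sum, uniformly over \<open>N\<close> with
  \<open>1/l \<le> real N\<close>, and is carried to the limit function only at the end. The
  condition on \<open>N\<close> keeps all n with n^2 l \<le> 1 in the sum, and these already carry
  the claimed size. Two obstacles shape the rest. The coefficients have no fixed sign once n^2 l >
  1, so each lower bound must look at low frequencies only: through squares, through a kernel whose
  order stops before the first sign change, or through windows of small sums of squares. And the
  powers of the logarithm are part of the claim: hence tents in place of sharp cut-offs in the Weyl
  step, and the quadratic summation of blocks at the critical exponent. The Weyl bound lives at
  exponents above 2, because a power p/2 > 1 has to be integrated around each rational; smaller p
  are served from exponent 3, which has the same growth. For p < 1 there is no triangle inequality,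
  so Minkowski is confined to the exponents of the Weyl bound, and the passage to the limit uses
  only (x+y)^p \<le> 2^p (x^p + y^p).\<close>

definition Lp_norm :: "real \<Rightarrow> (real \<Rightarrow> complex) \<Rightarrow> real" where
  "Lp_norm p f = integral {0..1} (\<lambda>x. cmod (f x) powr p) powr (1/p)"

lemma continuous_cmod_powr:
  fixes f :: "real \<Rightarrow> complex"
  assumes "continuous_on S f" "p > 0"
  shows "continuous_on S (\<lambda>x. cmod (f x) powr p)"
  using assms by (intro continuous_on_powr' continuous_intros) auto

lemma integrable_cmod_powr:
  fixes f :: "real \<Rightarrow> complex"
  assumes "continuous_on UNIV f" "p > 0"
  shows "(\<lambda>x. cmod (f x) powr p) integrable_on {0..1}"
  by (rule integrable_continuous_interval)
     (rule continuous_on_subset[OF continuous_cmod_powr[OF assms]], simp)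

lemma integral_cmod_powr_nonneg: "0 \<le> integral {0..1} (\<lambda>x. cmod (f x) powr p)"
proof (cases "(\<lambda>x. cmod (f x) powr p) integrable_on {0..1}")
  case True thus ?thesis by (intro integral_nonneg) auto
qed (simp add: not_integrable_integral)

lemma Lp_norm_nonneg [simp]: "0 \<le> Lp_norm p f"
  by (simp add: Lp_norm_def)

lemma Lp_norm_powr:
  "p > 0 \<Longrightarrow> Lp_norm p f powr p = integral {0..1} (\<lambda>x. cmod (f x) powr p)"
  by (simp add: Lp_norm_def powr_powr integral_cmod_powr_nonneg)

lemma Lp_norm_leI:
  assumes "p > 0" "0 \<le> a" "integral {0..1} (\<lambda>x. cmod (f x) powr p) \<le> a powr p"
  shows "Lp_norm p f \<le> a"
proof -
  have "Lp_norm p f \<le> (a powr p) powr (1/p)"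
    unfolding Lp_norm_def using assms by (intro powr_mono2) (auto simp: integral_cmod_powr_nonneg)
  thus ?thesis using assms by (simp add: powr_powr)
qed

lemma Lp_norm_geI:
  assumes "p > 0" "0 \<le> a" "a powr p \<le> integral {0..1} (\<lambda>x. cmod (f x) powr p)"
  shows "a \<le> Lp_norm p f"
proof -
  have "(a powr p) powr (1/p) \<le> Lp_norm p f"
    unfolding Lp_norm_def using assms by (intro powr_mono2) auto
  thus ?thesis using assms by (simp add: powr_powr)
qed

lemma Lp_norm_leD:
  assumes "p > 0" "Lp_norm p f \<le> a"
  shows "integral {0..1} (\<lambda>x. cmod (f x) powr p) \<le> a powr p"
  using assms powr_mono2[of p "Lp_norm p f" a] by (simp add: Lp_norm_powr)

text \<open>If one argument vanishes the claim shrinks to t^p \<le> t for 0 \<le> t \<le> 1;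
  otherwise it is convexity on the open half line.\<close>

lemma powr_convex_nonneg:
  fixes x y t p :: real
  assumes "p \<ge> 1" "0 \<le> x" "0 \<le> y" "0 \<le> t" "t \<le> 1"
  shows "(t * x + (1 - t) * y) powr p \<le> t * x powr p + (1 - t) * y powr p"
proof -
  have sc: "(s * z) powr p \<le> s * z powr p" if "0 \<le> s" "s \<le> 1" "0 \<le> z" for s z :: real
  proof (cases "s = 0")
    case False
    have "s powr p \<le> s powr 1" using that assms False by (intro powr_mono') auto
    thus ?thesis using that False by (simp add: powr_mult mult_right_mono)
  qed simp
  show ?thesis
  proof (cases "x = 0 \<or> y = 0")
    case True
    thus ?thesis using sc[of t x] sc[of "1-t" y] assms by auto
  next
    case False
    thus ?thesis using convex_onD[OF powr_convex[OF assms(1)], of "1-t" x y] assms by simp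
  qed
qed

text \<open>Minkowski by normalisation: |f+g|/(a+b) is dominated by the convex combination of |f|/a
  and |g|/b with weights a/(a+b) and b/(a+b), and convexity is integrated. Taking \<open>a\<close>
  and \<open>b\<close> strictly above the norms keeps them positive when a norm is 0.\<close>

lemma Lp_norm_triangle:
  assumes p: "p \<ge> 1" and f: "continuous_on UNIV f" and g: "continuous_on UNIV g"
  shows "Lp_norm p (\<lambda>x. f x + g x) \<le> Lp_norm p f + Lp_norm p g"
proof -
  have main: "Lp_norm p (\<lambda>x. f x + g x) \<le> a + b"
    if a: "Lp_norm p f < a" and b: "Lp_norm p g < b" for a b
  proof -
    have pos: "a > 0" "b > 0" using a b Lp_norm_nonneg[of p f] Lp_norm_nonneg[of p g] by linarith+
    define t where "t = a / (a + b)"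
    have t: "0 \<le> t" "t \<le> 1" "1 - t = b / (a+b)" using pos by (auto simp: t_def field_simps)
    have fa: "integral {0..1} (\<lambda>x. cmod (f x) powr p) \<le> a powr p"
      using Lp_norm_leD[of p f a] a p by simp
    have gb: "integral {0..1} (\<lambda>x. cmod (g x) powr p) \<le> b powr p"
      using Lp_norm_leD[of p g b] b p by simp
    have pt: "cmod (f x + g x) powr p \<le> (a+b) powr p * (t / a powr p * cmod (f x) powr p + (1-t) / b powr p * cmod (g x) powr p)" for x
    proof -
      have "cmod (f x + g x) \<le> (a+b) * (t * (cmod (f x) / a) + (1-t) * (cmod (g x) / b))"
      proof -
        have "(a+b) * (t * (cmod (f x) / a) + (1-t) * (cmod (g x) / b)) = cmod (f x) + cmod (g x)"
          unfolding t(3) unfolding t_def using pos by (simp add: distrib_left)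
        thus ?thesis using norm_triangle_ineq[of "f x" "g x"] by simp
      qed
      hence "cmod (f x + g x) powr p \<le> ((a+b) * (t * (cmod (f x) / a) + (1-t) * (cmod (g x) / b))) powr p"
        using p by (intro powr_mono2) auto
      also have "\<dots> = (a+b) powr p * (t * (cmod (f x) / a) + (1-t) * (cmod (g x) / b)) powr p"
        using pos t by (intro powr_mult) 
      also have "\<dots> \<le> (a+b) powr p * (t * (cmod (f x) / a) powr p + (1-t) * (cmod (g x) / b) powr p)"
        using pos t p by (intro mult_left_mono powr_convex_nonneg) auto
      also have "(cmod (f x) / a) powr p = cmod (f x) powr p / a powr p" using pos by (simp add: powr_divide)
      also have "(cmod (g x) / b) powr p = cmod (g x) powr p / b powr p" using pos by (simp add: powr_divide)
      finally show ?thesis by simp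
    qed
    have If: "(\<lambda>x. cmod (f x) powr p) integrable_on {0..1}" using integrable_cmod_powr[OF f] p by simp
    have Ig: "(\<lambda>x. cmod (g x) powr p) integrable_on {0..1}" using integrable_cmod_powr[OF g] p by simp
    have "integral {0..1} (\<lambda>x. cmod (f x + g x) powr p)
       \<le> integral {0..1} (\<lambda>x. (a+b) powr p * (t / a powr p * cmod (f x) powr p + (1-t) / b powr p * cmod (g x) powr p))"
      using If Ig pt p f g
      by (intro integral_le integrable_cmod_powr integrable_on_mult_right integrable_add continuous_intros) auto
    also have "\<dots> = (a+b) powr p * (t / a powr p * integral {0..1} (\<lambda>x. cmod (f x) powr p)
         + (1-t) / b powr p * integral {0..1} (\<lambda>x. cmod (g x) powr p))"
      by (simp only: integral_mult_right integral_add[OF integrable_on_mult_right[OF If] integrable_on_mult_right[OF Ig]])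
    also have "\<dots> \<le> (a+b) powr p * (t / a powr p * a powr p + (1-t) / b powr p * b powr p)"
      using fa gb t(1,2) by (intro mult_left_mono add_mono) auto
    also have "\<dots> = (a+b) powr p" using pos by simp
    finally show ?thesis using pos p by (intro Lp_norm_leI) auto
  qed
  show ?thesis
  proof (rule field_le_epsilon)
    fix e :: real assume "e > 0"
    thus "Lp_norm p (\<lambda>x. f x + g x) \<le> Lp_norm p f + Lp_norm p g + e"
      using main[of "Lp_norm p f + e/2" "Lp_norm p g + e/2"] by simp
  qed
qed

lemma Lp_norm_cmult:
  assumes "p > 0" "continuous_on UNIV f"
  shows "Lp_norm p (\<lambda>x. c * f x) = cmod c * Lp_norm p f"
proof -
  have "integral {0..1} (\<lambda>x. cmod (c * f x) powr p) = cmod c powr p * integral {0..1} (\<lambda>x. cmod (f x) powr p)"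
    by (simp add: norm_mult powr_mult)
  thus ?thesis using assms by (simp add: Lp_norm_def powr_mult powr_powr integral_cmod_powr_nonneg)
qed

lemma Lp_norm_uminus: "Lp_norm p (\<lambda>x. - f x) = Lp_norm p f"
  by (simp add: Lp_norm_def)

lemma Lp_norm_diff:
  assumes "p \<ge> 1" "continuous_on UNIV f" "continuous_on UNIV g"
  shows "Lp_norm p (\<lambda>x. f x - g x) \<le> Lp_norm p f + Lp_norm p g"
  using Lp_norm_triangle[OF assms(1,2), of "\<lambda>x. - g x"] assms
  by (simp add: Lp_norm_uminus continuous_on_minus)

lemma Lp_norm_sum:
  assumes "p \<ge> 1" "\<And>i. i \<in> A \<Longrightarrow> continuous_on UNIV (f i)"
  shows "Lp_norm p (\<lambda>x. \<Sum>i\<in>A. f i x) \<le> (\<Sum>i\<in>A. Lp_norm p (f i))"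
  using assms(2)
proof (induction A rule: infinite_finite_induct)
  case (insert a A)
  have "Lp_norm p (\<lambda>x. f a x + (\<Sum>i\<in>A. f i x)) \<le> Lp_norm p (f a) + Lp_norm p (\<lambda>x. \<Sum>i\<in>A. f i x)"
    using insert.prems by (intro Lp_norm_triangle assms(1) continuous_on_sum) auto
  moreover have "Lp_norm p (\<lambda>x. \<Sum>i\<in>A. f i x) \<le> (\<Sum>i\<in>A. Lp_norm p (f i))"
    using insert by simp
  ultimately show ?case using insert.hyps by simp
qed (use assms(1) in \<open>auto simp: Lp_norm_def\<close>)

lemma integral_periodic_shift:
  fixes f :: "real \<Rightarrow> real"
  assumes c: "continuous_on UNIV f" and per: "\<And>x. f (x + 1) = f x"
  shows "integral {0..1} (\<lambda>x. f (x + t)) = integral {0..1} f"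
proof -
  have I: "f integrable_on {a..b}" for a b
    by (rule integrable_continuous_interval) (rule continuous_on_subset[OF c], simp)
  have shift: "integral {a..b} (\<lambda>x. f (x + u)) = integral {a+u..b+u} f" for a b u
  proof (rule integral_unique)
    have "((f \<circ> (+) u) has_integral integral {a+u..b+u} f) {a..b}"
      using I[of "a+u" "b+u"] by (subst has_integral_shift_Icc_real) (simp add: has_integral_integral)
    thus "((\<lambda>x. f (x + u)) has_integral integral {a+u..b+u} f) {a..b}"
      by (simp add: o_def add.commute)
  qed
  have pn: "f (x + real n) = f x" for x n
  proof (induction n)
    case (Suc n) thus ?case using per[of "x + real n"] by (simp add: add_ac)
  qed simp
  have pint: "f (x + of_int n) = f x" for x n
  proof (cases "n \<ge> 0")
    case True thus ?thesis using pn[of x "nat n"] by simp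
  next
    case False thus ?thesis using pn[of "x + of_int n" "nat (-n)"] by simp
  qed
  define u where "u = frac t"
  have u: "0 \<le> u" "u < 1" by (auto simp: u_def frac_lt_1)
  have "f (x + t) = f (x + u)" for x
    using pint[of "x + u" "\<lfloor>t\<rfloor>"] by (simp add: u_def frac_def)
  hence "integral {0..1} (\<lambda>x. f (x + t)) = integral {u..1+u} f"
    using shift[of 0 1 u] by simp
  also have "\<dots> = integral {u..1} f + integral {1..1+u} f"
    using u I by (subst Henstock_Kurzweil_Integration.integral_combine) auto
  also have "integral {1..1+u} f = integral {0..u} f"
    using shift[of 0 u 1] per by (simp add: add.commute)
  also have "integral {u..1} f + integral {0..u} f = integral {0..1} f"
    using u I Henstock_Kurzweil_Integration.integral_combine[of 0 u 1 f] by simp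
  finally show ?thesis .
qed

lemma Lp_norm_shift:
  assumes "p > 0" "continuous_on UNIV f" "\<And>x. f (x + 1) = f x"
  shows "Lp_norm p (\<lambda>x. f (x + t)) = Lp_norm p f"
  unfolding Lp_norm_def
  using integral_periodic_shift[OF continuous_cmod_powr[OF assms(2,1)]] assms by simp

text \<open>Real coefficients suffice throughout because of the symmetrised increment \<open>osc_coeff\<close>.\<close>

definition qsum :: "(nat \<Rightarrow> real) \<Rightarrow> nat set \<Rightarrow> real \<Rightarrow> complex" where
  "qsum c A x = (\<Sum>n\<in>A. complex_of_real (c n) * cis (2*pi*(real n)^2*x))"

lemma continuous_qsum [continuous_intros]: "continuous_on S (qsum c A)"
  unfolding qsum_def cis_conv_exp by (intro continuous_intros)

lemma qsum_periodic: "qsum c A (x + 1) = qsum c A x"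
proof -
  have "cis (2*pi*(real n)^2*(x+1)) = cis (2*pi*(real n)^2*x)" for n
  proof -
    have "cis (2*pi*(real n)^2*(x+1)) = cis (2*pi*(real n)^2*x) * cis (2*pi*real (n^2))"
      by (simp add: cis_mult algebra_simps)
    thus ?thesis by (simp only: cis_multiple_2pi[of "real (n^2)"] Ints_of_nat mult_1_right)
  qed
  thus ?thesis by (simp add: qsum_def)
qed

lemma integral_cos_int:
  "integral {0..1} (\<lambda>x::real. cos (2*pi * of_int k*x)) = (if k = 0 then 1 else 0)"
proof (cases "k = 0")
  case False
  have "((\<lambda>x. cos (2*pi * of_int k*x)) has_integral
        sin (2*pi * of_int k*1) / (2*pi * of_int k) - sin (2*pi * of_int k*0) / (2*pi * of_int k)) {0..1}"
    using False by (intro fundamental_theorem_of_calculus)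
      (auto intro!: derivative_eq_intros simp flip: has_real_derivative_iff_has_vector_derivative)
  moreover have "sin (2*pi * of_int k) = 0"
    using sin_times_pi_eq_0[of "2 * of_int k"] by (simp add: mult_ac)
  ultimately show ?thesis using False by (auto dest: integral_unique)
qed simp

lemma cmod_trig_sum_sq:
  fixes A \<theta> :: "'a \<Rightarrow> real"
  shows
  "(cmod (\<Sum>v\<in>V. complex_of_real (A v) * cis (\<theta> v)))\<^sup>2 = (\<Sum>v\<in>V. \<Sum>w\<in>V. A v * A w * cos (\<theta> v - \<theta> w))"
proof -
  have "(cmod (\<Sum>v\<in>V. complex_of_real (A v) * cis (\<theta> v)))^2 = (\<Sum>v\<in>V. A v * cos (\<theta> v))^2 + (\<Sum>v\<in>V. A v * sin (\<theta> v))^2"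
    by (simp add: cmod_power2)
  also have "\<dots> = (\<Sum>v\<in>V. \<Sum>w\<in>V. (A v * cos (\<theta> v)) * (A w * cos (\<theta> w)) + (A v * sin (\<theta> v)) * (A w * sin (\<theta> w)))"
    by (simp only: power2_eq_square sum_product sum.distrib)
  also have "\<dots> = (\<Sum>v\<in>V. \<Sum>w\<in>V. A v * A w * cos (\<theta> v - \<theta> w))"
    by (intro sum.cong refl) (simp only: cos_diff distrib_left mult_ac)
  finally show ?thesis .
qed

text \<open>The frequency map may repeat values, so coefficients of equal frequency are added before
  squaring. This form serves for powers of a quadratic sum, where the index is a tuple and the
  frequency a sum of squares.\<close>

lemma trig_parseval:
  fixes \<nu> :: "'a \<Rightarrow> int" and A :: "'a \<Rightarrow> real"
  assumes V: "finite V"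
  shows "integral {0..1} (\<lambda>x. (cmod (\<Sum>v\<in>V. complex_of_real (A v) * cis (2*pi * of_int (\<nu> v)*x)))^2)
       = (\<Sum>m\<in>\<nu>`V. (\<Sum>v\<in>{v\<in>V. \<nu> v = m}. A v)^2)"
proof -
  have I: "(\<lambda>x. c * cos (2*pi * of_int k*x)) integrable_on {0..1}" for c k
    by (intro integrable_continuous_interval continuous_intros)
  have "integral {0..1} (\<lambda>x. (cmod (\<Sum>v\<in>V. complex_of_real (A v) * cis (2*pi * of_int (\<nu> v)*x)))^2)
     = integral {0..1} (\<lambda>x. \<Sum>v\<in>V. \<Sum>w\<in>V. A v * A w * cos (2*pi * of_int (\<nu> v - \<nu> w)*x))"
    by (simp only: cmod_trig_sum_sq of_int_diff right_diff_distrib left_diff_distrib)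
  also have "\<dots> = (\<Sum>v\<in>V. \<Sum>w\<in>V. integral {0..1} (\<lambda>x. A v * A w * cos (2*pi * of_int (\<nu> v - \<nu> w)*x)))"
    by (simp only: integral_sum[OF V I] integral_sum[OF V integrable_sum[OF V I]])
  also have "\<dots> = (\<Sum>v\<in>V. \<Sum>w\<in>V. A v * A w * (if \<nu> v = \<nu> w then 1 else 0))"
    by (intro sum.cong refl, subst integral_mult_right, subst integral_cos_int) simp
  also have "\<dots> = (\<Sum>m\<in>\<nu>`V. \<Sum>v\<in>{v\<in>V. \<nu> v = m}. \<Sum>w\<in>V. A v * A w * (if \<nu> v = \<nu> w then 1 else 0))"
    using V by (intro sum.image_gen) 
  also have "\<dots> = (\<Sum>m\<in>\<nu>`V. \<Sum>v\<in>{v\<in>V. \<nu> v = m}. \<Sum>w\<in>{v\<in>V. \<nu> v = m}. A v * A w)"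
    using V by (intro sum.cong refl sum.mono_neutral_cong_right) auto
  finally show ?thesis by (simp add: power2_eq_square sum_product)
qed

section \<open>Weyl sums with tent weights\<close>

lemma sum_int_shift:
  fixes g :: "int \<Rightarrow> 'a :: ab_group_add"
  shows "(\<Sum>k\<in>{a..b}. g (k + c)) = (\<Sum>k\<in>{a+c..b+c}. g k)"
  by (rule sum.reindex_bij_witness[of _ "\<lambda>k. k - c" "\<lambda>k. k + c"]) auto

text \<open>Two differences of the weight give the quadratic decay that avoids the logarithm of a sharp cut-off.\<close>

lemma sum_second_difference:
  fixes v :: "int \<Rightarrow> real" and B :: int
  assumes supp: "\<And>k. \<bar>k\<bar> \<ge> B \<Longrightarrow> v k = 0" and B: "B \<ge> 0"
  shows "cmod (\<Sum>k\<in>{-B..B}. complex_of_real (v k) * cis (of_int k * \<theta>)) * (2 - 2 * cos \<theta>)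
      \<le> (\<Sum>k\<in>{-B..B}. \<bar>v (k+1) - 2 * v k + v (k-1)\<bar>)"
proof -
  define e where "e k = cis (of_int k * \<theta>)" for k :: int
  have e1: "e k * cis \<theta> = e (k+1)" "e k * cis (-\<theta>) = e (k-1)" for k
    by (auto simp: e_def cis_mult algebra_simps)
  \<comment> \<open>The factor 2 - 2 cos \<theta> acts on the characters e as minus the second
    difference; shifting the index moves it to v, and the terms pushed over the ends vanish with
    v.\<close>
  have c2: "complex_of_real (2 - 2 * cos \<theta>) = 2 - cis \<theta> - cis (-\<theta>)"
    by (simp add: complex_eq_iff)
  have s1: "(\<Sum>k\<in>{-B..B}. complex_of_real (v k) * e (k+1)) = (\<Sum>k\<in>{-B..B}. complex_of_real (v (k-1)) * e k)"
  proof -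
    have "(\<Sum>k\<in>{-B..B}. complex_of_real (v k) * e (k+1)) = (\<Sum>k\<in>{-B+1..B+1}. complex_of_real (v (k-1)) * e k)"
      using sum_int_shift[of "\<lambda>k. complex_of_real (v (k-1)) * e k" 1 "-B" B] by simp
    also have "\<dots> = (\<Sum>k\<in>{-B..B+1}. complex_of_real (v (k-1)) * e k)"
      using supp by (intro sum.mono_neutral_left) auto
    also have "\<dots> = (\<Sum>k\<in>{-B..B}. complex_of_real (v (k-1)) * e k)"
      using supp by (intro sum.mono_neutral_right) auto
    finally show ?thesis .
  qed
  have s2: "(\<Sum>k\<in>{-B..B}. complex_of_real (v k) * e (k-1)) = (\<Sum>k\<in>{-B..B}. complex_of_real (v (k+1)) * e k)"
  proof -
    have "(\<Sum>k\<in>{-B..B}. complex_of_real (v k) * e (k-1)) = (\<Sum>k\<in>{-B-1..B-1}. complex_of_real (v (k+1)) * e k)"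
      using sum_int_shift[of "\<lambda>k. complex_of_real (v (k+1)) * e k" "-1" "-B" B] by simp
    also have "\<dots> = (\<Sum>k\<in>{-B-1..B}. complex_of_real (v (k+1)) * e k)"
      using supp by (intro sum.mono_neutral_left) auto
    also have "\<dots> = (\<Sum>k\<in>{-B..B}. complex_of_real (v (k+1)) * e k)"
      using supp by (intro sum.mono_neutral_right) auto
    finally show ?thesis .
  qed
  let ?S = "\<Sum>k\<in>{-B..B}. complex_of_real (v k) * e k"
  have "?S * complex_of_real (2 - 2 * cos \<theta>) = (\<Sum>k\<in>{-B..B}. 2 * (complex_of_real (v k) * e k))
        - (\<Sum>k\<in>{-B..B}. complex_of_real (v k) * e (k+1)) - (\<Sum>k\<in>{-B..B}. complex_of_real (v k) * e (k-1))"
    unfolding c2 sum_distrib_right sum_subtractf[symmetric] e1[symmetric]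
    by (intro sum.cong refl) (simp add: algebra_simps)
  also have "\<dots> = (\<Sum>k\<in>{-B..B}. - (complex_of_real (v (k+1) - 2 * v k + v (k-1)) * e k))"
    unfolding s1 s2 sum_subtractf[symmetric] by (intro sum.cong refl) (simp add: algebra_simps)
  finally have eq: "?S * complex_of_real (2 - 2 * cos \<theta>) = (\<Sum>k\<in>{-B..B}. - (complex_of_real (v (k+1) - 2 * v k + v (k-1)) * e k))" .
  have "cmod ?S * (2 - 2 * cos \<theta>) = cmod (?S * complex_of_real (2 - 2 * cos \<theta>))"
    by (subst norm_mult, subst norm_of_real) simp
  also have "\<dots> \<le> (\<Sum>k\<in>{-B..B}. cmod (- (complex_of_real (v (k+1) - 2 * v k + v (k-1)) * e k)))"
    unfolding eq by (rule norm_sum)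
  also have "\<dots> = (\<Sum>k\<in>{-B..B}. \<bar>v (k+1) - 2 * v k + v (k-1)\<bar>)"
    by (intro sum.cong refl) (simp add: norm_mult e_def del: of_real_diff of_real_add)
  finally show ?thesis by (simp add: e_def)
qed

definition tent :: "nat \<Rightarrow> int \<Rightarrow> real" where
  "tent L n = max 0 (1 - \<bar>of_int n\<bar> / real L)"

lemma tent_nonneg [simp]: "0 \<le> tent L n"
  unfolding tent_def by (rule max.cobounded1)

lemma tent_le_1 [simp]: "tent L n \<le> 1"
  unfolding tent_def by (rule max.boundedI) simp_all

lemma tent_eq_0: "L > 0 \<Longrightarrow> \<bar>n\<bar> \<ge> int L \<Longrightarrow> tent L n = 0"
  by (auto simp: tent_def field_simps max_def)

lemma tent_lipschitz:
  assumes "L > 0" shows "\<bar>tent L (n+1) - tent L n\<bar> \<le> 1 / real L"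
proof -
  have "\<bar>max 0 (1-u) - max 0 (1-w)\<bar> \<le> \<bar>u - w\<bar>" for u w :: real by (auto simp: max_def)
  hence "\<bar>tent L (n+1) - tent L n\<bar> \<le> \<bar>\<bar>of_int (n+1)\<bar> / real L - \<bar>of_int n\<bar> / real L\<bar>"
    unfolding tent_def by blast
  also have "\<dots> = \<bar>\<bar>real_of_int (n+1)\<bar> - \<bar>of_int n\<bar>\<bar> / real L"
    by (simp add: diff_divide_distrib[symmetric])
  also have "\<dots> \<le> 1 / real L" by (intro divide_right_mono) auto
  finally show ?thesis .
qed

text \<open>The tent is linear except at its kinks -L, 0, L, and at a kink the second difference is
  the difference of two slopes of size at most 1/L.\<close>

lemma tent_second_difference:
  assumes "L > 0"
  shows "\<bar>tent L (n+1) - 2 * tent L n + tent L (n-1)\<bar> \<le> (if n \<in> {- int L, 0, int L} then 2 / real L else 0)"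
proof -
  have lin: "tent L k = 1 - \<bar>of_int k\<bar> / real L" if "\<bar>k\<bar> \<le> int L" for k
    using that assms by (auto simp: tent_def field_simps max_def)
  consider "n \<in> {- int L, 0, int L}" | "n \<ge> int L + 1 \<or> n \<le> - int L - 1" | "1 \<le> n \<and> n \<le> int L - 1" | "n \<le> -1 \<and> n \<ge> 1 - int L" 
    by auto linarith+
  thus ?thesis
  proof cases
    case 1
    have "\<bar>tent L (n+1) - 2 * tent L n + tent L (n-1)\<bar> \<le> \<bar>tent L (n+1) - tent L n\<bar> + \<bar>tent L n - tent L (n-1)\<bar>" by linarith
    also have "\<dots> \<le> 2 / real L" using tent_lipschitz[OF assms, of n] tent_lipschitz[OF assms, of "n-1"] by simp
    finally show ?thesis using 1 by auto
  next
    case 2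
    hence "tent L (n+1) = 0" "tent L n = 0" "tent L (n-1) = 0" using assms by (auto intro!: tent_eq_0)
    thus ?thesis by simp
  next
    case 3
    hence "tent L (n+1) - 2 * tent L n + tent L (n-1) = 0" using assms by (simp add: lin field_simps)
    thus ?thesis by simp
  next
    case 4
    hence "\<bar>real_of_int (n+1)\<bar> = - of_int n - 1" "\<bar>real_of_int n\<bar> = - of_int n" "\<bar>real_of_int (n-1)\<bar> = 1 - of_int n" by auto
    hence "tent L (n+1) - 2 * tent L n + tent L (n-1) = 0" using 4 assms by (simp add: lin field_simps)
    thus ?thesis by simp
  qed
qed

lemma second_difference_mult:
  fixes a b a' b' a'' b'' :: "'a :: comm_ring_1"
  shows "a' * b' - 2 * (a * b) + a'' * b'' = a * (b' - 2 * b + b'') + b * (a' - 2 * a + a'')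
    + (a' - a) * (b' - b) + (a'' - a) * (b'' - b)"
  by (simp add: algebra_simps)

text \<open>By the discrete product rule each factor contributes its three kinks, 3 * 2/L, and the
  products of first differences contribute 2/L^2 at each of 2L+1 \<le> 3L points: 6 + 6 + 6 =
  18.\<close>

lemma tent_corr_second_difference:
  fixes h :: int
  assumes L: "L > 0"
  defines "v \<equiv> \<lambda>k. tent L k * tent L (k + h)"
  shows "(\<Sum>k\<in>{-int L..int L}. \<bar>v (k+1) - 2 * v k + v (k-1)\<bar>) \<le> 18 / real L"
proof -
  define I where "I n = (if n \<in> {- int L, 0, int L} then 2 / real L else 0)" for n
  have pt: "\<bar>v (k+1) - 2 * v k + v (k-1)\<bar> \<le> I (k+h) + I k + 2 / (real L)^2" for k
  proof -
    define a b where "a = tent L" and "b = (\<lambda>k. tent L (k+h))"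
    have eq: "v (k+1) - 2 * v k + v (k-1) = a k * (b (k+1) - 2 * b k + b (k-1)) + b k * (a (k+1) - 2 * a k + a (k-1))
       + (a (k+1) - a k) * (b (k+1) - b k) + (a (k-1) - a k) * (b (k-1) - b k)"
      unfolding v_def a_def b_def by (rule second_difference_mult)
    have "\<bar>v (k+1) - 2 * v k + v (k-1)\<bar> \<le> \<bar>a k\<bar> * \<bar>b (k+1) - 2 * b k + b (k-1)\<bar> + \<bar>b k\<bar> * \<bar>a (k+1) - 2 * a k + a (k-1)\<bar>
       + \<bar>a (k+1) - a k\<bar> * \<bar>b (k+1) - b k\<bar> + \<bar>a (k-1) - a k\<bar> * \<bar>b (k-1) - b k\<bar>"
      unfolding eq abs_mult[symmetric] by (intro order.trans[OF abs_triangle_ineq] add_mono order.refl)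
    also have "\<dots> \<le> 1 * I (k+h) + 1 * I k + 1 / real L * (1 / real L) + 1 / real L * (1 / real L)"
    proof (intro add_mono mult_mono)
      have sh: "k + 1 + h = k + h + 1" "k - 1 + h = k + h - 1" by auto
      show "\<bar>b (k+1) - 2 * b k + b (k-1)\<bar> \<le> I (k+h)"
        unfolding b_def sh I_def by (rule tent_second_difference[OF L])
      show "\<bar>a (k+1) - 2 * a k + a (k-1)\<bar> \<le> I k"
        using tent_second_difference[OF L, of "k"] unfolding a_def I_def .
      show "\<bar>b (k+1) - b k\<bar> \<le> 1 / real L" unfolding b_def sh by (rule tent_lipschitz[OF L])
      show "\<bar>b (k-1) - b k\<bar> \<le> 1 / real L" unfolding b_def sh
        using tent_lipschitz[OF L, of "k+h-1"] by (subst abs_minus_commute) simp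
      show "\<bar>a (k+1) - a k\<bar> \<le> 1 / real L" using tent_lipschitz[OF L, of "k"] by (simp add: a_def)
      show "\<bar>a (k-1) - a k\<bar> \<le> 1 / real L" unfolding a_def
        using tent_lipschitz[OF L, of "k-1"] by (subst abs_minus_commute) simp
    qed (auto simp: a_def b_def)
    finally show ?thesis by (simp add: power2_eq_square)
  qed
  have J: "(\<Sum>k\<in>{-int L..int L}. I (k+c)) \<le> 6 / real L" for c
  proof -
    have "(\<Sum>k\<in>{-int L..int L}. I (k+c)) = (\<Sum>k\<in>{-int L..int L} \<inter> {- int L - c, - c, int L - c}. 2 / real L)"
      by (intro sum.mono_neutral_cong_right) (auto simp: I_def)
    also have "\<dots> \<le> (\<Sum>k\<in>{- int L - c, - c, int L - c}. 2 / real L)"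
      by (intro sum_mono2) auto
    also have "\<dots> \<le> 3 * (2 / real L)"
      unfolding sum_constant by (intro mult_right_mono) (auto simp: card_insert_if)
    finally show ?thesis by simp
  qed
  have "(\<Sum>k\<in>{-int L..int L}. \<bar>v (k+1) - 2 * v k + v (k-1)\<bar>) \<le> (\<Sum>k\<in>{-int L..int L}. I (k+h) + I (k+0) + 2 / (real L)^2)"
    unfolding add_0_right by (intro sum_mono pt)
  also have "\<dots> \<le> 6 / real L + 6 / real L + (2 * real L + 1) * (2 / (real L)^2)"
    unfolding sum.distrib by (intro add_mono J) simp
  also have "(2 * real L + 1) * (2 / (real L)^2) \<le> (3 * real L) * (2 / (real L)^2)"
    using L by (intro mult_right_mono) auto
  also have "\<dots> = 6 / real L" using L by (simp add: power2_eq_square)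
  finally show ?thesis by simp
qed

text \<open>The trivial bound 3L and the bound 9/(2L sin^2) are merged into one fraction, as 3 + 9/2
  \<le> 8. The square of the sine, where a sharp cut-off has only the first power, is what saves the
  logarithm when the bound is summed over shifts.\<close>

lemma tent_corr_bound:
  assumes L: "L > 0"
  shows "cmod (\<Sum>k\<in>{-int L..int L}. complex_of_real (tent L k * tent L (k+h)) * cis (of_int k * (2*pi*y)))
     \<le> 8 * real L / (1 + (real L)^2 * (sin (pi*y))^2)" (is "?W \<le> _")
proof -
  have 1: "?W \<le> 3 * real L"
  proof -
    have "?W \<le> (\<Sum>k\<in>{-int L..int L}. 1)"
      by (intro order.trans[OF norm_sum] sum_mono) (auto simp: norm_mult intro!: mult_le_one)
    also have "\<dots> \<le> 3 * real L" using L by simp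
    finally show ?thesis .
  qed
  have "?W * (2 - 2 * cos (2*pi*y)) \<le> 18 / real L"
    using sum_second_difference[of "int L" "\<lambda>k. tent L k * tent L (k+h)" "2*pi*y"]
      tent_corr_second_difference[OF L, of h] tent_eq_0[OF L] by fastforce
  moreover have "2 - 2 * cos (2*pi*y) = 4 * (sin (pi*y))^2"
    using cos_double_sin[of "pi*y"] by (simp add: mult_ac)
  ultimately have 2: "?W * (sin (pi*y))^2 \<le> 9 / (2 * real L)" by simp
  have "?W * (1 + (real L)^2 * (sin (pi*y))^2) = ?W + (real L)^2 * (?W * (sin (pi*y))^2)"
    by (simp add: algebra_simps)
  also have "\<dots> \<le> 3 * real L + (real L)^2 * (9 / (2 * real L))"
    using 1 2 by (intro add_mono mult_left_mono) auto
  also have "\<dots> \<le> 8 * real L" using L by (simp add: power2_eq_square)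
  finally show ?thesis by (simp add: pos_le_divide_eq add_pos_nonneg)
qed

definition tent_sum :: "nat \<Rightarrow> int \<Rightarrow> real \<Rightarrow> complex" where
  "tent_sum L m x = (\<Sum>n\<in>{-int L..int L}. complex_of_real (tent L n) * cis (2*pi*(of_int (m+n))^2*x))"

text \<open>The phase difference (m+k+h)^2 - (m+k)^2 = 2hk + (2mh + h^2) is linear in k, and the
  centre m enters only through a factor of modulus 1: the bound is uniform in m.\<close>

lemma tent_sum_weyl_differencing:
  assumes L: "L > 0"
  shows "(cmod (tent_sum L m x))^2 \<le> 16 * real L * (\<Sum>j\<le>4*L. 1 / (1 + (real L)^2 * (sin (pi * (real j * x)))^2))"
proof -
  let ?I = "{-int L..int L}" and ?H = "{-2*int L..2*int L}"
  let ?e = "\<lambda>n. cis (2*pi*(of_int (m+n))^2*x)"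
  define g where "g j = 8 * real L / (1 + (real L)^2 * (sin (pi * (real j * x)))^2)" for j
  have gpos: "g j \<ge> 0" for j unfolding g_def by (intro divide_nonneg_nonneg add_nonneg_nonneg mult_nonneg_nonneg) auto
  have "complex_of_real ((cmod (tent_sum L m x))^2) = tent_sum L m x * cnj (tent_sum L m x)"
    by (rule complex_norm_square)
  also have "\<dots> = (\<Sum>k\<in>?I. \<Sum>n\<in>?I. complex_of_real (tent L n) * ?e n * (complex_of_real (tent L k) * cnj (?e k)))"
    unfolding tent_sum_def cnj_sum sum_product by (subst sum.swap) simp
  also have "\<dots> = (\<Sum>k\<in>?I. \<Sum>h\<in>?H. complex_of_real (tent L (k+h)) * ?e (k+h) * (complex_of_real (tent L k) * cnj (?e k)))"
  proof (rule sum.cong[OF refl])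
    fix k assume k: "k \<in> ?I"
    let ?f = "\<lambda>n. complex_of_real (tent L n) * ?e n * (complex_of_real (tent L k) * cnj (?e k))"
    have "(\<Sum>h\<in>?H. ?f (k+h)) = (\<Sum>n\<in>{-2*int L+k..2*int L+k}. ?f n)"
      using sum_int_shift[of ?f k "-2*int L" "2*int L"] by (simp add: add.commute)
    also have "\<dots> = (\<Sum>n\<in>?I. ?f n)"
      using k tent_eq_0[OF L] by (intro sum.mono_neutral_right) auto
    finally show "(\<Sum>n\<in>?I. ?f n) = (\<Sum>h\<in>?H. ?f (k+h))" by simp
  qed
  also have "\<dots> = (\<Sum>h\<in>?H. cis (2*pi*(2 * of_int m * of_int h + (of_int h)^2)*x) *
      (\<Sum>k\<in>?I. complex_of_real (tent L k * tent L (k+h)) * cis (of_int k * (2*pi*(2 * of_int h * x)))))"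
  proof (subst sum.swap, intro sum.cong refl, subst sum_distrib_left, intro sum.cong refl)
    fix h k
    have "?e (k+h) * cnj (?e k) = cis (2*pi*(2 * of_int m * of_int h + (of_int h)^2)*x) * cis (of_int k * (2*pi*(2 * of_int h * x)))"
      by (simp add: cis_cnj cis_mult power2_eq_square algebra_simps)
    thus "complex_of_real (tent L (k+h)) * ?e (k+h) * (complex_of_real (tent L k) * cnj (?e k)) =
      cis (2*pi*(2 * of_int m * of_int h + (of_int h)^2)*x) * (complex_of_real (tent L k * tent L (k+h)) * cis (of_int k * (2*pi*(2 * of_int h * x))))"
      by (simp add: mult_ac)
  qed
  finally have "(cmod (tent_sum L m x))^2 = cmod (\<Sum>h\<in>?H. cis (2*pi*(2 * of_int m * of_int h + (of_int h)^2)*x) *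
      (\<Sum>k\<in>?I. complex_of_real (tent L k * tent L (k+h)) * cis (of_int k * (2*pi*(2 * of_int h * x)))))"
    by (metis abs_power2 norm_of_real)
  also have "\<dots> \<le> (\<Sum>h\<in>?H. g (nat \<bar>2*h\<bar>))"
  proof (intro order.trans[OF norm_sum] sum_mono)
    fix h :: int
    have "cmod (\<Sum>k\<in>?I. complex_of_real (tent L k * tent L (k+h)) * cis (of_int k * (2*pi*(2 * of_int h * x))))
       \<le> 8 * real L / (1 + (real L)^2 * (sin (pi*(2 * of_int h * x)))^2)"
      by (rule tent_corr_bound[OF L])
    also have "(sin (pi*(2 * of_int h * x)))^2 = (sin (pi * (real (nat \<bar>2*h\<bar>) * x)))^2"
      by (cases "h \<ge> 0") auto
    finally show "cmod (cis (2*pi*(2 * of_int m * of_int h + (of_int h)^2)*x) *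
      (\<Sum>k\<in>?I. complex_of_real (tent L k * tent L (k+h)) * cis (of_int k * (2*pi*(2 * of_int h * x))))) \<le> g (nat \<bar>2*h\<bar>)"
      by (simp only: norm_mult norm_cis mult_1_left g_def)
  qed
  also have "\<dots> \<le> (\<Sum>h\<in>{0..2*int L}. g (nat \<bar>2*h\<bar>)) + (\<Sum>h\<in>{-2*int L..0}. g (nat \<bar>2*h\<bar>))"
  proof -
    have "?H = {0..2*int L} \<union> {-2*int L..0}" by auto
    thus ?thesis using gpos by (simp add: sum_Un sum_nonneg)
  qed
  also have "\<dots> = 2 * (\<Sum>h\<in>{0..2*int L}. g (nat \<bar>2*h\<bar>))"
  proof -
    have "(\<Sum>h\<in>{-2*int L..0}. g (nat \<bar>2*h\<bar>)) = (\<Sum>h\<in>{0..2*int L}. g (nat \<bar>2*h\<bar>))"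
      by (rule sum.reindex_bij_witness[of _ uminus uminus]) auto
    thus ?thesis by simp
  qed
  also have "(\<Sum>h\<in>{0..2*int L}. g (nat \<bar>2*h\<bar>)) = (\<Sum>j\<in>(\<lambda>h. nat \<bar>2*h\<bar>) ` {0..2*int L}. g j)"
    by (subst sum.reindex) (auto simp: inj_on_def)
  also have "\<dots> \<le> (\<Sum>j\<le>4*L. g j)"
    using gpos by (intro sum_mono2) auto
  also have "2 * (\<Sum>j\<le>4*L. g j) = 16 * real L * (\<Sum>j\<le>4*L. 1 / (1 + (real L)^2 * (sin (pi * (real j * x)))^2))"
    by (simp add: g_def sum_distrib_left)
  finally show ?thesis by simp
qed

section \<open>The sum over shifts near a rational point\<close>

lemma sin_pi_ge:
  fixes w :: real
  assumes "0 \<le> w" "w \<le> 1/2" shows "2 * w \<le> sin (pi * w)"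
proof -
  have "convex_on {0..1/2} (\<lambda>w. - sin (pi * w))"
  proof (rule f''_ge0_imp_convex)
    fix x :: real assume "x \<in> {0..1/2}"
    thus "0 \<le> pi^2 * sin (pi * x)" by (intro mult_nonneg_nonneg sin_ge_zero) auto
  qed (auto intro!: derivative_eq_intros simp: power2_eq_square)
  from convex_onD[OF this, of "2*w" 0 "1/2"] assms show ?thesis by simp
qed

lemma abs_sin_pi_ge:
  fixes w \<delta> :: real
  assumes "0 \<le> \<delta>" "\<delta> \<le> w" "w \<le> 1 - \<delta>" shows "2 * \<delta> \<le> \<bar>sin (pi * (of_int n + w))\<bar>"
proof -
  have "\<bar>sin (pi * (of_int n + w))\<bar> = \<bar>sin (pi * w)\<bar>"
    by (simp add: distrib_left sin_add abs_mult)
  moreover have "2 * \<delta> \<le> sin (pi * w)"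
  proof (cases "w \<le> 1/2")
    case True thus ?thesis using sin_pi_ge[of w] assms by simp
  next
    case False
    have "sin (pi * (1 - w)) = sin (pi * w)" by (simp add: right_diff_distrib)
    thus ?thesis using sin_pi_ge[of "1-w"] assms False by simp
  qed
  ultimately show ?thesis by linarith
qed

lemma sum_inverse_squares_le: "(\<Sum>r=1..n. 1 / (real r)^2) \<le> 2"
proof -
  have le: "(\<Sum>r=1..n. 1 / (real r)^2) \<le> 2 - 1 / real n" if "n \<ge> 1" for n
    using that
  proof (induction n rule: nat_induct_at_least)
    case (Suc n)
    have "1 / (real (Suc n))^2 \<le> 1 / (real n * real (Suc n))"
      using Suc.hyps by (intro divide_left_mono) (auto simp: power2_eq_square)
    also have "\<dots> = 1 / real n - 1 / real (Suc n)" using Suc.hyps by (simp add: field_simps)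
    finally show ?case using Suc.IH by simp
  qed simp
  show ?thesis
  proof (cases "n \<ge> 1")
    case True
    have "2 - 1 / real n \<le> 2" by simp
    with le[OF True] show ?thesis by linarith
  qed simp
qed

lemma sum_periodic_nat:
  fixes g :: "nat \<Rightarrow> real"
  assumes "\<And>j. g (j + q) = g j"
  shows "(\<Sum>j<q*n. g j) = real n * (\<Sum>j<q. g j)"
proof (induction n)
  case (Suc n)
  have gp: "g (j + q * n) = g j" for j
  proof (induction n)
    case (Suc n) thus ?case using assms[of "j + q*n"] by (simp add: algebra_simps)
  qed simp
  have "(\<Sum>j<q*Suc n. g j) = (\<Sum>j<q*n. g j) + (\<Sum>j=q*n..<q*n+q. g j)"
    using sum.atLeastLessThan_concat[of 0 "q*n" "q*n+q" g] by (simp add: lessThan_atLeast0 add.commute)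
  also have "(\<Sum>j=q*n..<q*n+q. g j) = (\<Sum>j=0..<q. g (j + q*n))"
    using sum.shift_bounds_nat_ivl[of g 0 "q*n" q] by (simp add: add.commute)
  finally show ?case unfolding gp using Suc by (simp add: algebra_simps lessThan_atLeast0)
qed simp

lemma sum_residues:
  fixes \<psi> :: "int \<Rightarrow> real"
  assumes q: "q > 0" and cop: "coprime a (int q)"
  shows "(\<Sum>j<q. \<psi> ((int j * a) mod int q)) = (\<Sum>r\<in>{0..<int q}. \<psi> r)"
proof -
  have inj: "inj_on (\<lambda>j. (int j * a) mod int q) {..<q}"
  proof (rule inj_onI)
    fix i j assume ij: "i \<in> {..<q}" "j \<in> {..<q}" and eq: "(int i * a) mod int q = (int j * a) mod int q"
    have "int q dvd (int i - int j) * a"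
      using eq by (simp add: mod_eq_dvd_iff left_diff_distrib)
    hence "int q dvd int i - int j" using cop by (simp add: coprime_dvd_mult_left_iff coprime_commute)
    moreover have "\<bar>int i - int j\<bar> < int q" using ij by auto
    ultimately show "i = j" using zdvd_imp_le[of "int q" "\<bar>int i - int j\<bar>"] by fastforce
  qed
  have "(\<lambda>j. (int j * a) mod int q) ` {..<q} = {0..<int q}"
    using q by (intro card_subset_eq) (auto simp: card_image[OF inj])
  thus ?thesis using sum.reindex[OF inj, of \<psi>] by simp
qed

text \<open>Comparison with the integral of 1/(1+t^2); arctan stays below pi/2 \<le> 2.\<close>

lemma sum_inverse_one_plus_sq:
  fixes c :: real
  assumes c: "c > 0"
  shows "(\<Sum>k\<le>K. 1 / (1 + (c * real k)^2)) \<le> 1 + 2 / c"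
proof -
  have "(\<Sum>k\<le>K. 1 / (1 + (c * real k)^2)) \<le> 1 + arctan (c * real K) / c"
  proof (induction K)
    case (Suc K)
    have "\<exists>z>c * real K. z < c * real (Suc K) \<and> arctan (c * real (Suc K)) - arctan (c * real K)
         = (c * real (Suc K) - c * real K) * inverse (1 + z^2)"
      using c by (intro MVT2) (auto intro!: derivative_eq_intros)
    then obtain z where z: "z > c * real K" "z < c * real (Suc K)"
      and eq: "arctan (c * real (Suc K)) - arctan (c * real K) = c * inverse (1 + z^2)"
      by (auto simp: algebra_simps)
    have "z \<ge> 0" using z(1) c by (meson less_imp_le mult_nonneg_nonneg of_nat_0_le_iff order.trans)
    hence "z^2 \<le> (c * real (Suc K))^2" using z by (intro power_mono) auto
    hence "1 / (1 + (c * real (Suc K))^2) \<le> 1 / (1 + z^2)" by (intro divide_left_mono) (auto intro!: add_pos_nonneg mult_pos_pos)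
    also have "\<dots> = (arctan (c * real (Suc K)) - arctan (c * real K)) / c" using eq c by (simp add: divide_inverse)
    finally show ?case using Suc by (simp add: diff_divide_distrib)
  qed simp
  also have "arctan (c * real K) / c \<le> 2 / c"
    using c arctan_ubound[of "c * real K"] pi_less_4 by (intro divide_right_mono) auto
  finally show ?thesis by simp
qed

text \<open>Put \<beta> = |x - a/q|. If q does not divide j, then ja/q is at least 1/q away from the
  integers, and since j \<beta> \<le> 4L/(8Lq) = 1/(2q) the perturbation eats at most half of this;
  these j together contribute O(1). The multiples j = qk see only the perturbation and produce the
  main term. Since q(1 + L^2 \<beta>) \<le> 9L, the O(1) is absorbed by the main term: 3480 = 24 + 9
  * 384.\<close>

lemma sum_sin_rational_approx:
  fixes a :: int and q L :: nat and x :: real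
  assumes L: "L > 0" and q: "q > 0" "q \<le> 8*L" and cop: "coprime a (int q)"
    and ap: "\<bar>real q * x - of_int a\<bar> < 1 / real (8*L)"
  shows "(\<Sum>j\<le>4*L. 1 / (1 + (real L)^2 * (sin (pi * (real j * x)))^2))
      \<le> 3480 * real L / (real q * (1 + (real L)^2 * \<bar>x - of_int a / real q\<bar>))"
proof -
  define \<beta> where "\<beta> = \<bar>x - of_int a / real q\<bar>"
  have qb: "real q * \<beta> = \<bar>real q * x - of_int a\<bar>"
  proof -
    have "real q * \<beta> = \<bar>real q * (x - of_int a / real q)\<bar>" by (simp add: \<beta>_def abs_mult)
    also have "real q * (x - of_int a / real q) = real q * x - of_int a" using q by (simp add: field_simps)
    finally show ?thesis .
  qed
  have qb_lt: "real q * \<beta> < 1 / (8 * real L)" using qb ap by simp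
  have b0: "\<beta> \<ge> 0" by (simp add: \<beta>_def)
  define \<Phi> where "\<Phi> j = 1 / (1 + (real L)^2 * (sin (pi * (real j * x)))^2)" for j
  define K where "K = 4 * L div q"
  define n where "n = K + 1"
  \<comment> \<open>1/min(r, q-r)^2 is bounded by the sum of both reciprocals, which can be summed
    over a full residue system; at r = 0 the first one is 1/0 = 0.\<close>
  define \<psi> where "\<psi> r = (real q)^2 / (real L)^2 * (1 / (of_int r)^2 + 1 / (of_int (int q - r))^2)" for r :: int
  have psi0: "\<psi> r \<ge> 0" for r by (simp add: \<psi>_def)
  have n_le: "real n \<le> 12 * real L / real q"
  proof -
    have "real q * real K \<le> 4 * real L" unfolding K_def
      by (metis of_nat_le_iff of_nat_mult of_nat_numeral times_div_less_eq_dividend)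
    hence "real q * real n \<le> 12 * real L" using q(2) unfolding n_def by (simp add: distrib_left)
    thus ?thesis using q by (simp add: field_simps)
  qed
  have nondvd: "\<Phi> j \<le> \<psi> ((int j * a) mod int q)" if j: "j \<le> 4*L" "\<not> q dvd j" for j
  proof -
    define r where "r = (int j * a) mod int q"
    have "r \<noteq> 0"
    proof
      assume "r = 0"
      hence "int q dvd int j * a" by (simp add: r_def dvd_eq_mod_eq_0)
      hence "int q dvd int j" using cop by (simp add: coprime_dvd_mult_left_iff coprime_commute)
      thus False using j by simp
    qed
    hence r: "1 \<le> r" "r \<le> int q - 1" using q pos_mod_bound[of "int q" "int j * a"] pos_mod_sign[of "int q" "int j * a"]
      unfolding r_def by linarith+
    define \<mu> where "\<mu> = min r (int q - r)"
    have mu: "\<mu> \<ge> 1" "\<mu> \<le> r" "\<mu> \<le> int q - r" using r by (auto simp: \<mu>_def)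
    define u where "u = real j * (x - of_int a / real q)"
    define w where "w = of_int r / real q + u"
    have jx: "real j * x = of_int ((int j * a) div int q) + w"
    proof -
      have "int j * a = int q * ((int j * a) div int q) + r" by (simp add: r_def)
      hence "real j * of_int a = real q * of_int ((int j * a) div int q) + of_int r"
        by (metis of_int_add of_int_mult of_int_of_nat_eq)
      thus ?thesis using q by (simp add: w_def u_def field_simps)
    qed
    have "\<bar>u\<bar> = real j * \<beta>" by (simp add: abs_mult \<beta>_def u_def)
    also have "\<dots> \<le> 4 * real L * \<beta>" using j b0 by (intro mult_right_mono) auto
    also have "\<dots> \<le> 1 / (2 * real q)" using qb_lt q L by (simp add: field_simps)
    finally have small: "\<bar>u\<bar> \<le> 1 / (2 * real q)" .
    \<comment> \<open>The half subtracted from \<mu> pays for |u| \<le> 1/(2q); as \<mu> \<ge> 1,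
      the doubling in \<open>abs_sin_pi_ge\<close> restores at least \<mu>/q.\<close>
    define \<delta> where "\<delta> = (of_int \<mu> - 1/2) / real q"
    have d1: "\<delta> \<le> w"
    proof -
      have "\<delta> + 1 / (2 * real q) \<le> of_int r / real q"
        using q mu by (simp add: \<delta>_def diff_divide_distrib divide_right_mono)
      thus ?thesis using small unfolding w_def by linarith
    qed
    have d2: "w \<le> 1 - \<delta>"
    proof -
      have "of_int r / real q + \<delta> + 1 / (2 * real q) = (of_int r + of_int \<mu>) / real q"
        using q by (simp add: \<delta>_def diff_divide_distrib add_divide_distrib)
      also have "\<dots> \<le> 1" using mu q by simp
      finally show ?thesis using small unfolding w_def by linarith
    qed
    have d0: "0 \<le> \<delta>" using mu q by (simp add: \<delta>_def)
    have "of_int \<mu> / real q \<le> 2 * \<delta>"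
    proof -
      have "real_of_int \<mu> \<le> 2 * (of_int \<mu> - 1/2)" using mu(1) by simp
      hence "of_int \<mu> / real q \<le> (2 * (of_int \<mu> - 1/2)) / real q" by (intro divide_right_mono) auto
      thus ?thesis by (simp only: \<delta>_def times_divide_eq_right)
    qed
    hence "of_int \<mu> / real q \<le> \<bar>sin (pi * (real j * x))\<bar>"
      using abs_sin_pi_ge[OF d0 d1 d2, of "(int j * a) div int q"] unfolding jx by linarith
    hence s: "(of_int \<mu> / real q)^2 \<le> (sin (pi * (real j * x)))^2"
      using mu by (subst abs_le_square_iff[symmetric]) simp
    have "\<Phi> j \<le> 1 / ((real L)^2 * (of_int \<mu> / real q)^2)"
      unfolding \<Phi>_def using s L mu q by (intro divide_left_mono add_increasing mult_left_mono mult_pos_pos) (auto intro!: add_pos_nonneg)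
    also have "\<dots> = (real q)^2 / (real L)^2 * (1 / (of_int \<mu>)^2)" by (simp add: power_divide)
    also have "\<dots> \<le> \<psi> r" unfolding \<psi>_def
      by (intro mult_left_mono) (auto simp: \<mu>_def min_def)
    finally show ?thesis by (simp add: r_def)
  qed
  have part1: "(\<Sum>j\<in>{j. j \<le> 4*L \<and> \<not> q dvd j}. \<Phi> j) \<le> 384"
  proof -
    have "(\<Sum>j\<in>{j. j \<le> 4*L \<and> \<not> q dvd j}. \<Phi> j) \<le> (\<Sum>j\<in>{j. j \<le> 4*L \<and> \<not> q dvd j}. \<psi> ((int j * a) mod int q))"
      by (intro sum_mono nondvd) auto
    also have "\<dots> \<le> (\<Sum>j<q*n. \<psi> ((int j * a) mod int q))"
    proof (intro sum_mono2)
      have "4*L < q * n" using dividend_less_times_div[OF q(1), of "4*L"] by (simp add: n_def K_def)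
      thus "{j. j \<le> 4*L \<and> \<not> q dvd j} \<subseteq> {..<q*n}" by auto
    qed (auto simp: psi0)
    also have "\<dots> = real n * (\<Sum>j<q. \<psi> ((int j * a) mod int q))"
      by (rule sum_periodic_nat) (simp add: distrib_right)
    also have "(\<Sum>j<q. \<psi> ((int j * a) mod int q)) = (\<Sum>r\<in>{0..<int q}. \<psi> r)"
      by (rule sum_residues[OF q(1) cop])
    also have "\<dots> \<le> (real q)^2 / (real L)^2 * (2 + 2)"
    proof -
      have A: "(\<Sum>r\<in>{0..<int q}. 1 / (real_of_int r)^2) \<le> 2"
      proof -
        have "(\<Sum>r\<in>{0..<int q}. 1 / (real_of_int r)^2) = (\<Sum>r\<in>{0..<q}. 1 / (real r)^2)"
          by (rule sum.reindex_bij_witness[of _ int nat]) auto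
        also have "\<dots> = (\<Sum>r\<in>{1..q-1}. 1 / (real r)^2)"
          by (intro sum.mono_neutral_right) auto
        finally show ?thesis using sum_inverse_squares_le[of "q-1"] by simp
      qed
      have B: "(\<Sum>r\<in>{0..<int q}. 1 / (real_of_int (int q - r))^2) \<le> 2"
      proof -
        have "(\<Sum>r\<in>{0..<int q}. 1 / (real_of_int (int q - r))^2) = (\<Sum>r\<in>{1..q}. 1 / (real r)^2)"
          by (rule sum.reindex_bij_witness[of _ "\<lambda>r. int q - int r" "\<lambda>r. nat (int q - r)"]) auto
        thus ?thesis using sum_inverse_squares_le[of q] by simp
      qed
      show ?thesis unfolding \<psi>_def sum_distrib_left[symmetric] sum.distrib
        by (intro mult_left_mono add_mono A B) auto
    qed
    finally have "(\<Sum>j\<in>{j. j \<le> 4*L \<and> \<not> q dvd j}. \<Phi> j) \<le> real n * ((real q)^2 / (real L)^2 * 4)"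
      by (simp add: mult_left_mono)
    also have "\<dots> \<le> 12 * real L / real q * ((real q)^2 / (real L)^2 * 4)"
      by (intro mult_right_mono n_le) auto
    also have "\<dots> = 48 * real q / real L" using q L by (simp add: power2_eq_square)
    also have "\<dots> \<le> 384" using q(2) L by (simp add: field_simps)
    finally show ?thesis .
  qed
  have part2: "(\<Sum>j\<in>{j. j \<le> 4*L \<and> q dvd j}. \<Phi> j) \<le> 24 * (real L / real q) / (1 + (real L)^2 * \<beta>)"
  proof -
    have "{j. j \<le> 4*L \<and> q dvd j} = (\<lambda>k. q * k) ` {..K}"
    proof -
      have "q * k \<le> 4*L \<longleftrightarrow> k \<le> K" for k
        unfolding K_def using q by (metis div_le_mono less_eq_div_iff_mult_less_eq mult.commute)
      thus ?thesis by (auto elim!: dvdE)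
    qed
    hence "(\<Sum>j\<in>{j. j \<le> 4*L \<and> q dvd j}. \<Phi> j) = (\<Sum>k\<le>K. \<Phi> (q * k))"
      using q by (simp add: sum.reindex inj_on_def)
    also have le: "\<Phi> (q*k) \<le> 1 / (1 + (2 * real L * real q * \<beta> * real k)^2)" if "k \<le> K" for k
    proof -
      have kq: "real k * (real q * \<beta>) \<le> 1/2"
      proof -
        have "real k \<le> 4 * real L"
        proof -
          have "k \<le> 4*L" using that div_le_dividend[of "4*L" q] unfolding K_def by linarith
          thus ?thesis by linarith
        qed
        hence "real k * (real q * \<beta>) \<le> 4 * real L * (1 / (8 * real L))"
          using qb_lt b0 by (intro mult_mono) auto
        thus ?thesis using L by simp
      qed
      define t where "t = real k * (real q * x - of_int a)"
      have t: "\<bar>t\<bar> = real k * (real q * \<beta>)" by (simp add: t_def abs_mult qb)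
      define N where "N = int k * a"
      have eq: "real (q*k) * x = of_int N + t" by (simp add: t_def N_def algebra_simps)
      have "\<bar>sin (pi * (real (q*k) * x))\<bar> = \<bar>sin (pi * t)\<bar>"
        by (simp only: eq distrib_left sin_add) (simp add: abs_mult)
      also have "\<dots> = \<bar>sin (pi * \<bar>t\<bar>)\<bar>" by (simp add: abs_if)
      also have "\<dots> \<ge> 2 * \<bar>t\<bar>" using sin_pi_ge[of "\<bar>t\<bar>"] t kq by linarith
      finally have "(2 * \<bar>t\<bar>)^2 \<le> (sin (pi * (real (q*k) * x)))^2"
        by (subst abs_le_square_iff[symmetric]) simp
      hence "(real L)^2 * (2 * \<bar>t\<bar>)^2 \<le> (real L)^2 * (sin (pi * (real (q*k) * x)))^2"
        by (intro mult_left_mono) auto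
      moreover have "(2 * real L * real q * \<beta> * real k)^2 = (real L)^2 * (2 * \<bar>t\<bar>)^2"
        unfolding t by (simp add: power_mult_distrib mult_ac)
      ultimately show ?thesis unfolding \<Phi>_def
        by (intro divide_left_mono) (auto intro!: mult_pos_pos add_pos_nonneg)
    qed
    hence "(\<Sum>k\<le>K. \<Phi> (q * k)) \<le> (\<Sum>k\<le>K. 1 / (1 + (2 * real L * real q * \<beta> * real k)^2))"
      by (intro sum_mono le) auto
    also have "\<dots> \<le> 24 * (real L / real q) / (1 + (real L)^2 * \<beta>)"
    \<comment> \<open>Very close to a/q the number of multiples, at most 12L/q, suffices as a bound;
      further away the arctangent sum with c \<le> 1/4 is at most 3/c.\<close>
    proof (cases "(real L)^2 * \<beta> \<le> 1")
      case True
      have "(\<Sum>k\<le>K. 1 / (1 + (2 * real L * real q * \<beta> * real k)^2)) \<le> (\<Sum>k\<le>K. 1)"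
        by (intro sum_mono) (auto simp: divide_le_eq_1 add_pos_nonneg)
      also have "\<dots> = real n" by (simp add: n_def)
      also have "\<dots> \<le> 12 * real L / real q" by (rule n_le)
      also have "\<dots> = 24 * (real L / real q) / 2" by simp
      also have "\<dots> \<le> 24 * (real L / real q) / (1 + (real L)^2 * \<beta>)"
        using True b0 by (intro divide_left_mono) (auto intro!: mult_pos_pos add_pos_nonneg)
      finally show ?thesis .
    next
      case False
      have bpos: "\<beta> > 0" using False b0 by (cases "\<beta> = 0") auto
      define c where "c = 2 * real L * real q * \<beta>"
      have c: "c > 0" using bpos L q by (simp add: c_def)
      have c1: "c \<le> 1/4"
        using qb_lt L by (simp add: c_def field_simps)
      have "(\<Sum>k\<le>K. 1 / (1 + (2 * real L * real q * \<beta> * real k)^2)) \<le> 1 + 2 / c"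
        using sum_inverse_one_plus_sq[OF c, of K] by (simp add: c_def)
      also have "\<dots> \<le> 3 / c" using c c1 by (simp add: field_simps)
      also have "\<dots> = 3 * (real L / real q) / (2 * ((real L)^2 * \<beta>))"
        using L q bpos by (simp add: c_def power2_eq_square field_simps)
      also have "\<dots> \<le> 24 * (real L / real q) / (1 + (real L)^2 * \<beta>)"
        using False by (intro frac_le) (auto simp: divide_right_mono mult.commute intro!: add_pos_nonneg mult_right_mono divide_nonneg_nonneg)
      finally show ?thesis .
    qed
    finally show ?thesis .
  qed
  have nine: "384 \<le> 3456 * real L / (real q * (1 + (real L)^2 * \<beta>))"
  proof -
    have "real q * (1 + (real L)^2 * \<beta>) = real q + real L * (real L * (real q * \<beta>))"
      by (simp add: power2_eq_square algebra_simps)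
    also have "\<dots> \<le> 8 * real L + real L * (real L * (1 / (8 * real L)))"
      using q qb_lt L by (intro add_mono mult_left_mono) auto
    also have "\<dots> \<le> 9 * real L" using L by simp
    finally have "real q * (1 + (real L)^2 * \<beta>) \<le> 9 * real L" .
    moreover have "0 < real q * (1 + (real L)^2 * \<beta>)" using q b0 by (intro mult_pos_pos add_pos_nonneg) auto
    ultimately show ?thesis by (simp add: pos_le_divide_eq)
  qed
  have split: "{..4*L} = {j. j \<le> 4*L \<and> q dvd j} \<union> {j. j \<le> 4*L \<and> \<not> q dvd j}" by auto
  have "(\<Sum>j\<le>4*L. \<Phi> j) = (\<Sum>j\<in>{j. j \<le> 4*L \<and> q dvd j}. \<Phi> j) + (\<Sum>j\<in>{j. j \<le> 4*L \<and> \<not> q dvd j}. \<Phi> j)"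
    unfolding split by (rule sum.union_disjoint) auto
  also have "\<dots> \<le> 24 * (real L / real q) / (1 + (real L)^2 * \<beta>) + 3456 * real L / (real q * (1 + (real L)^2 * \<beta>))"
    using part1 part2 nine by linarith
  also have "\<dots> = 3480 * real L / (real q * (1 + (real L)^2 * \<beta>))" by (simp add: add_divide_distrib[symmetric])
  finally show ?thesis by (simp add: \<Phi>_def \<beta>_def)
qed

text \<open>Dirichlet approximation of order 8L, twice the number 4L of shifts: this is what makes
  the perturbation at most 1/(2q) in \<open>sum_sin_rational_approx\<close>. For x in [0,1] the
  numerator lies in 0..q. The constant is 16 * 3480.\<close>

lemma tent_sum_weyl:
  assumes L: "L > 0" and x: "x \<in> {0..1}"
  shows "\<exists>q\<in>{1..8*L}. \<exists>a\<in>{0..q}. (cmod (tent_sum L m x))^2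
      \<le> 55680 * ((real L)^2 / (real q * (1 + (real L)^2 * \<bar>x - real a / real q\<bar>)))"
proof -
  obtain a k where ak: "coprime a k" "0 < k" "k \<le> int (8*L)" "\<bar>of_int k * x - of_int a\<bar> < 1 / real (8*L)"
    using Dirichlet_approx_coprime[of "8*L" x] L by auto
  define q where "q = nat k"
  have q: "q > 0" "q \<le> 8*L" "k = int q" using ak by (auto simp: q_def)
  have ap: "\<bar>real q * x - of_int a\<bar> < 1 / real (8*L)" using ak q by simp
  have "1 / real (8*L) \<le> 1" using L by simp
  hence lt1: "\<bar>real q * x - of_int a\<bar> < 1" using ap by linarith
  have "0 \<le> real q * x" "real q * x \<le> real q" using x by (auto simp: mult_left_le)
  hence "real_of_int a > -1" "real_of_int a < real q + 1" using lt1 by linarith+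
  hence a: "0 \<le> a" "a \<le> int q" by linarith+
  have "(cmod (tent_sum L m x))^2 \<le> 16 * real L * (3480 * real L / (real q * (1 + (real L)^2 * \<bar>x - of_int a / real q\<bar>)))"
    using sum_sin_rational_approx[OF L q(1,2) ak(1)[unfolded q(3)] ap]
    by (intro order.trans[OF tent_sum_weyl_differencing[OF L]] mult_left_mono) auto
  also have "\<dots> = 55680 * ((real L)^2 / (real q * (1 + (real L)^2 * \<bar>x - real (nat a) / real q\<bar>)))"
    using a by (simp add: power2_eq_square)
  finally show ?thesis using q a by (intro bexI[of _ q] bexI[of _ "nat a"]) auto
qed

section \<open>Integration around all rationals, and the size of the Weyl norm\<close>

lemma integral_powr_decay:
  fixes A r c :: real
  assumes A: "A > 0" and r: "r > 1" and c: "0 \<le> c" "c \<le> 1"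
  shows "integral {0..1} (\<lambda>x. (1 + A * \<bar>x - c\<bar>) powr (-r)) \<le> 2 / (A * (r - 1))"
proof -
  have cont: "continuous_on S (\<lambda>x. (1 + A * \<bar>x - c\<bar>) powr (-r))" for S
    using A by (intro continuous_intros) (auto simp: add_nonneg_eq_0_iff)
  have ge1: "1 + A * t > 0" if "t \<ge> 0" for t using A that by (simp add: add_pos_nonneg)
  have I1: "((\<lambda>x. (1 + A * \<bar>x - c\<bar>) powr (-r)) has_integral
      (1 + A * (c - c)) powr (1-r) / (A * (r-1)) - (1 + A * (c - 0)) powr (1-r) / (A * (r-1))) {0..c}"
  proof (rule fundamental_theorem_of_calculus[OF c(1)])
    fix x assume x: "x \<in> {0..c}"
    have p: "1 + A * (c - x) > 0" using x by (intro ge1) auto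
    have "((\<lambda>x. (1 + A * (c - x)) powr (1-r) / (A * (r-1))) has_real_derivative
        ((1-r) * (1 + A * (c - x)) powr (1-r-1) * (- A)) / (A * (r-1))) (at x within {0..c})"
      using p A r by (auto intro!: derivative_eq_intros)
    also have "((1-r) * (1 + A * (c - x)) powr (1-r-1) * (- A)) / (A * (r-1)) = (1 + A * \<bar>x - c\<bar>) powr (-r)"
      using x A r by (simp add: field_simps)
    finally show "((\<lambda>x. (1 + A * (c - x)) powr (1-r) / (A * (r-1))) has_vector_derivative (1 + A * \<bar>x - c\<bar>) powr (-r)) (at x within {0..c})"
      by (simp add: has_real_derivative_iff_has_vector_derivative)
  qed
  have I2: "((\<lambda>x. (1 + A * \<bar>x - c\<bar>) powr (-r)) has_integral
      - ((1 + A * (1 - c)) powr (1-r) / (A * (r-1))) - (- ((1 + A * (c - c)) powr (1-r) / (A * (r-1))))) {c..1}"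
  proof (rule fundamental_theorem_of_calculus[OF c(2)])
    fix x assume x: "x \<in> {c..1}"
    have p: "1 + A * (x - c) > 0" using x by (intro ge1) auto
    have "((\<lambda>x. - ((1 + A * (x - c)) powr (1-r) / (A * (r-1)))) has_real_derivative
        - (((1-r) * (1 + A * (x - c)) powr (1-r-1) * A) / (A * (r-1)))) (at x within {c..1})"
      using p A r by (auto intro!: derivative_eq_intros)
    also have "- (((1-r) * (1 + A * (x - c)) powr (1-r-1) * A) / (A * (r-1))) = (1 + A * \<bar>x - c\<bar>) powr (-r)"
      using x A r by (simp add: field_simps)
    finally show "((\<lambda>x. - ((1 + A * (x - c)) powr (1-r) / (A * (r-1)))) has_vector_derivative (1 + A * \<bar>x - c\<bar>) powr (-r)) (at x within {c..1})"
      by (simp add: has_real_derivative_iff_has_vector_derivative)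
  qed
  have "integral {0..1} (\<lambda>x. (1 + A * \<bar>x - c\<bar>) powr (-r)) =
     integral {0..c} (\<lambda>x. (1 + A * \<bar>x - c\<bar>) powr (-r)) + integral {c..1} (\<lambda>x. (1 + A * \<bar>x - c\<bar>) powr (-r))"
    using c by (intro Henstock_Kurzweil_Integration.integral_combine[symmetric] integrable_continuous_interval cont) auto
  also have "integral {0..c} (\<lambda>x. (1 + A * \<bar>x - c\<bar>) powr (-r)) \<le> 1 / (A * (r-1))"
    using integral_unique[OF I1] A r by simp
  also have "integral {c..1} (\<lambda>x. (1 + A * \<bar>x - c\<bar>) powr (-r)) \<le> 1 / (A * (r-1))"
    using integral_unique[OF I2] A r by simp
  finally show ?thesis by simp
qed

lemma continuous_tent_sum [continuous_intros]: "continuous_on S (tent_sum L m)"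
  unfolding tent_sum_def cis_conv_exp by (intro continuous_intros)

lemma power2_powr_half:
  fixes y p :: real
  assumes "y \<ge> 0" shows "(y^2) powr (p/2) = y powr p"
proof -
  have "y^2 = y powr 2" using assms by simp
  thus ?thesis by (simp only: powr_powr) simp
qed

lemma powr_half_expand:
  fixes C y q w p :: real
  assumes "C \<ge> 0" "y \<ge> 0" "q \<ge> 0" "w \<ge> 0"
  shows "(C * (y^2 / (q * w))) powr (p/2) = C powr (p/2) * (y powr p * q powr (-(p/2)) * w powr (-(p/2)))"
proof -
  have "(C * (y^2 / (q * w))) powr (p/2) = C powr (p/2) * ((y^2) powr (p/2) / (q powr (p/2) * w powr (p/2)))"
    using assms by (simp add: powr_mult powr_divide)
  thus ?thesis using assms by (simp add: power2_powr_half powr_minus_divide)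
qed

text \<open>The rational near x depends on x, so the pointwise bound is replaced by the sum over all
  pairs (q, a), each integrated over the whole interval. The decay exponent p/2 > 1 gives a multiple
  of L^(p-2) q^(-p/2) per pair, and there are q + 1 \<le> 2q numerators.\<close>

lemma tent_sum_Lp:
  assumes p: "p > 2"
  shows "\<exists>C>0. \<forall>L>0. \<forall>m. integral {0..1} (\<lambda>x. cmod (tent_sum L m x) powr p)
     \<le> C * (real L powr (p-2) * (\<Sum>q=1..8*L. real q powr (1 - p/2)))"
proof -
  define D :: real where "D = 55680 powr (p/2)"
  have D: "D > 0" by (simp add: D_def)
  show ?thesis
  proof (intro exI[of _ "D * 4 / (p/2 - 1)"] conjI allI impI)
    show "D * 4 / (p/2 - 1) > 0" using D p by simp
    fix L :: nat and m :: int assume L: "L > 0"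
    define f where "f q a x = D * (real L powr p * real q powr (-(p/2)) * (1 + (real L)^2 * \<bar>x - real a / real q\<bar>) powr (-(p/2)))"
      for q a :: nat and x :: real
    have f0: "f q a x \<ge> 0" for q a x using D by (simp add: f_def)
    have pos: "1 + (real L)^2 * \<bar>y\<bar> > 0" for y by (simp add: add_pos_nonneg)
    have cont: "continuous_on S (f q a)" for q a S
    proof -
      have *: "continuous_on S (\<lambda>x. (1 + (real L)^2 * \<bar>x - c\<bar>) powr r)" for c r
        by (intro continuous_intros ballI) (use pos in \<open>simp add: less_imp_neq[THEN not_sym]\<close>)
      show ?thesis unfolding f_def[abs_def]
        by (rule continuous_on_mult_left, rule continuous_on_mult_left, rule *)
    qed
    have If: "f q a integrable_on {0..1}" for q a by (intro integrable_continuous_interval cont)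
    have pt: "cmod (tent_sum L m x) powr p \<le> (\<Sum>q=1..8*L. \<Sum>a=0..q. f q a x)" if x: "x \<in> {0..1}" for x
    proof -
      obtain q a where qa: "q \<in> {1..8*L}" "a \<in> {0..q}" and le: "(cmod (tent_sum L m x))^2
          \<le> 55680 * ((real L)^2 / (real q * (1 + (real L)^2 * \<bar>x - real a / real q\<bar>)))"
        using tent_sum_weyl[OF L x, of m] by blast
      have "cmod (tent_sum L m x) powr p = ((cmod (tent_sum L m x))^2) powr (p/2)"
        by (simp add: power2_powr_half)
      also have "\<dots> \<le> (55680 * ((real L)^2 / (real q * (1 + (real L)^2 * \<bar>x - real a / real q\<bar>)))) powr (p/2)"
        using p by (intro powr_mono2 le) auto
      also have "\<dots> = f q a x"
        unfolding f_def D_def using pos[of "x - real a / real q"] by (intro powr_half_expand) auto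
      also have "\<dots> \<le> (\<Sum>a=0..q. f q a x)"
        using qa f0 by (intro member_le_sum) auto
      also have "\<dots> \<le> (\<Sum>q=1..8*L. \<Sum>a=0..q. f q a x)"
        using qa f0 by (intro member_le_sum[of q _ "\<lambda>q. \<Sum>a=0..q. f q a x"]) (auto intro!: sum_nonneg)
      finally show ?thesis .
    qed
    have "integral {0..1} (\<lambda>x. cmod (tent_sum L m x) powr p) \<le> integral {0..1} (\<lambda>x. \<Sum>q=1..8*L. \<Sum>a=0..q. f q a x)"
      using pt p by (intro integral_le integrable_cmod_powr integrable_sum If continuous_intros) auto
    also have "\<dots> = (\<Sum>q=1..8*L. \<Sum>a=0..q. integral {0..1} (f q a))"
      by (simp add: integral_sum integrable_sum If)
    also have "\<dots> \<le> (\<Sum>q=1..8*L. D * 4 / (p/2 - 1) * (real L powr (p-2) * real q powr (1 - p/2)))"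
    proof (intro sum_mono)
      fix q assume q: "q \<in> {1..8*L}"
      have "(\<Sum>a=0..q. integral {0..1} (f q a)) \<le> (\<Sum>a=0..q. D * (real L powr p * real q powr (-(p/2)) * (2 / ((real L)^2 * (p/2 - 1)))))"
      proof (intro sum_mono)
        fix a assume a: "a \<in> {0..q}"
        have "integral {0..1} (f q a) = D * (real L powr p * real q powr (-(p/2)) * integral {0..1} (\<lambda>x. (1 + (real L)^2 * \<bar>x - real a / real q\<bar>) powr (-(p/2))))"
          unfolding f_def[abs_def] by (simp only: integral_mult_right)
        also have "\<dots> \<le> D * (real L powr p * real q powr (-(p/2)) * (2 / ((real L)^2 * (p/2 - 1))))"
          using D L a q p by (intro mult_left_mono integral_powr_decay) (auto simp: divide_le_eq_1)
        finally show "integral {0..1} (f q a) \<le> D * (real L powr p * real q powr (-(p/2)) * (2 / ((real L)^2 * (p/2 - 1))))" .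
      qed
      also have "\<dots> = (real q + 1) * (D * (real L powr p * real q powr (-(p/2)) * (2 / ((real L)^2 * (p/2 - 1)))))" by simp
      also have "\<dots> \<le> (2 * real q) * (D * (real L powr p * real q powr (-(p/2)) * (2 / ((real L)^2 * (p/2 - 1)))))"
        using q D p by (intro mult_right_mono) auto
      also have "\<dots> = D * 4 / (p/2 - 1) * ((real L powr p / (real L)^2) * (real q * real q powr (-(p/2))))"
        by (simp add: mult_ac)
      also have "real L powr p / (real L)^2 = real L powr (p-2)" using L by (simp add: powr_diff)
      also have "real q * real q powr (-(p/2)) = real q powr (1 - p/2)" using q powr_mult_base[of "real q" "-(p/2)"] by simp
      finally show "(\<Sum>a=0..q. integral {0..1} (f q a)) \<le> D * 4 / (p/2 - 1) * (real L powr (p-2) * real q powr (1 - p/2))" .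
    qed
    also have "\<dots> = D * 4 / (p/2 - 1) * (real L powr (p-2) * (\<Sum>q=1..8*L. real q powr (1 - p/2)))"
      by (simp only: sum_distrib_left)
    finally show "integral {0..1} (\<lambda>x. cmod (tent_sum L m x) powr p)
        \<le> D * 4 / (p/2 - 1) * (real L powr (p-2) * (\<Sum>q=1..8*L. real q powr (1 - p/2)))" .
  qed
qed

text \<open>\<open>weyl_exp\<close> and \<open>weyl_log\<close> are the exponents of the length and
  of the logarithm in the p-norm of a Weyl sum. The shift in 1 + ln x keeps \<open>weyl_size\<close>
  at least 1 from x = 1 on, so that bounded remainders can be absorbed.\<close>

definition weyl_exp :: "real \<Rightarrow> real" where "weyl_exp p = (if p \<le> 4 then 1/2 else 1 - 2/p)"
definition weyl_log :: "real \<Rightarrow> real" where "weyl_log p = (if p = 4 then 1/4 else 0)"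
definition weyl_size :: "real \<Rightarrow> real \<Rightarrow> real" where
  "weyl_size p x = x powr weyl_exp p * (1 + ln x) powr weyl_log p"

lemma weyl_exp_ge: "weyl_exp p \<ge> 1/2" by (auto simp: weyl_exp_def field_simps)
lemma weyl_log_nonneg: "weyl_log p \<ge> 0" by (auto simp: weyl_log_def)

lemma weyl_size_mono: "1 \<le> x \<Longrightarrow> x \<le> y \<Longrightarrow> weyl_size p x \<le> weyl_size p y"
  unfolding weyl_size_def using weyl_exp_ge[of p] weyl_log_nonneg[of p]
  by (intro mult_mono powr_mono2) auto

lemma weyl_size_ge_1: "1 \<le> x \<Longrightarrow> 1 \<le> weyl_size p x"
  using weyl_size_mono[of 1 x p] by (simp add: weyl_size_def)

text \<open>A length ratio 16 gains the factor 16^(1/2) = 4, which exceeds the factor 3 lost on the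
  ramps in \<open>sharp_sum_recursion\<close>.\<close>

lemma weyl_size_16:
  assumes "1 \<le> x" "16 * x \<le> y" shows "4 * weyl_size p x \<le> weyl_size p y"
proof -
  have "4 * x powr weyl_exp p = 16 powr (1/2) * x powr weyl_exp p" by (simp add: powr_half_sqrt)
  also have "\<dots> \<le> 16 powr weyl_exp p * x powr weyl_exp p"
    using weyl_exp_ge[of p] by (intro mult_right_mono powr_mono) auto
  also have "\<dots> = (16 * x) powr weyl_exp p" using assms by (simp add: powr_mult)
  also have "\<dots> \<le> y powr weyl_exp p" using assms weyl_exp_ge[of p] by (intro powr_mono2) auto
  finally have "4 * x powr weyl_exp p * (1 + ln x) powr weyl_log p \<le> y powr weyl_exp p * (1 + ln y) powr weyl_log p"
    using assms weyl_log_nonneg[of p] by (intro mult_mono powr_mono2) auto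
  thus ?thesis by (simp add: weyl_size_def)
qed

lemma sum_powr_le:
  fixes b :: real
  assumes b: "0 < b" "b \<le> 1"
  shows "(\<Sum>q=1..Q. real q powr (b - 1)) \<le> real Q powr b / b"
proof (induction Q)
  case (Suc Q)
  have "real (Suc Q) powr (b-1) \<le> (real (Suc Q) powr b - real Q powr b) / b"
  proof (cases "Q = 0")
    case True thus ?thesis using b by simp
  next
    case False
    have "\<exists>z>real Q. z < real (Suc Q) \<and> real (Suc Q) powr b - real Q powr b = (real (Suc Q) - real Q) * (b * z powr (b-1))"
      using False by (intro MVT2) (auto intro!: derivative_eq_intros)
    then obtain z where z: "z > real Q" "z < real (Suc Q)" and eq: "real (Suc Q) powr b - real Q powr b = b * z powr (b-1)"
      by auto
    have "real (Suc Q) powr (b-1) \<le> z powr (b-1)" using z b by (intro powr_mono2') auto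
    thus ?thesis using eq b by simp
  qed
  thus ?case using Suc by (simp add: diff_divide_distrib)
qed (use b in simp)

lemma sum_inverse_le_ln: "Q \<ge> 1 \<Longrightarrow> (\<Sum>q=1..Q. 1 / real q) \<le> 1 + ln (real Q)"
proof (induction Q rule: nat_induct_at_least)
  case (Suc Q)
  have "ln (real Q / real (Suc Q)) \<le> real Q / real (Suc Q) - 1" using Suc.hyps by (intro ln_le_minus_one) auto
  also have "\<dots> = - (1 / real (Suc Q))" by (simp add: field_simps)
  finally have "1 / real (Suc Q) \<le> ln (real (Suc Q)) - ln (real Q)" using Suc.hyps by (simp add: ln_div)
  thus ?case using Suc.IH by simp
qed simp

text \<open>The term q^(1 - p/2) is 1/q exactly at p = 4: below, the largest denominators dominate;
  above, the series converges and the smallest dominate; at 4 all dyadic ranges of q weigh the same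
  and give the logarithm.\<close>

lemma weyl_size_sum:
  assumes p: "p > 2"
  shows "\<exists>C>0. \<forall>L>0. real L powr (p-2) * (\<Sum>q=1..8*L. real q powr (1 - p/2)) \<le> C * weyl_size p (real L) powr p"
proof -
  have S: "weyl_size p (real L) powr p = real L powr (weyl_exp p * p) * (1 + ln (real L)) powr (weyl_log p * p)" for L :: nat
    by (simp add: weyl_size_def powr_mult powr_powr)
  have ln1: "1 + ln (real L) \<noteq> 0" if "L > 0" for L :: nat
  proof -
    have "ln (real L) \<ge> 0" using that by simp
    thus ?thesis by linarith
  qed
  consider "p < 4" | "p = 4" | "p > 4" by linarith
  thus ?thesis
  proof cases
    case 1
    define b where "b = 2 - p/2"
    have b: "0 < b" "b \<le> 1" using 1 p by (auto simp: b_def)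
    show ?thesis
    proof (intro exI[of _ "8 powr b / b"] conjI allI impI)
      fix L :: nat assume L: "L > 0"
      have "(\<Sum>q=1..8*L. real q powr (1 - p/2)) \<le> real (8*L) powr b / b"
        using sum_powr_le[OF b, of "8*L"] by (simp add: b_def)
      also have "\<dots> = 8 powr b / b * real L powr b" by (simp add: powr_mult)
      finally have "real L powr (p-2) * (\<Sum>q=1..8*L. real q powr (1 - p/2)) \<le> real L powr (p-2) * (8 powr b / b * real L powr b)"
        by (intro mult_left_mono) auto
      also have "\<dots> = 8 powr b / b * real L powr (p/2)"
        by (simp add: b_def powr_add[symmetric])
      also have "\<dots> = 8 powr b / b * weyl_size p (real L) powr p"
        using 1 ln1[OF L] unfolding S by (simp add: weyl_exp_def weyl_log_def)
      finally show "real L powr (p-2) * (\<Sum>q=1..8*L. real q powr (1 - p/2)) \<le> 8 powr b / b * weyl_size p (real L) powr p" .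
    qed (use b in auto)
  next
    case 2
    show ?thesis
    proof (intro exI[of _ "1 + ln 8"] conjI allI impI)
      fix L :: nat assume L: "L > 0"
      have "(\<Sum>q=1..8*L. real q powr (1 - p/2)) = (\<Sum>q=1..8*L. 1 / real q)"
        using 2 by (intro sum.cong) (auto simp: powr_minus_divide)
      also have "\<dots> \<le> 1 + ln (real (8*L))" using L by (intro sum_inverse_le_ln) auto
      also have "\<dots> = 1 + ln 8 + ln (real L)" using L by (simp add: ln_mult)
      also have "\<dots> \<le> (1 + ln 8) * (1 + ln (real L))"
        using L by (simp add: algebra_simps)
      finally have "real L powr (p-2) * (\<Sum>q=1..8*L. real q powr (1 - p/2)) \<le> real L powr (p-2) * ((1 + ln 8) * (1 + ln (real L)))"
        by (intro mult_left_mono) auto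
      also have "\<dots> = (1 + ln 8) * weyl_size p (real L) powr p"
        unfolding S using 2 L by (simp add: weyl_exp_def weyl_log_def add_nonneg_nonneg)
      finally show "real L powr (p-2) * (\<Sum>q=1..8*L. real q powr (1 - p/2)) \<le> (1 + ln 8) * weyl_size p (real L) powr p" .
    qed (auto intro!: add_pos_nonneg)
  next
    case 3
    have sm: "summable (\<lambda>q. real q powr (1 - p/2))" using 3 by (simp add: summable_real_powr_iff)
    show ?thesis
    proof (intro exI[of _ "(\<Sum>q. real q powr (1 - p/2)) + 1"] conjI allI impI)
      show "0 < (\<Sum>q. real q powr (1 - p/2)) + 1" using suminf_nonneg[OF sm] by simp
      fix L :: nat assume L: "L > 0"
      have "(\<Sum>q=1..8*L. real q powr (1 - p/2)) \<le> (\<Sum>q. real q powr (1 - p/2))"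
        by (intro sum_le_suminf sm) auto
      hence "real L powr (p-2) * (\<Sum>q=1..8*L. real q powr (1 - p/2)) \<le> real L powr (p-2) * ((\<Sum>q. real q powr (1 - p/2)) + 1)"
        by (intro mult_left_mono) auto
      also have "\<dots> = ((\<Sum>q. real q powr (1 - p/2)) + 1) * weyl_size p (real L) powr p"
        unfolding S using 3 ln1[OF L] by (simp add: weyl_exp_def weyl_log_def left_diff_distrib)
      finally show "real L powr (p-2) * (\<Sum>q=1..8*L. real q powr (1 - p/2)) \<le> ((\<Sum>q. real q powr (1 - p/2)) + 1) * weyl_size p (real L) powr p" .
    qed
  qed
qed

lemma tent_sum_norm:
  assumes p: "p > 2"
  shows "\<exists>C>0. \<forall>L>0. \<forall>m. Lp_norm p (tent_sum L m) \<le> C * weyl_size p (real L)"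
proof -
  obtain C1 where C1: "C1 > 0" "\<And>L m. L > 0 \<Longrightarrow> integral {0..1} (\<lambda>x. cmod (tent_sum L m x) powr p)
     \<le> C1 * (real L powr (p-2) * (\<Sum>q=1..8*L. real q powr (1 - p/2)))" using tent_sum_Lp[OF p] by blast
  obtain C2 where C2: "C2 > 0" "\<And>L. L > 0 \<Longrightarrow> real L powr (p-2) * (\<Sum>q=1..8*L. real q powr (1 - p/2)) \<le> C2 * weyl_size p (real L) powr p"
    using weyl_size_sum[OF p] by blast
  show ?thesis
  proof (intro exI[of _ "(C1*C2) powr (1/p)"] conjI allI impI)
    show "(C1*C2) powr (1/p) > 0" using C1 C2 by simp
    fix L :: nat and m :: int assume L: "L > 0"
    have w: "weyl_size p (real L) \<ge> 0" using weyl_size_ge_1[of "real L" p] L by simp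
    have "integral {0..1} (\<lambda>x. cmod (tent_sum L m x) powr p) \<le> C1 * (C2 * weyl_size p (real L) powr p)"
      using C1 C2(2)[OF L] by (intro order.trans[OF C1(2)[OF L]] mult_left_mono) auto
    also have "\<dots> = ((C1*C2) powr (1/p) * weyl_size p (real L)) powr p"
      using C1 C2 p w by (simp add: powr_mult powr_powr)
    finally show "Lp_norm p (tent_sum L m) \<le> (C1*C2) powr (1/p) * weyl_size p (real L)"
      using p w by (intro Lp_norm_leI) auto
  qed
qed

section \<open>Sharp cut-offs and power weights\<close>

lemma qsum_empty [simp]: "qsum c {} x = 0" by (simp add: qsum_def)

lemma qsum_Un: "finite A \<Longrightarrow> finite B \<Longrightarrow> A \<inter> B = {} \<Longrightarrow> qsum c (A \<union> B) x = qsum c A x + qsum c B x"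
  unfolding qsum_def by (rule sum.union_disjoint)

lemma qsum_sum: "qsum (\<lambda>n. \<Sum>j\<in>J. c j n) A x = (\<Sum>j\<in>J. qsum (c j) A x)"
  unfolding qsum_def by (subst sum.swap) (simp add: sum_distrib_right)

lemma qsum_cong: "(\<And>n. n \<in> A \<Longrightarrow> c n = d n) \<Longrightarrow> qsum c A = qsum d A"
  by (rule ext) (simp add: qsum_def)

lemma qsum_restrict:
  assumes "finite A" "B \<subseteq> A" "\<And>n. n \<in> A - B \<Longrightarrow> c n = 0" shows "qsum c A = qsum c B"
  unfolding qsum_def using assms by (intro ext sum.mono_neutral_right) auto

lemma Lp_norm_bounded:
  assumes "p > 0" "0 \<le> K" "\<And>x. cmod (f x) \<le> K" "continuous_on UNIV f"
  shows "Lp_norm p f \<le> K"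
proof (rule Lp_norm_leI)
  have "integral {0..1} (\<lambda>x. cmod (f x) powr p) \<le> integral {0..1} (\<lambda>x::real. K powr p)"
    using assms by (intro integral_le integrable_cmod_powr) (auto intro!: powr_mono2)
  thus "integral {0..1} (\<lambda>x. cmod (f x) powr p) \<le> K powr p" by simp
qed (use assms in auto)

lemma Lp_norm_qsum_trivial:
  assumes "p > 0" shows "Lp_norm p (qsum c A) \<le> (\<Sum>n\<in>A. \<bar>c n\<bar>)"
proof (rule Lp_norm_bounded[OF assms])
  show "cmod (qsum c A x) \<le> (\<Sum>n\<in>A. \<bar>c n\<bar>)" for x
    unfolding qsum_def by (rule order.trans[OF norm_sum]) (simp add: norm_mult)
qed (auto intro: sum_nonneg continuous_intros)

lemma qsum_atLeastLessThan_Suc: "A \<le> B \<Longrightarrow> qsum c {A..<Suc B} x = qsum c {A..<B} x + complex_of_real (c B) * cis (2*pi*(real B)^2*x)"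
  by (simp add: qsum_def)

section \<open>Summation by parts and partition into tents\<close>

lemma qsum_abel:
  assumes "Suc A \<le> B"
  shows "qsum (\<lambda>n. c n * d n) {A..<B} x = complex_of_real (c (B-1)) * qsum d {A..<B} x
     + (\<Sum>n\<in>{A..<B-1}. complex_of_real (c n - c (Suc n)) * qsum d {A..<Suc n} x)"
  using assms
proof (induction B rule: nat_induct_at_least)
  case base
  show ?case by (simp add: qsum_def)
next
  case (Suc B)
  then obtain B' where B': "B = Suc B'" "A \<le> B'" by (cases B) auto
  show ?case using Suc.IH B'
    by (simp add: qsum_atLeastLessThan_Suc algebra_simps)
qed

lemma Lp_norm_abel:
  assumes p: "p \<ge> 1" and AB: "A < B" and T: "\<And>K. A < K \<Longrightarrow> K \<le> B \<Longrightarrow> Lp_norm p (qsum d {A..<K}) \<le> T"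
  shows "Lp_norm p (qsum (\<lambda>n. c n * d n) {A..<B}) \<le> T * (\<bar>c (B-1)\<bar> + (\<Sum>n\<in>{A..<B-1}. \<bar>c n - c (Suc n)\<bar>))"
proof -
  have "qsum (\<lambda>n. c n * d n) {A..<B} = (\<lambda>x. complex_of_real (c (B-1)) * qsum d {A..<B} x
     + (\<Sum>n\<in>{A..<B-1}. complex_of_real (c n - c (Suc n)) * qsum d {A..<Suc n} x))"
    using AB by (intro ext qsum_abel) auto
  hence "Lp_norm p (qsum (\<lambda>n. c n * d n) {A..<B}) \<le> Lp_norm p (\<lambda>x. complex_of_real (c (B-1)) * qsum d {A..<B} x)
      + Lp_norm p (\<lambda>x. \<Sum>n\<in>{A..<B-1}. complex_of_real (c n - c (Suc n)) * qsum d {A..<Suc n} x)"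
    using p by (simp only:) (intro Lp_norm_triangle continuous_intros; simp)
  also have "\<dots> \<le> \<bar>c (B-1)\<bar> * T + (\<Sum>n\<in>{A..<B-1}. \<bar>c n - c (Suc n)\<bar> * T)"
  proof (intro add_mono)
    show "Lp_norm p (\<lambda>x. complex_of_real (c (B-1)) * qsum d {A..<B} x) \<le> \<bar>c (B-1)\<bar> * T"
      using p AB T[of B] by (subst Lp_norm_cmult) (auto intro!: continuous_intros mult_left_mono)
    have "Lp_norm p (\<lambda>x. \<Sum>n\<in>{A..<B-1}. complex_of_real (c n - c (Suc n)) * qsum d {A..<Suc n} x)
       \<le> (\<Sum>n\<in>{A..<B-1}. Lp_norm p (\<lambda>x. complex_of_real (c n - c (Suc n)) * qsum d {A..<Suc n} x))"
      using p by (intro Lp_norm_sum continuous_intros)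
    also have "\<dots> \<le> (\<Sum>n\<in>{A..<B-1}. \<bar>c n - c (Suc n)\<bar> * T)"
    proof (intro sum_mono)
      fix n assume n: "n \<in> {A..<B-1}"
      have "Lp_norm p (\<lambda>x. complex_of_real (c n - c (Suc n)) * qsum d {A..<Suc n} x) = cmod (complex_of_real (c n - c (Suc n))) * Lp_norm p (qsum d {A..<Suc n})"
        using p by (intro Lp_norm_cmult continuous_intros) auto
      also have "\<dots> \<le> \<bar>c n - c (Suc n)\<bar> * T"
        unfolding norm_of_real using T[of "Suc n"] n by (intro mult_left_mono) auto
      finally show "Lp_norm p (\<lambda>x. complex_of_real (c n - c (Suc n)) * qsum d {A..<Suc n} x) \<le> \<bar>c n - c (Suc n)\<bar> * T" .
    qed
    finally show "Lp_norm p (\<lambda>x. \<Sum>n\<in>{A..<B-1}. complex_of_real (c n - c (Suc n)) * qsum d {A..<Suc n} x)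
       \<le> (\<Sum>n\<in>{A..<B-1}. \<bar>c n - c (Suc n)\<bar> * T)" .
  qed
  finally show ?thesis by (simp add: algebra_simps sum_distrib_left)
qed

lemma Lp_norm_abel_antimono:
  assumes p: "p \<ge> 1" and AB: "A < B" and T: "\<And>K. A < K \<Longrightarrow> K \<le> B \<Longrightarrow> Lp_norm p (qsum d {A..<K}) \<le> T"
    and dec: "\<And>n. A \<le> n \<Longrightarrow> Suc n < B \<Longrightarrow> c (Suc n) \<le> c n" and pos: "c (B-1) \<ge> 0"
  shows "Lp_norm p (qsum (\<lambda>n. c n * d n) {A..<B}) \<le> c A * T"
proof -
  have "(\<Sum>n\<in>{A..<B-1}. \<bar>c n - c (Suc n)\<bar>) = - (\<Sum>n\<in>{A..<B-1}. c (Suc n) - c n)"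
    unfolding sum_negf[symmetric] using dec by (intro sum.cong) auto
  also have "\<dots> = c A - c (B-1)" using AB by (subst sum_Suc_diff') auto
  finally show ?thesis using Lp_norm_abel[of p A B d T c, OF p AB T] pos by (simp add: mult.commute)
qed

text \<open>Total variation plus last value is 2 c(B-1) - c(A). The loss of 2 against the decreasing
  case is why the two ramps of an interval cost T + 2T.\<close>

lemma Lp_norm_abel_mono:
  assumes p: "p \<ge> 1" and AB: "A < B" and T: "\<And>K. A < K \<Longrightarrow> K \<le> B \<Longrightarrow> Lp_norm p (qsum d {A..<K}) \<le> T"
    and inc: "\<And>n. A \<le> n \<Longrightarrow> Suc n < B \<Longrightarrow> c n \<le> c (Suc n)" and pos: "c A \<ge> 0"
  shows "Lp_norm p (qsum (\<lambda>n. c n * d n) {A..<B}) \<le> 2 * c (B-1) * T"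
proof -
  have "(\<Sum>n\<in>{A..<B-1}. \<bar>c n - c (Suc n)\<bar>) = (\<Sum>n\<in>{A..<B-1}. c (Suc n) - c n)"
    using inc by (intro sum.cong) auto
  also have "\<dots> = c (B-1) - c A" using AB by (subst sum_Suc_diff') auto
  finally have eq: "(\<Sum>n\<in>{A..<B-1}. \<bar>c n - c (Suc n)\<bar>) = c (B-1) - c A" .
  moreover have "0 \<le> (\<Sum>n\<in>{A..<B-1}. \<bar>c n - c (Suc n)\<bar>)" by (rule sum_nonneg) simp
  ultimately have cB: "c (B-1) \<ge> 0" "c A \<le> c (B-1)" using pos by linarith+
  have T0: "T \<ge> 0" using T[of B] AB Lp_norm_nonneg[of p "qsum d {A..<B}"] by linarith
  have "Lp_norm p (qsum (\<lambda>n. c n * d n) {A..<B}) \<le> T * (c (B-1) + (c (B-1) - c A))"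
    using Lp_norm_abel[of p A B d T c, OF p AB T] cB unfolding eq by simp
  also have "\<dots> \<le> T * (2 * c (B-1))" using T0 pos by (intro mult_left_mono) auto
  finally show ?thesis by (simp add: mult_ac)
qed

text \<open>Tents centred at the multiples of L: between two neighbouring centres only those two
  tents can be nonzero, and their heights add up to 1.\<close>

lemma tent_partition:
  assumes L: "L > 0" and i: "i \<le> n * L"
  shows "(\<Sum>j\<le>n. tent L (int i - int (j * L))) = 1"
  using i
proof (induction n)
  case 0 thus ?case by (simp add: tent_def)
next
  case (Suc n)
  show ?case
  proof (cases "i \<le> n * L")
    case True
    hence "tent L (int i - int (Suc n * L)) = 0" using L
      by (intro tent_eq_0) (auto simp flip: of_nat_mult of_nat_add)
    thus ?thesis using Suc.IH True by (simp only: sum.atMost_Suc)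
  next
    case False
    have lo: "real (n * L) \<le> real i" using False by (simp only: of_nat_le_iff)
    have "i \<le> n * L + L" using Suc.prems by simp
    hence hi: "real i \<le> real (n * L) + real L" unfolding of_nat_add[symmetric] of_nat_le_iff .
    have "(\<Sum>j<n. tent L (int i - int (j * L))) = 0"
    proof (intro sum.neutral ballI tent_eq_0 L)
      fix j assume "j \<in> {..<n}"
      hence "Suc j * L \<le> n * L" by (intro mult_right_mono) auto
      hence "L + j * L < i" using False by simp
      hence "int (L + j * L) < int i" by (simp only: of_nat_less_iff)
      thus "\<bar>int i - int (j * L)\<bar> \<ge> int L" unfolding of_nat_add by linarith
    qed
    hence "(\<Sum>j\<le>Suc n. tent L (int i - int (j * L))) = tent L (int i - int (n * L)) + tent L (int i - int (Suc n * L))"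
      by (simp only: lessThan_Suc_atMost[symmetric] sum.lessThan_Suc add_0_left)
    also have "tent L (int i - int (n * L)) = 1 - (real i - real (n * L)) / real L"
    proof -
      have "\<bar>real_of_int (int i - int (n * L))\<bar> = real i - real (n * L)"
        using lo unfolding of_int_diff of_int_of_nat_eq by linarith
      thus ?thesis using L hi by (simp add: tent_def max_def)
    qed
    also have "tent L (int i - int (Suc n * L)) = 1 - (real (n * L) + real L - real i) / real L"
    proof -
      have "real (Suc n * L) = real (n * L) + real L" by (simp add: algebra_simps)
      hence "\<bar>real_of_int (int i - int (Suc n * L))\<bar> = real (n * L) + real L - real i"
        using hi unfolding of_int_diff of_int_of_nat_eq by linarith
      thus ?thesis using L lo by (simp add: tent_def max_def del: mult_Suc)
    qed
    finally show ?thesis using L by (simp add: field_simps)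
  qed
qed

lemma tent_sum_eq_qsum:
  assumes L: "L > 0" and m: "M + L \<le> m" "m + L < R"
  shows "tent_sum L (int m) = qsum (\<lambda>k. tent L (int k - int m)) {M..<R}"
proof (rule ext)
  fix x
  have "tent_sum L (int m) x = (\<Sum>k\<in>{m-L..m+L}. complex_of_real (tent L (int k - int m)) * cis (2*pi*(real k)^2*x))"
    unfolding tent_sum_def using m
    by (intro sum.reindex_bij_witness[of _ "\<lambda>k. int k - int m" "\<lambda>n. nat (int m + n)"]) auto
  also have "\<dots> = qsum (\<lambda>k. tent L (int k - int m)) {M..<R} x"
    unfolding qsum_def using m by (intro sum.mono_neutral_left) (auto simp: tent_eq_0[OF L])
  finally show "tent_sum L (int m) x = qsum (\<lambda>k. tent L (int k - int m)) {M..<R} x" .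
qed

text \<open>An interval of length \<open>16L + 1\<close> is the sum of 15 tents and two ramps; by summation by parts the ramps are
  controlled by sharp sums of length at most \<open>L\<close>, and \<open>3 * 16\<^sup>-\<^sup>1\<^sup>/\<^sup>2 < 1\<close> closes the induction.\<close>

lemma sharp_sum_recursion:
  assumes p: "p \<ge> 1" and L: "L > 0" and r: "r \<le> 15"
    and tent: "\<And>m. Lp_norm p (tent_sum L m) \<le> U"
    and sharp: "\<And>M K. 0 < K \<Longrightarrow> K \<le> L \<Longrightarrow> Lp_norm p (qsum (\<lambda>_. 1) {M..<M+K}) \<le> T"
  shows "Lp_norm p (qsum (\<lambda>_. 1) {M..<M+(16*L+1+r)}) \<le> 15 * U + 3 * T + 15"
proof -
  define R where "R = M + 16*L + 1"
  define \<tau> where "\<tau> j k = tent L (int k - int (M + j * L))" for j k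
  have one: "(\<Sum>j\<le>16. \<tau> j k) = 1" if "k \<in> {M..<R}" for k
  proof -
    have "(\<Sum>j\<le>16. \<tau> j k) = (\<Sum>j\<le>16. tent L (int (k - M) - int (j * L)))"
      using that by (intro sum.cong) (auto simp: \<tau>_def of_nat_diff algebra_simps)
    also have "\<dots> = 1" using that by (intro tent_partition L) (auto simp: R_def)
    finally show ?thesis .
  qed
  have split: "{..16::nat} = insert 0 (insert 16 {1..15})" by auto
  have eq: "qsum (\<lambda>_. 1) {M..<R} x = qsum (\<tau> 0) {M..<R} x + (qsum (\<tau> 16) {M..<R} x + (\<Sum>j\<in>{1..15}. qsum (\<tau> j) {M..<R} x))" for x
  proof -
    have "qsum (\<lambda>_. 1) {M..<R} x = qsum (\<lambda>k. \<Sum>j\<le>16. \<tau> j k) {M..<R} x"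
      using one by (simp add: qsum_def)
    also have "\<dots> = (\<Sum>j\<le>16. qsum (\<tau> j) {M..<R} x)" by (rule qsum_sum)
    finally show ?thesis unfolding split by simp
  qed
  have mid: "Lp_norm p (qsum (\<tau> j) {M..<R}) \<le> U" if "j \<in> {1..15}" for j
  proof -
    have "j * L \<le> 15 * L" "L \<le> j * L" using that by auto
    hence "tent_sum L (int (M + j*L)) = qsum (\<tau> j) {M..<R}"
      unfolding \<tau>_def[abs_def] R_def using L by (intro tent_sum_eq_qsum) linarith+
    thus ?thesis using tent[of "int (M + j*L)"] by simp
  qed
  have left: "Lp_norm p (qsum (\<tau> 0) {M..<R}) \<le> T"
  proof -
    have "qsum (\<tau> 0) {M..<R} = qsum (\<tau> 0) {M..<M+L}"
      by (intro qsum_restrict) (auto simp: R_def \<tau>_def intro!: tent_eq_0 L)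
    hence eq0: "qsum (\<tau> 0) {M..<R} = qsum (\<lambda>n. \<tau> 0 n * 1) {M..<M+L}" by simp
    have "Lp_norm p (qsum (\<lambda>n. \<tau> 0 n * 1) {M..<M+L}) \<le> \<tau> 0 M * T"
    proof (intro Lp_norm_abel_antimono p)
      show "M < M + L" using L by simp
      show "Lp_norm p (qsum (\<lambda>_. 1) {M..<K}) \<le> T" if "M < K" "K \<le> M + L" for K
        using sharp[of "K - M" M] that by simp
      show "\<tau> 0 (Suc n) \<le> \<tau> 0 n" if "M \<le> n" for n
        using that unfolding \<tau>_def tent_def by (intro max.mono diff_mono divide_right_mono) auto
    qed (simp add: \<tau>_def)
    moreover have "\<tau> 0 M = 1" by (simp add: \<tau>_def tent_def)
    ultimately show ?thesis unfolding eq0 by simp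
  qed
  \<comment> \<open>The last tent vanishes up to M + 15L, so its ramp starts one later and, with R =
    M + 16L + 1, has exactly L terms, within reach of \<open>sharp\<close>.\<close>
  have right: "Lp_norm p (qsum (\<tau> 16) {M..<R}) \<le> 2 * T"
  proof -
    have "qsum (\<tau> 16) {M..<R} = qsum (\<tau> 16) {M+15*L+1..<R}"
      by (intro qsum_restrict) (auto simp: R_def \<tau>_def intro!: tent_eq_0 L)
    hence eq0: "qsum (\<tau> 16) {M..<R} = qsum (\<lambda>n. \<tau> 16 n * 1) {M+15*L+1..<R}" by simp
    have "Lp_norm p (qsum (\<lambda>n. \<tau> 16 n * 1) {M+15*L+1..<R}) \<le> 2 * \<tau> 16 (R-1) * T"
    proof (intro Lp_norm_abel_mono p)
      show "M+15*L+1 < R" using L by (simp add: R_def)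
      show "Lp_norm p (qsum (\<lambda>_. 1) {M+15*L+1..<K}) \<le> T" if "M+15*L+1 < K" "K \<le> R" for K
        using sharp[of "K - (M+15*L+1)" "M+15*L+1"] that by (simp add: R_def)
      show "\<tau> 16 n \<le> \<tau> 16 (Suc n)" if "Suc n < R" for n
        using that unfolding \<tau>_def tent_def R_def by (intro max.mono diff_mono divide_right_mono) auto
    qed (simp add: \<tau>_def)
    moreover have "\<tau> 16 (R-1) = 1" by (simp add: \<tau>_def tent_def R_def)
    ultimately show ?thesis unfolding eq0 by simp
  qed
  have main: "Lp_norm p (qsum (\<lambda>_. 1) {M..<R}) \<le> T + (2 * T + 15 * U)"
  proof -
    have "qsum (\<lambda>_. 1) {M..<R} = (\<lambda>x. qsum (\<tau> 0) {M..<R} x + (qsum (\<tau> 16) {M..<R} x + (\<Sum>j\<in>{1..15}. qsum (\<tau> j) {M..<R} x)))"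
      by (rule ext) (rule eq)
    hence "Lp_norm p (qsum (\<lambda>_. 1) {M..<R}) \<le> Lp_norm p (qsum (\<tau> 0) {M..<R}) + Lp_norm p (\<lambda>x. qsum (\<tau> 16) {M..<R} x + (\<Sum>j\<in>{1..15}. qsum (\<tau> j) {M..<R} x))"
      using p by (simp only:) (intro Lp_norm_triangle continuous_intros; simp)
    also have "Lp_norm p (\<lambda>x. qsum (\<tau> 16) {M..<R} x + (\<Sum>j\<in>{1..15}. qsum (\<tau> j) {M..<R} x))
        \<le> Lp_norm p (qsum (\<tau> 16) {M..<R}) + Lp_norm p (\<lambda>x. \<Sum>j\<in>{1..15}. qsum (\<tau> j) {M..<R} x)"
      using p by (intro Lp_norm_triangle continuous_intros)
    also have "Lp_norm p (\<lambda>x. \<Sum>j\<in>{1..15}. qsum (\<tau> j) {M..<R} x) \<le> (\<Sum>j\<in>{1..15}. Lp_norm p (qsum (\<tau> j) {M..<R}))"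
      using p by (intro Lp_norm_sum continuous_intros)
    also have "\<dots> \<le> (\<Sum>j\<in>{1..15::nat}. U)" by (intro sum_mono mid)
    finally show ?thesis using left right by simp
  qed
  have "qsum (\<lambda>_. 1) {M..<M+(16*L+1+r)} = (\<lambda>x. qsum (\<lambda>_. 1) {M..<R} x + qsum (\<lambda>_. 1) {R..<R+r} x)"
  proof
    fix x
    have "{M..<M+(16*L+1+r)} = {M..<R} \<union> {R..<R+r}" by (auto simp: R_def)
    thus "qsum (\<lambda>_. 1) {M..<M+(16*L+1+r)} x = qsum (\<lambda>_. 1) {M..<R} x + qsum (\<lambda>_. 1) {R..<R+r} x"
      by (simp add: qsum_Un)
  qed
  hence "Lp_norm p (qsum (\<lambda>_. 1) {M..<M+(16*L+1+r)}) \<le> Lp_norm p (qsum (\<lambda>_. 1) {M..<R}) + Lp_norm p (qsum (\<lambda>_. 1) {R..<R+r})"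
    using p by (simp only:) (intro Lp_norm_triangle continuous_intros; simp)
  also have "Lp_norm p (qsum (\<lambda>_. 1) {R..<R+r}) \<le> 15"
    using Lp_norm_qsum_trivial[of p "\<lambda>_. 1" "{R..<R+r}"] p r by simp
  finally show ?thesis using main by simp
qed

lemma sharp_sum_norm:
  assumes p: "p > 2"
  shows "\<exists>C>0. \<forall>M N. N > 0 \<longrightarrow> Lp_norm p (qsum (\<lambda>_. 1) {M..<M+N}) \<le> C * weyl_size p (real N)"
proof -
  obtain C where C: "C > 0" "\<And>L m. L > 0 \<Longrightarrow> Lp_norm p (tent_sum L m) \<le> C * weyl_size p (real L)"
    using tent_sum_norm[OF p] by blast
  \<comment> \<open>Any B with (15C + 3B)/4 + 15 \<le> B closes the induction, that is B \<ge> 15C +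
    60; the base case needs B \<ge> 16.\<close>
  define B where "B = 60 * C + 60"
  have B: "B > 0" using C by (simp add: B_def)
  have main: "Lp_norm p (qsum (\<lambda>_. 1) {M..<M+N}) \<le> B * weyl_size p (real N)" if "N > 0" for M N
    using that
  proof (induction N arbitrary: M rule: less_induct)
    case (less N)
    have w1: "1 \<le> weyl_size p (real N)" using less.prems by (intro weyl_size_ge_1) auto
    show ?case
    proof (cases "N \<le> 16")
      case True
      have "Lp_norm p (qsum (\<lambda>_. 1) {M..<M+N}) \<le> 16"
        using Lp_norm_qsum_trivial[of p "\<lambda>_. 1" "{M..<M+N}"] p True by simp
      also have "\<dots> \<le> B * 1" using C by (simp add: B_def)
      also have "\<dots> \<le> B * weyl_size p (real N)" using w1 B by (intro mult_left_mono) auto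
      finally show ?thesis .
    next
      case False
      define L where "L = (N - 1) div 16"
      define r where "r = (N - 1) mod 16"
      have N: "N = 16*L + 1 + r" using False by (simp add: L_def r_def)
      have L: "L > 0" "r \<le> 15" using False by (auto simp: L_def r_def div_greater_zero_iff)
      have LN: "16 * real L \<le> real N" by (simp add: N)
      have w4: "4 * weyl_size p (real L) \<le> weyl_size p (real N)" using L LN by (intro weyl_size_16) auto
      have "Lp_norm p (qsum (\<lambda>_. 1) {M..<M+(16*L+1+r)}) \<le> 15 * (C * weyl_size p (real L)) + 3 * (B * weyl_size p (real L)) + 15"
      proof (rule sharp_sum_recursion)
        fix M K :: nat assume K: "0 < K" "K \<le> L"
        have "Lp_norm p (qsum (\<lambda>_. 1) {M..<M+K}) \<le> B * weyl_size p (real K)"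
          using K N by (intro less.IH) auto
        also have "\<dots> \<le> B * weyl_size p (real L)" using K B by (intro mult_left_mono weyl_size_mono) auto
        finally show "Lp_norm p (qsum (\<lambda>_. 1) {M..<M+K}) \<le> B * weyl_size p (real L)" .
      qed (use p L C in auto)
      also have "\<dots> = (15 * C + 3 * B) * weyl_size p (real L) + 15" by (simp add: algebra_simps)
      also have "\<dots> \<le> (15 * C + 3 * B) * (weyl_size p (real N) / 4) + 15 * weyl_size p (real N)"
        using C B w4 w1 by (intro add_mono mult_left_mono) auto
      also have "\<dots> = ((15 * C + 3 * B) / 4 + 15) * weyl_size p (real N)" by (simp add: algebra_simps)
      also have "\<dots> \<le> B * weyl_size p (real N)"
        using w1 C by (intro mult_right_mono) (auto simp: B_def)
      finally show ?thesis by (simp add: N)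
    qed
  qed
  show ?thesis using main B by blast
qed

text \<open>On a block the weight is monotone and changes by at most the factor 2^|\<alpha>|, so
  summation by parts costs a constant for either sign of \<alpha>.\<close>

lemma power_block_norm:
  assumes p: "p > 2"
  shows "\<exists>C>0. \<forall>A B. 0 < A \<longrightarrow> B \<le> 2*A \<longrightarrow>
     Lp_norm p (qsum (\<lambda>n. real n powr \<alpha>) {A..<B}) \<le> C * (real A powr \<alpha> * weyl_size p (real A))"
proof -
  obtain C where C: "C > 0" "\<And>M N. N > 0 \<Longrightarrow> Lp_norm p (qsum (\<lambda>_. 1) {M..<M+N}) \<le> C * weyl_size p (real N)"
    using sharp_sum_norm[OF p] by blast
  show ?thesis
  proof (intro exI[of _ "2 * 2 powr \<bar>\<alpha>\<bar> * C"] conjI allI impI)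
    show "2 * 2 powr \<bar>\<alpha>\<bar> * C > 0" using C by simp
    fix A B :: nat assume A: "0 < A" and B: "B \<le> 2*A"
    have w: "weyl_size p (real A) \<ge> 1" using A by (intro weyl_size_ge_1) auto
    show "Lp_norm p (qsum (\<lambda>n. real n powr \<alpha>) {A..<B}) \<le> 2 * 2 powr \<bar>\<alpha>\<bar> * C * (real A powr \<alpha> * weyl_size p (real A))"
    proof (cases "A < B")
      case False
      hence "Lp_norm p (qsum (\<lambda>n. real n powr \<alpha>) {A..<B}) \<le> 0"
        using Lp_norm_qsum_trivial[of p "\<lambda>n. real n powr \<alpha>" "{A..<B}"] p by simp
      also have "0 \<le> 2 * 2 powr \<bar>\<alpha>\<bar> * C * (real A powr \<alpha> * weyl_size p (real A))" using C w by simp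
      finally show ?thesis .
    next
      case AB: True
      define T where "T = C * weyl_size p (real A)"
      have T0: "T \<ge> 0" using C w by (simp add: T_def)
      have T: "Lp_norm p (qsum (\<lambda>_. 1) {A..<K}) \<le> T" if "A < K" "K \<le> B" for K
      proof -
        have "Lp_norm p (qsum (\<lambda>_. 1) {A..<A+(K-A)}) \<le> C * weyl_size p (real (K-A))" using that by (intro C) auto
        also have "\<dots> \<le> T" unfolding T_def using that B C by (intro mult_left_mono weyl_size_mono) auto
        finally show ?thesis using that by simp
      qed
      have "Lp_norm p (qsum (\<lambda>n. real n powr \<alpha> * 1) {A..<B}) \<le> 2 * 2 powr \<bar>\<alpha>\<bar> * real A powr \<alpha> * T"
      proof (cases "\<alpha> \<le> 0")
        case True
        have "Lp_norm p (qsum (\<lambda>n. real n powr \<alpha> * 1) {A..<B}) \<le> real A powr \<alpha> * T"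
          using p AB T True A by (intro Lp_norm_abel_antimono) (auto intro!: powr_mono2')
        also have "\<dots> \<le> (2 * 2 powr \<bar>\<alpha>\<bar>) * (real A powr \<alpha> * T)"
        proof -
          have "1 \<le> 2 * 2 powr \<bar>\<alpha>\<bar>" using ge_one_powr_ge_zero[of 2 "\<bar>\<alpha>\<bar>"] by simp
          from mult_right_mono[OF this, of "real A powr \<alpha> * T"] show ?thesis using T0 by simp
        qed
        finally show ?thesis by (simp add: mult_ac)
      next
        case False
        have "Lp_norm p (qsum (\<lambda>n. real n powr \<alpha> * 1) {A..<B}) \<le> 2 * real (B-1) powr \<alpha> * T"
          using p AB T False A by (intro Lp_norm_abel_mono) (auto intro!: powr_mono2)
        also have "\<dots> \<le> 2 * (2 * real A) powr \<alpha> * T"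
          using False B T0 by (intro mult_right_mono mult_left_mono powr_mono2) auto
        also have "(2 * real A) powr \<alpha> = 2 powr \<bar>\<alpha>\<bar> * real A powr \<alpha>" using False by (simp add: powr_mult)
        finally show ?thesis by (simp add: mult_ac)
      qed
      thus ?thesis by (simp add: T_def mult_ac)
    qed
  qed
qed

text \<open>Cutting the block at an arbitrary B lets incomplete and empty last blocks share the
  bound, so that sums with any end point can be decomposed.\<close>

lemma dyadic_block_norm:
  assumes p: "p > 2"
  shows "\<exists>C>0. \<forall>j B. Lp_norm p (qsum (\<lambda>n. real n powr \<alpha>) {2^j..<min B (2^Suc j)})
      \<le> C * (2 powr (real j * (\<alpha> + weyl_exp p)) * (1 + real j) powr weyl_log p)"
proof -
  obtain C where C: "C > 0" "\<And>A B. 0 < A \<Longrightarrow> B \<le> 2*A \<Longrightarrow>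
     Lp_norm p (qsum (\<lambda>n. real n powr \<alpha>) {A..<B}) \<le> C * (real A powr \<alpha> * weyl_size p (real A))"
    using power_block_norm[OF p, of \<alpha>] by blast
  have "Lp_norm p (qsum (\<lambda>n. real n powr \<alpha>) {2^j..<min B (2^Suc j)})
      \<le> C * (2 powr (real j * (\<alpha> + weyl_exp p)) * (1 + real j) powr weyl_log p)" for j B
  proof -
    have pw: "real (2^j) = 2 powr real j" by (simp add: powr_realpow)
    have l2: "ln 2 \<le> (1::real)" using ln_le_minus_one[of 2] by simp
    have lnj: "1 + ln (real (2^j)) \<le> 1 + real j" "0 \<le> ln (real (2^j))"
      using l2 by (auto simp: ln_realpow mult_left_le)
    have "Lp_norm p (qsum (\<lambda>n. real n powr \<alpha>) {2^j..<min B (2^Suc j)}) \<le> C * (real (2^j) powr \<alpha> * weyl_size p (real (2^j)))"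
      by (intro C) auto
    also have "\<dots> = C * (2 powr (real j * (\<alpha> + weyl_exp p)) * (1 + ln (real (2^j))) powr weyl_log p)"
      unfolding weyl_size_def pw by (simp add: powr_powr powr_add[symmetric] algebra_simps)
    also have "\<dots> \<le> C * (2 powr (real j * (\<alpha> + weyl_exp p)) * (1 + real j) powr weyl_log p)"
      using C lnj weyl_log_nonneg[of p] by (intro mult_left_mono powr_mono2) auto
    finally show ?thesis .
  qed
  thus ?thesis using C by blast
qed

lemma dyadic_decomposition:
  assumes "i \<le> J"
  shows "qsum c {2^i..<min B (2^J)} x = (\<Sum>j\<in>{i..<J}. qsum c {2^j..<min B (2^Suc j)} x)"
  using assms
proof (induction J rule: dec_induct)
  case (step J)
  have ij: "(2::nat)^i \<le> 2^J" using step by (intro power_increasing) auto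
  have "{2^i..<min B (2^Suc J)} = {2^i..<min B (2^J)} \<union> {2^J..<min B (2^Suc J)}"
    using ij by (auto dest: order.trans[OF ij])
  moreover have "{2^i..<min B (2^J)} \<inter> {2^J..<min B (2^Suc J)} = {}" by auto
  ultimately have "qsum c {2^i..<min B (2^Suc J)} x = qsum c {2^i..<min B (2^J)} x + qsum c {2^J..<min B (2^Suc J)} x"
    using qsum_Un[of "{2^i..<min B (2^J)}" "{2^J..<min B (2^Suc J)}" c x] by simp
  thus ?case using step by simp
qed simp

section \<open>Sums of blocks with separated frequencies\<close>

lemma powr_minus_one_mvt:
  fixes u r :: real
  assumes "u > 0"
  shows "\<exists>z. min u 1 \<le> z \<and> z \<le> max u 1 \<and> u powr r - 1 = r * z powr (r-1) * (u - 1)"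
proof -
  have mvt: "\<exists>z>a. z < b \<and> b powr r - a powr r = (b - a) * (r * z powr (r-1))" if "0 < a" "a < b" for a b :: real
    using that by (intro MVT2) (auto intro!: derivative_eq_intros)
  consider "u = 1" | "u < 1" | "u > 1" by linarith
  thus ?thesis
  proof cases
    case 1 thus ?thesis by (intro exI[of _ 1]) auto
  next
    case 2
    obtain z where "z > u" "z < 1" "1 powr r - u powr r = (1 - u) * (r * z powr (r-1))" using mvt[OF assms 2] by blast
    thus ?thesis using 2 by (intro exI[of _ z]) (auto simp: algebra_simps)
  next
    case 3
    obtain z where "z > 1" "z < u" "u powr r - 1 powr r = (u - 1) * (r * z powr (r-1))" using mvt[of 1 u] 3 by auto
    thus ?thesis using 3 by (intro exI[of _ z]) (auto simp: algebra_simps)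
  qed
qed

text \<open>Two applications of the mean value theorem. The range [1/4, 4] contains the intermediate
  points, and on it a power r - 2 of either sign is at most 4^|r-2|.\<close>

lemma powr_taylor2_le:
  fixes u r :: real
  assumes r: "r \<ge> 1" and u: "1/4 \<le> u" "u \<le> 4"
  shows "u powr r \<le> 1 + r * (u - 1) + r * (r - 1) * 4 powr \<bar>r - 2\<bar> * (u - 1)^2"
proof -
  obtain z where z: "min u 1 \<le> z" "z \<le> max u 1" and e1: "u powr r - 1 = r * z powr (r-1) * (u - 1)"
    using powr_minus_one_mvt[of u r] u by auto
  have z0: "z > 0" using z u by (auto simp: min_def split: if_splits)
  obtain w where w: "min z 1 \<le> w" "w \<le> max z 1" and e2: "z powr (r-1) - 1 = (r-1) * w powr (r-1-1) * (z - 1)"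
    using powr_minus_one_mvt[OF z0, of "r-1"] by auto
  have wb: "1/4 \<le> w" "w \<le> 4" using w z u by (auto simp: min_def max_def split: if_splits)
  have "w powr (r-2) \<le> 4 powr \<bar>r-2\<bar>"
  proof (cases "r \<ge> 2")
    case True thus ?thesis using wb powr_mono2[of "r-2" w 4] by simp
  next
    case False
    hence "w powr (r-2) \<le> (1/4) powr (r-2)" using wb by (intro powr_mono2') auto
    also have "\<dots> = 4 powr \<bar>r-2\<bar>" using False by (simp add: powr_divide powr_minus_divide[symmetric])
    finally show ?thesis .
  qed
  moreover have "(z - 1) * (u - 1) \<le> (u - 1)^2" "0 \<le> (z - 1) * (u - 1)"
  proof -
    have "0 \<le> (z - 1) * (u - 1) \<and> (z - 1) * (u - 1) \<le> (u - 1) * (u - 1)"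
    proof (cases "u \<ge> 1")
      case True
      thus ?thesis using z by (auto intro!: mult_right_mono)
    next
      case False
      hence "0 \<le> (1 - z) * (1 - u)" "(1 - z) * (1 - u) \<le> (1 - u) * (1 - u)" using z by (auto intro!: mult_right_mono mult_nonneg_nonneg)
      thus ?thesis by (simp add: algebra_simps)
    qed
    thus "(z - 1) * (u - 1) \<le> (u - 1)^2" "0 \<le> (z - 1) * (u - 1)" by (auto simp: power2_eq_square)
  qed
  ultimately have "w powr (r-2) * ((z - 1) * (u - 1)) \<le> 4 powr \<bar>r-2\<bar> * (u - 1)^2"
    by (intro mult_mono) auto
  hence "r * (r-1) * (w powr (r-2) * ((z - 1) * (u - 1))) \<le> r * (r-1) * (4 powr \<bar>r-2\<bar> * (u - 1)^2)"
    using r by (intro mult_left_mono) auto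
  moreover have "u powr r - 1 - r * (u - 1) = r * (r-1) * (w powr (r-2) * ((z - 1) * (u - 1)))"
  proof -
    have "u powr r - 1 - r * (u - 1) = r * (z powr (r-1) - 1) * (u - 1)" using e1 by (simp add: algebra_simps)
    also have "\<dots> = r * ((r-1) * w powr (r-2) * (z - 1)) * (u - 1)" unfolding e2 by simp
    finally show ?thesis by (simp add: mult_ac)
  qed
  ultimately show ?thesis by (simp add: mult_ac)
qed

text \<open>If |a| \<le> 2|b|, every term is at most a multiple of |b|^p. Otherwise u =
  |a+b|^2/|a|^2 lies in [1/4, 4] and is expanded to second order with exponent r = p/2, u - 1 being
  at most of size |b|/|a|; the linear part of u - 1 yields the inner product, everything else goes
  into the error.\<close>

lemma cmod_add_powr_le:
  assumes p: "p > 2"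
  shows "\<exists>C>0. \<forall>a b::complex. cmod (a + b) powr p \<le> cmod a powr p + p * (cmod a powr (p-2) * (a \<bullet> b))
      + C * (cmod a powr (p-2) * (cmod b)^2 + cmod b powr p)"
proof -
  define r where "r = p/2"
  have r: "r \<ge> 1" "2 * r = p" using p by (auto simp: r_def)
  define Cr where "Cr = r * (r - 1) * 4 powr \<bar>r - 2\<bar>"
  have Cr: "Cr \<ge> 0" using r by (simp add: Cr_def)
  define C where "C = (r + 25/4 * Cr) + (3 powr p + p * 2 powr (p-1))"
  have C0: "r + 25/4 * Cr > 0" "3 powr p + p * 2 powr (p-1) > 0" using r Cr p by (auto intro!: add_pos_nonneg)
  have C: "C > 0" using C0 by (simp add: C_def)
  have "cmod (a + b) powr p \<le> cmod a powr p + p * (cmod a powr (p-2) * (a \<bullet> b)) + C * (cmod a powr (p-2) * (cmod b)^2 + cmod b powr p)" for a b :: complex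
  proof (cases "cmod a \<le> 2 * cmod b")
    case True
    have "cmod (a + b) powr p \<le> (3 * cmod b) powr p"
      using True norm_triangle_ineq[of a b] p by (intro powr_mono2) auto
    also have "\<dots> = 3 powr p * cmod b powr p" by (simp add: powr_mult)
    finally have 1: "cmod (a + b) powr p \<le> 3 powr p * cmod b powr p" .
    have "cmod a powr (p-2) * (- (a \<bullet> b)) \<le> cmod a powr (p-2) * (cmod a * cmod b)"
      using Cauchy_Schwarz_ineq2[of a b] by (intro mult_left_mono) (auto simp: abs_le_iff)
    also have "\<dots> = cmod a powr (p-1) * cmod b"
    proof (cases "a = 0")
      case False
      hence "cmod a powr (p-2) * cmod a = cmod a powr (p-1)" using powr_mult_base[of "cmod a" "p-2"] by (simp add: mult.commute)
      thus ?thesis by (simp add: mult.assoc[symmetric])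
    qed simp
    also have "\<dots> \<le> (2 * cmod b) powr (p-1) * cmod b"
      using True p by (intro mult_right_mono powr_mono2) auto
    also have "\<dots> = 2 powr (p-1) * cmod b powr p"
      using powr_mult_base[of "cmod b" "p-1"] by (cases "b = 0") (auto simp: powr_mult mult_ac)
    finally have "p * (cmod a powr (p-2) * (- (a \<bullet> b))) \<le> p * (2 powr (p-1) * cmod b powr p)"
      using p by (intro mult_left_mono) auto
    hence 2: "- (p * (cmod a powr (p-2) * (a \<bullet> b))) \<le> p * 2 powr (p-1) * cmod b powr p" by simp
    have "(3 powr p + p * 2 powr (p-1)) * cmod b powr p \<le> C * (cmod a powr (p-2) * (cmod b)^2 + cmod b powr p)"
      using C0 by (intro mult_mono) (auto simp: C_def)
    hence "3 powr p * cmod b powr p + p * 2 powr (p-1) * cmod b powr p \<le> C * (cmod a powr (p-2) * (cmod b)^2 + cmod b powr p)"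
      by (simp add: distrib_right)
    moreover have "0 \<le> cmod a powr p" by simp
    ultimately show ?thesis using 1 2 by linarith
  next
    case False
    define A where "A = cmod a"
    define B where "B = cmod b"
    have A: "A > 0" "B \<ge> 0" "2 * B < A" using False norm_ge_zero[of b] unfolding A_def B_def by linarith+
    define u where "u = (cmod (a+b))^2 / A^2"
    have ab: "(cmod (a+b))^2 = A^2 + 2 * (a \<bullet> b) + B^2"
      by (simp add: A_def B_def power2_norm_eq_inner inner_add_left inner_add_right inner_commute algebra_simps)
    have u1: "u - 1 = (2 * (a \<bullet> b) + B^2) / A^2" using A by (simp add: u_def ab field_simps)
    have cs: "\<bar>a \<bullet> b\<bar> \<le> A * B" unfolding A_def B_def by (rule Cauchy_Schwarz_ineq2)
    have "\<bar>2 * (a \<bullet> b) + B^2\<bar> \<le> 2 * (A * B) + B * B" using cs mult_nonneg_nonneg[OF A(2) A(2)] unfolding power2_eq_square by linarith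
    also have "\<dots> \<le> 2 * (A * B) + A/2 * B" using A by (intro add_left_mono mult_right_mono) auto
    finally have tb: "\<bar>2 * (a \<bullet> b) + B^2\<bar> \<le> 5/2 * (A * B)" by simp
    have t2: "(u - 1)^2 \<le> 25/4 * (B^2 / A^2)"
    proof -
      have "\<bar>u - 1\<bar> \<le> (5/2 * (A * B)) / A^2" unfolding u1 abs_divide using divide_right_mono[OF tb, of "A^2"] by (simp only: abs_power2 zero_le_power2)
      also have "\<dots> = 5/2 * (B / A)" using A by (simp add: power2_eq_square)
      finally have "(u - 1)^2 \<le> (5/2 * (B / A))^2" using A by (subst abs_le_square_iff[symmetric]) simp
      thus ?thesis by (simp add: power_mult_distrib power_divide)
    qed
    have ub: "1/4 \<le> u" "u \<le> 4"
    proof -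
      have "cmod (a + b) \<ge> A - B" using norm_diff_ineq[of a b] by (simp add: A_def B_def)
      hence "A / 2 \<le> cmod (a+b)" using A by linarith
      hence "(A/2)^2 \<le> (cmod (a+b))^2" using A by (intro power_mono) auto
      thus "1/4 \<le> u" using A by (simp add: u_def field_simps)
      have "cmod (a + b) \<le> 2 * A" using norm_triangle_ineq[of a b] A unfolding A_def B_def by linarith
      hence "(cmod (a+b))^2 \<le> (2*A)^2" by (intro power_mono) auto
      thus "u \<le> 4" using A by (simp add: u_def field_simps)
    qed
    have "cmod (a+b) powr p = A powr p * u powr r"
    proof -
      have "A powr p * u powr r = (A^2) powr r * u powr r" using A by (simp add: r_def power2_powr_half)
      also have "\<dots> = (A^2 * u) powr r" using A ub by (simp add: powr_mult)
      also have "A^2 * u = (cmod (a+b))^2" using A by (simp add: u_def)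
      also have "\<dots> powr r = cmod (a+b) powr p" by (simp add: r_def power2_powr_half)
      finally show ?thesis by simp
    qed
    also have "\<dots> \<le> A powr p * (1 + r * (u - 1) + Cr * (25/4 * (B^2 / A^2)))"
    proof (intro mult_left_mono)
      have "u powr r \<le> 1 + r * (u - 1) + Cr * (u - 1)^2"
        using powr_taylor2_le[OF r(1) ub] by (simp add: Cr_def)
      also have "\<dots> \<le> 1 + r * (u - 1) + Cr * (25/4 * (B^2 / A^2))" using t2 Cr by (intro add_left_mono mult_left_mono) auto
      finally show "u powr r \<le> 1 + r * (u - 1) + Cr * (25/4 * (B^2 / A^2))" .
    qed auto
    also have "\<dots> = A powr p + A powr p / A^2 * (2 * r * (a \<bullet> b) + (r + 25/4 * Cr) * B^2)"
      unfolding u1 using A by (simp add: field_simps)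
    also have "A powr p / A^2 = A powr (p-2)" using A by (simp add: powr_diff)
    also have "A powr p + A powr (p-2) * (2 * r * (a \<bullet> b) + (r + 25/4 * Cr) * B^2)
        = A powr p + p * (A powr (p-2) * (a \<bullet> b)) + (r + 25/4 * Cr) * (A powr (p-2) * B^2)"
      using r(2) by (simp add: algebra_simps)
    also have "(r + 25/4 * Cr) * (A powr (p-2) * B^2) \<le> C * (A powr (p-2) * B^2 + B powr p)"
      using C0 by (intro mult_mono) (auto simp: C_def)
    finally show ?thesis by (simp add: A_def B_def)
  qed
  thus ?thesis using C by blast
qed

text \<open>A substitute for the three-function Hoelder inequality; the loss of a constant is harmless.\<close>

lemma powr_mult3_le:
  fixes u v w p :: real
  assumes "p > 2" "u \<ge> 0" "v \<ge> 0" "w \<ge> 0"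
  shows "u powr (p-2) * (v * w) \<le> u powr p + v powr p + w powr p"
proof -
  define m where "m = max u (max v w)"
  have m: "u \<le> m" "v \<le> m" "w \<le> m" "m \<ge> 0" using assms by (auto simp: m_def)
  have "u powr (p-2) * (v * w) \<le> m powr (p-2) * (m * m)"
    using assms m by (intro mult_mono powr_mono2) auto
  also have "\<dots> = m powr p"
    by (cases "m = 0") (use m in \<open>auto simp: powr_diff power2_eq_square\<close>)
  also have "\<dots> \<le> u powr p + v powr p + w powr p" by (auto simp: m_def max_def)
  finally show ?thesis .
qed

lemma integral_powr_mult3_le:
  fixes f g h :: "real \<Rightarrow> complex"
  assumes p: "p > 2" and c: "continuous_on UNIV f" "continuous_on UNIV g" "continuous_on UNIV h"
    and pos: "a > 0" "b > 0" "d > 0"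
    and bd: "integral {0..1} (\<lambda>x. cmod (f x) powr p) \<le> a powr p" "integral {0..1} (\<lambda>x. cmod (g x) powr p) \<le> b powr p"
      "integral {0..1} (\<lambda>x. cmod (h x) powr p) \<le> d powr p"
  shows "integral {0..1} (\<lambda>x. cmod (f x) powr (p-2) * (cmod (g x) * cmod (h x))) \<le> 3 * (a powr (p-2) * (b * d))"
proof -
  define K where "K = a powr (p-2) * (b * d)"
  have K: "K \<ge> 0" using pos by (simp add: K_def)
  have I: "(\<lambda>x. cmod (f x) powr p) integrable_on {0..1}" "(\<lambda>x. cmod (g x) powr p) integrable_on {0..1}"
     "(\<lambda>x. cmod (h x) powr p) integrable_on {0..1}" using p c by (auto intro!: integrable_cmod_powr)
  have pt: "cmod (f x) powr (p-2) * (cmod (g x) * cmod (h x)) \<le>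
     K * (cmod (f x) powr p / a powr p + cmod (g x) powr p / b powr p + cmod (h x) powr p / d powr p)" for x
  proof -
    \<comment> \<open>Scaling each function by its bound makes the three integrals at most 1, so the
      sum from \<open>powr_mult3_le\<close> becomes a product times 3.\<close>
    have "cmod (f x) powr (p-2) * (cmod (g x) * cmod (h x)) = K * ((cmod (f x) / a) powr (p-2) * (cmod (g x) / b * (cmod (h x) / d)))"
      using pos by (simp add: K_def powr_divide)
    also have "\<dots> \<le> K * ((cmod (f x) / a) powr p + (cmod (g x) / b) powr p + (cmod (h x) / d) powr p)"
      using K p pos by (intro mult_left_mono powr_mult3_le) auto
    finally show ?thesis using pos by (simp add: powr_divide)
  qed
  have Iw: "(\<lambda>x. cmod (f x) powr p / a powr p + cmod (g x) powr p / b powr p + cmod (h x) powr p / d powr p) integrable_on {0..1}"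
    using I by (intro integrable_add integrable_on_divide)
  have "integral {0..1} (\<lambda>x. cmod (f x) powr (p-2) * (cmod (g x) * cmod (h x))) \<le>
     integral {0..1} (\<lambda>x. K * (cmod (f x) powr p / a powr p + cmod (g x) powr p / b powr p + cmod (h x) powr p / d powr p))"
  proof (intro integral_le pt)
    show "(\<lambda>x. cmod (f x) powr (p-2) * (cmod (g x) * cmod (h x))) integrable_on {0..1}"
    proof (rule integrable_continuous_interval)
      show "continuous_on {0..1} (\<lambda>x. cmod (f x) powr (p-2) * (cmod (g x) * cmod (h x)))"
        using p by (intro continuous_on_mult continuous_cmod_powr continuous_on_norm continuous_on_subset[OF c(1)]
            continuous_on_subset[OF c(2)] continuous_on_subset[OF c(3)]) auto
    qed
    show "(\<lambda>x. K * (cmod (f x) powr p / a powr p + cmod (g x) powr p / b powr p + cmod (h x) powr p / d powr p)) integrable_on {0..1}"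
      using Iw by (rule integrable_on_mult_right)
  qed
  also have "\<dots> = K * (integral {0..1} (\<lambda>x. cmod (f x) powr p) / a powr p + integral {0..1} (\<lambda>x. cmod (g x) powr p) / b powr p
      + integral {0..1} (\<lambda>x. cmod (h x) powr p) / d powr p)"
    using I by (simp add: integral_add integrable_add integrable_on_divide)
  also have "\<dots> \<le> K * (1 + 1 + 1)"
    using K bd pos by (intro mult_left_mono add_mono) (auto simp: divide_le_eq_1)
  finally show ?thesis by (simp add: K_def)
qed

text \<open>Integration by parts: \<Phi> = |F|^(p-2) <F, g> is periodic, so its derivative has
  integral 0. Moving the derivative from g onto F costs 1 for the inner product and p - 2 for the
  power, hence the factor p - 1. The gain is that g is much smaller than g' when its frequencies are
  high.\<close>

lemma integral_powr_inner_le: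
  fixes F F' g g' :: "real \<Rightarrow> complex"
  assumes p: "p > 2"
    and dF: "\<And>x. (F has_vector_derivative F' x) (at x)" and dg: "\<And>x. (g has_vector_derivative g' x) (at x)"
    and cont: "continuous_on UNIV F'" "continuous_on UNIV g'"
    and per: "F 1 = F 0" "g 1 = g 0"
  shows "integral {0..1} (\<lambda>x. cmod (F x) powr (p-2) * (F x \<bullet> g' x))
      \<le> (p-1) * integral {0..1} (\<lambda>x. cmod (F x) powr (p-2) * (cmod (F' x) * cmod (g x)))"
proof -
  have cF: "continuous_on S F" for S using dF by (meson continuous_at_imp_continuous_on has_vector_derivative_continuous)
  have cg: "continuous_on S g" for S using dg by (meson continuous_at_imp_continuous_on has_vector_derivative_continuous)
  have cpow: "continuous_on S (\<lambda>x. cmod (F x) powr (p-2))" for S using p by (intro continuous_cmod_powr cF) auto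
  define v where "v x = F x \<bullet> g x" for x
  define v' where "v' x = F x \<bullet> g' x + F' x \<bullet> g x" for x
  have dv: "(v has_real_derivative v' x) (at x)" for x
    unfolding v_def v'_def has_real_derivative_iff_has_vector_derivative has_vector_derivative_def
    using has_derivative_inner[OF dF[of x, unfolded has_vector_derivative_def] dg[of x, unfolded has_vector_derivative_def]]
    by (rule has_derivative_eq_rhs) (auto simp: algebra_simps)
  define \<Phi> where "\<Phi> x = cmod (F x) powr (p-2) * v x" for x
  define D where "D x = cmod (F x) powr (p-2) * v' x + (p-2) * cmod (F x) powr (p-4) * (F x \<bullet> F' x) * v x" for x
  have d\<Phi>: "(\<Phi> has_real_derivative D x) (at x)" for x
  \<comment> \<open>At a zero of F the power p - 4 may be singular. There v vanishes too, so the
    difference quotient of \<Phi> tends to 0, and D is 0 as well because 0 powr any exponent is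
    0.\<close>
  proof (cases "F x = 0")
    case True
    have "((\<lambda>y. cmod (F y) powr (p-2) * ((v y - v x) / (y - x))) \<longlongrightarrow> cmod (F x) powr (p-2) * v' x) (at x)"
    proof (intro tendsto_mult)
      show "((\<lambda>y. cmod (F y) powr (p-2)) \<longlongrightarrow> cmod (F x) powr (p-2)) (at x)"
        using cpow[of UNIV] by (simp add: continuous_on_def)
      show "((\<lambda>y. (v y - v x) / (y - x)) \<longlongrightarrow> v' x) (at x)"
        using dv[of x] by (simp add: has_field_derivative_iff)
    qed
    moreover have "v x = 0" "D x = 0" "\<Phi> x = 0" using True p by (auto simp: v_def D_def \<Phi>_def)
    ultimately show ?thesis using True by (simp add: has_field_derivative_iff \<Phi>_def)
  next
    case False
    have nn: "F x \<bullet> F x > 0" using False by simp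
    have dn: "((\<lambda>y. F y \<bullet> F y) has_real_derivative 2 * (F x \<bullet> F' x)) (at x)"
      unfolding has_real_derivative_iff_has_vector_derivative has_vector_derivative_def
      using has_derivative_inner[OF dF[of x, unfolded has_vector_derivative_def] dF[of x, unfolded has_vector_derivative_def]]
      by (rule has_derivative_eq_rhs) (auto simp: algebra_simps inner_commute)
    have e: "(F y \<bullet> F y) powr (q/2) = cmod (F y) powr q" for y q
      by (simp add: power2_norm_eq_inner[symmetric] power2_powr_half)
    have "((\<lambda>y. (F y \<bullet> F y) powr ((p-2)/2) * v y) has_real_derivative
       (F x \<bullet> F x) powr ((p-2)/2) * v' x + ((p-2)/2) * (F x \<bullet> F x) powr ((p-2)/2 - 1) * (2 * (F x \<bullet> F' x)) * v x) (at x)"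
      using nn by (auto intro!: derivative_eq_intros dn dv)
    also have "(p-2)/2 - 1 = (p-4)/2" by (simp add: diff_divide_distrib)
    finally show ?thesis unfolding e \<Phi>_def[abs_def] D_def by (simp add: mult_ac)
  qed
  have "(D has_integral (\<Phi> 1 - \<Phi> 0)) {0..1}"
    using d\<Phi> by (intro fundamental_theorem_of_calculus)
      (auto simp flip: has_real_derivative_iff_has_vector_derivative intro: has_field_derivative_at_within)
  moreover have "\<Phi> 1 = \<Phi> 0" by (simp add: \<Phi>_def v_def per)
  ultimately have ID: "(D has_integral 0) {0..1}" by simp
  have pt: "cmod (F x) powr (p-2) * (F x \<bullet> g' x) \<le> D x + (p-1) * (cmod (F x) powr (p-2) * (cmod (F' x) * cmod (g x)))" for x
  proof -
    have a: "- (cmod (F x) powr (p-2) * (F' x \<bullet> g x)) \<le> cmod (F x) powr (p-2) * (cmod (F' x) * cmod (g x))"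
    proof -
      have "cmod (F x) powr (p-2) * (- (F' x \<bullet> g x)) \<le> cmod (F x) powr (p-2) * (cmod (F' x) * cmod (g x))"
        using Cauchy_Schwarz_ineq2[of "F' x" "g x"] by (intro mult_left_mono) (auto simp: abs_le_iff)
      thus ?thesis by simp
    qed
    have b: "- ((p-2) * cmod (F x) powr (p-4) * (F x \<bullet> F' x) * v x) \<le> (p-2) * (cmod (F x) powr (p-2) * (cmod (F' x) * cmod (g x)))"
    proof -
      have "- ((F x \<bullet> F' x) * v x) \<le> \<bar>F x \<bullet> F' x\<bar> * \<bar>v x\<bar>" unfolding abs_mult[symmetric] by linarith
      also have "\<dots> \<le> (cmod (F x) * cmod (F' x)) * (cmod (F x) * cmod (g x))"
        unfolding v_def by (intro mult_mono Cauchy_Schwarz_ineq2) auto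
      finally have "(p-2) * cmod (F x) powr (p-4) * (- ((F x \<bullet> F' x) * v x)) \<le> (p-2) * cmod (F x) powr (p-4) * ((cmod (F x) * cmod (F' x)) * (cmod (F x) * cmod (g x)))"
        using p by (intro mult_left_mono) auto
      also have "\<dots> = (p-2) * ((cmod (F x) powr (p-4) * (cmod (F x))^2) * (cmod (F' x) * cmod (g x)))"
        by (simp add: power2_eq_square mult_ac)
      also have "cmod (F x) powr (p-4) * (cmod (F x))^2 = cmod (F x) powr (p-2)"
      proof (cases "F x = 0")
        case False
        have "cmod (F x) powr (p-4) * cmod (F x) powr 2 = cmod (F x) powr (p-2)" by (simp only: powr_add[symmetric]) simp
        thus ?thesis using False by simp
      qed simp
      finally show ?thesis by (simp add: mult_ac)
    qed
    have "cmod (F x) powr (p-2) * (F x \<bullet> g' x) = D x - cmod (F x) powr (p-2) * (F' x \<bullet> g x) - (p-2) * cmod (F x) powr (p-4) * (F x \<bullet> F' x) * v x"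
      by (simp add: D_def v'_def algebra_simps)
    also have "\<dots> \<le> D x + cmod (F x) powr (p-2) * (cmod (F' x) * cmod (g x)) + (p-2) * (cmod (F x) powr (p-2) * (cmod (F' x) * cmod (g x)))"
      using a b by linarith
    finally show ?thesis by (simp add: algebra_simps)
  qed
  have I1: "(\<lambda>x. cmod (F x) powr (p-2) * (F x \<bullet> g' x)) integrable_on {0..1}"
    by (intro integrable_continuous_interval continuous_on_mult cpow continuous_on_inner cF continuous_on_subset[OF cont(2)]) auto
  have I2: "(\<lambda>x. cmod (F x) powr (p-2) * (cmod (F' x) * cmod (g x))) integrable_on {0..1}"
    by (intro integrable_continuous_interval continuous_on_mult cpow continuous_on_norm cg continuous_on_subset[OF cont(1)]) auto
  have "integral {0..1} (\<lambda>x. cmod (F x) powr (p-2) * (F x \<bullet> g' x))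
     \<le> integral {0..1} (\<lambda>x. D x + (p-1) * (cmod (F x) powr (p-2) * (cmod (F' x) * cmod (g x))))"
    using pt I1 ID I2 by (intro integral_le integrable_add integrable_on_mult_right) auto
  also have "\<dots> = integral {0..1} D + (p-1) * integral {0..1} (\<lambda>x. cmod (F x) powr (p-2) * (cmod (F' x) * cmod (g x)))"
    using ID I2 by (subst integral_add) (auto intro: integrable_on_mult_right)
  finally show ?thesis using integral_unique[OF ID] by simp
qed

text \<open>The tangent lies below a convex power. Read backwards, an increment of order y^(p/2-1)
  D^2 to the p-th power of a norm is absorbed by an increment of order D^2 to its square y.\<close>

lemma powr_add_ge:
  fixes y v r :: real
  assumes y: "y > 0" and v: "v \<ge> 0" and r: "r \<ge> 1"
  shows "y powr r + r * (y powr (r-1) * v) \<le> (y + v) powr r"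
proof (cases "v = 0")
  case False
  hence "\<exists>z>y. z < y + v \<and> (y+v) powr r - y powr r = (y + v - y) * (r * z powr (r-1))"
    using y v by (intro MVT2) (auto intro!: derivative_eq_intros)
  then obtain z where z: "z > y" and eq: "(y+v) powr r - y powr r = v * (r * z powr (r-1))" by auto
  have "y powr (r-1) \<le> z powr (r-1)" using z y r by (intro powr_mono2) auto
  hence "r * (y powr (r-1) * v) \<le> r * (z powr (r-1) * v)" using v r by (intro mult_left_mono mult_right_mono) auto
  thus ?thesis using eq by (simp add: mult_ac)
qed simp

text \<open>\<open>M\<close> is the frequency scale of \<open>f\<close>, which has the primitive \<open>g\<close>, while \<open>F\<close> lives at lower frequencies.\<close>

lemma lacunary_sum_step:
  fixes F F' f g :: "real \<Rightarrow> complex"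
  assumes p: "p > 2" and Cp: "C0 > 0" "\<And>a b::complex. cmod (a + b) powr p \<le> cmod a powr p + p * (cmod a powr (p-2) * (a \<bullet> b))
      + C0 * (cmod a powr (p-2) * (cmod b)^2 + cmod b powr p)"
    and dF: "\<And>x. (F has_vector_derivative F' x) (at x)" and dg: "\<And>x. (g has_vector_derivative f x) (at x)"
    and cont: "continuous_on UNIV F'" "continuous_on UNIV f" and per: "F 1 = F 0" "g 1 = g 0"
    and D: "D > 0" and K: "K > 0" and M: "M > 0" and y: "y \<ge> D^2"
    and bF: "integral {0..1} (\<lambda>x. cmod (F x) powr p) \<le> y powr (p/2)"
    and bf: "Lp_norm p f \<le> D" and bg: "Lp_norm p g \<le> D / M" and bF': "Lp_norm p F' \<le> K * M * D"
  shows "integral {0..1} (\<lambda>x. cmod (F x + f x) powr p) \<le> (y + (3 * p * (p-1) * K + 4 * C0) / (p/2) * D^2) powr (p/2)"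
proof -
  have cF: "continuous_on S F" for S using dF by (meson continuous_at_imp_continuous_on has_vector_derivative_continuous)
  have cg: "continuous_on S g" for S using dg by (meson continuous_at_imp_continuous_on has_vector_derivative_continuous)
  have cf: "continuous_on S f" for S by (rule continuous_on_subset[OF cont(2)]) simp
  have y0: "y > 0" using y D by (smt (verit) zero_less_power)
  define a where "a = sqrt y"
  have a: "a > 0" "a^2 = y" "a \<ge> D" using y0 y D by (auto simp: a_def real_le_rsqrt)
  have ap: "a powr q = y powr (q/2)" for q using a power2_powr_half[of a q] by simp
  have If: "integral {0..1} (\<lambda>x. cmod (f x) powr p) \<le> D powr p" using bf p by (intro Lp_norm_leD) auto
  have Ig: "integral {0..1} (\<lambda>x. cmod (g x) powr p) \<le> (D/M) powr p" using bg p by (intro Lp_norm_leD) auto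
  have IF': "integral {0..1} (\<lambda>x. cmod (F' x) powr p) \<le> (K*M*D) powr p" using bF' p by (intro Lp_norm_leD) auto
  have IF: "integral {0..1} (\<lambda>x. cmod (F x) powr p) \<le> a powr p" using bF ap by simp
  have i1: "(\<lambda>x. cmod (F x) powr p) integrable_on {0..1}" using p by (intro integrable_cmod_powr cF) auto
  have i2: "(\<lambda>x. cmod (F x) powr (p-2) * (F x \<bullet> f x)) integrable_on {0..1}"
    using p by (intro integrable_continuous_interval continuous_on_mult continuous_cmod_powr continuous_on_inner cF cf) auto
  have i3: "(\<lambda>x. cmod (F x) powr (p-2) * (cmod (f x))^2) integrable_on {0..1}"
    using p by (intro integrable_continuous_interval continuous_on_mult continuous_cmod_powr continuous_on_power continuous_on_norm cF cf) auto
  have i4: "(\<lambda>x. cmod (f x) powr p) integrable_on {0..1}" using p by (intro integrable_cmod_powr cf) auto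
  have "integral {0..1} (\<lambda>x. cmod (F x + f x) powr p) \<le> integral {0..1} (\<lambda>x. (cmod (F x) powr p + p * (cmod (F x) powr (p-2) * (F x \<bullet> f x)))
      + C0 * (cmod (F x) powr (p-2) * (cmod (f x))^2 + cmod (f x) powr p))"
    using p i1 i2 i3 i4 Cp(2)
    by (intro integral_le integrable_add integrable_on_mult_right integrable_cmod_powr continuous_on_add cF cf) auto
  also have "\<dots> = (integral {0..1} (\<lambda>x. cmod (F x) powr p) + p * integral {0..1} (\<lambda>x. cmod (F x) powr (p-2) * (F x \<bullet> f x)))
      + C0 * (integral {0..1} (\<lambda>x. cmod (F x) powr (p-2) * (cmod (f x))^2) + integral {0..1} (\<lambda>x. cmod (f x) powr p))"
    by (simp only: integral_add[OF integrable_add[OF i1 integrable_on_mult_right[OF i2]] integrable_on_mult_right[OF integrable_add[OF i3 i4]]]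
        integral_add[OF i1 integrable_on_mult_right[OF i2]] integral_mult_right integral_add[OF i3 i4])
  \<comment> \<open>The primitive of f has size D/M and F' has size K M D: the scale M cancels, and
    the first-order term is of the order a^(p-2) D^2 of the quadratic one.\<close>
  also have "integral {0..1} (\<lambda>x. cmod (F x) powr (p-2) * (F x \<bullet> f x)) \<le> (p-1) * (3 * (a powr (p-2) * ((K*M*D) * (D/M))))"
  proof -
    have "integral {0..1} (\<lambda>x. cmod (F x) powr (p-2) * (F x \<bullet> f x)) \<le> (p-1) * integral {0..1} (\<lambda>x. cmod (F x) powr (p-2) * (cmod (F' x) * cmod (g x)))"
      by (rule integral_powr_inner_le[OF p dF dg cont per])
    also have "\<dots> \<le> (p-1) * (3 * (a powr (p-2) * ((K*M*D) * (D/M))))"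
      using p a D K M IF IF' Ig by (intro mult_left_mono integral_powr_mult3_le cF cg cont) auto
    finally show ?thesis .
  qed
  also have "(K*M*D) * (D/M) = K * D^2" using M by (simp add: power2_eq_square)
  also have "integral {0..1} (\<lambda>x. cmod (F x) powr (p-2) * (cmod (f x))^2) \<le> 3 * (a powr (p-2) * (D * D))"
    unfolding power2_eq_square using p a D IF If by (intro integral_powr_mult3_le cF cf) auto
  also have "integral {0..1} (\<lambda>x. cmod (f x) powr p) \<le> a powr (p-2) * D^2"
  proof -
    have "D powr p = D powr (p-2) * D powr 2" by (simp add: powr_add[symmetric])
    also have "\<dots> \<le> a powr (p-2) * D^2" using a D p by (intro mult_mono powr_mono2) auto
    finally show ?thesis using If by linarith
  qed
  also have "integral {0..1} (\<lambda>x. cmod (F x) powr p) \<le> y powr (p/2)" by (rule bF)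
  finally have "integral {0..1} (\<lambda>x. cmod (F x + f x) powr p) \<le> (y powr (p/2) + p * ((p-1) * (3 * (a powr (p-2) * (K * D^2)))))
      + C0 * (3 * (a powr (p-2) * (D * D)) + a powr (p-2) * D^2)"
    using p Cp(1) by (simp add: mult_left_mono add_mono)
  also have "\<dots> = y powr (p/2) + (p/2) * (a powr (p-2) * ((3 * p * (p-1) * K + 4 * C0) / (p/2) * D^2))"
    using p by (simp add: power2_eq_square field_simps)
  also have "a powr (p-2) = y powr (p/2 - 1)" unfolding ap by (simp add: diff_divide_distrib)
  also have "y powr (p/2) + (p/2) * (y powr (p/2 - 1) * ((3 * p * (p-1) * K + 4 * C0) / (p/2) * D^2))
      \<le> (y + (3 * p * (p-1) * K + 4 * C0) / (p/2) * D^2) powr (p/2)"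
    using y0 p K Cp(1) by (intro powr_add_ge) auto
  finally show ?thesis .
qed

text \<open>Induction over the blocks with y = D^2 (1 + C3 j): each block adds at most C3 D^2 to the
  square of the norm, so J blocks cost sqrt J instead of J. The base 4 is the frequency ratio of
  consecutive dyadic blocks, frequencies being squares; the initial 1 keeps y \<ge> D^2.\<close>

lemma lacunary_sum_norm:
  assumes p: "p > 2" and K: "K > 0"
  shows "\<exists>C>0. \<forall>(f :: nat \<Rightarrow> real \<Rightarrow> complex) f' g D J. D > 0 \<longrightarrow>
     (\<forall>j x. (f j has_vector_derivative f' j x) (at x)) \<longrightarrow> (\<forall>j x. (g j has_vector_derivative f j x) (at x)) \<longrightarrow>
     (\<forall>j. continuous_on UNIV (f' j)) \<longrightarrow> (\<forall>j. f j 1 = f j 0 \<and> g j 1 = g j 0) \<longrightarrow>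
     (\<forall>j<J. Lp_norm p (f j) \<le> D \<and> Lp_norm p (g j) \<le> D / 4^j \<and> Lp_norm p (\<lambda>x. \<Sum>i<j. f' i x) \<le> K * 4^j * D) \<longrightarrow>
     Lp_norm p (\<lambda>x. \<Sum>j<J. f j x) \<le> C * D * sqrt (1 + real J)"
proof -
  obtain C0 where C0: "C0 > 0" "\<And>a b::complex. cmod (a + b) powr p \<le> cmod a powr p + p * (cmod a powr (p-2) * (a \<bullet> b))
      + C0 * (cmod a powr (p-2) * (cmod b)^2 + cmod b powr p)" using cmod_add_powr_le[OF p] by blast
  define C3 where "C3 = (3 * p * (p-1) * K + 4 * C0) / (p/2)"
  have C3: "C3 \<ge> 0" using p K C0 by (simp add: C3_def)
  show ?thesis
  proof (intro exI[of _ "sqrt (1 + C3)"] conjI allI impI)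
    show "sqrt (1 + C3) > 0" using C3 by simp
    fix f f' g :: "nat \<Rightarrow> real \<Rightarrow> complex" and D :: real and J :: nat
    assume D: "D > 0" and df: "\<forall>j x. (f j has_vector_derivative f' j x) (at x)"
      and dg: "\<forall>j x. (g j has_vector_derivative f j x) (at x)" and cont: "\<forall>j. continuous_on UNIV (f' j)"
      and per: "\<forall>j. f j 1 = f j 0 \<and> g j 1 = g j 0"
      and bd: "\<forall>j<J. Lp_norm p (f j) \<le> D \<and> Lp_norm p (g j) \<le> D / 4^j \<and> Lp_norm p (\<lambda>x. \<Sum>i<j. f' i x) \<le> K * 4^j * D"
    have cf: "continuous_on UNIV (f j)" for j
      using df by (meson continuous_at_imp_continuous_on has_vector_derivative_continuous)
    have "integral {0..1} (\<lambda>x. cmod (\<Sum>i<j. f i x) powr p) \<le> (D^2 * (1 + C3 * real j)) powr (p/2)" if "j \<le> J" for j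
      using that
    proof (induction j)
      case (Suc j)
      have "integral {0..1} (\<lambda>x. cmod ((\<Sum>i<j. f i x) + f j x) powr p) \<le> (D^2 * (1 + C3 * real j) + C3 * D^2) powr (p/2)"
        unfolding C3_def
      proof (rule lacunary_sum_step[OF p C0 _ _ _ _ _ _ D K, where F' = "\<lambda>x. \<Sum>i<j. f' i x" and g = "g j" and M = "4^j"])
        show "((\<lambda>x. \<Sum>i<j. f i x) has_vector_derivative (\<Sum>i<j. f' i x)) (at x)" for x
          using df by (intro has_vector_derivative_sum) auto
        show "D^2 \<le> D^2 * (1 + (3 * p * (p-1) * K + 4 * C0) / (p/2) * real j)"
          using C3 D unfolding C3_def[symmetric] by (simp add: mult_left_mono[of 1, simplified])
        show "integral {0..1} (\<lambda>x. cmod (\<Sum>i<j. f i x) powr p) \<le> (D^2 * (1 + (3 * p * (p-1) * K + 4 * C0) / (p/2) * real j)) powr (p/2)"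
          using Suc unfolding C3_def by simp
      qed (use dg cont per bd Suc.prems cf in \<open>auto intro!: continuous_on_sum\<close>)
      thus ?case by (simp add: algebra_simps)
    qed (use p in simp)
    from this[of J] have "integral {0..1} (\<lambda>x. cmod (\<Sum>i<J. f i x) powr p) \<le> (D^2 * (1 + C3 * real J)) powr (p/2)" by simp
    also have "\<dots> = (sqrt (D^2 * (1 + C3 * real J))) powr p"
      using power2_powr_half[of "sqrt (D^2 * (1 + C3 * real J))" p] C3 by simp
    finally have "Lp_norm p (\<lambda>x. \<Sum>j<J. f j x) \<le> sqrt (D^2 * (1 + C3 * real J))"
      using p C3 by (intro Lp_norm_leI) auto
    also have "\<dots> \<le> sqrt (D^2 * ((1 + C3) * (1 + real J)))"
      using C3 by (intro real_sqrt_le_mono mult_left_mono) (auto simp: algebra_simps)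
    also have "\<dots> = sqrt (1 + C3) * D * sqrt (1 + real J)" using D by (simp add: real_sqrt_mult)
    finally show "Lp_norm p (\<lambda>x. \<Sum>j<J. f j x) \<le> sqrt (1 + C3) * D * sqrt (1 + real J)" .
  qed
qed

section \<open>Power sums\<close>

lemma has_vector_derivative_cis:
  "((\<lambda>x. cis (k * x)) has_vector_derivative (\<i> * of_real k * cis (k * x))) (at x)"
proof -
  have "((\<lambda>z. exp (\<i> * of_real k * z)) has_field_derivative exp (\<i> * of_real k * of_real x) * (\<i> * of_real k)) (at (of_real x))"
    by (auto intro!: derivative_eq_intros)
  from has_vector_derivative_real_field[OF this]
  show ?thesis by (simp add: cis_conv_exp mult_ac)
qed

lemma qsum_has_vector_derivative:
  "(qsum c A has_vector_derivative (2 * pi * \<i>) * qsum (\<lambda>n. (real n)^2 * c n) A x) (at x)"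
proof -
  have "((\<lambda>x. \<Sum>n\<in>A. complex_of_real (c n) * cis (2*pi*(real n)^2*x)) has_vector_derivative
     (\<Sum>n\<in>A. complex_of_real (c n) * (\<i> * of_real (2*pi*(real n)^2) * cis (2*pi*(real n)^2*x)))) (at x)"
    by (intro has_vector_derivative_sum has_vector_derivative_mult_right has_vector_derivative_cis)
  moreover have "(\<Sum>n\<in>A. complex_of_real (c n) * (\<i> * of_real (2*pi*(real n)^2) * cis (2*pi*(real n)^2*x)))
      = (2 * pi * \<i>) * qsum (\<lambda>n. (real n)^2 * c n) A x"
    unfolding qsum_def sum_distrib_left by (intro sum.cong refl) (simp add: mult_ac)
  ultimately show ?thesis unfolding qsum_def[abs_def] by simp
qed

lemma sum_geometric_le:
  fixes z :: real assumes "z > 1" shows "(\<Sum>j<J. z ^ j) \<le> z ^ J / (z - 1)"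
  using assms geometric_sum[of z J] by (simp add: divide_right_mono)

lemma dyadic_sum_increasing:
  assumes d: "d > 0" and k: "k \<ge> 0"
  shows "\<exists>C>0. \<forall>J. (\<Sum>j<J. 2 powr (real j * d) * (1 + real j) powr k) \<le> C * (2 powr (real J * d) * (1 + real J) powr k)"
proof -
  define z :: real where "z = 2 powr d"
  have z: "z > 1" using d by (simp add: z_def)
  have zp: "2 powr (real j * d) = z ^ j" for j by (simp add: z_def powr_powr mult.commute flip: powr_realpow)
  show ?thesis
  proof (intro exI[of _ "1 / (z - 1)"] conjI allI)
    fix J
    have "(\<Sum>j<J. 2 powr (real j * d) * (1 + real j) powr k) \<le> (\<Sum>j<J. z ^ j * (1 + real J) powr k)"
      unfolding zp using z k by (intro sum_mono mult_left_mono powr_mono2) auto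
    also have "\<dots> = (\<Sum>j<J. z ^ j) * (1 + real J) powr k" by (simp only: sum_distrib_right)
    also have "\<dots> \<le> z ^ J / (z - 1) * (1 + real J) powr k" by (intro mult_right_mono sum_geometric_le z) auto
    finally show "(\<Sum>j<J. 2 powr (real j * d) * (1 + real j) powr k) \<le> 1 / (z - 1) * (2 powr (real J * d) * (1 + real J) powr k)"
      by (simp add: zp)
  qed (use z in auto)
qed

text \<open>Writing j = i + m, the weight splits as (1+i+m)^k \<le> (1+i)^k (1+m), by k \<le> 1;
  what is left is the series of (m+1) z^m with sum 1/(1-z)^2.\<close>

lemma dyadic_sum_decreasing:
  assumes d: "d < 0" and k: "0 \<le> k" "k \<le> 1"
  shows "\<exists>C>0. \<forall>i J. (\<Sum>j\<in>{i..<J}. 2 powr (real j * d) * (1 + real j) powr k) \<le> C * (2 powr (real i * d) * (1 + real i) powr k)"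
proof -
  define z :: real where "z = 2 powr d"
  have z: "0 < z" "z < 1" using d by (auto simp: z_def powr_less_one)
  have zp: "2 powr (real j * d) = z ^ j" for j by (simp add: z_def powr_powr mult.commute flip: powr_realpow)
  have sm: "(\<lambda>n. of_nat (Suc n) * z ^ n) sums (1 / (1 - z)^2)"
    using geometric_deriv_sums[of z] z by simp
  show ?thesis
  proof (intro exI[of _ "1 / (1 - z)^2"] conjI allI)
    fix i J :: nat
    have "(\<Sum>j\<in>{i..<J}. 2 powr (real j * d) * (1 + real j) powr k) \<le> (\<Sum>j\<in>{i..<J}. (z ^ i * (1 + real i) powr k) * (real (Suc (j - i)) * z ^ (j - i)))"
    proof (intro sum_mono)
      fix j assume j: "j \<in> {i..<J}"
      define m where "m = j - i"
      have jm: "j = i + m" using j by (simp add: m_def)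
      have "(1 + real j) powr k \<le> ((1 + real i) * (1 + real m)) powr k"
        unfolding jm using k by (intro powr_mono2) (auto simp: algebra_simps)
      also have "\<dots> = (1 + real i) powr k * (1 + real m) powr k" by (simp add: powr_mult)
      also have "\<dots> \<le> (1 + real i) powr k * (1 + real m) powr 1"
        using k by (intro mult_left_mono powr_mono) auto
      finally have "(1 + real j) powr k \<le> (1 + real i) powr k * real (Suc m)" by simp
      hence "z ^ j * (1 + real j) powr k \<le> z ^ j * ((1 + real i) powr k * real (Suc m))" using z by (intro mult_left_mono) auto
      thus "2 powr (real j * d) * (1 + real j) powr k \<le> (z ^ i * (1 + real i) powr k) * (real (Suc (j - i)) * z ^ (j - i))"
        unfolding zp m_def[symmetric] by (simp add: jm power_add mult_ac)
    qed
    also have "\<dots> = (z ^ i * (1 + real i) powr k) * (\<Sum>j\<in>{i..<J}. real (Suc (j - i)) * z ^ (j - i))"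
      by (simp only: sum_distrib_left)
    also have "(\<Sum>j\<in>{i..<J}. real (Suc (j - i)) * z ^ (j - i)) = (\<Sum>m\<in>{..<J-i}. real (Suc m) * z ^ m)"
      by (rule sum.reindex_bij_witness[of _ "\<lambda>m. m + i" "\<lambda>j. j - i"]) auto
    also have "(z ^ i * (1 + real i) powr k) * (\<Sum>m\<in>{..<J-i}. real (Suc m) * z ^ m) \<le> (z ^ i * (1 + real i) powr k) * (1 / (1 - z)^2)"
      using sum_le_suminf[OF sums_summable[OF sm], of "{..<J-i}"] z sums_unique[OF sm]
      by (intro mult_left_mono) auto
    finally show "(\<Sum>j\<in>{i..<J}. 2 powr (real j * d) * (1 + real j) powr k) \<le> 1 / (1 - z)^2 * (2 powr (real i * d) * (1 + real i) powr k)"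
      unfolding zp by (simp only: mult.commute)
  qed (use z in auto)
qed

lemma weyl_log_le: "weyl_log p \<le> 1" by (simp add: weyl_log_def)

lemma dyadic_range_norm:
  assumes p: "p > 2"
  shows "\<exists>C>0. \<forall>i J B. i \<le> J \<longrightarrow> B \<le> 2^J \<longrightarrow> Lp_norm p (qsum (\<lambda>n. real n powr \<alpha>) {2^i..<B})
      \<le> C * (\<Sum>j\<in>{i..<J}. 2 powr (real j * (\<alpha> + weyl_exp p)) * (1 + real j) powr weyl_log p)"
proof -
  obtain C where C: "C > 0" "\<And>j B. Lp_norm p (qsum (\<lambda>n. real n powr \<alpha>) {2^j..<min B (2^Suc j)})
      \<le> C * (2 powr (real j * (\<alpha> + weyl_exp p)) * (1 + real j) powr weyl_log p)" using dyadic_block_norm[OF p, of \<alpha>] by blast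
  have "Lp_norm p (qsum (\<lambda>n. real n powr \<alpha>) {2^i..<B})
      \<le> C * (\<Sum>j\<in>{i..<J}. 2 powr (real j * (\<alpha> + weyl_exp p)) * (1 + real j) powr weyl_log p)" if "i \<le> J" "B \<le> 2^J" for i J B
  proof -
    have "qsum (\<lambda>n. real n powr \<alpha>) {2^i..<B} = (\<lambda>x. \<Sum>j\<in>{i..<J}. qsum (\<lambda>n. real n powr \<alpha>) {2^j..<min B (2^Suc j)} x)"
      using dyadic_decomposition[OF that(1), of "\<lambda>n. real n powr \<alpha>" B] that(2) by (auto simp: fun_eq_iff min_absorb1)
    hence "Lp_norm p (qsum (\<lambda>n. real n powr \<alpha>) {2^i..<B}) \<le> (\<Sum>j\<in>{i..<J}. Lp_norm p (qsum (\<lambda>n. real n powr \<alpha>) {2^j..<min B (2^Suc j)}))"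
      using p by (simp only:) (intro Lp_norm_sum continuous_intros; simp)
    also have "\<dots> \<le> (\<Sum>j\<in>{i..<J}. C * (2 powr (real j * (\<alpha> + weyl_exp p)) * (1 + real j) powr weyl_log p))"
      by (intro sum_mono C)
    finally show ?thesis by (simp only: sum_distrib_left)
  qed
  thus ?thesis using C by blast
qed

lemma power_tail_norm:
  assumes p: "p > 2" and a: "\<alpha> + weyl_exp p < 0"
  shows "\<exists>C>0. \<forall>i B. Lp_norm p (qsum (\<lambda>n. real n powr \<alpha>) {2^i..<B})
      \<le> C * (2 powr (real i * (\<alpha> + weyl_exp p)) * (1 + real i) powr weyl_log p)"
proof -
  obtain C1 where C1: "C1 > 0" "\<And>i J B. i \<le> J \<Longrightarrow> B \<le> 2^J \<Longrightarrow> Lp_norm p (qsum (\<lambda>n. real n powr \<alpha>) {2^i..<B})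
      \<le> C1 * (\<Sum>j\<in>{i..<J}. 2 powr (real j * (\<alpha> + weyl_exp p)) * (1 + real j) powr weyl_log p)"
    using dyadic_range_norm[OF p, of \<alpha>] by blast
  obtain C2 where C2: "C2 > 0" "\<And>i J. (\<Sum>j\<in>{i..<J}. 2 powr (real j * (\<alpha> + weyl_exp p)) * (1 + real j) powr weyl_log p)
      \<le> C2 * (2 powr (real i * (\<alpha> + weyl_exp p)) * (1 + real i) powr weyl_log p)"
    using dyadic_sum_decreasing[OF a weyl_log_nonneg weyl_log_le, of p] by blast
  have "Lp_norm p (qsum (\<lambda>n. real n powr \<alpha>) {2^i..<B}) \<le> C1 * C2 * (2 powr (real i * (\<alpha> + weyl_exp p)) * (1 + real i) powr weyl_log p)" for i B
  proof -
    have "B \<le> 2 ^ (max i B)" using less_exp[of B] power_increasing[OF max.cobounded2[of B i], of "2::nat"] by linarith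
    hence "Lp_norm p (qsum (\<lambda>n. real n powr \<alpha>) {2^i..<B}) \<le> C1 * (\<Sum>j\<in>{i..<max i B}. 2 powr (real j * (\<alpha> + weyl_exp p)) * (1 + real j) powr weyl_log p)"
      by (intro C1) auto
    also have "\<dots> \<le> C1 * (C2 * (2 powr (real i * (\<alpha> + weyl_exp p)) * (1 + real i) powr weyl_log p))"
      using C1 by (intro mult_left_mono C2) auto
    finally show ?thesis by (simp add: mult_ac)
  qed
  thus ?thesis using C1 C2 by (intro exI[of _ "C1 * C2"]) auto
qed

text \<open>Blocks with weights n^\<alpha>, n^(\<alpha>-2) and n^(\<alpha>+2) are, up to constants,
  the functions, their primitives and their derivatives. At the critical exponent their norms are of
  order 1, 4^(-j), 4^j times the logarithmic factor, as \<open>lacunary_sum_norm\<close> demands;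
  the derivatives of the lower blocks sum geometrically.\<close>

lemma power_sum_norm_critical:
  assumes p: "p > 2" and a: "\<alpha> + weyl_exp p = 0"
  shows "\<exists>C>0. \<forall>J B. B \<le> 2^J \<longrightarrow> Lp_norm p (qsum (\<lambda>n. real n powr \<alpha>) {1..<B}) \<le> C * (1 + real J) powr (weyl_log p + 1/2)"
proof -
  let ?k = "weyl_log p"
  obtain C0 where C0: "C0 > 0" "\<And>j B. Lp_norm p (qsum (\<lambda>n. real n powr \<alpha>) {2^j..<min B (2^Suc j)})
      \<le> C0 * (2 powr (real j * (\<alpha> + weyl_exp p)) * (1 + real j) powr ?k)" using dyadic_block_norm[OF p, of \<alpha>] by blast
  obtain C1 where C1: "C1 > 0" "\<And>j B. Lp_norm p (qsum (\<lambda>n. real n powr (\<alpha>-2)) {2^j..<min B (2^Suc j)})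
      \<le> C1 * (2 powr (real j * (\<alpha> - 2 + weyl_exp p)) * (1 + real j) powr ?k)" using dyadic_block_norm[OF p, of "\<alpha>-2"] by blast
  obtain C2 where C2: "C2 > 0" "\<And>j B. Lp_norm p (qsum (\<lambda>n. real n powr (\<alpha>+2)) {2^j..<min B (2^Suc j)})
      \<le> C2 * (2 powr (real j * (\<alpha> + 2 + weyl_exp p)) * (1 + real j) powr ?k)" using dyadic_block_norm[OF p, of "\<alpha>+2"] by blast
  have pm: "2 powr (real j * (\<alpha> - 2 + weyl_exp p)) = 1 / 4 ^ j" and pp: "2 powr (real j * (\<alpha> + 2 + weyl_exp p)) = 4 ^ j" for j
  proof -
    have "(4::real) ^ j = (2 ^ 2) ^ j" by simp
    also have "\<dots> = 2 ^ (2 * j)" by (rule power_mult[symmetric])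
    also have "\<dots> = 2 powr real (2 * j)" by (rule powr_realpow[symmetric]) simp
    finally have 4: "(4::real) ^ j = 2 powr (real j * 2)" by (simp add: mult.commute)
    have e: "\<alpha> - 2 + weyl_exp p = -2" "\<alpha> + 2 + weyl_exp p = 2" using a by linarith+
    show "2 powr (real j * (\<alpha> - 2 + weyl_exp p)) = 1 / 4 ^ j" "2 powr (real j * (\<alpha> + 2 + weyl_exp p)) = 4 ^ j"
      unfolding e 4 by (simp_all add: powr_minus_divide)
  qed
  define K where "K = 2 * pi"
  obtain C where C: "C > 0" "\<And>(f :: nat \<Rightarrow> real \<Rightarrow> complex) f' g D J. D > 0 \<Longrightarrow>
     (\<forall>j x. (f j has_vector_derivative f' j x) (at x)) \<Longrightarrow> (\<forall>j x. (g j has_vector_derivative f j x) (at x)) \<Longrightarrow>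
     (\<forall>j. continuous_on UNIV (f' j)) \<Longrightarrow> (\<forall>j. f j 1 = f j 0 \<and> g j 1 = g j 0) \<Longrightarrow>
     (\<forall>j<J. Lp_norm p (f j) \<le> D \<and> Lp_norm p (g j) \<le> D / 4^j \<and> Lp_norm p (\<lambda>x. \<Sum>i<j. f' i x) \<le> K * 4^j * D) \<Longrightarrow>
     Lp_norm p (\<lambda>x. \<Sum>j<J. f j x) \<le> C * D * sqrt (1 + real J)"
    using lacunary_sum_norm[OF p, of K] by (auto simp: K_def)
  have main: "Lp_norm p (qsum (\<lambda>n. real n powr \<alpha>) {1..<B}) \<le> C * (C0 + C1 + C2) * (1 + real J) powr (?k + 1/2)" if BJ: "B \<le> 2^J" for B J
  proof -
    define I where "I j = {2^j..<min B (2^Suc j)}" for j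
    define D where "D = (C0 + C1 + C2) * (1 + real J) powr ?k"
    define f where "f j = qsum (\<lambda>n. real n powr \<alpha>) (I j)" for j
    define f' where "f' j x = (2 * pi * \<i>) * qsum (\<lambda>n. real n powr (\<alpha> + 2)) (I j) x" for j x
    define g where "g j x = 1 / (2 * pi * \<i>) * qsum (\<lambda>n. real n powr (\<alpha> - 2)) (I j) x" for j x
    have Ipos: "n > 0" if "n \<in> I j" for n j
      using that unfolding I_def by (metis atLeastLessThan_iff less_le_trans zero_less_numeral zero_less_power)
    have D: "D > 0" using C0 C1 C2 by (simp add: D_def)
    have d1: "(f j has_vector_derivative f' j x) (at x)" for j x
    proof -
      have "qsum (\<lambda>n. (real n)^2 * real n powr \<alpha>) (I j) = qsum (\<lambda>n. real n powr (\<alpha>+2)) (I j)"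
        using Ipos by (intro qsum_cong) (simp add: powr_add mult.commute)
      thus ?thesis unfolding f_def f'_def using qsum_has_vector_derivative[of "\<lambda>n. real n powr \<alpha>" "I j" x] by simp
    qed
    have d2: "(g j has_vector_derivative f j x) (at x)" for j x
    proof -
      have "qsum (\<lambda>n. (real n)^2 * real n powr (\<alpha>-2)) (I j) = qsum (\<lambda>n. real n powr \<alpha>) (I j)"
        using Ipos by (intro qsum_cong) (simp add: powr_diff)
      with has_vector_derivative_mult_right[OF qsum_has_vector_derivative[of "\<lambda>n. real n powr (\<alpha>-2)" "I j" x], of "1 / (2 * pi * \<i>)"]
      show ?thesis unfolding f_def g_def[abs_def] by simp
    qed
    have qp: "qsum c A 1 = qsum c A 0" for c A using qsum_periodic[of c A 0] by simp
    have lp: "Lp_norm p (f j) \<le> D \<and> Lp_norm p (g j) \<le> D / 4^j \<and> Lp_norm p (\<lambda>x. \<Sum>i<j. f' i x) \<le> K * 4^j * D" if j: "j < J" for j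
    proof (intro conjI)
      have kj: "(1 + real i) powr ?k \<le> (1 + real J) powr ?k" if "i < J" for i
        using that weyl_log_nonneg[of p] by (intro powr_mono2) auto
      have "Lp_norm p (f j) \<le> C0 * (1 + real j) powr ?k" using C0(2)[of j B] a by (simp add: f_def I_def)
      also have "\<dots> \<le> D" unfolding D_def using C0 C1 C2 kj[OF j] by (intro mult_mono) auto
      finally show "Lp_norm p (f j) \<le> D" .
      have "Lp_norm p (g j) = cmod (1 / (2 * pi * \<i>)) * Lp_norm p (qsum (\<lambda>n. real n powr (\<alpha> - 2)) (I j))"
        unfolding g_def[abs_def] using p by (intro Lp_norm_cmult continuous_intros) auto
      also have "\<dots> \<le> 1 * (C1 * (1 / 4^j * (1 + real j) powr ?k))"
      proof (intro mult_mono)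
        have "2 * pi \<ge> 1" using pi_gt3 by simp
        thus "cmod (1 / (2 * pi * \<i>)) \<le> 1" by (simp add: norm_divide norm_mult divide_le_eq_1)
        show "Lp_norm p (qsum (\<lambda>n. real n powr (\<alpha> - 2)) (I j)) \<le> C1 * (1 / 4^j * (1 + real j) powr ?k)"
          using C1(2)[of j B] unfolding pm by (simp add: I_def)
      qed auto
      also have "\<dots> = (C1 * (1 + real j) powr ?k) / 4^j" by simp
      also have "\<dots> \<le> D / 4^j" unfolding D_def using C0 C1 C2 kj[OF j] by (intro divide_right_mono mult_mono) auto
      finally show "Lp_norm p (g j) \<le> D / 4^j" .
      have "Lp_norm p (\<lambda>x. \<Sum>i<j. f' i x) \<le> (\<Sum>i<j. Lp_norm p (f' i))"
        using p unfolding f'_def by (intro Lp_norm_sum continuous_intros) auto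
      also have "\<dots> \<le> (\<Sum>i<j. K * D * 4^i)"
      proof (intro sum_mono)
        fix i assume i: "i \<in> {..<j}"
        have "Lp_norm p (f' i) = cmod (2 * pi * \<i>) * Lp_norm p (qsum (\<lambda>n. real n powr (\<alpha> + 2)) (I i))"
          unfolding f'_def[abs_def] using p by (intro Lp_norm_cmult continuous_intros) auto
        also have "\<dots> = K * Lp_norm p (qsum (\<lambda>n. real n powr (\<alpha> + 2)) (I i))" by (simp add: K_def norm_mult)
        also have "\<dots> \<le> K * (C2 * (4^i * (1 + real i) powr ?k))"
          using C2(2)[of i B] unfolding pp by (intro mult_left_mono) (auto simp: I_def K_def)
        also have "\<dots> = K * (C2 * (1 + real i) powr ?k) * 4^i" by simp
        also have "\<dots> \<le> K * D * 4^i"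
          unfolding D_def using C0 C1 C2 kj[of i] i j by (intro mult_right_mono mult_left_mono mult_mono) (auto simp: K_def)
        finally show "Lp_norm p (f' i) \<le> K * D * 4^i" .
      qed
      also have "\<dots> = K * D * (\<Sum>i<j. 4^i)" by (simp only: sum_distrib_left)
      also have "\<dots> \<le> K * D * 4^j"
      proof (intro mult_left_mono)
        have "(\<Sum>i<j. (4::real)^i) \<le> 4^j / 3" using sum_geometric_le[of 4 j] by simp
        also have "\<dots> \<le> 4^j" by simp
        finally show "(\<Sum>i<j. (4::real)^i) \<le> 4^j" .
      qed (use D in \<open>auto simp: K_def\<close>)
      finally show "Lp_norm p (\<lambda>x. \<Sum>i<j. f' i x) \<le> K * 4^j * D" by (simp add: mult_ac)
    qed
    have "Lp_norm p (\<lambda>x. \<Sum>j<J. f j x) \<le> C * D * sqrt (1 + real J)"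
    proof (rule C(2)[OF D, of f f' g J])
      show "\<forall>j. continuous_on UNIV (f' j)" unfolding f'_def[abs_def] by (intro allI continuous_intros)
      show "\<forall>j. f j 1 = f j 0 \<and> g j 1 = g j 0" unfolding f_def g_def by (simp add: qp)
    qed (use d1 d2 lp in auto)
    also have "C * D * sqrt (1 + real J) = C * (C0 + C1 + C2) * (1 + real J) powr (?k + 1/2)"
      by (simp add: D_def powr_add powr_half_sqrt)
    also have "(\<lambda>x. \<Sum>j<J. f j x) = qsum (\<lambda>n. real n powr \<alpha>) {1..<B}"
      using dyadic_decomposition[of 0 J "\<lambda>n. real n powr \<alpha>" B] BJ
      by (auto simp: fun_eq_iff f_def I_def min_absorb1 lessThan_atLeast0)
    finally show ?thesis .
  qed
  show ?thesis using main C C0 C1 C2 by (intro exI[of _ "C * (C0 + C1 + C2)"]) auto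
qed

text \<open>\<open>d\<close> is the exponent of growth of the dyadic blocks; \<open>d = 0\<close> is the critical case.\<close>

definition low_size :: "real \<Rightarrow> real \<Rightarrow> nat \<Rightarrow> real" where
  "low_size d k J = (if d > 0 then 2 powr (real J * d) * (1 + real J) powr k
     else if d = 0 then (1 + real J) powr (k + 1/2) else 1)"

lemma power_sum_norm:
  assumes p: "p > 2"
  shows "\<exists>C>0. \<forall>J B. B \<le> 2^J \<longrightarrow> Lp_norm p (qsum (\<lambda>n. real n powr \<alpha>) {1..<B}) \<le> C * low_size (\<alpha> + weyl_exp p) (weyl_log p) J"
proof -
  consider "\<alpha> + weyl_exp p > 0" | "\<alpha> + weyl_exp p = 0" | "\<alpha> + weyl_exp p < 0" by linarith
  thus ?thesis
  proof cases
    case 1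
    obtain C1 where C1: "C1 > 0" "\<And>i J B. i \<le> J \<Longrightarrow> B \<le> 2^J \<Longrightarrow> Lp_norm p (qsum (\<lambda>n. real n powr \<alpha>) {2^i..<B})
      \<le> C1 * (\<Sum>j\<in>{i..<J}. 2 powr (real j * (\<alpha> + weyl_exp p)) * (1 + real j) powr weyl_log p)"
      using dyadic_range_norm[OF p, of \<alpha>] by blast
    obtain C2 where C2: "C2 > 0" "\<And>J. (\<Sum>j<J. 2 powr (real j * (\<alpha> + weyl_exp p)) * (1 + real j) powr weyl_log p)
       \<le> C2 * (2 powr (real J * (\<alpha> + weyl_exp p)) * (1 + real J) powr weyl_log p)"
      using dyadic_sum_increasing[OF 1 weyl_log_nonneg[of p]] by blast
    have "Lp_norm p (qsum (\<lambda>n. real n powr \<alpha>) {1..<B}) \<le> C1 * C2 * low_size (\<alpha> + weyl_exp p) (weyl_log p) J" if "B \<le> 2^J" for B J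
    proof -
      have "Lp_norm p (qsum (\<lambda>n. real n powr \<alpha>) {1..<B}) \<le> C1 * (\<Sum>j<J. 2 powr (real j * (\<alpha> + weyl_exp p)) * (1 + real j) powr weyl_log p)"
        using C1(2)[of 0 J B] that by (simp add: lessThan_atLeast0)
      also have "\<dots> \<le> C1 * (C2 * (2 powr (real J * (\<alpha> + weyl_exp p)) * (1 + real J) powr weyl_log p))"
        using C1 by (intro mult_left_mono C2) auto
      finally show ?thesis using 1 by (simp add: low_size_def mult_ac)
    qed
    thus ?thesis using C1 C2 by (intro exI[of _ "C1 * C2"]) auto
  next
    case 2
    thus ?thesis using power_sum_norm_critical[OF p 2] by (simp add: low_size_def)
  next
    case 3
    obtain C where C: "C > 0" "\<And>i B. Lp_norm p (qsum (\<lambda>n. real n powr \<alpha>) {2^i..<B})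
      \<le> C * (2 powr (real i * (\<alpha> + weyl_exp p)) * (1 + real i) powr weyl_log p)" using power_tail_norm[OF p 3] by blast
    have "Lp_norm p (qsum (\<lambda>n. real n powr \<alpha>) {1..<B}) \<le> C" for B using C(2)[of 0 B] by simp
    thus ?thesis using 3 C(1) by (intro exI[of _ C]) (auto simp: low_size_def)
  qed
qed

section \<open>Upper bounds for the increments\<close>

text \<open>Concavity of the sine on [0, pi] makes sin(pi u)/u decrease. Hence sin(pi n^2 l)/n^2 is
  monotone in n as long as n^2 l \<le> 1, and summation by parts applies to it.\<close>

lemma sin_pi_ratio_antimono:
  fixes u v :: real
  assumes "0 < u" "u \<le> v" "v \<le> 1" shows "u * sin (pi * v) \<le> v * sin (pi * u)"
proof -
  have "convex_on {0..1} (\<lambda>w. - sin (pi * w))"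
  proof (rule f''_ge0_imp_convex)
    fix x :: real assume "x \<in> {0..1}"
    thus "0 \<le> pi^2 * sin (pi * x)" by (intro mult_nonneg_nonneg sin_ge_zero) auto
  qed (auto intro!: derivative_eq_intros simp: power2_eq_square)
  from convex_onD[OF this, of "u/v" 0 v] assms have "u / v * sin (pi * v) \<le> sin (pi * u)" by simp
  thus ?thesis using assms by (simp add: field_simps)
qed

definition osc_coeff :: "real \<Rightarrow> real \<Rightarrow> nat \<Rightarrow> real" where
  "osc_coeff \<sigma> l n = real n powr (-(2*\<sigma>)) * sin (pi * ((real n)^2 * l))"

lemma qsum_difference:
  "qsum c A (x + l) - qsum c A x = (2 * \<i>) * qsum (\<lambda>n. c n * sin (pi * ((real n)^2 * l))) A (x + l/2)"
proof -
  have e: "cis (a + b) - cis a = 2 * \<i> * complex_of_real (sin (b/2)) * cis (a + b/2)" for a b :: real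
  proof -
    have "cis (a + b) = cis (a + b/2) * cis (b/2)" by (simp add: cis_mult add.assoc)
    moreover have "cis a = cis (a + b/2) * cis (-(b/2))" by (simp add: cis_mult)
    moreover have "cis (b/2) - cis (-(b/2)) = 2 * \<i> * complex_of_real (sin (b/2))" by (simp add: complex_eq_iff)
    ultimately have "cis (a + b) - cis a = cis (a + b/2) * (2 * \<i> * complex_of_real (sin (b/2)))"
      by (metis right_diff_distrib)
    thus ?thesis by simp
  qed
  have "complex_of_real (c n) * cis (2*pi*(real n)^2*(x+l)) - complex_of_real (c n) * cis (2*pi*(real n)^2*x)
      = (2 * \<i>) * (complex_of_real (c n * sin (pi * ((real n)^2 * l))) * cis (2*pi*(real n)^2*(x + l/2)))" for n
    using e[of "2*pi*(real n)^2*x" "2*pi*(real n)^2*l"] by (simp add: algebra_simps flip: right_diff_distrib)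
  thus ?thesis unfolding qsum_def sum_subtractf[symmetric] sum_distrib_left by (intro sum.cong refl) blast
qed

lemma Lp_norm_difference:
  assumes p: "p > 0"
  shows "Lp_norm p (\<lambda>x. qsum c A (x + l) - qsum c A x) = 2 * Lp_norm p (qsum (\<lambda>n. c n * sin (pi * ((real n)^2 * l))) A)"
proof -
  let ?q = "qsum (\<lambda>n. c n * sin (pi * ((real n)^2 * l))) A"
  have "Lp_norm p (\<lambda>x. qsum c A (x + l) - qsum c A x) = Lp_norm p (\<lambda>x. (2 * \<i>) * ?q (x + l/2))"
    by (simp only: qsum_difference)
  also have "\<dots> = cmod (2 * \<i>) * Lp_norm p (\<lambda>x. ?q (x + l/2))"
    using p by (intro Lp_norm_cmult continuous_on_compose2[OF continuous_qsum[of UNIV]] continuous_intros) auto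
  also have "Lp_norm p (\<lambda>x. ?q (x + l/2)) = Lp_norm p ?q"
    using p by (intro Lp_norm_shift continuous_qsum qsum_periodic)
  finally show ?thesis by (simp add: norm_mult)
qed

text \<open>For large n the factor sin(pi n^2 l) oscillates, and summation by parts fails. Instead
  the sum is read as half a difference of two translates, each with the norm of the sum without that
  factor.\<close>

lemma Lp_norm_osc_le:
  assumes p: "p \<ge> 1"
  shows "Lp_norm p (qsum (\<lambda>n. c n * sin (pi * ((real n)^2 * l))) A) \<le> Lp_norm p (qsum c A)"
proof -
  have "2 * Lp_norm p (qsum (\<lambda>n. c n * sin (pi * ((real n)^2 * l))) A) = Lp_norm p (\<lambda>x. qsum c A (x + l) - qsum c A x)"
    using p by (simp add: Lp_norm_difference)
  also have "\<dots> \<le> Lp_norm p (\<lambda>x. qsum c A (x + l)) + Lp_norm p (qsum c A)"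
    using p by (intro Lp_norm_diff continuous_on_compose2[OF continuous_qsum[of UNIV]] continuous_intros) auto
  also have "Lp_norm p (\<lambda>x. qsum c A (x + l)) = Lp_norm p (qsum c A)"
    using p by (intro Lp_norm_shift continuous_qsum qsum_periodic) auto
  finally show ?thesis by simp
qed

text \<open>The coefficients are n^(2-2\<sigma>) times the decreasing factor sin(pi n^2 l)/n^2,
  whose first value is at most pi l.\<close>

lemma osc_low_norm:
  assumes p: "p \<ge> 1" and l: "l > 0" and B: "1 < B" "(real B - 1)^2 * l \<le> 1"
    and T: "\<And>K. K \<le> B \<Longrightarrow> Lp_norm p (qsum (\<lambda>n. real n powr (2 - 2*\<sigma>)) {1..<K}) \<le> T"
  shows "Lp_norm p (qsum (osc_coeff \<sigma> l) {1..<B}) \<le> pi * l * T"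
proof -
  define c where "c n = sin (pi * ((real n)^2 * l)) / (real n)^2" for n
  have le1: "(real n)^2 * l \<le> 1" if "n < B" for n
  proof -
    have "(real n)^2 * l \<le> (real B - 1)^2 * l" using that l by (intro mult_right_mono power_mono) auto
    thus ?thesis using B by linarith
  qed
  have eq: "qsum (osc_coeff \<sigma> l) {1..<B} = qsum (\<lambda>n. c n * real n powr (2 - 2*\<sigma>)) {1..<B}"
    by (intro qsum_cong) (auto simp: osc_coeff_def c_def powr_diff powr_minus_divide)
  have "Lp_norm p (qsum (\<lambda>n. c n * real n powr (2 - 2*\<sigma>)) {1..<B}) \<le> c 1 * T"
  proof (rule Lp_norm_abel_antimono[OF p B(1)])
    fix n assume n: "1 \<le> n" "Suc n < B"
    have "(real n)^2 * l * sin (pi * ((real (Suc n))^2 * l)) \<le> (real (Suc n))^2 * l * sin (pi * ((real n)^2 * l))"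
      using n l le1[of "Suc n"] by (intro sin_pi_ratio_antimono mult_right_mono power_mono) auto
    hence "(real n)^2 * sin (pi * ((real (Suc n))^2 * l)) \<le> (real (Suc n))^2 * sin (pi * ((real n)^2 * l))"
      using l by (simp add: mult.assoc mult.left_commute[of _ l])
    thus "c (Suc n) \<le> c n" unfolding c_def using n by (simp add: divide_simps mult.commute del: of_nat_Suc)
  next
    show "c (B - 1) \<ge> 0" unfolding c_def using B l le1[of "B-1"]
      by (intro divide_nonneg_nonneg sin_ge_zero) auto
  qed (use T in auto)
  also have "\<dots> \<le> pi * l * T"
  proof (intro mult_right_mono)
    show "c 1 \<le> pi * l" unfolding c_def using sin_x_le_x[of "pi * l"] l by simp
    show "0 \<le> T" using T[of B] Lp_norm_nonneg[of p "qsum (\<lambda>n. real n powr (2 - 2*\<sigma>)) {1..<B}"] by linarith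
  qed
  finally show ?thesis unfolding eq .
qed

text \<open>The three cases follow the growth exponent d = 2 - 2\<sigma> + \<open>weyl_exp p\<close>
  of the dyadic blocks of n^(2-2\<sigma>): the block at l^(-1/2) dominates, or no block does, or the
  block at n = 1 dominates.\<close>

definition upper_size :: "real \<Rightarrow> real \<Rightarrow> real \<Rightarrow> real" where
  "upper_size \<sigma> p l = (if 2 - 2*\<sigma> + weyl_exp p > 0 then l powr (\<sigma> - weyl_exp p / 2) * ln (1/l) powr weyl_log p
     else if 2 - 2*\<sigma> + weyl_exp p = 0 then l * ln (1/l) powr (weyl_log p + 1/2) else l)"

lemma ln_inverse_ge_1:
  fixes l :: real
  assumes "0 < l" "l \<le> 1/4" shows "1 \<le> ln (1/l)"
proof -
  have "1/2 \<le> ln (2::real)" using ln_ge_iff[of 2 "1/2"] ln_le_minus_one[of "1/2::real"] by (simp add: ln_div)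
  moreover have "ln (4::real) = 2 * ln 2" using ln_realpow[of 2 2] by simp
  ultimately have "1 \<le> ln (4::real)" by simp
  also have "ln 4 \<le> ln (1/l)" using assms by (subst ln_le_cancel_iff) (auto simp: field_simps)
  finally show ?thesis .
qed

lemma dyadic_scale:
  fixes l :: real
  assumes l: "0 < l" "l \<le> 1/4"
  obtains i :: nat where "i \<ge> 1" "2 powr real i \<le> l powr (-(1/2))" "l powr (-(1/2)) \<le> 2 powr (real i + 1)"
    "1 + real i \<le> 2 * ln (1/l)"
proof -
  define t where "t = log 2 (1/l) / 2"
  have l2: "1/2 \<le> ln (2::real)" using ln_le_minus_one[of "1/2::real"] by (simp add: ln_div)
  have pt: "2 powr t = l powr (-(1/2))"
  proof -
    have "2 powr t = (2 powr (log 2 (1/l))) powr (1/2)" by (simp add: powr_powr t_def)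
    also have "2 powr (log 2 (1/l)) = 1/l" using l by (subst powr_log_cancel) auto
    also have "(1/l) powr (1/2) = l powr (-(1/2))" using l by (simp add: powr_divide powr_minus_divide)
    finally show ?thesis .
  qed
  have t1: "t \<ge> 1"
  proof -
    have "log 2 (2 powr 2) \<le> log 2 (1/l)" using l by (subst log_le_cancel_iff) (auto simp: field_simps)
    moreover have "log 2 (2 powr 2) = (2::real)" by (rule log_powr_cancel) auto
    ultimately show ?thesis unfolding t_def by linarith
  qed
  have tl: "t \<le> ln (1/l)"
  proof -
    have L: "ln (1/l) \<ge> 0" using ln_inverse_ge_1[OF l] by simp
    have "t = ln (1/l) / (2 * ln 2)" by (simp add: t_def log_def)
    also have "\<dots> \<le> ln (1/l) / 1" using l2 L by (intro divide_left_mono) auto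
    finally show ?thesis by simp
  qed
  define i where "i = nat \<lfloor>t\<rfloor>"
  have i: "real i \<le> t" "t < real i + 1" "i \<ge> 1"
    using t1 by (auto simp: i_def le_nat_iff)
  show ?thesis
  proof (rule that[of i])
    show "2 powr real i \<le> l powr (-(1/2))" unfolding pt[symmetric] using i by simp
    show "l powr (-(1/2)) \<le> 2 powr (real i + 1)" unfolding pt[symmetric] using i by simp
    show "1 + real i \<le> 2 * ln (1/l)" using i tl ln_inverse_ge_1[OF l] by linarith
  qed (use i in auto)
qed

text \<open>The sum is cut at 2^i next to l^(-1/2). Below, \<open>osc_low_norm\<close> reduces it to
  power sums; above, the sine is dropped and the tail decays by \<open>s\<close>. For d > 0 both
  parts have the same order; for d \<le> 0 the lower part sets the size. The hypothesis
  \<open>d4\<close> makes the logarithm of the tail trivial when d < 0, so that the tail is at most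
  a multiple of l.\<close>

lemma osc_upper:
  assumes p: "p > 2" and s: "weyl_exp p < 2 * \<sigma>" and d4: "2 - 2*\<sigma> + weyl_exp p < 0 \<Longrightarrow> p \<noteq> 4"
  shows "\<exists>C>0. \<forall>l N. 0 < l \<longrightarrow> l \<le> 1/4 \<longrightarrow> 1/l \<le> real N \<longrightarrow>
     Lp_norm p (qsum (osc_coeff \<sigma> l) {1..N}) \<le> C * upper_size \<sigma> p l"
proof -
  let ?g = "weyl_exp p" and ?k = "weyl_log p"
  define d where "d = 2 - 2*\<sigma> + ?g"
  obtain C1 where C1: "C1 > 0" "\<And>J B. B \<le> 2^J \<Longrightarrow> Lp_norm p (qsum (\<lambda>n. real n powr (2 - 2*\<sigma>)) {1..<B}) \<le> C1 * low_size d ?k J"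
    using power_sum_norm[OF p, of "2 - 2*\<sigma>"] unfolding d_def by blast
  have neg: "-(2*\<sigma>) + ?g < 0" using s by simp
  obtain C2 where C2: "C2 > 0" "\<And>i B. Lp_norm p (qsum (\<lambda>n. real n powr (-(2*\<sigma>))) {2^i..<B})
      \<le> C2 * (2 powr (real i * (-(2*\<sigma>) + ?g)) * (1 + real i) powr ?k)" using power_tail_norm[OF p neg] by blast
  define M where "M = 2 powr (2*\<sigma> - ?g)"
  have M: "M > 0" by (simp add: M_def)
  have k0: "?k \<ge> 0" by (rule weyl_log_nonneg)
  define C where "C = 4 * pi * C1 + 4 * C2 * M"
  have Cpos: "C > 0" using C1 C2 M by (auto simp: C_def intro!: add_pos_pos)
  have "Lp_norm p (qsum (osc_coeff \<sigma> l) {1..N}) \<le> C * upper_size \<sigma> p l"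
    if l: "0 < l" "l \<le> 1/4" and N: "1/l \<le> real N" for l N
  proof -
    obtain i where i: "i \<ge> 1" "2 powr real i \<le> l powr (-(1/2))" "l powr (-(1/2)) \<le> 2 powr (real i + 1)" "1 + real i \<le> 2 * ln (1/l)"
      using dyadic_scale[OF l] by blast
    define \<Lambda> where "\<Lambda> = ln (1/l)"
    have \<Lambda>: "\<Lambda> \<ge> 1" unfolding \<Lambda>_def by (rule ln_inverse_ge_1[OF l])
    have pw: "real (2^i) = 2 powr real i" by (simp add: powr_realpow)
    have i2: "real (2^i) \<le> l powr (-(1/2))" using i pw by simp
    have sq: "(l powr (-(1/2)))^2 = 1/l" 
    proof -
      have "(l powr (-(1/2)))^2 = l powr (-(1/2)) * l powr (-(1/2))" by (rule power2_eq_square)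
      also have "\<dots> = l powr (-1)" by (simp only: powr_add[symmetric]) simp
      finally show ?thesis using l by (simp add: powr_minus_divide)
    qed
    have B1: "1 < (2::nat)^i" by (rule one_less_power) (use i(1) in auto)
    have Bl: "(real (2^i) - 1)^2 * l \<le> 1"
    proof -
      have "(real (2^i) - 1)^2 \<le> (l powr (-(1/2)))^2" using i2 B1 by (intro power_mono) (auto simp: less_imp_le)
      hence "(real (2^i) - 1)^2 * l \<le> 1/l * l" unfolding sq using l by (intro mult_right_mono) auto
      thus ?thesis using l by simp
    qed
    have iN: "2^i \<le> N + 1"
    proof -
      have "l powr (-(1/2)) \<le> l powr (-1)" using l by (intro powr_mono') auto
      also have "\<dots> = 1/l" using l by (simp add: powr_minus_divide)
      finally have "real (2^i) \<le> real N" using i2 N by linarith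
      thus ?thesis unfolding of_nat_le_iff by simp
    qed
    have lowT: "Lp_norm p (qsum (osc_coeff \<sigma> l) {1..<2^i}) \<le> pi * l * (C1 * low_size d ?k i)"
      using p l B1 Bl C1 by (intro osc_low_norm) auto
    have highT: "Lp_norm p (qsum (osc_coeff \<sigma> l) {2^i..<N+1}) \<le> C2 * (2 powr (real i * (-(2*\<sigma>) + ?g)) * (1 + real i) powr ?k)"
    proof -
      have "Lp_norm p (qsum (osc_coeff \<sigma> l) {2^i..<N+1}) \<le> Lp_norm p (qsum (\<lambda>n. real n powr (-(2*\<sigma>))) {2^i..<N+1})"
        unfolding osc_coeff_def[abs_def] using p by (intro Lp_norm_osc_le) auto
      also note C2(2)
      finally show ?thesis .
    qed
    have "qsum (osc_coeff \<sigma> l) {1..N} = (\<lambda>x. qsum (osc_coeff \<sigma> l) {1..<2^i} x + qsum (osc_coeff \<sigma> l) {2^i..<N+1} x)"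
    proof
      fix x
      have "{1..N} = {1..<2^i} \<union> {2^i..<N+1}" using iN B1 by auto
      thus "qsum (osc_coeff \<sigma> l) {1..N} x = qsum (osc_coeff \<sigma> l) {1..<2^i} x + qsum (osc_coeff \<sigma> l) {2^i..<N+1} x"
        using qsum_Un[of "{1..<2^i}" "{2^i..<N+1}"] by auto
    qed
    hence "Lp_norm p (qsum (osc_coeff \<sigma> l) {1..N}) \<le> Lp_norm p (qsum (osc_coeff \<sigma> l) {1..<2^i}) + Lp_norm p (qsum (osc_coeff \<sigma> l) {2^i..<N+1})"
      using p by (simp only:) (intro Lp_norm_triangle continuous_intros; simp)
    also have "\<dots> \<le> pi * l * (C1 * low_size d ?k i) + C2 * (2 powr (real i * (-(2*\<sigma>) + ?g)) * (1 + real i) powr ?k)"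
      using lowT highT by (rule add_mono)
    finally have tot: "Lp_norm p (qsum (osc_coeff \<sigma> l) {1..N})
       \<le> pi * l * (C1 * low_size d ?k i) + C2 * (2 powr (real i * (-(2*\<sigma>) + ?g)) * (1 + real i) powr ?k)" .
    \<comment> \<open>1 + i \<le> 2 ln(1/l), and the exponents used stay below 2, so one factor 2^2
      = 4 serves for all of them.\<close>
    have ik: "(1 + real i) powr e \<le> 4 * \<Lambda> powr e" if "0 \<le> e" "e \<le> 2" for e
    proof -
      have "(1 + real i) powr e \<le> (2 * \<Lambda>) powr e" using i that by (intro powr_mono2) (auto simp: \<Lambda>_def)
      also have "\<dots> = 2 powr e * \<Lambda> powr e" using \<Lambda> by (simp add: powr_mult)
      also have "\<dots> \<le> 2 powr 2 * \<Lambda> powr e" using that by (intro mult_right_mono powr_mono) auto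
      finally show ?thesis by simp
    qed
    have hi: "2 powr (real i * (-(2*\<sigma>) + ?g)) \<le> M * l powr (\<sigma> - ?g/2)"
    proof -
      have "2 powr (real i * (-(2*\<sigma>) + ?g)) = M * (2 powr (real i + 1)) powr (-(2*\<sigma>) + ?g)"
        by (simp add: M_def powr_powr powr_add[symmetric] algebra_simps)
      also have "\<dots> \<le> M * (l powr (-(1/2))) powr (-(2*\<sigma>) + ?g)"
        using M neg i(3) l by (intro mult_left_mono powr_mono2') auto
      also have "(l powr (-(1/2))) powr (-(2*\<sigma>) + ?g) = l powr (\<sigma> - ?g/2)"
        by (simp add: powr_powr algebra_simps)
      finally show ?thesis .
    qed
    have k1: "?k \<le> 1" by (rule weyl_log_le)
    have high2: "C2 * (2 powr (real i * (-(2*\<sigma>) + ?g)) * (1 + real i) powr ?k) \<le> C2 * (M * l powr (\<sigma> - ?g/2) * (4 * \<Lambda> powr ?k))"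
      using C2 M hi ik[of ?k] k0 k1 by (intro mult_left_mono mult_mono) auto
    consider "d > 0" | "d = 0" | "d < 0" by linarith
    thus ?thesis
    proof cases
      case 1
      have "l * low_size d ?k i \<le> l * (l powr (-(d/2)) * (4 * \<Lambda> powr ?k))"
      proof -
        have "2 powr (real i * d) = (2 powr real i) powr d" by (simp add: powr_powr)
        also have "\<dots> \<le> (l powr (-(1/2))) powr d" using i 1 by (intro powr_mono2) auto
        also have "\<dots> = l powr (-(d/2))" by (simp add: powr_powr)
        finally show ?thesis using 1 l ik[of ?k] k0 k1 by (auto simp: low_size_def intro!: mult_left_mono mult_mono)
      qed
      also have "\<dots> = (l powr 1 * l powr (-(d/2))) * (4 * \<Lambda> powr ?k)" using l by simp
      also have "l powr 1 * l powr (-(d/2)) = l powr (\<sigma> - ?g/2)"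
        unfolding powr_add[symmetric] d_def by (simp add: diff_divide_distrib add_divide_distrib)
      finally have "pi * C1 * (l * low_size d ?k i) \<le> pi * C1 * (l powr (\<sigma> - ?g/2) * (4 * \<Lambda> powr ?k))"
        using C1 by (intro mult_left_mono) auto
      hence "Lp_norm p (qsum (osc_coeff \<sigma> l) {1..N}) \<le> pi * C1 * (l powr (\<sigma> - ?g/2) * (4 * \<Lambda> powr ?k)) + C2 * (M * l powr (\<sigma> - ?g/2) * (4 * \<Lambda> powr ?k))"
        using tot high2 by (simp add: mult_ac)
      also have "\<dots> = C * (l powr (\<sigma> - ?g/2) * \<Lambda> powr ?k)" by (simp add: C_def algebra_simps)
      finally show ?thesis using 1 by (simp add: upper_size_def d_def \<Lambda>_def)
    next
      case 2
      have e1: "\<sigma> - ?g/2 = 1" using 2 unfolding d_def by (simp add: field_simps)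
      have "pi * l * (C1 * low_size d ?k i) \<le> pi * l * (C1 * (4 * \<Lambda> powr (?k + 1/2)))"
        using 2 l C1 ik[of "?k + 1/2"] k0 k1 by (intro mult_left_mono) (auto simp: low_size_def)
      moreover have "C2 * (M * l powr (\<sigma> - ?g/2) * (4 * \<Lambda> powr ?k)) \<le> C2 * (M * l * (4 * \<Lambda> powr (?k + 1/2)))"
        unfolding e1 using C2 M l \<Lambda> by (intro mult_left_mono mult_mono powr_mono) auto
      ultimately have "Lp_norm p (qsum (osc_coeff \<sigma> l) {1..N}) \<le> pi * l * (C1 * (4 * \<Lambda> powr (?k + 1/2))) + C2 * (M * l * (4 * \<Lambda> powr (?k + 1/2)))"
        using tot high2 by linarith
      also have "\<dots> = C * (l * \<Lambda> powr (?k + 1/2))" by (simp add: C_def algebra_simps)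
      finally show ?thesis using 2 by (simp add: upper_size_def d_def \<Lambda>_def)
    next
      case 3
      have k: "?k = 0" using d4 3 by (simp add: weyl_log_def d_def)
      have ls: "low_size d ?k i = 1" using 3 by (simp add: low_size_def)
      have "l powr (\<sigma> - ?g/2) \<le> l powr 1" using 3 l unfolding d_def by (intro powr_mono') (auto simp: field_simps)
      hence "C2 * (M * l powr (\<sigma> - ?g/2) * (4 * \<Lambda> powr ?k)) \<le> C2 * (M * l * (4 * 1))"
        using C2 M l \<Lambda> by (intro mult_left_mono mult_mono) (auto simp: k)
      hence "Lp_norm p (qsum (osc_coeff \<sigma> l) {1..N}) \<le> pi * l * C1 + C2 * (M * l * 4)"
        using tot high2 unfolding ls by linarith
      also have "\<dots> \<le> C * l" using C1 l by (simp add: C_def algebra_simps)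
      finally show ?thesis using 3 by (simp add: upper_size_def d_def)
    qed
  qed
  thus ?thesis using Cpos by blast
qed

section \<open>Lower bounds for the increments\<close>

lemma integral_cmod_sq_qsum:
  assumes "finite A"
  shows "integral {0..1} (\<lambda>x. (cmod (qsum c A x))^2) = (\<Sum>n\<in>A. (c n)^2)"
proof -
  define \<nu> where "\<nu> n = int (n^2)" for n :: nat
  have inj: "inj_on \<nu> A" by (auto simp: inj_on_def \<nu>_def simp flip: of_nat_power)
  have "integral {0..1} (\<lambda>x. (cmod (qsum c A x))^2) = (\<Sum>m\<in>\<nu>`A. (\<Sum>v\<in>{v\<in>A. \<nu> v = m}. c v)^2)"
    using trig_parseval[OF assms, of c \<nu>] by (simp add: qsum_def \<nu>_def)
  also have "\<dots> = (\<Sum>n\<in>A. (\<Sum>v\<in>{v\<in>A. \<nu> v = \<nu> n}. c v)^2)"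
    by (simp add: sum.reindex[OF inj])
  also have "\<dots> = (\<Sum>n\<in>A. (c n)^2)"
  proof (intro sum.cong refl)
    fix n assume "n \<in> A"
    hence "{v\<in>A. \<nu> v = \<nu> n} = {n}" using inj by (auto simp: inj_on_def)
    thus "(\<Sum>v\<in>{v\<in>A. \<nu> v = \<nu> n}. c v)^2 = (c n)^2" by simp
  qed
  finally show ?thesis .
qed

text \<open>Truncation at t = A/2 in place of Jensen: |f|^2 \<le> t^2 + t^(2-p) |f|^p, and the first
  term can hold only a quarter of A^2.\<close>

lemma Lp_norm_ge_L2:
  assumes p: "p \<ge> 2" and c: "continuous_on UNIV f" and A: "A > 0" "A^2 \<le> integral {0..1} (\<lambda>x. (cmod (f x))^2)"
  shows "A / 2 \<le> Lp_norm p f"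
proof (rule Lp_norm_geI)
  define t where "t = A / 2"
  have t: "t > 0" using A by (simp add: t_def)
  have i1: "(\<lambda>x. cmod (f x) powr p) integrable_on {0..1}" using p c by (intro integrable_cmod_powr) auto
  have i2: "(\<lambda>x. (cmod (f x))^2) integrable_on {0..1}"
    by (intro integrable_continuous_interval continuous_intros continuous_on_subset[OF c]) auto
  have pt: "(cmod (f x))^2 \<le> t^2 + t powr (2-p) * cmod (f x) powr p" for x
  proof (cases "cmod (f x) \<le> t")
    case True
    hence "(cmod (f x))^2 \<le> t^2" by (intro power_mono) auto
    thus ?thesis by (simp add: add_increasing2)
  next
    case False
    have "(cmod (f x))^2 = cmod (f x) powr (2-p) * cmod (f x) powr p"
      using False t by (simp add: powr_add[symmetric] flip: powr_numeral)
    also have "\<dots> \<le> t powr (2-p) * cmod (f x) powr p" using False t p by (intro mult_right_mono powr_mono2') auto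
    finally show ?thesis by (simp add: add_increasing)
  qed
  have "A^2 \<le> integral {0..1} (\<lambda>x. t^2 + t powr (2-p) * cmod (f x) powr p)"
    using pt i1 i2 by (intro order.trans[OF A(2)] integral_le integrable_add integrable_on_mult_right) auto
  also have "\<dots> = t^2 + t powr (2-p) * integral {0..1} (\<lambda>x. cmod (f x) powr p)"
    using i1 by (subst integral_add) (auto intro: integrable_on_mult_right)
  finally have "3 * t^2 \<le> t powr (2-p) * integral {0..1} (\<lambda>x. cmod (f x) powr p)" by (simp add: t_def power2_eq_square)
  hence "t^2 \<le> t powr (2-p) * integral {0..1} (\<lambda>x. cmod (f x) powr p)"
    using zero_le_power2[of t] by linarith
  hence h: "t powr (p-2) * t^2 \<le> t powr (p-2) * (t powr (2-p) * integral {0..1} (\<lambda>x. cmod (f x) powr p))"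
    by (intro mult_left_mono) auto
  have e: "t powr (p-2) * t^2 = t powr p" using t by (simp add: powr_diff)
  have cancel: "t powr (p-2) * (t powr (2-p) * z) = z" for z using t by (simp add: mult.assoc[symmetric] powr_add[symmetric])
  show "(A/2) powr p \<le> integral {0..1} (\<lambda>x. cmod (f x) powr p)" using h unfolding e cancel unfolding t_def .
qed (use p A in auto)

text \<open>Interpolation of the 2-norm between p < 2 and 3, by |f|^2 \<le> t^(2-p) |f|^p + |f|^3/t.
  With t = 2 K^3 A the cubic term is at most A^2/2, so the other half must come from the
  p-norm.\<close>

lemma Lp_norm_ge_L2_interpolation:
  assumes p: "0 < p" "p < 2" and K: "K > 0"
  shows "\<exists>c>0. \<forall>f A. continuous_on UNIV f \<longrightarrow> A > 0 \<longrightarrow> A^2 \<le> integral {0..1} (\<lambda>x. (cmod (f x))^2)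
     \<longrightarrow> Lp_norm 3 f \<le> K * A \<longrightarrow> c * A \<le> Lp_norm p f"
proof -
  define c where "c = (1/2 * (2 * K^3) powr (p-2)) powr (1/p)"
  have c: "c > 0" using K by (simp add: c_def)
  have "c * A \<le> Lp_norm p f" if f: "continuous_on UNIV f" and A: "A > 0" "A^2 \<le> integral {0..1} (\<lambda>x. (cmod (f x))^2)"
    and L3: "Lp_norm 3 f \<le> K * A" for f A
  proof (rule Lp_norm_geI)
    define t where "t = 2 * K^3 * A"
    have t: "t > 0" using A K by (simp add: t_def)
    have i1: "(\<lambda>x. cmod (f x) powr p) integrable_on {0..1}" using p f by (intro integrable_cmod_powr) auto
    have i2: "(\<lambda>x. (cmod (f x))^2) integrable_on {0..1}"
      by (intro integrable_continuous_interval continuous_intros continuous_on_subset[OF f]) auto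
    have i3: "(\<lambda>x. cmod (f x) powr 3) integrable_on {0..1}" using f by (intro integrable_cmod_powr) auto
    have pt: "(cmod (f x))^2 \<le> t powr (2-p) * cmod (f x) powr p + 1/t * cmod (f x) powr 3" for x
    proof (cases "f x = 0")
      case True thus ?thesis by simp
    next
      case False
      hence pos: "cmod (f x) > 0" by simp
      show ?thesis
      proof (cases "cmod (f x) \<le> t")
        case True
        have "(cmod (f x))^2 = cmod (f x) powr (2-p) * cmod (f x) powr p"
          using pos by (simp add: powr_add[symmetric] flip: powr_numeral)
        also have "\<dots> \<le> t powr (2-p) * cmod (f x) powr p" using True pos p by (intro mult_right_mono powr_mono2) auto
        finally show ?thesis using t by (simp add: add_increasing2)
      next
        case False
        have "t * (cmod (f x))^2 \<le> cmod (f x) * (cmod (f x))^2" using False by (intro mult_right_mono) auto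
        also have "\<dots> = cmod (f x) powr 3" using pos by (simp add: power2_eq_square power3_eq_cube)
        finally have "(cmod (f x))^2 \<le> 1/t * cmod (f x) powr 3" using t by (simp add: field_simps)
        thus ?thesis by (simp add: add_increasing)
      qed
    qed
    have "A^2 \<le> integral {0..1} (\<lambda>x. t powr (2-p) * cmod (f x) powr p + 1/t * cmod (f x) powr 3)"
      using pt i1 i2 i3 by (intro order.trans[OF A(2)] integral_le integrable_add integrable_on_mult_right) auto
    also have "\<dots> = t powr (2-p) * integral {0..1} (\<lambda>x. cmod (f x) powr p) + 1/t * integral {0..1} (\<lambda>x. cmod (f x) powr 3)"
      by (simp only: integral_add[OF integrable_on_mult_right[OF i1] integrable_on_mult_right[OF i3]] integral_mult_right)
    also have "integral {0..1} (\<lambda>x. cmod (f x) powr 3) \<le> (K * A) powr 3" using L3 by (intro Lp_norm_leD) auto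
    also have "(K * A) powr 3 = t * (A^2 / 2)" using K A by (simp add: t_def power3_eq_cube power2_eq_square)
    finally have "A^2 \<le> t powr (2-p) * integral {0..1} (\<lambda>x. cmod (f x) powr p) + A^2 / 2"
      using t by (simp add: mult_left_mono divide_right_mono)
    hence "A^2 / 2 \<le> t powr (2-p) * integral {0..1} (\<lambda>x. cmod (f x) powr p)" by simp
    hence h: "t powr (p-2) * (A^2/2) \<le> t powr (p-2) * (t powr (2-p) * integral {0..1} (\<lambda>x. cmod (f x) powr p))"
      by (intro mult_left_mono) auto
    have cancel: "t powr (p-2) * (t powr (2-p) * z) = z" for z using t by (simp add: mult.assoc[symmetric] powr_add[symmetric])
    have e: "(c * A) powr p = t powr (p-2) * (A^2/2)"
    proof -
      have "(c * A) powr p = c powr p * A powr p" using A c by (simp add: powr_mult)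
      also have "c powr p = 1/2 * (2 * K^3) powr (p-2)" unfolding c_def using p K by (simp add: powr_powr)
      also have "A powr p = A powr (p-2) * A^2" using A by (simp add: powr_diff)
      finally show ?thesis using K A by (simp add: t_def powr_mult)
    qed
    show "(c * A) powr p \<le> integral {0..1} (\<lambda>x. cmod (f x) powr p)" using h unfolding e cancel .
  qed (use p A c in auto)
  thus ?thesis using c by blast
qed

text \<open>Truncation at height A again, an argument that works below exponent 1 as well as above;
  it costs the factor 2^(1/p).\<close>

lemma Lp_norm_mono_exponent:
  assumes p: "0 < p" "p \<le> q" and c: "continuous_on UNIV f" and A: "A > 0" "Lp_norm q f \<le> A"
  shows "Lp_norm p f \<le> 2 powr (1/p) * A"
proof (rule Lp_norm_leI)
  have i1: "(\<lambda>x. cmod (f x) powr p) integrable_on {0..1}" using p c by (intro integrable_cmod_powr) auto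
  have i2: "(\<lambda>x. cmod (f x) powr q) integrable_on {0..1}" using p c by (intro integrable_cmod_powr) auto
  have pt: "cmod (f x) powr p \<le> A powr p + A powr (p-q) * cmod (f x) powr q" for x
  proof (cases "cmod (f x) \<le> A")
    case True
    hence "cmod (f x) powr p \<le> A powr p" using p by (intro powr_mono2) auto
    thus ?thesis by (simp add: add_increasing2)
  next
    case False
    have "cmod (f x) powr p = cmod (f x) powr (p-q) * cmod (f x) powr q" by (simp add: powr_add[symmetric])
    also have "\<dots> \<le> A powr (p-q) * cmod (f x) powr q" using False A p by (intro mult_right_mono powr_mono2') auto
    finally show ?thesis by (simp add: add_increasing)
  qed
  have "integral {0..1} (\<lambda>x. cmod (f x) powr p) \<le> integral {0..1} (\<lambda>x. A powr p + A powr (p-q) * cmod (f x) powr q)"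
    using pt i1 i2 by (intro integral_le integrable_add integrable_on_mult_right) auto
  also have "\<dots> = A powr p + A powr (p-q) * integral {0..1} (\<lambda>x. cmod (f x) powr q)"
    using i2 by (subst integral_add) (auto intro: integrable_on_mult_right)
  also have "\<dots> \<le> A powr p + A powr (p-q) * A powr q"
    using Lp_norm_leD[of q f A] A p by (intro add_left_mono mult_left_mono) auto
  also have "\<dots> = 2 * A powr p" by (simp add: powr_add[symmetric])
  also have "\<dots> = (2 powr (1/p) * A) powr p" using A p by (simp add: powr_mult powr_powr)
  finally show "integral {0..1} (\<lambda>x. cmod (f x) powr p) \<le> (2 powr (1/p) * A) powr p" .
qed (use p A in auto)

section \<open>Testing against the Fejer kernel\<close>

definition fejer :: "nat \<Rightarrow> real \<Rightarrow> real" where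
  "fejer M x = (\<Sum>i<M. \<Sum>j<M. cos (2*pi * of_int (int i - int j) * x)) / real M"

lemma fejer_eq: "fejer M x = (cmod (\<Sum>j<M. complex_of_real 1 * cis (2*pi*real j*x)))^2 / real M"
  unfolding fejer_def cmod_trig_sum_sq by (simp add: algebra_simps)

lemma fejer_nonneg: "0 \<le> fejer M x" by (simp add: fejer_eq)

lemma fejer_le: "fejer M x \<le> real M"
proof -
  have "cmod (\<Sum>j<M. complex_of_real 1 * cis (2*pi*real j*x)) \<le> (\<Sum>j<M. 1)"
    by (rule order.trans[OF norm_sum]) simp
  hence "(cmod (\<Sum>j<M. complex_of_real 1 * cis (2*pi*real j*x)))^2 \<le> (real M)^2" by (intro power_mono) auto
  thus ?thesis unfolding fejer_eq by (cases "M = 0") (auto simp: field_simps power2_eq_square)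
qed

lemma continuous_fejer: "continuous_on S (fejer M)"
  unfolding fejer_def[abs_def] by (cases "M = 0") (auto intro!: continuous_intros)

lemma count_differences:
  "(\<Sum>i<M. \<Sum>j<M. if int i - int j = int k then 1 else 0 :: real) = real (M - k)"
proof -
  have "(\<Sum>i<M. \<Sum>j<M. if int i - int j = int k then 1 else 0 :: real) = (\<Sum>j<M. \<Sum>i<M. if i = j + k then 1 else 0)"
    by (subst sum.swap) (intro sum.cong refl, auto)
  also have "\<dots> = (\<Sum>j<M. if j + k < M then 1 else 0)" by (simp add: sum.delta)
  also have "\<dots> = (\<Sum>j\<in>{..<M-k}. 1)" by (intro sum.mono_neutral_cong_right) auto
  finally show ?thesis by simp
qed

text \<open>The subtraction of naturals encodes the triangular coefficient max(0, 1 - k/M):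
  frequencies from M on are invisible to the kernel.\<close>

lemma integral_cos_fejer:
  assumes M: "M > 0"
  shows "integral {0..1} (\<lambda>x. cos (2*pi * of_int (int k) * x) * fejer M x) = real (M - k) / real M"
proof -
  have I: "(\<lambda>x. cos (2*pi * of_int n * x)) integrable_on {0..1}" for n :: int
    by (intro integrable_continuous_interval continuous_intros)
  have cc: "cos (2*pi * of_int a * x) * cos (2*pi * of_int b * x) = (cos (2*pi * of_int (a - b) * x) + cos (2*pi * of_int (a + b) * x)) / 2" for a b :: int and x :: real
    by (simp add: cos_times_cos algebra_simps)
  have "integral {0..1} (\<lambda>x. cos (2*pi * of_int (int k) * x) * fejer M x)
     = integral {0..1} (\<lambda>x. (\<Sum>i<M. \<Sum>j<M. (cos (2*pi * of_int (int k - (int i - int j)) * x) + cos (2*pi * of_int (int k + (int i - int j)) * x)) / 2) / real M)"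
    unfolding fejer_def times_divide_eq_right sum_distrib_left cc ..
  also have "\<dots> = (\<Sum>i<M. \<Sum>j<M. (integral {0..1} (\<lambda>x. cos (2*pi * of_int (int k - (int i - int j)) * x)) + integral {0..1} (\<lambda>x. cos (2*pi * of_int (int k + (int i - int j)) * x))) / 2) / real M"
    by (simp only: integral_divide integral_sum[OF finite_lessThan] integrable_sum[OF finite_lessThan] integrable_on_divide integrable_add I integral_add)
  also have "\<dots> = (\<Sum>i<M. \<Sum>j<M. ((if int i - int j = int k then 1 else 0) + (if int j - int i = int k then 1 else 0)) / 2) / real M"
    unfolding integral_cos_int
    by (intro arg_cong[where f = "\<lambda>z. z / real M"] sum.cong refl arg_cong[where f = "\<lambda>z. z / 2"] arg_cong2[where f = "(+)"]) auto
  also have "\<dots> = ((\<Sum>i<M. \<Sum>j<M. if int i - int j = int k then 1 else 0) + (\<Sum>i<M. \<Sum>j<M. if int j - int i = int k then 1 else 0)) / 2 / real M"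
    by (simp only: sum_divide_distrib[symmetric] sum.distrib)
  also have "(\<Sum>i<M. \<Sum>j<M. if int j - int i = int k then 1 else 0 :: real) = real (M - k)"
    by (subst sum.swap) (rule count_differences)
  finally show ?thesis by (simp only: count_differences) simp
qed

text \<open>Pairing the sum E with the kernel gives at least A. Where |E| \<le> t = A/2 the kernel,
  of mass 1, accounts for at most A/2; elsewhere the kernel is at most M and |E| \<le> t^(1-p)
  |E|^p. This stands in for Hoelder with the dual norm of the kernel, of order M^(1/p).\<close>

lemma fejer_lower:
  assumes p: "p > 1" and M: "M > 0" and S: "finite S"
    and A: "A > 0" "A \<le> (\<Sum>n\<in>S. c n * (real (M - n^2) / real M))"
  shows "A / 2 * real M powr (-(1/p)) \<le> Lp_norm p (qsum c S)"
proof (rule Lp_norm_geI)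
  define E where "E = qsum c S"
  define t where "t = A/2"
  have t: "t > 0" using A by (simp add: t_def)
  have cE: "continuous_on T E" for T unfolding E_def by (rule continuous_qsum)
  have i1: "(\<lambda>x. cmod (E x) powr p) integrable_on {0..1}" using p by (intro integrable_cmod_powr cE) auto
  have i2: "fejer M integrable_on {0..1}" by (intro integrable_continuous_interval continuous_fejer)
  have int1: "integral {0..1} (fejer M) = 1" using integral_cos_fejer[OF M, of 0] M by simp
  have ReE: "Re (E x) = (\<Sum>n\<in>S. c n * cos (2*pi * of_int (int (n^2)) * x))" for x
    by (simp add: E_def qsum_def)
  have I: "(\<lambda>x. c n * (cos (2*pi * of_int (int k) * x) * fejer M x)) integrable_on {0..1}" for k n
    by (intro integrable_continuous_interval continuous_intros continuous_fejer)
  have "integral {0..1} (\<lambda>x. Re (E x) * fejer M x) = integral {0..1} (\<lambda>x. \<Sum>n\<in>S. c n * (cos (2*pi * of_int (int (n^2)) * x) * fejer M x))"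
    by (simp only: ReE sum_distrib_right mult.assoc)
  also have "\<dots> = (\<Sum>n\<in>S. c n * (real (M - n^2) / real M))"
    by (simp only: integral_sum[OF S I] integral_mult_right integral_cos_fejer[OF M])
  finally have "A \<le> integral {0..1} (\<lambda>x. Re (E x) * fejer M x)" using A by simp
  also have "\<dots> \<le> integral {0..1} (\<lambda>x. t * fejer M x + t powr (1-p) * real M * cmod (E x) powr p)"
  proof (intro integral_le integrable_add integrable_on_mult_right i1 i2)
    show "(\<lambda>x. Re (E x) * fejer M x) integrable_on {0..1}"
      by (intro integrable_continuous_interval continuous_on_mult continuous_fejer continuous_on_Re cE)
    fix x :: real
    have "cmod (E x) * fejer M x \<le> t * fejer M x + t powr (1-p) * real M * cmod (E x) powr p"
    proof (cases "cmod (E x) \<le> t")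
      case True
      hence "cmod (E x) * fejer M x \<le> t * fejer M x" by (intro mult_right_mono fejer_nonneg)
      thus ?thesis by (simp add: add_increasing2)
    next
      case False
      have "cmod (E x) = cmod (E x) powr (1-p) * cmod (E x) powr p" using False t by (simp add: powr_add[symmetric])
      also have "\<dots> \<le> t powr (1-p) * cmod (E x) powr p" using False t p by (intro mult_right_mono powr_mono2') auto
      finally have "cmod (E x) * fejer M x \<le> (t powr (1-p) * cmod (E x) powr p) * real M"
        by (intro mult_mono fejer_le fejer_nonneg) auto
      moreover have "0 \<le> t * fejer M x" using t fejer_nonneg[of M x] by simp
      ultimately show ?thesis by (simp add: mult_ac)
    qed
    moreover have "Re (E x) * fejer M x \<le> cmod (E x) * fejer M x"
      by (intro mult_right_mono fejer_nonneg complex_Re_le_cmod)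
    ultimately show "Re (E x) * fejer M x \<le> t * fejer M x + t powr (1-p) * real M * cmod (E x) powr p" by linarith
  qed
  also have "\<dots> = t + t powr (1-p) * real M * integral {0..1} (\<lambda>x. cmod (E x) powr p)"
    by (simp only: integral_add[OF integrable_on_mult_right[OF i2] integrable_on_mult_right[OF i1]] integral_mult_right int1 mult_1_right)
  finally have "t \<le> t powr (1-p) * (real M * integral {0..1} (\<lambda>x. cmod (E x) powr p))" by (simp add: t_def mult_ac)
  hence "t powr (p-1) * t \<le> t powr (p-1) * (t powr (1-p) * (real M * integral {0..1} (\<lambda>x. cmod (E x) powr p)))"
    by (intro mult_left_mono) auto
  moreover have "t powr (p-1) * (t powr (1-p) * z) = z" for z using t by (simp add: mult.assoc[symmetric] powr_add[symmetric])
  moreover have "t powr (p-1) * t = t powr p" using t by (simp add: powr_diff)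
  ultimately have "t powr p \<le> real M * integral {0..1} (\<lambda>x. cmod (E x) powr p)" by simp
  hence "t powr p / real M \<le> integral {0..1} (\<lambda>x. cmod (E x) powr p)" using M by (simp add: field_simps)
  moreover have "(A/2 * real M powr (-(1/p))) powr p = t powr p / real M"
  proof -
    have "(A/2 * real M powr (-(1/p))) powr p = t powr p * (real M powr (-(1/p))) powr p"
      unfolding t_def by (rule powr_mult)
    also have "(real M powr (-(1/p))) powr p = 1 / real M"
      unfolding powr_powr using M p by (simp add: powr_minus_divide)
    finally show ?thesis by simp
  qed
  ultimately show "(A/2 * real M powr (-(1/p))) powr p \<le> integral {0..1} (\<lambda>x. cmod (qsum c S x) powr p)" by (simp add: E_def)
qed (use p A in auto)

lemma powr_comparable:
  fixes x y e K :: real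
  assumes "0 < x" "x \<le> y" "y \<le> K * x" "K \<ge> 1"
  shows "K powr (-\<bar>e\<bar>) * y powr e \<le> x powr e"
proof (cases "e \<ge> 0")
  case True
  have "K powr (-\<bar>e\<bar>) * y powr e = (y / K) powr e" using assms True by (simp add: powr_divide powr_minus_divide)
  also have "\<dots> \<le> x powr e" using assms True by (intro powr_mono2) (auto simp: field_simps)
  finally show ?thesis .
next
  case False
  have "K powr (-\<bar>e\<bar>) * y powr e \<le> 1 * y powr e"
    using assms False powr_mono[of e 0 K] by (intro mult_right_mono) auto
  also have "\<dots> \<le> x powr e" using assms False by (simp add: powr_mono2')
  finally show ?thesis .
qed

text \<open>\<open>S\<close> is the upper half of the integers up to l^(-1/2)/4: their number is a
  fixed proportion of l^(-1/2) and each is comparable to l^(-1/2), so e may have either sign. The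
  bound 1/16 leaves room for the weight 1 - n^2/M \<ge> 1/2 in the Fejer test.\<close>

lemma dyadic_power_sum_lower:
  "\<exists>c>0. \<forall>l. 0 < l \<longrightarrow> l \<le> 1/64 \<longrightarrow> (\<exists>S. finite S \<and> (\<forall>n\<in>S. n \<ge> 1 \<and> (real n)^2 * l \<le> 1/16)
      \<and> c * l powr (-((e+1)/2)) \<le> (\<Sum>n\<in>S. real n powr e))"
proof -
  define c where "c = 16 powr (-\<bar>e\<bar>) / 16"
  have c: "c > 0" by (simp add: c_def)
  have "\<exists>S. finite S \<and> (\<forall>n\<in>S. n \<ge> 1 \<and> (real n)^2 * l \<le> 1/16) \<and> c * l powr (-((e+1)/2)) \<le> (\<Sum>n\<in>S. real n powr e)"
    if l: "0 < l" "l \<le> 1/64" for l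
  proof -
    define Y where "Y = l powr (-(1/2))"
    have Y: "Y > 0" "Y^2 * l = 1"
    proof -
      have "Y^2 = l powr (-(1/2)) * l powr (-(1/2))" by (simp add: Y_def power2_eq_square)
      also have "\<dots> = l powr (-1)" by (simp only: powr_add[symmetric]) simp
      finally show "Y^2 * l = 1" using l by (simp add: powr_minus_divide)
    qed (use l in \<open>simp add: Y_def\<close>)
    have Y8: "Y \<ge> 8"
    proof -
      have "64 = 64 * (Y^2 * l)" using Y by simp
      also have "\<dots> \<le> 64 * (Y^2 * (1/64))" using l by (intro mult_left_mono) auto
      finally have "8^2 \<le> Y^2" by simp
      thus ?thesis by (rule power2_le_imp_le) (use Y(1) in simp)
    qed
    define b where "b = nat \<lfloor>Y/4\<rfloor>"
    define S where "S = {b div 2 + 1..b}"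
    have b: "real b \<le> Y/4" "Y/8 \<le> real b"
    proof -
      have "real b = of_int \<lfloor>Y/4\<rfloor>" using Y by (simp add: b_def)
      thus "real b \<le> Y/4" "Y/8 \<le> real b" using Y8 floor_correct[of "Y/4"] by linarith+
    qed
    have nS: "real n \<le> Y/4" "Y/16 \<le> real n" "n \<ge> 1" if "n \<in> S" for n
    proof -
      have "real n \<le> real b" "real b \<le> 2 * real n" using that by (auto simp: S_def)
      thus "real n \<le> Y/4" "Y/16 \<le> real n" using b by linarith+
      show "n \<ge> 1" using that by (auto simp: S_def)
    qed
    have sq: "(real n)^2 * l \<le> 1/16" if "n \<in> S" for n
    proof -
      have "(real n)^2 * l \<le> (Y/4)^2 * l" using nS[OF that] l by (intro mult_right_mono power_mono) auto
      also have "\<dots> = Y^2 * l / 16" by (simp add: power_divide)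
      finally show ?thesis using Y by simp
    qed
    have "c * l powr (-((e+1)/2)) = (Y/16) * (16 powr (-\<bar>e\<bar>) * Y powr e)"
    proof -
      have "l powr (-((e+1)/2)) = Y powr (e+1)" unfolding Y_def by (simp add: powr_powr)
      also have "\<dots> = Y powr e * Y" using Y by (simp add: powr_add)
      finally show ?thesis by (simp add: c_def)
    qed
    also have "\<dots> \<le> real (card S) * (16 powr (-\<bar>e\<bar>) * Y powr e)"
    proof (intro mult_right_mono)
      have "real b \<le> 2 * real (card S)" by (simp add: S_def)
      thus "Y/16 \<le> real (card S)" using b by linarith
    qed auto
    also have "\<dots> = (\<Sum>n\<in>S. 16 powr (-\<bar>e\<bar>) * Y powr e)" by simp
    also have "\<dots> \<le> (\<Sum>n\<in>S. real n powr e)"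
    proof (intro sum_mono powr_comparable)
      fix n assume n: "n \<in> S"
      show "0 < real n" "real n \<le> Y" "Y \<le> 16 * real n" using nS[OF n] Y by auto
    qed simp
    finally show ?thesis using nS sq by (intro exI[of _ S]) (auto simp: S_def)
  qed
  thus ?thesis using c by blast
qed

lemma osc_coeff_ge:
  assumes "l > 0" "n \<ge> 1" "(real n)^2 * l \<le> 1/2"
  shows "2 * l * real n powr (2 - 2*\<sigma>) \<le> osc_coeff \<sigma> l n"
proof -
  have "2 * l * real n powr (2 - 2*\<sigma>) = real n powr (-(2*\<sigma>)) * (2 * ((real n)^2 * l))"
    using assms by (simp add: powr_diff powr_minus_divide)
  also have "\<dots> \<le> osc_coeff \<sigma> l n" unfolding osc_coeff_def using assms by (intro mult_left_mono sin_pi_ge) auto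
  finally show ?thesis .
qed

lemma osc_index_le:
  assumes "l > 0" "1/l \<le> real N" "(real n)^2 * l \<le> 1" shows "n \<le> N"
proof -
  have "real n \<le> (real n)^2" by (cases n) (auto simp: power2_eq_square)
  also have "\<dots> \<le> 1/l" using assms by (simp add: field_simps)
  finally show ?thesis using assms by simp
qed

text \<open>Parseval leaves only nonnegative terms, so any convenient set of low n may be kept,
  whatever the signs of the other coefficients.\<close>

lemma osc_L2_lower_sum:
  assumes l: "l > 0" and N: "1/l \<le> real N" and S: "finite S" "\<And>n. n \<in> S \<Longrightarrow> n \<ge> 1 \<and> (real n)^2 * l \<le> 1/2"
  shows "4 * l^2 * (\<Sum>n\<in>S. real n powr (4 - 4*\<sigma>)) \<le> integral {0..1} (\<lambda>x. (cmod (qsum (osc_coeff \<sigma> l) {1..N} x))^2)"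
proof -
  have "4 * l^2 * (\<Sum>n\<in>S. real n powr (4 - 4*\<sigma>)) = (\<Sum>n\<in>S. (2 * l * real n powr (2 - 2*\<sigma>))^2)"
  proof -
    have "(real n powr (2 - 2*\<sigma>))^2 = real n powr (4 - 4*\<sigma>)" for n
      by (simp add: power2_eq_square powr_add[symmetric])
    thus ?thesis by (simp add: power_mult_distrib sum_distrib_left)
  qed
  also have "\<dots> \<le> (\<Sum>n\<in>S. (osc_coeff \<sigma> l n)^2)"
    using S l by (intro sum_mono power_mono osc_coeff_ge) auto
  also have "\<dots> \<le> (\<Sum>n\<in>{1..N}. (osc_coeff \<sigma> l n)^2)"
  proof (intro sum_mono2)
    show "S \<subseteq> {1..N}" using S(2) osc_index_le[OF l N] by fastforce
  qed auto
  finally show ?thesis by (simp add: integral_cmod_sq_qsum)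
qed

lemma osc_L2_lower:
  "\<exists>c>0. \<forall>l N. 0 < l \<longrightarrow> l \<le> 1/64 \<longrightarrow> 1/l \<le> real N \<longrightarrow>
     (c * l powr (\<sigma> - 1/4))^2 \<le> integral {0..1} (\<lambda>x. (cmod (qsum (osc_coeff \<sigma> l) {1..N} x))^2)"
proof -
  obtain c where c: "c > 0" "\<And>l. 0 < l \<Longrightarrow> l \<le> 1/64 \<Longrightarrow> (\<exists>S. finite S \<and> (\<forall>n\<in>S. n \<ge> 1 \<and> (real n)^2 * l \<le> 1/16)
      \<and> c * l powr (-((4 - 4*\<sigma>+1)/2)) \<le> (\<Sum>n\<in>S. real n powr (4 - 4*\<sigma>)))"
    using dyadic_power_sum_lower[of "4 - 4*\<sigma>"] by blast
  have "(2 * sqrt c * l powr (\<sigma> - 1/4))^2 \<le> integral {0..1} (\<lambda>x. (cmod (qsum (osc_coeff \<sigma> l) {1..N} x))^2)"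
    if l: "0 < l" "l \<le> 1/64" and N: "1/l \<le> real N" for l N
  proof -
    obtain S where S: "finite S" "\<forall>n\<in>S. n \<ge> 1 \<and> (real n)^2 * l \<le> 1/16" "c * l powr (-((4 - 4*\<sigma>+1)/2)) \<le> (\<Sum>n\<in>S. real n powr (4 - 4*\<sigma>))"
      using c(2)[OF l] by blast
    have "(2 * sqrt c * l powr (\<sigma> - 1/4))^2 = 4 * c * (l powr (\<sigma> - 1/4) * l powr (\<sigma> - 1/4))"
      using c(1) by (simp add: power_mult_distrib power2_eq_square)
    also have "l powr (\<sigma> - 1/4) * l powr (\<sigma> - 1/4) = l powr 2 * l powr (-((4 - 4*\<sigma>+1)/2))"
      unfolding powr_add[symmetric] by (rule arg_cong[where f = "(powr) l"]) (simp add: field_simps)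
    also have "4 * c * \<dots> = 4 * l^2 * (c * l powr (-((4 - 4*\<sigma>+1)/2)))" using l by simp
    also have "\<dots> \<le> 4 * l^2 * (\<Sum>n\<in>S. real n powr (4 - 4*\<sigma>))" using S by (intro mult_left_mono) auto
    also have "\<dots> \<le> integral {0..1} (\<lambda>x. (cmod (qsum (osc_coeff \<sigma> l) {1..N} x))^2)"
      using S by (intro osc_L2_lower_sum l N) force+
    finally show ?thesis .
  qed
  thus ?thesis using c(1) by (intro exI[of _ "2 * sqrt c"]) auto
qed

text \<open>At \<sigma> = 5/4 the squares of l n^(2-2\<sigma>) are l^2/n, and the harmonic sum up to
  l^(-1/2)/2 gives the logarithm.\<close>

lemma osc_L2_lower_log:
  assumes l: "0 < l" "l \<le> 1/64" and N: "1/l \<le> real N"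
  shows "(l * ln (1/l) powr (1/2))^2 \<le> integral {0..1} (\<lambda>x. (cmod (qsum (osc_coeff (5/4) l) {1..N} x))^2)"
proof -
  define Y where "Y = l powr (-(1/2))"
  have Y: "Y > 0" "Y^2 * l = 1"
  proof -
    have "Y^2 = l powr (-(1/2)) * l powr (-(1/2))" by (simp add: Y_def power2_eq_square)
    also have "\<dots> = l powr (-1)" by (simp only: powr_add[symmetric]) simp
    finally show "Y^2 * l = 1" using l by (simp add: powr_minus_divide)
  qed (use l in \<open>simp add: Y_def\<close>)
  have lnY: "ln Y = ln (1/l) / 2" using l by (simp add: Y_def ln_powr ln_div)
  define b where "b = nat \<lfloor>Y/2\<rfloor>"
  have b: "real b \<le> Y/2" "Y/2 \<le> real b + 1"
  proof -
    have "real b = of_int \<lfloor>Y/2\<rfloor>" using Y by (simp add: b_def)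
    thus "real b \<le> Y/2" "Y/2 \<le> real b + 1" using floor_correct[of "Y/2"] by linarith+
  qed
  have \<Lambda>: "0 \<le> ln (1/l)" using ln_inverse_ge_1[of l] l by simp
  have "ln (1/l) / 4 \<le> ln (Y/2)"
  proof -
    have "4 * ln 2 = ln ((2::real)^4)" using ln_realpow[of 2 4] by simp
    also have "\<dots> \<le> ln (1/l)" using l by (subst ln_le_cancel_iff) (auto simp: field_simps)
    finally have "ln 2 \<le> ln (1/l) / 4" by simp
    moreover have "ln (Y/2) = ln (1/l) / 2 - ln 2" using Y(1) lnY by (simp add: ln_div)
    ultimately show ?thesis by linarith
  qed
  also have "\<dots> \<le> ln (real b + 1)" using b Y(1) by (subst ln_le_cancel_iff) auto
  also have "\<dots> \<le> harm b" by (rule ln_le_harm)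
  also have "harm b = (\<Sum>n\<in>{1..b}. real n powr (4 - 4*(5/4)))"
    unfolding harm_def by (intro sum.cong refl) (auto simp: powr_minus)
  finally have h: "ln (1/l) / 4 \<le> (\<Sum>n\<in>{1..b}. real n powr (4 - 4*(5/4)))" .
  have "(l * ln (1/l) powr (1/2))^2 = 4 * l^2 * (ln (1/l) / 4)"
    using \<Lambda> by (simp add: power_mult_distrib powr_half_sqrt)
  also have "\<dots> \<le> 4 * l^2 * (\<Sum>n\<in>{1..b}. real n powr (4 - 4*(5/4)))" by (intro mult_left_mono h) auto
  also have "\<dots> \<le> integral {0..1} (\<lambda>x. (cmod (qsum (osc_coeff (5/4) l) {1..N} x))^2)"
  proof (rule osc_L2_lower_sum[OF l(1) N])
    fix n assume n: "n \<in> {1..b}"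
    have "(real n)^2 * l \<le> (Y/2)^2 * l" using n b l by (intro mult_right_mono power_mono) auto
    also have "\<dots> = Y^2 * l / 4" by (simp add: power_divide)
    finally show "1 \<le> n \<and> (real n)^2 * l \<le> 1/2" using n Y(2) by auto
  qed auto
  finally show ?thesis .
qed

lemma osc_L2_lower_trivial:
  assumes l: "0 < l" "l \<le> 1/64" and N: "1/l \<le> real N"
  shows "l^2 \<le> integral {0..1} (\<lambda>x. (cmod (qsum (osc_coeff \<sigma> l) {1..N} x))^2)"
proof -
  have "l^2 \<le> 4 * l^2 * (\<Sum>n\<in>{1::nat}. real n powr (4 - 4*\<sigma>))" by simp
  also have "\<dots> \<le> integral {0..1} (\<lambda>x. (cmod (qsum (osc_coeff \<sigma> l) {1..N} x))^2)"
    using l by (intro osc_L2_lower_sum N) auto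
  finally show ?thesis .
qed

text \<open>The order M is close to 1/(2l): the kernel then sees only n^2 < M \<le> 1/(2l), where
  the sine is positive, so all visible terms are nonnegative and the sum may be restricted to
  \<open>S\<close>. There n^2 \<le> M/4, so the weights are at least 1/2. The remaining factor
  M^(-1/p) is of order l^(1/p).\<close>

lemma osc_fejer_lower:
  assumes p: "p > 1"
  shows "\<exists>c>0. \<forall>l N. 0 < l \<longrightarrow> l \<le> 1/64 \<longrightarrow> 1/l \<le> real N \<longrightarrow>
     c * l powr (\<sigma> + 1/p - 1/2) \<le> Lp_norm p (qsum (osc_coeff \<sigma> l) {1..N})"
proof -
  obtain c where c: "c > 0" "\<And>l. 0 < l \<Longrightarrow> l \<le> 1/64 \<Longrightarrow> (\<exists>S. finite S \<and> (\<forall>n\<in>S. n \<ge> 1 \<and> (real n)^2 * l \<le> 1/16)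
      \<and> c * l powr (-((2 - 2*\<sigma>+1)/2)) \<le> (\<Sum>n\<in>S. real n powr (2 - 2*\<sigma>)))"
    using dyadic_power_sum_lower[of "2 - 2*\<sigma>"] by blast
  have "c/2 * l powr (\<sigma> + 1/p - 1/2) \<le> Lp_norm p (qsum (osc_coeff \<sigma> l) {1..N})"
    if l: "0 < l" "l \<le> 1/64" and N: "1/l \<le> real N" for l N
  proof -
    obtain S where S: "finite S" "\<forall>n\<in>S. n \<ge> 1 \<and> (real n)^2 * l \<le> 1/16" "c * l powr (-((2 - 2*\<sigma>+1)/2)) \<le> (\<Sum>n\<in>S. real n powr (2 - 2*\<sigma>))"
      using c(2)[OF l] by blast
    define M where "M = nat \<lfloor>1/(2*l)\<rfloor>"
    have M: "real M \<le> 1/(2*l)" "1/(4*l) \<le> real M"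
    proof -
      have e: "real M = of_int \<lfloor>1/(2*l)\<rfloor>" using l by (simp add: M_def)
      have "1/(4*l) \<ge> 1" using l by (simp add: field_simps)
      moreover have "1/(2*l) = 1/(4*l) + 1/(4*l)" using l by (simp add: field_simps)
      ultimately show "real M \<le> 1/(2*l)" "1/(4*l) \<le> real M" using e floor_correct[of "1/(2*l)"] by linarith+
    qed
    have "0 < 1/(4*l)" using l by simp
    hence M0: "M > 0" using M(2) by (metis gr0I less_le_trans not_less_iff_gr_or_eq of_nat_0)
    define A where "A = c * l powr (\<sigma> - 1/2)"
    have A: "A > 0" using c l by (simp add: A_def)
    have "A = l * (c * l powr (-((2 - 2*\<sigma>+1)/2)))"
    proof -
      have "l powr (\<sigma> - 1/2) = l powr 1 * l powr (-((2 - 2*\<sigma>+1)/2))" unfolding powr_add[symmetric] by (simp add: field_simps)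
      thus ?thesis using l by (simp add: A_def)
    qed
    also have "\<dots> \<le> l * (\<Sum>n\<in>S. real n powr (2 - 2*\<sigma>))" using S l by (intro mult_left_mono) auto
    also have "\<dots> = (\<Sum>n\<in>S. 2 * l * real n powr (2 - 2*\<sigma>) * (1/2))" by (simp add: sum_distrib_left)
    also have "\<dots> \<le> (\<Sum>n\<in>S. osc_coeff \<sigma> l n * (real (M - n^2) / real M))"
    proof (intro sum_mono mult_mono)
      fix n assume n: "n \<in> S"
      show g: "2 * l * real n powr (2 - 2*\<sigma>) \<le> osc_coeff \<sigma> l n" using S n l by (intro osc_coeff_ge) force+
      have "0 \<le> 2 * l * real n powr (2 - 2*\<sigma>)" using l by simp
      thus "0 \<le> osc_coeff \<sigma> l n" using g by linarith
      have "(real n)^2 * l \<le> 1/16" using S n by blast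
      hence "(real n)^2 \<le> 1/(16*l)" using l by (simp add: field_simps)
      moreover have "1/(16*l) = 1/(4*l) / 4" by simp
      ultimately have q: "2 * (real n)^2 \<le> real M" using M(2) by linarith
      hence "real (n^2) \<le> real M" using zero_le_power2[of "real n"] by (simp only: of_nat_power)
      hence "n^2 \<le> M" by (simp only: of_nat_le_iff)
      hence "real (M - n^2) = real M - (real n)^2" by (simp add: of_nat_diff)
      hence "real M \<le> 2 * real (M - n^2)" using q by linarith
      thus "1/2 \<le> real (M - n^2) / real M" using M0 q by (subst pos_le_divide_eq) auto
    qed auto
    also have "\<dots> \<le> (\<Sum>n\<in>{1..N}. osc_coeff \<sigma> l n * (real (M - n^2) / real M))"
    proof (intro sum_mono2)
      show "S \<subseteq> {1..N}" using S(2) osc_index_le[OF l(1) N] by fastforce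
      fix n assume n: "n \<in> {1..N} - S"
      show "0 \<le> osc_coeff \<sigma> l n * (real (M - n^2) / real M)"
      proof (cases "n^2 < M")
        case True
        hence "real (n^2) \<le> real M" by (simp only: of_nat_le_iff) 
        hence "(real n)^2 \<le> 1/(2*l)" using M(1) unfolding of_nat_power by linarith
        hence "(real n)^2 * l \<le> 1/2" using l by (simp add: field_simps)
        hence "2 * l * real n powr (2 - 2*\<sigma>) \<le> osc_coeff \<sigma> l n" using n l by (intro osc_coeff_ge) auto
        moreover have "0 \<le> 2 * l * real n powr (2 - 2*\<sigma>)" using l by simp
        ultimately have "0 \<le> osc_coeff \<sigma> l n" by linarith
        thus ?thesis by simp
      qed simp
    qed auto
    finally have "A / 2 * real M powr (-(1/p)) \<le> Lp_norm p (qsum (osc_coeff \<sigma> l) {1..N})"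
      by (intro fejer_lower p M0 A) auto
    moreover have "c/2 * l powr (\<sigma> + 1/p - 1/2) \<le> A / 2 * real M powr (-(1/p))"
    proof -
      have "c/2 * l powr (\<sigma> + 1/p - 1/2) = A / 2 * l powr (1/p)"
        unfolding A_def by (simp add: powr_add[symmetric] algebra_simps)
      also have "l powr (1/p) = (1/l) powr (-(1/p))" using l by (simp add: powr_divide powr_minus_divide)
      also have "\<dots> \<le> real M powr (-(1/p))"
      proof (intro powr_mono2')
        show "real M \<le> 1/l" using M(1) l by (auto simp: field_simps intro: order.trans)
      qed (use M0 p in auto)
      finally show ?thesis using A by (simp add: mult_left_mono)
    qed
    ultimately show ?thesis by linarith
  qed
  thus ?thesis using c(1) by (intro exI[of _ "c/2"]) auto
qed

section \<open>Even exponents: Fourier coefficients of powers\<close>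

lemma qsum_power:
  assumes S: "finite S"
  shows "qsum c S x ^ k = (\<Sum>v\<in>PiE {..<k} (\<lambda>_. S). complex_of_real (\<Prod>i<k. c (v i)) * cis (2*pi * of_int (\<Sum>i<k. int ((v i)^2)) * x))"
proof -
  have cp: "(\<Prod>i<k. cis (f i)) = cis (\<Sum>i<k. f i)" for f :: "nat \<Rightarrow> real"
    by (induction k) (auto simp: cis_mult)
  have "qsum c S x ^ k = (\<Prod>i<k. \<Sum>n\<in>S. complex_of_real (c n) * cis (2*pi*(real n)^2*x))"
    by (simp add: qsum_def)
  also have "\<dots> = (\<Sum>v\<in>PiE {..<k} (\<lambda>_. S). \<Prod>i<k. complex_of_real (c (v i)) * cis (2*pi*(real (v i))^2*x))"
    using S by (intro prod_sum_PiE) auto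
  also have "\<dots> = (\<Sum>v\<in>PiE {..<k} (\<lambda>_. S). complex_of_real (\<Prod>i<k. c (v i)) * cis (2*pi * of_int (\<Sum>i<k. int ((v i)^2)) * x))"
    by (intro sum.cong refl) (simp add: prod.distrib cp sum_distrib_left sum_distrib_right)
  finally show ?thesis .
qed

lemma integral_qsum_even_power:
  fixes k :: nat
  assumes S: "finite S" and k: "k > 0"
  defines "V \<equiv> PiE {..<k} (\<lambda>_. S)" and "\<nu> \<equiv> \<lambda>v::nat\<Rightarrow>nat. \<Sum>i<k. int ((v i)^2)"
  shows "integral {0..1} (\<lambda>x. cmod (qsum c S x) powr (real (2*k)))
     = (\<Sum>m\<in>\<nu>`V. (\<Sum>v\<in>{v\<in>V. \<nu> v = m}. \<Prod>i<k. c (v i))^2)"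
proof -
  have V: "finite V" unfolding V_def using S by (intro finite_PiE) auto
  have "cmod (qsum c S x) powr (real (2*k)) = (cmod (\<Sum>v\<in>V. complex_of_real (\<Prod>i<k. c (v i)) * cis (2*pi * of_int (\<nu> v) * x)))^2" for x
  proof -
    have "cmod (qsum c S x) powr (real (2*k)) = cmod (qsum c S x) ^ (2*k)"
      using k by (intro powr_realpow') auto
    also have "\<dots> = (cmod (qsum c S x ^ k))^2" by (simp add: norm_power power_mult[symmetric] mult.commute)
    also have "qsum c S x ^ k = (\<Sum>v\<in>V. complex_of_real (\<Prod>i<k. c (v i)) * cis (2*pi * of_int (\<nu> v) * x))"
      unfolding V_def \<nu>_def by (rule qsum_power[OF S])
    finally show ?thesis .
  qed
  thus ?thesis using trig_parseval[OF V, of "\<lambda>v. \<Prod>i<k. c (v i)" \<nu>] by simp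
qed

text \<open>Cauchy-Schwarz over the at most hi - lo frequencies of a window: the squares of the
  representation sums add up to at least the square of their total divided by the window length.
  Nonnegativity inside the window allows the total to be taken over a convenient subset
  \<open>W\<close>.\<close>

lemma sum_blocks_lower:
  fixes A :: "'a \<Rightarrow> real" and \<nu> :: "'a \<Rightarrow> int"
  assumes V: "finite V" and pos: "\<And>v. v \<in> V \<Longrightarrow> lo < \<nu> v \<Longrightarrow> \<nu> v \<le> hi \<Longrightarrow> A v \<ge> 0"
    and W: "W \<subseteq> V" "\<And>v. v \<in> W \<Longrightarrow> lo < \<nu> v \<and> \<nu> v \<le> hi" and lh: "lo < hi"
  shows "(\<Sum>v\<in>W. A v)^2 / of_int (hi - lo) \<le> (\<Sum>m\<in>\<nu>`V \<inter> {lo<..hi}. (\<Sum>v\<in>{v\<in>V. \<nu> v = m}. A v)^2)"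
proof -
  define I where "I = \<nu>`V \<inter> {lo<..hi}"
  define a where "a m = (\<Sum>v\<in>{v\<in>V. \<nu> v = m}. A v)" for m
  have I: "finite I" using V by (simp add: I_def)
  have "(\<Sum>v\<in>W. A v) \<le> (\<Sum>v\<in>{v\<in>V. lo < \<nu> v \<and> \<nu> v \<le> hi}. A v)"
    using V W pos by (intro sum_mono2) auto
  also have "\<dots> = (\<Sum>m\<in>\<nu>`{v\<in>V. lo < \<nu> v \<and> \<nu> v \<le> hi}. \<Sum>v\<in>{v\<in>{v\<in>V. lo < \<nu> v \<and> \<nu> v \<le> hi}. \<nu> v = m}. A v)"
    using V by (intro sum.image_gen) auto
  also have "\<dots> = (\<Sum>m\<in>I. a m)"
  proof (rule sum.cong)
    show "\<nu>`{v\<in>V. lo < \<nu> v \<and> \<nu> v \<le> hi} = I" by (auto simp: I_def)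
    fix m assume "m \<in> I"
    hence "{v\<in>{v\<in>V. lo < \<nu> v \<and> \<nu> v \<le> hi}. \<nu> v = m} = {v\<in>V. \<nu> v = m}" by (auto simp: I_def)
    thus "(\<Sum>v\<in>{v\<in>{v\<in>V. lo < \<nu> v \<and> \<nu> v \<le> hi}. \<nu> v = m}. A v) = a m" by (simp add: a_def)
  qed
  finally have le: "(\<Sum>v\<in>W. A v) \<le> (\<Sum>m\<in>I. a m)" .
  have W0: "0 \<le> (\<Sum>v\<in>W. A v)" using W pos by (intro sum_nonneg) auto
  have "(\<Sum>v\<in>W. A v)^2 \<le> (\<Sum>m\<in>I. a m)^2" using le W0 by (intro power_mono)
  also have "\<dots> \<le> (\<Sum>m\<in>I. (a m)^2) * (\<Sum>m\<in>I. 1^2)"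
    using Cauchy_Schwarz_ineq_sum[of a "\<lambda>_. 1" I] by simp
  also have "\<dots> \<le> (\<Sum>m\<in>I. (a m)^2) * of_int (hi - lo)"
  proof (intro mult_left_mono sum_nonneg)
    have "card I \<le> card {lo<..hi}" by (intro card_mono) (auto simp: I_def)
    hence "real (card I) \<le> real (nat (hi - lo))" by simp
    thus "(\<Sum>m\<in>I. 1^2) \<le> (of_int (hi - lo) :: real)" using lh by simp
  qed auto
  finally show ?thesis using lh by (simp add: field_simps I_def a_def)
qed

lemma four_power: "(4::'a::comm_semiring_1)^j = (2^j)^2"
  by (simp add: power2_eq_square flip: power_mult_distrib)

text \<open>At the critical exponent the low coefficients are at least 2 l n^(1/k - 1). Over 2^r < n
  \<le> 2^(r+1) they sum to at least l 2^(r/k), so the k-tuples from this range give at least l^k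
  2^r, and all these tuples have their sum of squares in one window of length 3k 4^r. The square
  l^(2k) 4^r divided by that length no longer depends on r. Hypothesis \<open>r\<close> keeps every
  entry of a tuple from the window where the sine is positive.\<close>

lemma osc_even_lower_block:
  fixes k r :: nat
  assumes k: "k > 0" and \<sigma>: "2 - 2*\<sigma> = 1 / real k - 1" and l: "l > 0" and N: "1/l \<le> real N"
    and r: "4 * real k * 4^r * l \<le> 1/2"
  defines "V \<equiv> PiE {..<k} (\<lambda>_. {1..N})" and "\<nu> \<equiv> \<lambda>v::nat\<Rightarrow>nat. \<Sum>i<k. int ((v i)^2)"
  shows "l powr real (2*k) / (3 * real k) \<le> (\<Sum>m\<in>\<nu>`V \<inter> {int k * 4^r<..int k * 4^Suc r}. (\<Sum>v\<in>{v\<in>V. \<nu> v = m}. \<Prod>i<k. osc_coeff \<sigma> l (v i))^2)"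
proof -
  define T where "T = {2^r+1..2^Suc r :: nat}"
  define W where "W = PiE {..<k} (\<lambda>_. T)"
  have V: "finite V" unfolding V_def by (intro finite_PiE) auto
  have small: "(real n)^2 * l \<le> 1/2" if "int (n^2) \<le> int k * 4^Suc r" for n
  proof -
    have "real_of_int (int (n^2)) \<le> real_of_int (int k * 4^Suc r)" using that by (simp only: of_int_le_iff)
    hence "(real n)^2 \<le> 4 * real k * 4^r" by simp
    hence "(real n)^2 * l \<le> 4 * real k * 4^r * l" using l by (intro mult_right_mono) auto
    thus ?thesis using r by linarith
  qed
  have Tsq: "4^r < int (n^2)" "int (n^2) \<le> 4^Suc r" if "n \<in> T" for n
  proof -
    have "2^r < n" "n \<le> 2^Suc r" using that by (auto simp: T_def)
    hence "int (2^r) < int n" "int n \<le> int (2^Suc r)" by (simp_all only: of_nat_less_iff of_nat_le_iff)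
    hence "2^r < int n" "int n \<le> 2^Suc r" by (simp_all only: of_nat_power of_nat_numeral)
    thus "4^r < int (n^2)" "int (n^2) \<le> 4^Suc r" unfolding four_power of_nat_power
      by (auto intro!: power_strict_mono power_mono simp del: power_Suc)
  qed
  have TN: "n \<in> {1..N}" "(real n)^2 * l \<le> 1/2" if "n \<in> T" for n
  proof -
    have "int (n^2) \<le> 1 * 4^Suc r" using Tsq[OF that] by simp
    also have "\<dots> \<le> int k * 4^Suc r" using k by (intro mult_right_mono) auto
    finally show sm: "(real n)^2 * l \<le> 1/2" by (rule small)
    have "n \<le> N" using sm by (intro osc_index_le[OF l N]) simp
    thus "n \<in> {1..N}" using that by (auto simp: T_def)
  qed
  have pos: "(\<Prod>i<k. osc_coeff \<sigma> l (v i)) \<ge> 0" if v: "v \<in> V" and hi: "\<nu> v \<le> int k * 4^Suc r" for v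
  proof (intro prod_nonneg ballI)
    fix i assume i: "i \<in> {..<k}"
    have vi: "v i \<in> {1..N}" using v unfolding V_def by (rule PiE_mem) (rule i)
    have "int ((v i)^2) \<le> \<nu> v" unfolding \<nu>_def
      using member_le_sum[OF i, of "\<lambda>i. int ((v i)^2)"] by simp
    hence "(real (v i))^2 * l \<le> 1/2" using hi by (intro small) linarith
    hence "2 * l * real (v i) powr (2 - 2*\<sigma>) \<le> osc_coeff \<sigma> l (v i)" using vi l by (intro osc_coeff_ge) auto
    moreover have "0 \<le> 2 * l * real (v i) powr (2 - 2*\<sigma>)" using l by simp
    ultimately show "0 \<le> osc_coeff \<sigma> l (v i)" by linarith
  qed
  have "(\<Sum>v\<in>W. \<Prod>i<k. osc_coeff \<sigma> l (v i))^2 / of_int (int k * 4^Suc r - int k * 4^r)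
     \<le> (\<Sum>m\<in>\<nu>`V \<inter> {int k * 4^r<..int k * 4^Suc r}. (\<Sum>v\<in>{v\<in>V. \<nu> v = m}. \<Prod>i<k. osc_coeff \<sigma> l (v i))^2)"
  proof (rule sum_blocks_lower[OF V])
    show "W \<subseteq> V" unfolding W_def V_def using TN by (intro PiE_mono) auto
    show "int k * 4^r < int k * 4^Suc r" using k by simp
    fix v assume v: "v \<in> W"
    have vT: "v i \<in> T" if "i < k" for i using v unfolding W_def by (rule PiE_mem) (use that in simp)
    have "(\<Sum>i<k. (4::int)^r) < \<nu> v" unfolding \<nu>_def using k Tsq(1)[OF vT] by (intro sum_strict_mono) auto
    moreover have "\<nu> v \<le> (\<Sum>i<k. (4::int)^Suc r)" unfolding \<nu>_def using Tsq(2)[OF vT] by (intro sum_mono) auto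
    ultimately show "int k * 4^r < \<nu> v \<and> \<nu> v \<le> int k * 4^Suc r" by simp
  qed (use pos in auto)
  moreover have "l powr real (2*k) / (3 * real k) \<le> (\<Sum>v\<in>W. \<Prod>i<k. osc_coeff \<sigma> l (v i))^2 / of_int (int k * 4^Suc r - int k * 4^r)"
  proof -
    define e where "e = 1 / real k"
    have e: "0 < e" "e \<le> 1" using k by (auto simp: e_def)
    have prodsum: "(\<Sum>v\<in>W. \<Prod>i<k. osc_coeff \<sigma> l (v i)) = (\<Sum>n\<in>T. osc_coeff \<sigma> l n)^k"
      unfolding W_def using prod_sum_PiE[of "{..<k}" "\<lambda>_. T" "\<lambda>_. osc_coeff \<sigma> l"] by (simp add: T_def)
    have base: "l * 2 powr (real r * e) \<le> (\<Sum>n\<in>T. osc_coeff \<sigma> l n)"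
    proof -
      have "l * 2 powr (real r * e) \<le> real (2^r) * (2 * l * (2 powr (real r + 1)) powr (e - 1))"
      proof -
        have "real (2^r) * (2 * l * (2 powr (real r + 1)) powr (e - 1)) = l * (2 powr real r * 2 powr 1 * 2 powr ((real r + 1) * (e-1)))"
          by (simp add: powr_powr powr_realpow)
        also have "2 powr real r * 2 powr 1 * 2 powr ((real r + 1) * (e-1)) = 2 powr (real r * e + e)"
          unfolding powr_add[symmetric] by (simp add: algebra_simps)
        finally have "real (2^r) * (2 * l * (2 powr (real r + 1)) powr (e - 1)) = l * 2 powr (real r * e + e)" .
        moreover have "2 powr (real r * e) \<le> 2 powr (real r * e + e)" using e by (intro powr_mono) auto
        ultimately show ?thesis using l by (simp add: mult_left_mono)
      qed
      also have "\<dots> = (\<Sum>n\<in>T. 2 * l * (2 powr (real r + 1)) powr (e - 1))" by (simp add: T_def)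
      also have "\<dots> \<le> (\<Sum>n\<in>T. osc_coeff \<sigma> l n)"
      proof (intro sum_mono)
        fix n assume n: "n \<in> T"
        have n1: "n \<ge> 1" using n by (auto simp: T_def)
        have "real n \<le> real (2^Suc r)" using n unfolding of_nat_le_iff by (simp add: T_def)
        also have "real (2^Suc r) = 2 powr (real r + 1)" by (simp add: powr_add powr_realpow)
        finally have "(2 powr (real r + 1)) powr (e - 1) \<le> real n powr (e - 1)" using n1 e by (intro powr_mono2') auto
        hence "2 * l * (2 powr (real r + 1)) powr (e - 1) \<le> 2 * l * real n powr (2 - 2*\<sigma>)"
          using l unfolding \<sigma> e_def[symmetric] by (intro mult_left_mono) auto
        also have "\<dots> \<le> osc_coeff \<sigma> l n" using l n1 TN(2)[OF n] by (intro osc_coeff_ge) auto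
        finally show "2 * l * (2 powr (real r + 1)) powr (e - 1) \<le> osc_coeff \<sigma> l n" .
      qed
      finally show ?thesis .
    qed
    have "(l * 2 powr (real r * e))^k \<le> (\<Sum>n\<in>T. osc_coeff \<sigma> l n)^k" by (rule power_mono[OF base]) (use l in simp)
    hence "((l * 2 powr (real r * e))^k)^2 \<le> ((\<Sum>n\<in>T. osc_coeff \<sigma> l n)^k)^2" by (rule power_mono) (use l in simp)
    moreover have "((l * 2 powr (real r * e))^k)^2 = l powr real (2*k) * 4^r"
    proof -
      have "(2 powr (real r * e))^k = 2 powr (real r * e * real k)" by (simp add: powr_powr flip: powr_realpow)
      also have "\<dots> = 2 ^ r" using k by (simp add: e_def powr_realpow)
      finally have a: "(l * 2 powr (real r * e))^k = l^k * 2^r" by (simp add: power_mult_distrib)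
      have b: "(l^k)^2 = l powr real (2*k)" using l by (simp add: powr_realpow power_mult[symmetric] mult.commute del: of_nat_mult)
      show ?thesis unfolding a unfolding power_mult_distrib b four_power ..
    qed
    ultimately have "l powr real (2*k) * 4^r \<le> (\<Sum>v\<in>W. \<Prod>i<k. osc_coeff \<sigma> l (v i))^2" by (simp only: prodsum)
    hence "l powr real (2*k) * 4^r / of_int (int k * 4^Suc r - int k * 4^r) \<le> (\<Sum>v\<in>W. \<Prod>i<k. osc_coeff \<sigma> l (v i))^2 / of_int (int k * 4^Suc r - int k * 4^r)"
      by (intro divide_right_mono) auto
    moreover have "l powr real (2*k) * 4^r / of_int (int k * 4^Suc r - int k * 4^r) = l powr real (2*k) / (3 * real k)"
    proof -
      have "real_of_int (int k * 4^Suc r - int k * 4^r) = 3 * real k * 4^r" by simp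
      thus ?thesis by simp
    qed
    ultimately show ?thesis by linarith
  qed
  ultimately show ?thesis by linarith
qed

text \<open>About ln(1/l)/4 disjoint windows each contribute l^(2k)/(3k); their number is the
  logarithm.\<close>

lemma osc_even_lower:
  fixes k :: nat
  assumes k: "k > 0" and \<sigma>: "2 - 2*\<sigma> = 1 / real k - 1"
  shows "\<exists>c>0. \<exists>l0>0. \<forall>l N. 0 < l \<longrightarrow> l \<le> l0 \<longrightarrow> 1/l \<le> real N \<longrightarrow>
     c * (l * ln (1/l) powr (1 / real (2*k))) \<le> Lp_norm (real (2*k)) (qsum (osc_coeff \<sigma> l) {1..N})"
proof -
  define c where "c = (1 / (24 * real k)) powr (1 / real (2*k))"
  have c: "c > 0" using k by (simp add: c_def)
  \<comment> \<open>With r \<le> ln(1/l)/4 one has 4^r \<le> l^(-1/2), as ln 4 \<le> 2; then 4k 4^r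
    l \<le> 4k sqrt l, and the second entry makes this at most 1/2.\<close>
  define l0 where "l0 = min (1/64) ((1 / (8 * real k))^2)"
  have l0: "l0 > 0" using k by (simp add: l0_def)
  have "c * (l * ln (1/l) powr (1 / real (2*k))) \<le> Lp_norm (real (2*k)) (qsum (osc_coeff \<sigma> l) {1..N})"
    if l: "0 < l" "l \<le> l0" and N: "1/l \<le> real N" for l N
  proof (rule Lp_norm_geI)
    have l64: "l \<le> 1/64" and lk: "l \<le> (1 / (8 * real k))^2" using l by (auto simp: l0_def)
    define \<Lambda> where "\<Lambda> = ln (1/l)"
    have \<Lambda>: "\<Lambda> \<ge> 1" unfolding \<Lambda>_def using l64 l by (intro ln_inverse_ge_1) auto
    define V where "V = PiE {..<k} (\<lambda>_. {1..N})"
    define \<nu> where "\<nu> v = (\<Sum>i<k. int ((v i)^2))" for v :: "nat \<Rightarrow> nat"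
    define a where "a m = (\<Sum>v\<in>{v\<in>V. \<nu> v = m}. \<Prod>i<k. osc_coeff \<sigma> l (v i))" for m
    have V: "finite V" unfolding V_def by (intro finite_PiE) auto
    define R where "R = nat \<lfloor>\<Lambda> / 4\<rfloor>"
    have Rle: "real R \<le> \<Lambda> / 4" "\<Lambda>/4 \<le> real R + 1"
    proof -
      have "real R = of_int \<lfloor>\<Lambda>/4\<rfloor>" using \<Lambda> by (simp add: R_def)
      thus "real R \<le> \<Lambda>/4" "\<Lambda>/4 \<le> real R + 1" using floor_correct[of "\<Lambda>/4"] by linarith+
    qed
    have blk: "4 * real k * 4^r * l \<le> 1/2" if "r \<le> R" for r
    proof -
      have "(4::real)^r = exp (real r * ln 4)" by (simp add: exp_of_nat_mult)
      also have "\<dots> \<le> exp (\<Lambda> / 2)"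
      proof -
        have "ln (2::real) \<le> 1" using ln_le_minus_one[of "2::real"] by simp
        moreover have "ln (4::real) = 2 * ln 2" using ln_realpow[of "2::real" 2] by simp
        ultimately have "ln (4::real) \<le> 2" by simp
        hence "real r * ln 4 \<le> \<Lambda> / 4 * 2" using that Rle(1) \<Lambda> by (intro mult_mono) auto
        thus ?thesis by simp
      qed
      also have "\<dots> = sqrt (1/l)"
      proof -
        have "exp (\<Lambda> / 2) = (1/l) powr (1/2)" using l by (simp add: powr_def \<Lambda>_def)
        thus ?thesis using l by (simp add: powr_half_sqrt)
      qed
      finally have "4 * real k * 4^r * l \<le> 4 * real k * sqrt (1/l) * l" using l by (intro mult_right_mono mult_left_mono) auto
      also have "sqrt (1/l) * l = sqrt l" using l by (simp add: real_sqrt_divide field_simps)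
      hence "4 * real k * sqrt (1/l) * l = 4 * real k * sqrt l" by (simp add: mult.assoc)
      also have "\<dots> \<le> 4 * real k * (1 / (8 * real k))"
        using real_sqrt_le_mono[OF lk] k by (intro mult_left_mono) (auto simp: real_sqrt_abs)
      also have "\<dots> = 1/2" using k by simp
      finally show ?thesis .
    qed
    have "(c * (l * \<Lambda> powr (1 / real (2*k)))) powr real (2*k) = l powr real (2*k) * (\<Lambda> / (24 * real k))"
      using k \<Lambda> l by (simp add: c_def powr_mult powr_powr del: of_nat_mult) 
    also have "\<dots> \<le> l powr real (2*k) * ((real R + 1) / (3 * real k))"
    proof (intro mult_left_mono)
      have "\<Lambda> / (24 * real k) \<le> (8 * (real R + 1)) / (24 * real k)" using Rle(2) \<Lambda> by (intro divide_right_mono) auto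
      also have "(8 * (real R + 1)) / (24 * real k) = (real R + 1) / (3 * real k)" using k by (simp add: field_simps)
      finally show "\<Lambda> / (24 * real k) \<le> (real R + 1) / (3 * real k)" .
    qed auto
    also have "\<dots> = (\<Sum>r\<le>R. l powr real (2*k) / (3 * real k))" by (simp add: field_simps)
    also have "\<dots> \<le> (\<Sum>r\<le>R. \<Sum>m\<in>\<nu>`V \<inter> {int k * 4^r<..int k * 4^Suc r}. (a m)^2)"
      unfolding a_def V_def \<nu>_def using blk by (intro sum_mono osc_even_lower_block k \<sigma> l N) auto
    also have "\<dots> = (\<Sum>m\<in>(\<Union>r\<le>R. \<nu>`V \<inter> {int k * 4^r<..int k * 4^Suc r}). (a m)^2)"
    proof (rule sum.UNION_disjoint[symmetric])
      show "\<forall>i\<in>{..R}. \<forall>j\<in>{..R}. i \<noteq> j \<longrightarrow> \<nu>`V \<inter> {int k * 4^i<..int k * 4^Suc i} \<inter> (\<nu>`V \<inter> {int k * 4^j<..int k * 4^Suc j}) = {}"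
      proof (intro ballI impI)
        fix i j :: nat assume ij: "i \<noteq> j"
        have dis: "{int k * 4^i<..int k * 4^Suc i} \<inter> {int k * 4^j<..int k * 4^Suc j} = {}" if "i < j" for i j :: nat
        proof -
          have "(4::int)^Suc i \<le> 4^j" using that by (intro power_increasing) auto
          hence "int k * 4^Suc i \<le> int k * 4^j" by (intro mult_left_mono) auto
          thus ?thesis by auto
        qed
        show "\<nu>`V \<inter> {int k * 4^i<..int k * 4^Suc i} \<inter> (\<nu>`V \<inter> {int k * 4^j<..int k * 4^Suc j}) = {}"
          using dis[of i j] dis[of j i] ij by (cases "i < j") auto
      qed
    qed (use V in auto)
    also have "\<dots> \<le> (\<Sum>m\<in>\<nu>`V. (a m)^2)" using V by (intro sum_mono2) auto
    also have "\<dots> = integral {0..1} (\<lambda>x. cmod (qsum (osc_coeff \<sigma> l) {1..N} x) powr (real (2*k)))"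
      unfolding a_def V_def \<nu>_def by (rule integral_qsum_even_power[symmetric]) (use k in auto)
    finally show "(c * (l * ln (1/l) powr (1 / real (2*k)))) powr real (2*k) \<le> integral {0..1} (\<lambda>x. cmod (qsum (osc_coeff \<sigma> l) {1..N} x) powr (real (2*k)))"
      by (simp only: \<Lambda>_def)
  qed (use k l c in auto)
  thus ?thesis using c l0 by blast
qed

section \<open>Counting coincidences between sums of two squares\<close>

lemma sum_inverse_squares_from_2: "(\<Sum>d=2..X. 1 / (real d)^2) \<le> 25/36"
proof -
  \<comment> \<open>25/36 = 1/4 + 1/9 + 1/3: two terms are kept exactly and the rest telescopes. The
    precision matters, because 1 - 25/36 = 11/36 must still leave 1/10 after the loss of 2/10 in
    \<open>card_large_coprime\<close>.\<close>
  have ge3: "(\<Sum>d=2..X. 1 / (real d)^2) \<le> 25/36 - 1 / real X" if "X \<ge> 3" for X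
    using that
  proof (induction X rule: nat_induct_at_least)
    case base
    have "{2..3::nat} = {2,3}" by auto
    thus ?case by simp
  next
    case (Suc n)
    have "1 / (real (Suc n))^2 \<le> 1 / (real n * real (Suc n))"
      using Suc.hyps by (intro divide_left_mono) (auto simp: power2_eq_square)
    also have "\<dots> = 1 / real n - 1 / real (Suc n)" using Suc.hyps by (simp add: field_simps)
    finally show ?case using Suc.IH Suc.hyps by simp
  qed
  consider "X \<ge> 3" | "X = 2" | "X < 2" by linarith
  thus ?thesis
  proof cases
    case 1
    have "25/36 - 1 / real X \<le> 25/36" by simp
    with ge3[OF 1] show ?thesis by linarith
  qed auto
qed

text \<open>Union bound: a pair that is not coprime has its gcd d in 2..X and lies among at most
  (X/d)^2 pairs of multiples of d.\<close>

lemma card_coprime_pairs: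
  "11/36 * (real X)^2 \<le> real (card {(a, b). a \<in> {1..X} \<and> b \<in> {1..X} \<and> coprime a b})"
proof -
  let ?P = "{(a, b). a \<in> {1..X} \<and> b \<in> {1..X} \<and> coprime a b}"
  let ?D = "\<lambda>d. {a \<in> {1..X}. d dvd a}"
  have cD: "real (card (?D d)) \<le> real X / real d" if "d \<ge> 2" for d
  proof -
    have "?D d \<subseteq> (\<lambda>k. d * k) ` {1..X div d}"
    proof
      fix a assume "a \<in> ?D d"
      then obtain k where k: "a = d * k" "1 \<le> a" "a \<le> X" by auto
      have "k \<le> X div d" using k that by (metis div_le_mono nonzero_mult_div_cancel_left not_numeral_le_zero)
      moreover have "k \<ge> 1" using k by (cases k) auto
      ultimately show "a \<in> (\<lambda>k. d * k) ` {1..X div d}" using k(1) by (intro image_eqI[of _ _ k]) auto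
    qed
    hence "card (?D d) \<le> card ((\<lambda>k. d * k) ` {1..X div d})" by (intro card_mono) auto
    also have "\<dots> \<le> X div d" using card_image_le[of "{1..X div d}" "\<lambda>k. d * k"] by simp
    finally have "real (card (?D d)) \<le> real (X div d)" by simp
    thus ?thesis using of_nat_div_le_of_nat[of X d, where ?'a = real] by linarith
  qed
  have "{1..X} \<times> {1..X} \<subseteq> ?P \<union> (\<Union>d\<in>{2..X}. ?D d \<times> ?D d)"
  proof
    fix z assume "z \<in> {1..X} \<times> {1..X}"
    then obtain a b where z: "z = (a, b)" "a \<in> {1..X}" "b \<in> {1..X}" by auto
    show "z \<in> ?P \<union> (\<Union>d\<in>{2..X}. ?D d \<times> ?D d)"
    proof (cases "coprime a b")
      case False
      have "gcd a b \<noteq> 1" "gcd a b \<noteq> 0" using False z by (auto simp: coprime_iff_gcd_eq_1)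
      moreover have "gcd a b \<le> a" using z by (intro gcd_le1_nat) auto
      moreover have "a \<le> X" using z by simp
      ultimately have "2 \<le> gcd a b" "gcd a b \<le> X" by linarith+
      hence "gcd a b \<in> {2..X}" by simp
      thus ?thesis using z by (intro UnI2 UN_I[of "gcd a b"]) auto
    qed (use z in auto)
  qed
  hence "card ({1..X} \<times> {1..X}) \<le> card (?P \<union> (\<Union>d\<in>{2..X}. ?D d \<times> ?D d))"
    by (intro card_mono finite_UnI finite_UN_I finite_subset[of ?P "{1..X} \<times> {1..X}"]) auto
  also have "\<dots> \<le> card ?P + card (\<Union>d\<in>{2..X}. ?D d \<times> ?D d)" by (rule card_Un_le)
  also have "\<dots> \<le> card ?P + (\<Sum>d\<in>{2..X}. card (?D d \<times> ?D d))"
    by (intro add_left_mono card_UN_le) auto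
  finally have "real (X * X) \<le> real (card ?P + (\<Sum>d\<in>{2..X}. card (?D d) * card (?D d)))"
    by (simp only: of_nat_le_iff card_cartesian_product card_atLeastAtMost diff_Suc_1 Suc_diff_1)
  hence "(real X)^2 \<le> real (card ?P) + (\<Sum>d\<in>{2..X}. real (card (?D d)) * real (card (?D d)))"
    by (simp add: power2_eq_square)
  also have "(\<Sum>d\<in>{2..X}. real (card (?D d)) * real (card (?D d))) \<le> (\<Sum>d\<in>{2..X}. (real X / real d) * (real X / real d))"
    by (intro sum_mono mult_mono cD) auto
  also have "\<dots> = (real X)^2 * (\<Sum>d=2..X. 1 / (real d)^2)" by (simp add: sum_distrib_left power2_eq_square)
  also have "\<dots> \<le> (real X)^2 * (25/36)" by (intro mult_left_mono sum_inverse_squares_from_2) auto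
  finally show ?thesis by simp
qed

text \<open>Entries above X/10 serve twice: the numbers built from them are of one order of
  magnitude, and an entry determines the scale X among the powers of 16.\<close>

definition large_coprime :: "nat \<Rightarrow> (nat \<times> nat) set" where
  "large_coprime X = {(a, b). a \<in> {X div 10 + 1..X} \<and> b \<in> {X div 10 + 1..X} \<and> coprime a b}"

lemma finite_large_coprime: "finite (large_coprime X)"
  by (rule finite_subset[of _ "{X div 10 + 1..X} \<times> {X div 10 + 1..X}"]) (auto simp: large_coprime_def)

lemma card_large_coprime: "(real X)^2 / 10 \<le> real (card (large_coprime X))"
proof -
  let ?P = "{(a, b). a \<in> {1..X} \<and> b \<in> {1..X} \<and> coprime a b}"
  have "?P \<subseteq> large_coprime X \<union> ({1..X div 10} \<times> {1..X} \<union> {1..X} \<times> {1..X div 10})"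
    by (auto simp: large_coprime_def)
  hence "card ?P \<le> card (large_coprime X \<union> ({1..X div 10} \<times> {1..X} \<union> {1..X} \<times> {1..X div 10}))"
    by (intro card_mono) (auto simp: finite_large_coprime)
  also have "\<dots> \<le> card (large_coprime X) + (card ({1..X div 10} \<times> {1..X}) + card ({1..X} \<times> {1..X div 10}))"
    by (intro order.trans[OF card_Un_le] add_left_mono card_Un_le)
  finally have "card ?P \<le> card (large_coprime X) + 2 * (X div 10 * X)" by (simp add: card_cartesian_product algebra_simps)
  hence "real (card ?P) \<le> real (card (large_coprime X) + 2 * (X div 10 * X))" by (simp only: of_nat_le_iff)
  hence "real (card ?P) \<le> real (card (large_coprime X)) + 2 * (real (X div 10) * real X)" by simp
  moreover have "real (X div 10) * real X \<le> (real X / 10) * real X"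
    using of_nat_div_le_of_nat[of X 10, where ?'a = real] by (intro mult_right_mono) auto
  ultimately show ?thesis using card_coprime_pairs[of X] by (simp add: power2_eq_square)
qed

text \<open>The general solution of \<open>(n\<^sub>1 - n\<^sub>4)(n\<^sub>1 + n\<^sub>4) = (n\<^sub>3 - n\<^sub>2)(n\<^sub>3 + n\<^sub>2)\<close> with all factors even.\<close>

definition quad_param :: "nat \<Rightarrow> nat \<Rightarrow> nat \<Rightarrow> nat \<Rightarrow> (nat \<times> nat) \<times> (nat \<times> nat)" where
  "quad_param g k a b = ((k*b + g*a, k*a - g*b), (k*a + g*b, k*b - g*a))"

text \<open>Sums and differences of the components give ka, kb, ga, gb; by coprimality g = gcd(ga,
  gb), and the rest follows by division. The strict inequalities prevent truncation in the
  subtractions of naturals.\<close>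

lemma quad_param_inj:
  assumes "quad_param g k a b = quad_param g' k' a' b'"
    and "g*a < k*b" "g*b < k*a" "g'*a' < k'*b'" "g'*b' < k'*a'"
    and "coprime a b" "coprime a' b'" "g > 0" "a > 0" "b > 0"
  shows "g = g' \<and> k = k' \<and> a = a' \<and> b = b'"
proof -
  have e: "k*b + g*a = k'*b' + g'*a'" "k*b - g*a = k'*b' - g'*a'" "k*a + g*b = k'*a' + g'*b'" "k*a - g*b = k'*a' - g'*b'"
    using assms(1) by (auto simp: quad_param_def)
  have ga: "g*a = g'*a'" and kb: "k*b = k'*b'" using e(1,2) assms by linarith+
  have gb: "g*b = g'*b'" using e(3,4) assms by linarith
  have "g = gcd (g*a) (g*b)" using assms by (simp add: gcd_mult_distrib_nat[symmetric] coprime_iff_gcd_eq_1)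
  also have "\<dots> = g'" unfolding ga gb using assms by (simp add: gcd_mult_distrib_nat[symmetric] coprime_iff_gcd_eq_1)
  finally have g: "g = g'" .
  have a: "a = a'" "b = b'" using ga gb g assms by auto
  have "k = k'" using kb a assms by auto
  thus ?thesis using g a by simp
qed

lemma quad_param_squares:
  assumes "g*a \<le> k*b" "g*b \<le> k*a"
  shows "(k*b + g*a)^2 + (k*a - g*b)^2 = (k*a + g*b)^2 + (k*b - g*a :: nat)^2"
proof -
  have d: "int (k*a - g*b) = int k * int a - int g * int b" "int (k*b - g*a) = int k * int b - int g * int a"
    using assms by (simp_all only: of_nat_diff of_nat_mult)
  have "int ((k*b + g*a)^2 + (k*a - g*b)^2) = int ((k*a + g*b)^2 + (k*b - g*a)^2)"
    unfolding of_nat_add of_nat_power d of_nat_mult by (simp add: power2_eq_square algebra_simps)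
  thus ?thesis by (simp only: of_nat_eq_iff)
qed

definition top_range :: "nat \<Rightarrow> nat set" where "top_range u = {n. 2^u \<le> 80*n \<and> n \<le> 2^u}"

text \<open>Its cardinality is the additive energy of the squares of \<open>G\<close>, the fourth
  moment of the Weyl sum over \<open>G\<close>.\<close>

definition energy_set :: "nat set \<Rightarrow> ((nat \<times> nat) \<times> (nat \<times> nat)) set" where
  "energy_set G = {((n1, n2), (n3, n4)). n1 \<in> G \<and> n2 \<in> G \<and> n3 \<in> G \<and> n4 \<in> G \<and> n1^2 + n2^2 = n3^2 + n4^2}"

lemma finite_top_range: "finite (top_range u)"
  by (rule finite_subset[of _ "{..2^u}"]) (auto simp: top_range_def)

lemma finite_energy_set: "finite G \<Longrightarrow> finite (energy_set G)"
  by (rule finite_subset[of _ "(G \<times> G) \<times> (G \<times> G)"]) (auto simp: energy_set_def)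

text \<open>At scale j the factors g, k are taken of size K = 2^(u-1-4j) and a, b of size X = 16^j,
  with K X = 2^(u-1) fixed. Each j yields a multiple of K^2 X^2 solutions, at least 4^u/6400, and a
  identifies j. The number of scales, about u/4, is the logarithm; the diagonal solutions alone
  would not show it.\<close>

lemma energy_lower:
  assumes u: "u \<ge> 7"
  shows "(real u - 7) / 4 * (4^u / 6400) \<le> real (card (energy_set (top_range u)))"
proof -
  \<comment> \<open>The margin 7 keeps K \<ge> 64, so that K div 40 is at least K/80.\<close>
  define J where "J = (u - 7) div 4"
  define K where "K j = (2::nat)^(u - 1 - 4*j)" for j
  define X where "X j = (16::nat)^j" for j
  define Q where "Q j = {1..K j div 40} \<times> {K j div 2 + 1..K j} \<times> large_coprime (X j)" for j
  have Jj: "4*j + 7 \<le> u" if "j \<le> J" for j using that u by (auto simp: J_def)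
  have KX: "K j * X j * 2 = 2^u" if "j \<le> J" for j
  proof -
    have "X j = 2^(4*j)" by (simp add: X_def power_mult)
    hence "K j * X j * 2 = 2^(u - 1 - 4*j + 4*j + 1)" by (simp add: K_def power_add)
    also have "u - 1 - 4*j + 4*j + 1 = u" using Jj[OF that] by simp
    finally show ?thesis .
  qed
  have K64: "64 \<le> K j" if "j \<le> J" for j
  proof -
    have "(2::nat)^6 \<le> 2^(u - 1 - 4*j)" using Jj[OF that] by (intro power_increasing) auto
    thus ?thesis by (simp add: K_def)
  qed
  have bounds: "2 * (g*a) < k*b" "2 * (g*b) < k*a" "2^u \<le> 80 * (k*b - g*a)" "2^u \<le> 80 * (k*a - g*b)"
      "k*b + g*a \<le> 2^u" "k*a + g*b \<le> 2^u" "g > 0" "a > 0" "b > 0" "coprime a b"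
      "X j < 10*a" "a \<le> X j"
    if j: "j \<le> J" and q: "(g, k, a, b) \<in> Q j" for j g k a b
  proof -
    have g: "1 \<le> g" "g \<le> K j div 40" and k: "K j div 2 + 1 \<le> k" "k \<le> K j"
      and a: "X j div 10 + 1 \<le> a" "a \<le> X j" and b: "X j div 10 + 1 \<le> b" "b \<le> X j" and co: "coprime a b"
      using q by (auto simp: Q_def large_coprime_def)
    have g40: "40 * g \<le> K j" using g by linarith
    have k2: "K j \<le> 2 * k" using k by linarith
    have a10: "X j < 10 * a" and b10: "X j < 10 * b" using a b by linarith+
    have K0: "K j > 0" using K64[OF j] by linarith
    \<comment> \<open>k y > K X/20 and g y \<le> K X/40 leave differences of at least K X/40 =
      2^u/80, which is the 80 of \<open>top_range\<close>.\<close>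
    have low: "K j * X j < 20 * (k * y)" if "X j < 10 * y" for y
    proof -
      have "K j * X j < K j * (10 * y)" using that K0 by simp
      also have "\<dots> \<le> (2 * k) * (10 * y)" using k2 by (intro mult_right_mono) auto
      finally show ?thesis by simp
    qed
    have up: "40 * (g * y) \<le> K j * X j" if "y \<le> X j" for y
    proof -
      have "(40 * g) * y \<le> K j * X j" using that g40 by (intro mult_mono) auto
      thus ?thesis by simp
    qed
    have kup: "k * y \<le> K j * X j" if "y \<le> X j" for y using that k by (intro mult_mono) auto
    note f = low[OF a10] low[OF b10] up[OF a(2)] up[OF b(2)] kup[OF a(2)] kup[OF b(2)] KX[OF j]
    show "2 * (g*a) < k*b" "2 * (g*b) < k*a" "2^u \<le> 80 * (k*b - g*a)" "2^u \<le> 80 * (k*a - g*b)"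
      "k*b + g*a \<le> 2^u" "k*a + g*b \<le> 2^u" using f by linarith+
    show "g > 0" "a > 0" "b > 0" "coprime a b" "X j < 10*a" "a \<le> X j" using g a b co a10 by auto
  qed
  define \<phi> where "\<phi> = (\<lambda>(j::nat, g, k, a, b). quad_param g k a b)"
  define D where "D = (SIGMA j:{..J}. Q j)"
  have finQ: "finite (Q j)" for j unfolding Q_def by (intro finite_cartesian_product finite_large_coprime) auto
  have sub: "\<phi> ` D \<subseteq> energy_set (top_range u)"
  proof
    fix z assume "z \<in> \<phi> ` D"
    then obtain j g k a b where q: "j \<le> J" "(g, k, a, b) \<in> Q j" and z: "z = quad_param g k a b"
      by (auto simp: D_def \<phi>_def)
    note bd = bounds[OF q]
    have mem: "n \<in> top_range u" if "2^u \<le> 80 * n" "n \<le> 2^u" for n using that by (simp add: top_range_def)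
    have ar: "P \<le> 80 * (p + q)" "p - q \<le> P" if "P \<le> 80 * (p - q)" "p + q \<le> P" for p q P :: nat using that by auto
    have "k*b + g*a \<in> top_range u" "k*b - g*a \<in> top_range u" by (auto intro!: mem bd(3,5) ar[OF bd(3,5)])
    moreover have "k*a + g*b \<in> top_range u" "k*a - g*b \<in> top_range u" by (auto intro!: mem bd(4,6) ar[OF bd(4,6)])
    moreover have "(k*b + g*a)^2 + (k*a - g*b)^2 = (k*a + g*b)^2 + (k*b - g*a)^2"
      using bd(1,2) by (intro quad_param_squares) linarith+
    ultimately show "z \<in> energy_set (top_range u)" unfolding z quad_param_def energy_set_def by simp
  qed
  have inj: "inj_on \<phi> D"
  proof (rule inj_onI)
    fix y y' assume "y \<in> D" "y' \<in> D" and eq: "\<phi> y = \<phi> y'"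
    obtain j g k a b where y: "y = (j, g, k, a, b)" by (cases y) auto
    obtain j' g' k' a' b' where y': "y' = (j', g', k', a', b')" by (cases y') auto
    have q: "j \<le> J" "(g, k, a, b) \<in> Q j" and q': "j' \<le> J" "(g', k', a', b') \<in> Q j'"
      using \<open>y \<in> D\<close> \<open>y' \<in> D\<close> by (auto simp: D_def y y')
    note bd = bounds[OF q] and bd' = bounds[OF q']
    have same: "g = g' \<and> k = k' \<and> a = a' \<and> b = b'"
    proof (rule quad_param_inj)
      show "quad_param g k a b = quad_param g' k' a' b'" using eq by (simp add: y y' \<phi>_def)
    qed (use bd bd' in linarith)+
    have "j = j'"
    proof -
      \<comment> \<open>10 < 16: the ranges of a for different scales do not overlap.\<close>
      have lt: "i < i' + 1" if "X i < 10 * a" "a \<le> X i'" for i i'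
      proof -
        have "(16::nat)^i < 16^(i' + 1)" using that by (simp add: X_def)
        thus ?thesis by (subst (asm) power_strict_increasing_iff) auto
      qed
      show ?thesis using lt[of j j'] lt[of j' j] bd(11,12) bd'(11,12) same by auto
    qed
    thus "y = y'" using same by (simp add: y y')
  qed
  have cardQ: "4^u / 6400 \<le> real (card (Q j))" if j: "j \<le> J" for j
  proof -
    have "real (card (Q j)) = real (K j div 40) * (real (K j - K j div 2) * real (card (large_coprime (X j))))"
      by (simp add: Q_def card_cartesian_product)
    also have "\<dots> \<ge> (real (K j) / 80) * ((real (K j) / 2) * ((real (X j))^2 / 10))"
    proof (intro mult_mono)
      have "K j \<le> 80 * (K j div 40)" using K64[OF j] by presburger
      hence "real (K j) \<le> real (80 * (K j div 40))" by (simp only: of_nat_le_iff)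
      thus "real (K j) / 80 \<le> real (K j div 40)" by simp
      have "K j \<le> 2 * (K j - K j div 2)" by linarith
      hence "real (K j) \<le> real (2 * (K j - K j div 2))" by (simp only: of_nat_le_iff)
      thus "real (K j) / 2 \<le> real (K j - K j div 2)" by simp
      show "(real (X j))^2 / 10 \<le> real (card (large_coprime (X j)))" by (rule card_large_coprime)
    qed auto
    also have "(real (K j) / 80) * ((real (K j) / 2) * ((real (X j))^2 / 10)) = (real (K j * X j * 2))^2 / 6400"
      by (simp add: power2_eq_square)
    also have "\<dots> = 4^u / 6400" unfolding KX[OF j] by (simp add: four_power)
    finally show ?thesis .
  qed
  have "(real u - 7) / 4 * (4^u / 6400) \<le> (real J + 1) * (4^u / 6400)"
  proof (intro mult_right_mono)
    have "u - 7 \<le> 4 * J + 4" by (simp add: J_def)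
    hence "real (u - 7) \<le> real (4 * J + 4)" by (simp only: of_nat_le_iff)
    thus "(real u - 7) / 4 \<le> real J + 1" using u by (simp add: of_nat_diff)
  qed auto
  also have "\<dots> = (\<Sum>j\<le>J. 4^u / 6400)" by simp
  also have "\<dots> \<le> (\<Sum>j\<le>J. real (card (Q j)))" by (intro sum_mono cardQ) auto
  also have "\<dots> = real (card D)" unfolding D_def using finQ by (simp add: card_SigmaI)
  also have "card D = card (\<phi> ` D)" by (rule card_image[OF inj, symmetric])
  also have "real \<dots> \<le> real (card (energy_set (top_range u)))"
    unfolding of_nat_le_iff by (intro card_mono sub finite_energy_set finite_top_range)
  finally show ?thesis .
qed

lemma integral_qsum_power4:
  fixes S :: "nat set"
  assumes S: "finite S"
  defines "\<nu> \<equiv> \<lambda>v::nat\<times>nat. int ((fst v)^2 + (snd v)^2)"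
  shows "integral {0..1} (\<lambda>x. cmod (qsum c S x) powr 4)
     = (\<Sum>m\<in>\<nu>`(S\<times>S). (\<Sum>v\<in>{v\<in>S\<times>S. \<nu> v = m}. c (fst v) * c (snd v))^2)"
proof -
  have "cmod (qsum c S x) powr 4 = (cmod (\<Sum>v\<in>S\<times>S. complex_of_real (c (fst v) * c (snd v)) * cis (2*pi * of_int (\<nu> v) * x)))^2" for x
  proof -
    have "cmod (qsum c S x) powr 4 = (cmod (qsum c S x * qsum c S x))^2"
      by (simp add: norm_mult power2_eq_square power4_eq_xxxx)
    also have "qsum c S x * qsum c S x = (\<Sum>v\<in>S\<times>S. complex_of_real (c (fst v) * c (snd v)) * cis (2*pi * of_int (\<nu> v) * x))"
    proof -
      have pt: "complex_of_real (c (fst v)) * cis (2*pi*(real (fst v))^2*x) * (complex_of_real (c (snd v)) * cis (2*pi*(real (snd v))^2*x))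
         = complex_of_real (c (fst v) * c (snd v)) * cis (2*pi * of_int (\<nu> v) * x)" for v
      proof -
        have "cis (2*pi*(real (fst v))^2*x) * cis (2*pi*(real (snd v))^2*x) = cis (2*pi * of_int (\<nu> v) * x)"
          by (simp add: \<nu>_def cis_mult algebra_simps)
        thus ?thesis by (simp add: mult_ac)
      qed
      show ?thesis unfolding qsum_def sum_product sum.cartesian_product case_prod_beta pt ..
    qed
    finally show ?thesis .
  qed
  thus ?thesis using trig_parseval[of "S \<times> S" "\<lambda>v. c (fst v) * c (snd v)" \<nu>] S by simp
qed

text \<open>Expanding the squares gives a sum over pairs of equal frequency. Only frequencies up to
  M are expanded: there the products are nonnegative, so the pairs in \<open>E\<close> may be
  singled out; beyond M a complete square is dropped as a whole.\<close>

lemma sum_squares_ge_energy: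
  fixes A :: "'a \<Rightarrow> real" and \<nu> :: "'a \<Rightarrow> int"
  assumes V: "finite V" and pos: "\<And>v. v \<in> V \<Longrightarrow> \<nu> v \<le> M \<Longrightarrow> A v \<ge> 0" and b: "b \<ge> 0"
    and E: "\<And>v w. (v, w) \<in> E \<Longrightarrow> v \<in> V \<and> w \<in> V \<and> \<nu> v = \<nu> w \<and> \<nu> v \<le> M \<and> b \<le> A v \<and> b \<le> A w"
  shows "real (card E) * b^2 \<le> (\<Sum>m\<in>\<nu>`V. (\<Sum>v\<in>{v\<in>V. \<nu> v = m}. A v)^2)"
proof -
  define F where "F = {(v, w). v \<in> V \<and> w \<in> V \<and> \<nu> v = \<nu> w \<and> \<nu> v \<le> M}"
  have F: "finite F" by (rule finite_subset[of _ "V \<times> V"]) (auto simp: F_def V)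
  define h where "h = (\<lambda>(v, w). A v * A w)"
  have "real (card E) * b^2 = (\<Sum>z\<in>E. b * b)" by (simp add: power2_eq_square)
  also have "\<dots> \<le> (\<Sum>z\<in>E. h z)"
  proof (rule sum_mono)
    fix z assume z: "z \<in> E"
    obtain v w where "z = (v, w)" by (cases z)
    thus "b * b \<le> h z" using E[of v w] z b by (auto simp: h_def intro!: mult_mono)
  qed
  also have "\<dots> \<le> (\<Sum>z\<in>F. h z)"
    using E F pos by (intro sum_mono2) (auto simp: F_def h_def)
  also have "\<dots> = (\<Sum>m\<in>(\<lambda>z. \<nu> (fst z))`F. \<Sum>z\<in>{z\<in>F. \<nu> (fst z) = m}. h z)"
    by (rule sum.image_gen[OF F])
  also have "\<dots> = (\<Sum>m\<in>(\<lambda>z. \<nu> (fst z))`F. (\<Sum>v\<in>{v\<in>V. \<nu> v = m}. A v)^2)"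
  proof (rule sum.cong[OF refl])
    fix m assume "m \<in> (\<lambda>z. \<nu> (fst z))`F"
    hence "{z\<in>F. \<nu> (fst z) = m} = {v\<in>V. \<nu> v = m} \<times> {v\<in>V. \<nu> v = m}" by (auto simp: F_def)
    thus "(\<Sum>z\<in>{z\<in>F. \<nu> (fst z) = m}. h z) = (\<Sum>v\<in>{v\<in>V. \<nu> v = m}. A v)^2"
      by (simp add: h_def power2_eq_square sum_product sum.cartesian_product)
  qed
  also have "\<dots> \<le> (\<Sum>m\<in>\<nu>`V. (\<Sum>v\<in>{v\<in>V. \<nu> v = m}. A v)^2)"
    using V by (intro sum_mono2) (auto simp: F_def)
  finally show ?thesis .
qed

text \<open>On \<open>top_range u\<close>, with 2^u comparable to l^(-1/2), all coefficients are at
  least b, which has their common order; so the integral of the fourth power is at least b^4 times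
  the additive energy, and the logarithm of the energy is the one claimed.\<close>

lemma osc_L4_lower:
  "\<exists>c>0. \<exists>l0>0. \<forall>l N. 0 < l \<longrightarrow> l \<le> l0 \<longrightarrow> 1/l \<le> real N \<longrightarrow>
     c * (l powr (\<sigma> - 1/4) * ln (1/l) powr (1/4)) \<le> Lp_norm 4 (qsum (osc_coeff \<sigma> l) {1..N})"
proof -
  define e where "e = 2 - 2*\<sigma>"
  \<comment> \<open>The factors compare n with 2^u (ratio at most 80) and 2^u with l^(-1/2) (ratio
    at most 4), for either sign of e.\<close>
  define \<kappa> where "\<kappa> = 2 * (80 powr (-\<bar>e\<bar>) * 4 powr (-\<bar>e\<bar>))"
  have \<kappa>: "\<kappa> > 0" by (simp add: \<kappa>_def)
  define c where "c = (\<kappa>^4 / (16 * 16 * 6400)) powr (1/4)"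
  have c: "c > 0" using \<kappa> by (simp add: c_def)
  \<comment> \<open>ln(1/l) \<ge> 36 is what (u - 7)/4 \<ge> ln(1/l)/16 requires when u \<ge>
    ln(1/l)/2 - 2.\<close>
  define l0 :: real where "l0 = exp (-36)"
  have l0: "l0 > 0" by (simp add: l0_def)
  have "c * (l powr (\<sigma> - 1/4) * ln (1/l) powr (1/4)) \<le> Lp_norm 4 (qsum (osc_coeff \<sigma> l) {1..N})"
    if l: "0 < l" "l \<le> l0" and N: "1/l \<le> real N" for l N
  proof (rule Lp_norm_geI)
    define \<Lambda> where "\<Lambda> = ln (1/l)"
    have \<Lambda>: "\<Lambda> \<ge> 36"
    proof -
      have "ln l \<le> ln l0" using l l0 by simp
      thus ?thesis using l by (simp add: \<Lambda>_def ln_div l0_def)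
    qed
    have l4: "l \<le> 1/4"
    proof -
      have "(4::real) \<le> exp 36" using exp_ge_add_one_self[of 36] by simp
      hence "exp (-36) \<le> (1/4::real)" by (simp add: exp_minus field_simps)
      thus ?thesis using l by (simp add: l0_def)
    qed
    obtain i where i: "i \<ge> 1" "2 powr real i \<le> l powr (-(1/2))" "l powr (-(1/2)) \<le> 2 powr (real i + 1)"
      using dyadic_scale[OF l(1) l4] by blast
    define Y where "Y = l powr (-(1/2))"
    have Y: "Y > 0" "Y^2 * l = 1"
    proof -
      have "Y^2 = l powr (-(1/2)) * l powr (-(1/2))" by (simp add: Y_def power2_eq_square)
      also have "\<dots> = l powr (-1)" by (simp only: powr_add[symmetric]) simp
      finally show "Y^2 * l = 1" using l by (simp add: powr_minus_divide)
    qed (use l in \<open>simp add: Y_def\<close>)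
    define u where "u = i - 1"
    have iu: "i = u + 1" using i by (simp add: u_def)
    define U where "U = real (2^u)"
    have U: "2 * U \<le> Y" "Y \<le> 4 * U" "U > 0"
    proof -
      have "2 powr real i = 2 * U" by (simp add: iu U_def powr_add powr_realpow)
      thus "2 * U \<le> Y" "Y \<le> 4 * U" using i(2,3) by (simp_all add: Y_def powr_add)
    qed (simp add: U_def)
    have uL: "real u \<ge> \<Lambda> / 2 - 2"
    proof -
      have "ln Y \<le> ln (2 powr (real i + 1))" using i(3) Y(1) unfolding Y_def[symmetric] by (subst ln_le_cancel_iff) auto
      also have "\<dots> = (real i + 1) * ln 2" by (simp add: ln_powr)
      also have "\<dots> \<le> (real i + 1) * 1" using ln_le_minus_one[of "2::real"] by (intro mult_left_mono) auto
      finally have "ln Y \<le> real i + 1" by simp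
      moreover have "ln Y = \<Lambda> / 2" using l by (simp add: Y_def \<Lambda>_def ln_powr ln_div)
      ultimately show ?thesis using iu by simp
    qed
    have u7: "u \<ge> 7" using uL \<Lambda> by linarith
    define G where "G = top_range u"
    define S where "S = {1..N}"
    define \<nu> where "\<nu> v = int ((fst v)^2 + (snd v)^2)" for v :: "nat \<times> nat"
    define A where "A v = osc_coeff \<sigma> l (fst v) * osc_coeff \<sigma> l (snd v)" for v
    \<comment> \<open>A pair with n1^2 + n2^2 \<le> 1/(2l) has both entries in the range where the
      sine is positive.\<close>
    define M where "M = \<lfloor>1/(2*l)\<rfloor>"
    have small: "(real n)^2 * l \<le> 1/2" if "int (n^2) \<le> M" for n
    proof -
      have "of_int (int (n^2)) \<le> 1/(2*l)" using that unfolding M_def by (simp add: le_floor_iff)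
      thus ?thesis using l by (simp add: field_simps)
    qed
    have nonneg: "osc_coeff \<sigma> l n \<ge> 0" if "n \<ge> 1" "(real n)^2 * l \<le> 1/2" for n
    proof -
      have "2 * l * real n powr (2 - 2*\<sigma>) \<le> osc_coeff \<sigma> l n" by (rule osc_coeff_ge[OF l(1) that])
      moreover have "0 \<le> 2 * l * real n powr (2 - 2*\<sigma>)" using l by simp
      ultimately show ?thesis by linarith
    qed
    have GU: "real n \<le> U" "U \<le> 80 * real n" "n \<ge> 1" if "n \<in> G" for n
    proof -
      have n: "2^u \<le> 80 * n" "n \<le> 2^u" using that by (auto simp: G_def top_range_def)
      have "real n \<le> real (2^u)" using n(2) by (simp only: of_nat_le_iff)
      thus "real n \<le> U" by (simp add: U_def)
      have "real (2^u) \<le> real (80 * n)" using n(1) by (simp only: of_nat_le_iff)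
      thus le: "U \<le> 80 * real n" by (simp add: U_def)
      show "n \<ge> 1" using le U(3) by (cases n) auto
    qed
    have Gl: "(real n)^2 * l \<le> 1/4" if "n \<in> G" for n
    proof -
      have "(real n)^2 * l \<le> (Y/2)^2 * l" using GU(1)[OF that] U l by (intro mult_right_mono power_mono) auto
      also have "\<dots> = Y^2 * l / 4" by (simp add: power_divide)
      finally show ?thesis using Y(2) by simp
    qed
    have GN: "n \<in> S" if "n \<in> G" for n
      using osc_index_le[OF l(1) N, of n] Gl[OF that] GU(3)[OF that] by (simp add: S_def)
    define b where "b = \<kappa> * l * Y powr e"
    have b0: "b \<ge> 0" using \<kappa> l by (simp add: b_def)
    have Gb: "b \<le> osc_coeff \<sigma> l n" if n: "n \<in> G" for n
    proof -
      have "4 powr (-\<bar>e\<bar>) * Y powr e \<le> U powr e" using U by (intro powr_comparable) auto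
      hence "80 powr (-\<bar>e\<bar>) * (4 powr (-\<bar>e\<bar>) * Y powr e) \<le> 80 powr (-\<bar>e\<bar>) * U powr e" by (intro mult_left_mono) auto
      also have "\<dots> \<le> real n powr e" using GU[OF n] by (intro powr_comparable) auto
      finally have "2 * l * (80 powr (-\<bar>e\<bar>) * (4 powr (-\<bar>e\<bar>) * Y powr e)) \<le> 2 * l * real n powr e" using l by (intro mult_left_mono) auto
      also have "\<dots> \<le> osc_coeff \<sigma> l n" unfolding e_def using Gl[OF n] GU(3)[OF n] by (intro osc_coeff_ge l(1)) auto
      finally show ?thesis by (simp add: b_def \<kappa>_def mult_ac)
    qed
    have main: "real (card (energy_set G)) * (b^2)^2 \<le> (\<Sum>m\<in>\<nu>`(S\<times>S). (\<Sum>v\<in>{v\<in>S\<times>S. \<nu> v = m}. A v)^2)"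
    proof (rule sum_squares_ge_energy)
      show "finite (S \<times> S)" by (simp add: S_def)
      show "A v \<ge> 0" if v: "v \<in> S \<times> S" and vM: "\<nu> v \<le> M" for v
      proof -
        have "int ((fst v)^2) \<le> M" "int ((snd v)^2) \<le> M" using vM unfolding \<nu>_def by linarith+
        thus ?thesis unfolding A_def using v by (intro mult_nonneg_nonneg nonneg small) (auto simp: S_def)
      qed
      fix v w assume vw: "(v, w) \<in> energy_set G"
      obtain n1 n2 where v: "v = (n1, n2)" by (cases v)
      obtain n3 n4 where w: "w = (n3, n4)" by (cases w)
      have g: "n1 \<in> G" "n2 \<in> G" "n3 \<in> G" "n4 \<in> G" "n1^2 + n2^2 = n3^2 + n4^2"
        using vw by (auto simp: v w energy_set_def)
      have "of_int (\<nu> v) \<le> 1/(2*l)"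
      proof -
        have "((real n1)^2 + (real n2)^2) * l \<le> 1/2" using Gl[OF g(1)] Gl[OF g(2)] by (simp add: distrib_right)
        thus ?thesis using l by (simp add: \<nu>_def v field_simps)
      qed
      hence "\<nu> v \<le> M" by (simp add: M_def le_floor_iff)
      moreover have "b^2 \<le> A v" "b^2 \<le> A w" unfolding power2_eq_square A_def v w fst_conv snd_conv
        using b0 g Gb by (auto intro!: mult_mono intro: order.trans[OF b0])
      moreover have "\<nu> v = \<nu> w" using g(5) by (simp only: \<nu>_def v w fst_conv snd_conv)
      ultimately show "v \<in> S \<times> S \<and> w \<in> S \<times> S \<and> \<nu> v = \<nu> w \<and> \<nu> v \<le> M \<and> b^2 \<le> A v \<and> b^2 \<le> A w"
        using g GN by (simp add: v w)
    qed simp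
    have en: "\<Lambda>/16 * (Y^2 / 16 / 6400) \<le> real (card (energy_set G))"
    proof -
      have "Y^2 \<le> (4*U)^2" using U Y(1) by (intro power_mono) auto
      also have "\<dots> = 16 * 4^u" by (simp add: U_def power_mult_distrib four_power)
      finally have "Y^2 / 16 \<le> 4^u" by simp
      moreover have "\<Lambda>/16 \<le> (real u - 7)/4" using uL \<Lambda> by simp
      ultimately have "\<Lambda>/16 * (Y^2 / 16 / 6400) \<le> (real u - 7)/4 * (4^u / 6400)"
        using \<Lambda> by (intro mult_mono divide_right_mono) auto
      also have "\<dots> \<le> real (card (energy_set G))" unfolding G_def by (rule energy_lower[OF u7])
      finally show ?thesis .
    qed
    have "(c * (l powr (\<sigma> - 1/4) * \<Lambda> powr (1/4))) powr 4 = \<Lambda>/16 * (Y^2 / 16 / 6400) * (b^2)^2"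
    proof -
      have "(c * (l powr (\<sigma> - 1/4) * \<Lambda> powr (1/4))) powr 4 = c powr 4 * ((l powr (\<sigma> - 1/4)) powr 4 * (\<Lambda> powr (1/4)) powr 4)"
        by (simp only: powr_mult)
      also have "c powr 4 = \<kappa>^4 / (16 * 16 * 6400)" unfolding c_def powr_powr using \<kappa> by simp
      also have "(\<Lambda> powr (1/4)) powr 4 = \<Lambda>" unfolding powr_powr using \<Lambda> by simp
      also have "(l powr (\<sigma> - 1/4)) powr 4 = l^4 * (Y^2 * (Y powr e)^4)"
      proof -
        have "(Y powr e)^4 = l powr (-(1/2) * e * 4)"
        proof -
          have "(Y powr e)^4 = (Y powr e) powr 4" using Y by simp
          thus ?thesis by (simp only: Y_def powr_powr)
        qed
        moreover have "Y^2 = l powr (-(1/2) * 2)"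
        proof -
          have "Y^2 = Y powr 2" using Y by simp
          thus ?thesis by (simp only: Y_def powr_powr)
        qed
        moreover have "l^4 = l powr 4" using l by simp
        ultimately have "l^4 * (Y^2 * (Y powr e)^4) = l powr (4 + (-(1/2) * 2 + -(1/2) * e * 4))" by (simp only: powr_add)
        thus ?thesis unfolding powr_powr by (simp add: e_def algebra_simps)
      qed
      finally show ?thesis by (simp add: b_def power_mult_distrib)
    qed
    also have "\<dots> \<le> real (card (energy_set G)) * (b^2)^2" using en by (intro mult_right_mono) auto
    also note main
    also have "(\<Sum>m\<in>\<nu>`(S\<times>S). (\<Sum>v\<in>{v\<in>S\<times>S. \<nu> v = m}. A v)^2) = integral {0..1} (\<lambda>x. cmod (qsum (osc_coeff \<sigma> l) {1..N} x) powr 4)"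
      unfolding A_def \<nu>_def S_def by (rule integral_qsum_power4[symmetric]) simp
    finally show "(c * (l powr (\<sigma> - 1/4) * ln (1/l) powr (1/4))) powr 4 \<le> integral {0..1} (\<lambda>x. cmod (qsum (osc_coeff \<sigma> l) {1..N} x) powr 4)"
      by (simp only: \<Lambda>_def)
  qed (use l c in auto)
  thus ?thesis using c l0 by blast
qed

section \<open>The limit function\<close>

lemma Rs_partial_eq_qsum: "Rs_partial \<sigma> N = qsum (\<lambda>n. real n powr (-(2*\<sigma>))) {1..N}"
  by (rule ext) (simp add: Rs_partial_def qsum_def)

lemma nn_integral_cmod_powr:
  fixes f :: "real \<Rightarrow> complex"
  assumes "continuous_on UNIV f" "p > 0"
  shows "(\<integral>\<^sup>+ x\<in>{0..1}. ennreal (cmod (f x) powr p) \<partial>lborel) = ennreal (integral {0..1} (\<lambda>x. cmod (f x) powr p))"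
  using integrable_cmod_powr[OF assms] by (intro nn_integral_has_integral_lebesgue' integrable_integral) auto

lemma borel_measurable_qsum [measurable]: "qsum c A \<in> borel_measurable borel"
  by (rule borel_measurable_continuous_onI) (rule continuous_qsum)

lemma qsum_split:
  assumes "1 \<le> M" "M \<le> B" shows "qsum c {1..<B} x = qsum c {1..<M} x + qsum c {M..<B} x"
proof -
  have "{1..<B} = {1..<M} \<union> {M..<B}" using assms by auto
  thus ?thesis using qsum_Un[of "{1..<M}" "{M..<B}" c x] by auto
qed

lemma Rs_tail_bound:
  assumes q: "q > 2" and s: "weyl_exp q < 2 * \<sigma>"
  obtains \<tau> where "\<And>i. \<tau> i > 0" "summable \<tau>"
    "\<And>i B. Lp_norm q (qsum (\<lambda>n. real n powr (-(2*\<sigma>))) {2^i..<B}) \<le> \<tau> i"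
proof -
  have neg: "-(2*\<sigma>) + weyl_exp q < 0" using s by simp
  obtain C where C: "C > 0" "\<And>i B. Lp_norm q (qsum (\<lambda>n. real n powr (-(2*\<sigma>))) {2^i..<B})
      \<le> C * (2 powr (real i * (-(2*\<sigma>) + weyl_exp q)) * (1 + real i) powr weyl_log q)" using power_tail_norm[OF q neg] by blast
  define t where "t i = 2 powr (real i * (-(2*\<sigma>) + weyl_exp q)) * (1 + real i) powr weyl_log q" for i
  obtain C2 where C2: "\<And>i J. (\<Sum>j\<in>{i..<J}. t j) \<le> C2 * t i"
    using dyadic_sum_decreasing[OF neg weyl_log_nonneg weyl_log_le, of q] unfolding t_def by blast
  have "summable t"
    using C2[of 0] by (intro summableI_nonneg_bounded[of t "C2 * t 0"]) (auto simp: t_def lessThan_atLeast0)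
  hence "summable (\<lambda>i. C * t i)" by (rule summable_mult)
  thus ?thesis using C by (intro that[of "\<lambda>i. C * t i"]) (auto simp: t_def add_nonneg_eq_0_iff)
qed

text \<open>The exponent \<open>q\<close> gives access to the Weyl bound also when p is small. The
  dyadic blocks are summable in the 1-norm, so the dyadic partial sums converge almost everywhere,
  and Fatou carries the tail bound to the limit. Comparing with the partial sum at any N \<ge> 2^i -
  1 gives convergence of the whole sequence, not only of the dyadic one.\<close>

lemma is_Rs_exists:
  assumes p: "p > 0" "p \<le> q" and q: "q > 2" and s: "weyl_exp q < 2 * \<sigma>"
  shows "\<exists>f. is_Rs \<sigma> p f"
proof -
  define c where "c n = real n powr (-(2*\<sigma>))" for n :: nat
  obtain \<tau> where \<tau>: "\<And>i. \<tau> i > 0" "summable \<tau>" "\<And>i B. Lp_norm q (qsum c {2^i..<B}) \<le> \<tau> i"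
    using Rs_tail_bound[OF q s] unfolding c_def by metis
  define u where "u j = qsum c {1..<2^j}" for j
  define d where "d j = qsum c {2^j..<2^Suc j}" for j
  have ud: "u j x = (\<Sum>i<j. d i x)" for j x
  proof (induction j)
    case (Suc j)
    have "u (Suc j) x = u j x + d j x" unfolding u_def d_def by (rule qsum_split) auto
    thus ?case using Suc by simp
  qed (simp add: u_def)
  have d1: "integral {0..1} (\<lambda>x. cmod (d j x) powr 1) \<le> 2 * \<tau> j" for j
  proof -
    have "Lp_norm 1 (d j) \<le> 2 powr (1/1) * \<tau> j"
      unfolding d_def using q \<tau> by (intro Lp_norm_mono_exponent[of 1 q] continuous_qsum) auto
    from Lp_norm_leD[OF _ this] show ?thesis using \<tau>(1)[of j] by simp
  qed
  have "(\<integral>\<^sup>+ x. (\<Sum>j. ennreal (cmod (d j x) powr 1) * indicator {0..1} x) \<partial>lborel) = (\<Sum>j. \<integral>\<^sup>+ x\<in>{0..1}. ennreal (cmod (d j x) powr 1) \<partial>lborel)"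
    unfolding d_def by (intro nn_integral_suminf) measurable
  also have "\<dots> = (\<Sum>j. ennreal (integral {0..1} (\<lambda>x. cmod (d j x) powr 1)))"
    unfolding d_def by (subst nn_integral_cmod_powr) (auto intro: continuous_qsum)
  also have "\<dots> \<le> (\<Sum>j. ennreal (2 * \<tau> j))" using d1 by (intro suminf_le) (auto intro!: ennreal_leI)
  also have "\<dots> = ennreal (\<Sum>j. 2 * \<tau> j)" using \<tau> by (intro suminf_ennreal2 summable_mult) (auto simp: less_imp_le)
  also have "\<dots> < \<infinity>" by simp
  finally have "(\<integral>\<^sup>+ x. (\<Sum>j. ennreal (cmod (d j x) powr 1) * indicator {0..1} x) \<partial>lborel) \<noteq> \<infinity>" by simp
  hence "AE x in lborel. (\<Sum>j. ennreal (cmod (d j x) powr 1) * indicator {0..1} x) \<noteq> \<infinity>"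
    by (intro nn_integral_PInf_AE) (unfold d_def, measurable)
  hence conv: "AE x in lborel. x \<in> {0..1} \<longrightarrow> (\<lambda>j. u j x) \<longlonglongrightarrow> lim (\<lambda>j. u j x)"
  proof eventually_elim
    case (elim x)
    show ?case
    proof
      assume "x \<in> {0..1}"
      hence "(\<Sum>j. ennreal (cmod (d j x))) \<noteq> top" using elim by simp
      hence "summable (\<lambda>j. cmod (d j x))" by (intro summable_suminf_not_top) auto
      hence "summable (\<lambda>j. d j x)" by (rule summable_norm_cancel)
      hence "convergent (\<lambda>j. u j x)" unfolding ud summable_iff_convergent .
      thus "(\<lambda>j. u j x) \<longlonglongrightarrow> lim (\<lambda>j. u j x)" by (simp add: convergent_LIMSEQ_iff)
    qed
  qed
  \<comment> \<open>Where the sums diverge \<open>lim\<close> is some default value; this happens on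
    a null set only, and f is still Borel measurable.\<close>
  define f where "f x = lim (\<lambda>j. u j x)" for x
  have fm: "f \<in> borel_measurable borel" unfolding f_def[abs_def] u_def by measurable
  define a where "a N = (\<integral>\<^sup>+ x\<in>{0..1}. ennreal (cmod (f x - Rs_partial \<sigma> N x) powr p) \<partial>lborel)" for N
  have key: "a N \<le> ennreal ((2 powr (1/p) * (2 * \<tau> i)) powr p)" if iN: "2^i \<le> N + 1" for i N
  proof -
    have diff: "integral {0..1} (\<lambda>x. cmod (u j x - Rs_partial \<sigma> N x) powr p) \<le> (2 powr (1/p) * (2 * \<tau> i)) powr p" if j: "j \<ge> i" for j
    proof -
      \<comment> \<open>The two sums share everything below 2^i, and each remainder is a tail
        bounded by \<tau> i.\<close>
      have "(\<lambda>x. u j x - Rs_partial \<sigma> N x) = (\<lambda>x. qsum c {2^i..<2^j} x - qsum c {2^i..<N+1} x)"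
      proof
        fix x
        have "(2::nat)^i \<le> 2^j" using j by (intro power_increasing) auto
        hence "u j x = qsum c {1..<2^i} x + qsum c {2^i..<2^j} x" unfolding u_def by (intro qsum_split) auto
        moreover have "Rs_partial \<sigma> N x = qsum c {1..<N+1} x"
          unfolding Rs_partial_eq_qsum c_def by (simp add: atLeastLessThanSuc_atLeastAtMost)
        moreover have "qsum c {1..<N+1} x = qsum c {1..<2^i} x + qsum c {2^i..<N+1} x"
          using iN by (intro qsum_split) auto
        ultimately show "u j x - Rs_partial \<sigma> N x = qsum c {2^i..<2^j} x - qsum c {2^i..<N+1} x" by simp
      qed
      moreover have "Lp_norm q (\<lambda>x. qsum c {2^i..<2^j} x - qsum c {2^i..<N+1} x) \<le> 2 * \<tau> i"
        using q \<tau>(3)[of i "2^j"] \<tau>(3)[of i "N+1"]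
          Lp_norm_diff[of q "qsum c {2^i..<2^j}" "qsum c {2^i..<N+1}"] by (simp add: continuous_qsum)
      ultimately have "Lp_norm q (\<lambda>x. u j x - Rs_partial \<sigma> N x) \<le> 2 * \<tau> i" by simp
      hence "Lp_norm p (\<lambda>x. u j x - Rs_partial \<sigma> N x) \<le> 2 powr (1/p) * (2 * \<tau> i)"
        using p \<tau>(1)[of i] unfolding u_def Rs_partial_eq_qsum
        by (intro Lp_norm_mono_exponent[OF p] continuous_on_diff continuous_qsum) auto
      thus ?thesis using p by (intro Lp_norm_leD)
    qed
    have "a N = (\<integral>\<^sup>+ x. liminf (\<lambda>j. ennreal (cmod (u j x - Rs_partial \<sigma> N x) powr p) * indicator {0..1} x) \<partial>lborel)"
      unfolding a_def
    proof (rule nn_integral_cong_AE)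
      show "AE x in lborel. ennreal (cmod (f x - Rs_partial \<sigma> N x) powr p) * indicator {0..1} x
          = liminf (\<lambda>j. ennreal (cmod (u j x - Rs_partial \<sigma> N x) powr p) * indicator {0..1} x)"
        using conv
      proof eventually_elim
        case (elim x)
        show ?case
        proof (cases "x \<in> {0..1}")
          case True
          hence "(\<lambda>j. u j x) \<longlonglongrightarrow> f x" using elim by (simp add: f_def)
          hence "(\<lambda>j. ennreal (cmod (u j x - Rs_partial \<sigma> N x) powr p)) \<longlonglongrightarrow> ennreal (cmod (f x - Rs_partial \<sigma> N x) powr p)"
            using p by (intro tendsto_ennrealI tendsto_powr2 tendsto_norm tendsto_diff tendsto_const) auto
          from lim_imp_Liminf[OF _ this] show ?thesis using True by simp
        qed (simp add: Liminf_const)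
      qed
    qed
    also have "\<dots> \<le> liminf (\<lambda>j. \<integral>\<^sup>+ x. ennreal (cmod (u j x - Rs_partial \<sigma> N x) powr p) * indicator {0..1} x \<partial>lborel)"
      unfolding u_def Rs_partial_eq_qsum by (intro nn_integral_liminf) measurable
    also have "\<dots> \<le> limsup (\<lambda>j. \<integral>\<^sup>+ x. ennreal (cmod (u j x - Rs_partial \<sigma> N x) powr p) * indicator {0..1} x \<partial>lborel)"
      by (rule Liminf_le_Limsup) simp
    also have "\<dots> \<le> ennreal ((2 powr (1/p) * (2 * \<tau> i)) powr p)"
    proof (rule Limsup_bounded)
      show "\<forall>\<^sub>F j in sequentially. (\<integral>\<^sup>+ x. ennreal (cmod (u j x - Rs_partial \<sigma> N x) powr p) * indicator {0..1} x \<partial>lborel) \<le> ennreal ((2 powr (1/p) * (2 * \<tau> i)) powr p)"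
        using eventually_ge_at_top[of i]
      proof eventually_elim
        case (elim j)
        have "continuous_on UNIV (\<lambda>x. u j x - Rs_partial \<sigma> N x)"
          unfolding u_def Rs_partial_eq_qsum by (intro continuous_on_diff continuous_qsum)
        from nn_integral_cmod_powr[OF this p(1)] diff[OF elim] show ?case by (simp add: ennreal_leI)
      qed
    qed
    finally show ?thesis .
  qed
  have "a \<longlonglongrightarrow> 0"
  proof (rule order_tendstoI)
    fix b :: ennreal assume b: "b > 0"
    have "(\<lambda>i. 2 powr (1/p) * (2 * \<tau> i)) \<longlonglongrightarrow> 2 powr (1/p) * (2 * 0)"
      by (intro tendsto_intros summable_LIMSEQ_zero \<tau>)
    hence "(\<lambda>i. (2 powr (1/p) * (2 * \<tau> i)) powr p) \<longlonglongrightarrow> 0"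
      using \<tau>(1) p by (intro tendsto_zero_powrI[where b = p] tendsto_const) (auto simp: less_imp_le)
    hence "(\<lambda>i. ennreal ((2 powr (1/p) * (2 * \<tau> i)) powr p)) \<longlonglongrightarrow> ennreal 0" by (rule tendsto_ennrealI)
    hence "\<forall>\<^sub>F i in sequentially. ennreal ((2 powr (1/p) * (2 * \<tau> i)) powr p) < b"
      using b by (intro order_tendstoD(2)) auto
    then obtain i where i: "ennreal ((2 powr (1/p) * (2 * \<tau> i)) powr p) < b" by (auto simp: eventually_sequentially)
    show "\<forall>\<^sub>F N in sequentially. a N < b"
      using eventually_ge_at_top[of "2^i"]
    proof eventually_elim
      case (elim N) thus ?case using key[of i N] i by (auto intro: le_less_trans)
    qed
  qed simp
  thus ?thesis using fm unfolding is_Rs_def a_def by (intro exI[of _ f]) auto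
qed

section \<open>Comparison of the limit function with its partial sums\<close>

lemma powr_add_le_double:
  fixes x y p :: real
  assumes "0 \<le> x" "0 \<le> y" "p > 0"
  shows "(x + y) powr p \<le> 2 powr p * (x powr p + y powr p)"
proof -
  have "(x + y) powr p \<le> (2 * max x y) powr p" using assms by (intro powr_mono2) auto
  also have "\<dots> = 2 powr p * max x y powr p" using assms by (simp add: powr_mult)
  also have "\<dots> \<le> 2 powr p * (x powr p + y powr p)" by (intro mult_left_mono) (auto simp: max_def)
  finally show ?thesis .
qed

text \<open>The wrapped translate is covered by two ordinary translates of h cut off to [0,1], each
  counted in full. The factor 2 is harmless since it multiplies an error tending to 0.\<close>

lemma nn_integral_frac_shift_le:
  fixes h :: "real \<Rightarrow> ennreal"
  assumes h [measurable]: "h \<in> borel_measurable borel" and l: "0 < l" "l < 1"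
  shows "(\<integral>\<^sup>+ x\<in>{0..1}. h (frac (x + l)) \<partial>lborel) \<le> 2 * (\<integral>\<^sup>+ x\<in>{0..1}. h x \<partial>lborel)"
proof -
  define k where "k x = h x * indicator {0..1} x" for x
  have [measurable]: "k \<in> borel_measurable borel" unfolding k_def[abs_def] by measurable
  have shift: "(\<integral>\<^sup>+ x. k (x + t) \<partial>lborel) = (\<integral>\<^sup>+ x. k x \<partial>lborel)" for t
    using nn_integral_real_affine[of k 1 t] by (simp add: add.commute)
  have "(\<integral>\<^sup>+ x\<in>{0..1}. h (frac (x + l)) \<partial>lborel) \<le> (\<integral>\<^sup>+ x. k (x + l) + k (x + (l - 1)) \<partial>lborel)"
  proof (rule nn_integral_mono)
    fix x :: real
    show "h (frac (x + l)) * indicator {0..1} x \<le> k (x + l) + k (x + (l - 1))"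
    proof (cases "x \<in> {0..1}")
      case True
      show ?thesis
      proof (cases "x + l < 1")
        case t: True
        hence "frac (x + l) = x + l" using True l by (simp add: frac_eq)
        thus ?thesis using True t l by (simp add: k_def add_increasing2)
      next
        case t: False
        hence "\<lfloor>x + l\<rfloor> = 1" using True l by (simp add: floor_eq_iff)
        hence "frac (x + l) = x + (l - 1)" by (simp add: frac_def)
        thus ?thesis using True t l by (simp add: k_def add_increasing)
      qed
    qed simp
  qed
  also have "\<dots> = (\<integral>\<^sup>+ x. k (x + l) \<partial>lborel) + (\<integral>\<^sup>+ x. k (x + (l - 1)) \<partial>lborel)"
    by (intro nn_integral_add) measurable
  also have "\<dots> = 2 * (\<integral>\<^sup>+ x. k x \<partial>lborel)" by (simp only: shift mult_2)
  finally show ?thesis by (simp add: k_def)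
qed

lemma qsum_frac: "qsum c A (frac y) = qsum c A y"
proof -
  have p: "qsum c A (x + real n) = qsum c A x" for x n
  proof (induction n)
    case (Suc n) thus ?case using qsum_periodic[of c A "x + real n"] by (simp add: add_ac)
  qed simp
  show ?thesis
  proof (cases "\<lfloor>y\<rfloor> \<ge> 0")
    case True
    thus ?thesis using p[of "frac y" "nat \<lfloor>y\<rfloor>"] by (simp add: frac_def)
  next
    case False
    thus ?thesis using p[of y "nat (- \<lfloor>y\<rfloor>)"] by (simp add: frac_def)
  qed
qed

lemma nn_integral_powr_add_le:
  fixes f g :: "real \<Rightarrow> real"
  assumes [measurable]: "f \<in> borel_measurable borel" "g \<in> borel_measurable borel" "h \<in> borel_measurable borel"
    and le: "\<And>x. x \<in> {0..1} \<Longrightarrow> h x \<le> f x + g x" and nn: "\<And>x. 0 \<le> f x" "\<And>x. 0 \<le> g x" "\<And>x. 0 \<le> h x" and p: "p > 0"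
  shows "(\<integral>\<^sup>+ x\<in>{0..1}. ennreal (h x powr p) \<partial>lborel) \<le>
     ennreal (2 powr p) * ((\<integral>\<^sup>+ x\<in>{0..1}. ennreal (f x powr p) \<partial>lborel) + (\<integral>\<^sup>+ x\<in>{0..1}. ennreal (g x powr p) \<partial>lborel))"
proof -
  have "(\<integral>\<^sup>+ x\<in>{0..1}. ennreal (h x powr p) \<partial>lborel) \<le>
     (\<integral>\<^sup>+ x. ennreal (2 powr p) * (ennreal (f x powr p) * indicator {0..1} x + ennreal (g x powr p) * indicator {0..1} x) \<partial>lborel)"
  proof (rule nn_integral_mono)
    fix x :: real
    show "ennreal (h x powr p) * indicator {0..1} x \<le> ennreal (2 powr p) * (ennreal (f x powr p) * indicator {0..1} x + ennreal (g x powr p) * indicator {0..1} x)"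
    proof (cases "x \<in> {0..1}")
      case True
      have "h x powr p \<le> (f x + g x) powr p" using le[OF True] nn[of x] p by (intro powr_mono2) auto
      also have "\<dots> \<le> 2 powr p * (f x powr p + g x powr p)" using nn p by (intro powr_add_le_double) auto
      finally have "ennreal (h x powr p) \<le> ennreal (2 powr p * (f x powr p + g x powr p))" by (rule ennreal_leI)
      thus ?thesis using True by (simp add: ennreal_mult ennreal_plus)
    qed simp
  qed
  also have "\<dots> = ennreal (2 powr p) * ((\<integral>\<^sup>+ x\<in>{0..1}. ennreal (f x powr p) \<partial>lborel) + (\<integral>\<^sup>+ x\<in>{0..1}. ennreal (g x powr p) \<partial>lborel))"
    by (subst nn_integral_cmult, measurable, subst nn_integral_add) auto
  finally show ?thesis .
qed

text \<open>The increments of f and of the partial sum differ by two approximation errors, one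
  translated (2 a N) and one not (a N). The quasi-triangle inequality used here holds for every p >
  0 and costs a factor K at each use.\<close>

lemma difference_nn_integral_compare:
  assumes f: "is_Rs \<sigma> p f" and p: "p > 0" and l: "0 < l" "l < 1"
  defines "G \<equiv> \<integral>\<^sup>+ x\<in>{0..1}. ennreal (cmod (f (frac (x + l)) - f x) powr p) \<partial>lborel"
    and "a \<equiv> \<lambda>N. \<integral>\<^sup>+ x\<in>{0..1}. ennreal (cmod (f x - Rs_partial \<sigma> N x) powr p) \<partial>lborel"
    and "d \<equiv> \<lambda>N. ennreal ((2 * Lp_norm p (qsum (osc_coeff \<sigma> l) {1..N})) powr p)"
    and "K \<equiv> ennreal (2 powr p)"
  shows "G \<le> K * (d N + K * (3 * a N))" "d N \<le> K * (G + K * (3 * a N))"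
proof -
  have fm [measurable]: "f \<in> borel_measurable borel" using f by (simp add: is_Rs_def)
  define P where "P = qsum (\<lambda>n. real n powr (-(2*\<sigma>))) {1..N}"
  have P: "Rs_partial \<sigma> N = P" by (simp add: P_def Rs_partial_eq_qsum)
  have [measurable]: "P \<in> borel_measurable borel" unfolding P_def by measurable
  define D where "D x = P (x + l) - P x" for x
  have Dm [measurable]: "D \<in> borel_measurable borel" unfolding D_def[abs_def] by measurable
  define g where "g x = f (frac (x + l)) - f x" for x
  have gm [measurable]: "g \<in> borel_measurable borel" unfolding g_def[abs_def] frac_def[abs_def] by measurable
  have Dint: "(\<integral>\<^sup>+ x\<in>{0..1}. ennreal (cmod (D x) powr p) \<partial>lborel) = d N"
  proof -
    have cD: "continuous_on UNIV D" unfolding D_def[abs_def] P_def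
      by (intro continuous_on_diff continuous_on_compose2[OF continuous_qsum[of UNIV]] continuous_intros) auto
    have "Lp_norm p D = 2 * Lp_norm p (qsum (osc_coeff \<sigma> l) {1..N})"
      unfolding D_def[abs_def] P_def osc_coeff_def[abs_def] using p by (rule Lp_norm_difference)
    hence "integral {0..1} (\<lambda>x. cmod (D x) powr p) = (2 * Lp_norm p (qsum (osc_coeff \<sigma> l) {1..N})) powr p"
      using Lp_norm_powr[OF p, of D] by simp
    thus ?thesis using nn_integral_cmod_powr[OF cD p] by (simp add: d_def)
  qed
  have err: "(\<integral>\<^sup>+ x\<in>{0..1}. ennreal (cmod (g x - D x) powr p) \<partial>lborel) \<le> K * (3 * a N)"
  proof -
    have "(\<integral>\<^sup>+ x\<in>{0..1}. ennreal (cmod (g x - D x) powr p) \<partial>lborel) \<le>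
      K * ((\<integral>\<^sup>+ x\<in>{0..1}. ennreal (cmod (f (frac (x+l)) - P (frac (x+l))) powr p) \<partial>lborel) + (\<integral>\<^sup>+ x\<in>{0..1}. ennreal (cmod (f x - P x) powr p) \<partial>lborel))"
      unfolding K_def
    proof (rule nn_integral_powr_add_le)
      show "cmod (g x - D x) \<le> cmod (f (frac (x+l)) - P (frac (x+l))) + cmod (f x - P x)" for x
      proof -
        have "g x - D x = (f (frac (x+l)) - P (frac (x+l))) - (f x - P x)" by (simp add: g_def D_def P_def qsum_frac)
        thus ?thesis using norm_triangle_ineq4[of "f (frac (x+l)) - P (frac (x+l))" "f x - P x"] by simp
      qed
    qed (use p in \<open>auto simp: frac_def\<close>)
    also have "\<dots> \<le> K * (2 * a N + a N)"
      using nn_integral_frac_shift_le[of "\<lambda>x. ennreal (cmod (f x - P x) powr p)" l] l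
      by (intro mult_left_mono add_mono) (auto simp: a_def P)
    also have "2 * a N + a N = 3 * a N"
      using distrib_right[of 2 1 "a N"] by simp
    finally show ?thesis .
  qed
  have "G \<le> K * ((\<integral>\<^sup>+ x\<in>{0..1}. ennreal (cmod (D x) powr p) \<partial>lborel) + (\<integral>\<^sup>+ x\<in>{0..1}. ennreal (cmod (g x - D x) powr p) \<partial>lborel))"
    unfolding G_def K_def g_def[symmetric]
  proof (rule nn_integral_powr_add_le)
    show "cmod (g x) \<le> cmod (D x) + cmod (g x - D x)" for x using norm_triangle_ineq[of "D x" "g x - D x"] by simp
  qed (use p in auto)
  also have "\<dots> \<le> K * (d N + K * (3 * a N))" using err by (intro mult_left_mono add_mono) (auto simp: Dint)
  finally show "G \<le> K * (d N + K * (3 * a N))" .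
  have "d N \<le> K * ((\<integral>\<^sup>+ x\<in>{0..1}. ennreal (cmod (g x) powr p) \<partial>lborel) + (\<integral>\<^sup>+ x\<in>{0..1}. ennreal (cmod (g x - D x) powr p) \<partial>lborel))"
    unfolding Dint[symmetric] K_def
  proof (rule nn_integral_powr_add_le)
    show "cmod (D x) \<le> cmod (g x) + cmod (g x - D x)" for x using norm_triangle_ineq4[of "g x" "g x - D x"] by simp
  qed (use p in auto)
  also have "\<dots> \<le> K * (G + K * (3 * a N))" using err by (intro mult_left_mono add_mono) (auto simp: G_def g_def)
  finally show "d N \<le> K * (G + K * (3 * a N))" .
qed

text \<open>For fixed l the error a N tends to 0, so N may be chosen so large, depending on l, that
  the error is dominated by A; what is lost is a factor depending on p alone.\<close>

lemma S_sp_compare: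
  assumes ex: "\<exists>f. is_Rs \<sigma> p f" and p: "p > 0" and l: "0 < l" "l < 1"
  shows S_sp_upper: "\<And>A N0. A > 0 \<Longrightarrow> (\<And>N. N \<ge> N0 \<Longrightarrow> Lp_norm p (qsum (osc_coeff \<sigma> l) {1..N}) \<le> A)
      \<Longrightarrow> S_sp \<sigma> p l powr (1/p) \<le> (2 * 2 powr p) powr (1/p) * (2 * A)"
    and S_sp_lower: "\<And>A N0. A > 0 \<Longrightarrow> (\<And>N. N \<ge> N0 \<Longrightarrow> A \<le> Lp_norm p (qsum (osc_coeff \<sigma> l) {1..N}))
      \<Longrightarrow> 2 * A \<le> (2 * 2 powr p) powr (1/p) * S_sp \<sigma> p l powr (1/p)"
proof -
  define f where "f = Rs \<sigma> p"
  have f: "is_Rs \<sigma> p f" unfolding f_def Rs_def using ex by (rule someI_ex)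
  have fm [measurable]: "f \<in> borel_measurable borel" using f by (simp add: is_Rs_def)
  define G where "G = (\<integral>\<^sup>+ x\<in>{0..1}. ennreal (cmod (f (frac (x + l)) - f x) powr p) \<partial>lborel)"
  define a where "a N = (\<integral>\<^sup>+ x\<in>{0..1}. ennreal (cmod (f x - Rs_partial \<sigma> N x) powr p) \<partial>lborel)" for N
  define L where "L N = Lp_norm p (qsum (osc_coeff \<sigma> l) {1..N})" for N
  define k where "k = 2 powr p"
  have k: "k > 0" by (simp add: k_def)
  have cmp: "G \<le> ennreal k * (ennreal ((2 * L N) powr p) + ennreal k * (3 * a N))"
      "ennreal ((2 * L N) powr p) \<le> ennreal k * (G + ennreal k * (3 * a N))" for N
    unfolding G_def a_def L_def k_def by (rule difference_nn_integral_compare[OF f p l])+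
  have a0: "a \<longlonglongrightarrow> 0" using f by (simp add: is_Rs_def a_def[abs_def])
  have small: "\<exists>N\<ge>N0. a N \<le> ennreal e" if "e > 0" for e N0
  proof -
    have "\<forall>\<^sub>F N in sequentially. a N < ennreal e" using that by (intro order_tendstoD(2)[OF a0]) auto
    then obtain N1 where "\<And>N. N \<ge> N1 \<Longrightarrow> a N < ennreal e" by (auto simp: eventually_sequentially)
    thus ?thesis by (intro exI[of _ "max N0 N1"]) (auto simp: less_imp_le)
  qed
  have sum_enn: "ennreal k * (ennreal x + ennreal k * (3 * ennreal e)) = ennreal (k * (x + k * (3 * e)))" if "x \<ge> 0" "e \<ge> 0" for x e
    using that k by (simp add: ennreal_mult ennreal_plus flip: ennreal_numeral)
  \<comment> \<open>Finiteness must be known before the integral in \<open>S_sp\<close> is read off: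
    a divergent one would default to 0, and no lower bound could hold.\<close>
  have Gfin: "G < top"
  proof -
    obtain N where N: "a N \<le> ennreal 1" using small[of 1 0] by auto
    have "G \<le> ennreal k * (ennreal ((2 * L N) powr p) + ennreal k * (3 * ennreal 1))"
      using N by (intro order.trans[OF cmp(1)[of N]] mult_left_mono add_mono) auto
    also have "\<dots> < top" by (subst sum_enn) auto
    finally show ?thesis .
  qed
  have S: "S_sp \<sigma> p l = enn2real G"
  proof -
    have "S_sp \<sigma> p l = (\<integral>x. indicator {0..1} x * cmod (f (frac (x + l)) - f x) powr p \<partial>lborel)"
      by (simp add: S_sp_def set_lebesgue_integral_def f_def)
    also have "\<dots> = enn2real (\<integral>\<^sup>+ x. ennreal (indicator {0..1} x * cmod (f (frac (x + l)) - f x) powr p) \<partial>lborel)"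
    proof (rule integral_eq_nn_integral)
      have "(\<lambda>x. f (x + l - of_int \<lfloor>x + l\<rfloor>)) \<in> borel_measurable borel" by measurable
      thus "(\<lambda>x. indicator {0..1} x * cmod (f (frac (x + l)) - f x) powr p) \<in> borel_measurable lborel"
        unfolding frac_def by measurable
    qed auto
    also have "(\<integral>\<^sup>+ x. ennreal (indicator {0..1} x * cmod (f (frac (x + l)) - f x) powr p) \<partial>lborel) = G"
      unfolding G_def by (intro nn_integral_cong) (auto simp: indicator_def)
    finally show ?thesis .
  qed
  have GS: "G = ennreal (S_sp \<sigma> p l)" unfolding S using Gfin by simp
  have S0: "S_sp \<sigma> p l \<ge> 0" by (simp add: S)
  {
    fix A :: real and N0 assume A: "A > 0" and le: "\<And>N. N \<ge> N0 \<Longrightarrow> Lp_norm p (qsum (osc_coeff \<sigma> l) {1..N}) \<le> A"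
    define b where "b = (2 * A) powr p"
    have b: "b > 0" using A by (simp add: b_def)
    obtain N where N: "N \<ge> N0" "a N \<le> ennreal (b / (3 * k))" using small[of "b / (3 * k)" N0] b k by auto
    have "(2 * L N) powr p \<le> b" unfolding b_def L_def using le[OF N(1)] p by (intro powr_mono2) auto
    hence "G \<le> ennreal k * (ennreal b + ennreal k * (3 * ennreal (b / (3 * k))))"
      using N(2) by (intro order.trans[OF cmp(1)[of N]] mult_left_mono add_mono ennreal_leI) auto
    also have "\<dots> = ennreal (k * (b + k * (3 * (b / (3 * k)))))" using b k by (intro sum_enn) auto
    also have "k * (b + k * (3 * (b / (3 * k)))) = 2 * k * b" using k by simp
    finally have "S_sp \<sigma> p l \<le> 2 * k * b" unfolding GS using b k by (subst (asm) ennreal_le_iff) auto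
    hence "S_sp \<sigma> p l powr (1/p) \<le> (2 * k * b) powr (1/p)" using S0 p by (intro powr_mono2) auto
    also have "\<dots> = (2 * k) powr (1/p) * (2 * A)" using A p k by (simp add: b_def powr_mult powr_powr)
    finally show "S_sp \<sigma> p l powr (1/p) \<le> (2 * 2 powr p) powr (1/p) * (2 * A)" by (simp add: k_def)
  }
  {
    fix A :: real and N0 assume A: "A > 0" and le: "\<And>N. N \<ge> N0 \<Longrightarrow> A \<le> Lp_norm p (qsum (osc_coeff \<sigma> l) {1..N})"
    define b where "b = (2 * A) powr p"
    have b: "b > 0" using A by (simp add: b_def)
    \<comment> \<open>This e makes the error k * k * 3e equal to b/2, which is absorbed on the
      left.\<close>
    define e where "e = b / (6 * k^2)"
    have e: "e > 0" using b k by (simp add: e_def)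
    obtain N where N: "N \<ge> N0" "a N \<le> ennreal e" using small[OF e, of N0] by auto
    have "b \<le> (2 * L N) powr p" unfolding b_def L_def using le[OF N(1)] p A by (intro powr_mono2) auto
    hence "ennreal b \<le> ennreal ((2 * L N) powr p)" by (rule ennreal_leI)
    also have "\<dots> \<le> ennreal k * (ennreal (S_sp \<sigma> p l) + ennreal k * (3 * ennreal e))"
      using N(2) unfolding GS[symmetric] by (intro order.trans[OF cmp(2)[of N]] mult_left_mono add_mono) auto
    also have "\<dots> = ennreal (k * (S_sp \<sigma> p l + k * (3 * e)))" using S0 e by (intro sum_enn) auto
    finally have "b \<le> k * (S_sp \<sigma> p l + k * (3 * e))" using S0 e k by (subst (asm) ennreal_le_iff) auto
    also have "\<dots> = k * S_sp \<sigma> p l + b / 2" using k by (simp add: e_def power2_eq_square field_simps)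
    finally have "b \<le> 2 * k * S_sp \<sigma> p l" by simp
    hence "b powr (1/p) \<le> (2 * k * S_sp \<sigma> p l) powr (1/p)" using b p by (intro powr_mono2) auto
    also have "\<dots> = (2 * k) powr (1/p) * S_sp \<sigma> p l powr (1/p)" using k S0 by (simp add: powr_mult)
    also have "b powr (1/p) = 2 * A" using A p by (simp add: b_def powr_powr)
    finally show "2 * A \<le> (2 * 2 powr p) powr (1/p) * S_sp \<sigma> p l powr (1/p)" by (simp add: k_def)
  }
qed

section \<open>From bounds uniform in N to the asymptotic relations\<close>

definition osc_le :: "real \<Rightarrow> real \<Rightarrow> (real \<Rightarrow> real) \<Rightarrow> bool" where
  "osc_le \<sigma> p h \<longleftrightarrow> (\<exists>C>0. \<exists>l0>0. \<forall>l N. 0 < l \<longrightarrow> l \<le> l0 \<longrightarrow> 1/l \<le> real N \<longrightarrow> Lp_norm p (qsum (osc_coeff \<sigma> l) {1..N}) \<le> C * h l)"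

definition osc_ge :: "real \<Rightarrow> real \<Rightarrow> (real \<Rightarrow> real) \<Rightarrow> bool" where
  "osc_ge \<sigma> p h \<longleftrightarrow> (\<exists>c>0. \<exists>l0>0. \<forall>l N. 0 < l \<longrightarrow> l \<le> l0 \<longrightarrow> 1/l \<le> real N \<longrightarrow> c * h l \<le> Lp_norm p (qsum (osc_coeff \<sigma> l) {1..N}))"

lemma osc_le_imp_lesssim:
  assumes ex: "\<exists>f. is_Rs \<sigma> p f" and p: "p > 0" and h: "\<And>l. 0 < l \<Longrightarrow> l \<le> 1/4 \<Longrightarrow> h l > 0" and le: "osc_le \<sigma> p h"
  shows "lesssim0 (\<lambda>l. S_sp \<sigma> p l powr (1/p)) h"
proof -
  obtain C l0 where C: "C > 0" "l0 > 0" "\<And>l N. 0 < l \<Longrightarrow> l \<le> l0 \<Longrightarrow> 1/l \<le> real N \<Longrightarrow> Lp_norm p (qsum (osc_coeff \<sigma> l) {1..N}) \<le> C * h l"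
    using le unfolding osc_le_def by blast
  define K where "K = (2 * 2 powr p) powr (1/p) * 2 * C"
  have "K > 0" using C by (simp add: K_def)
  moreover have "\<forall>\<^sub>F l in at_right 0. S_sp \<sigma> p l powr (1/p) \<le> K * h l"
    unfolding eventually_at_right_field
  proof (intro exI[of _ "min l0 (1/4)"] conjI allI impI)
    fix l :: real assume l: "0 < l" "l < min l0 (1/4)"
    have hl: "h l > 0" using l by (intro h) auto
    have "S_sp \<sigma> p l powr (1/p) \<le> (2 * 2 powr p) powr (1/p) * (2 * (C * h l))"
    proof (rule S_sp_upper[OF ex p, where ?N0.0 = "nat \<lceil>1/l\<rceil>"])
      fix N assume "nat \<lceil>1/l\<rceil> \<le> N"
      hence "1/l \<le> real N" by linarith
      thus "Lp_norm p (qsum (osc_coeff \<sigma> l) {1..N}) \<le> C * h l" using l by (intro C) auto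
    qed (use l C hl in auto)
    thus "S_sp \<sigma> p l powr (1/p) \<le> K * h l" by (simp add: K_def mult_ac)
  qed (use C in auto)
  ultimately show ?thesis unfolding lesssim0_def by blast
qed

lemma osc_ge_imp_lesssim:
  assumes ex: "\<exists>f. is_Rs \<sigma> p f" and p: "p > 0" and h: "\<And>l. 0 < l \<Longrightarrow> l \<le> 1/4 \<Longrightarrow> h l > 0" and ge: "osc_ge \<sigma> p h"
  shows "lesssim0 h (\<lambda>l. S_sp \<sigma> p l powr (1/p))"
proof -
  obtain c l0 where c: "c > 0" "l0 > 0" "\<And>l N. 0 < l \<Longrightarrow> l \<le> l0 \<Longrightarrow> 1/l \<le> real N \<Longrightarrow> c * h l \<le> Lp_norm p (qsum (osc_coeff \<sigma> l) {1..N})"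
    using ge unfolding osc_ge_def by blast
  define K where "K = (2 * 2 powr p) powr (1/p) / (2 * c)"
  have "K > 0" using c by (simp add: K_def)
  moreover have "\<forall>\<^sub>F l in at_right 0. h l \<le> K * S_sp \<sigma> p l powr (1/p)"
    unfolding eventually_at_right_field
  proof (intro exI[of _ "min l0 (1/4)"] conjI allI impI)
    fix l :: real assume l: "0 < l" "l < min l0 (1/4)"
    have hl: "h l > 0" using l by (intro h) auto
    have "2 * (c * h l) \<le> (2 * 2 powr p) powr (1/p) * S_sp \<sigma> p l powr (1/p)"
    proof (rule S_sp_lower[OF ex p, where ?N0.0 = "nat \<lceil>1/l\<rceil>"])
      fix N assume "nat \<lceil>1/l\<rceil> \<le> N"
      hence "1/l \<le> real N" by linarith
      thus "c * h l \<le> Lp_norm p (qsum (osc_coeff \<sigma> l) {1..N})" using l by (intro c) auto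
    qed (use l c hl in auto)
    thus "h l \<le> K * S_sp \<sigma> p l powr (1/p)" using c by (simp add: K_def field_simps)
  qed (use c in auto)
  ultimately show ?thesis unfolding lesssim0_def by blast
qed

lemma ln_inverse_pos: "0 < l \<Longrightarrow> l \<le> 1/4 \<Longrightarrow> 0 < ln (1/l)" for l :: real
  using ln_inverse_ge_1[of l] by linarith

lemma upper_size_pos: "0 < l \<Longrightarrow> l \<le> 1/4 \<Longrightarrow> 0 < upper_size \<sigma> p l"
  using ln_inverse_pos[of l] by (simp add: upper_size_def)

text \<open>Working at an exponent q \<ge> p covers p \<le> 2, and lets q = 4 with its logarithm be
  bypassed by a larger q.\<close>

lemma osc_le_upper_size:
  assumes p: "0 < p" "p \<le> q" and q: "q > 2" and s: "weyl_exp q < 2 * \<sigma>" and d4: "2 - 2*\<sigma> + weyl_exp q < 0 \<Longrightarrow> q \<noteq> 4"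
  shows "osc_le \<sigma> p (upper_size \<sigma> q)"
proof -
  obtain C where C: "C > 0" "\<And>l N. 0 < l \<Longrightarrow> l \<le> 1/4 \<Longrightarrow> 1/l \<le> real N \<Longrightarrow>
     Lp_norm q (qsum (osc_coeff \<sigma> l) {1..N}) \<le> C * upper_size \<sigma> q l" using osc_upper[OF q s d4] by blast
  have "Lp_norm p (qsum (osc_coeff \<sigma> l) {1..N}) \<le> (2 powr (1/p) * C) * upper_size \<sigma> q l" if l: "0 < l" "l \<le> 1/4" "1/l \<le> real N" for l N
    using Lp_norm_mono_exponent[OF p continuous_qsum _ C(2)[OF l]] C(1) upper_size_pos[OF l(1,2), of \<sigma> q] by (simp add: mult_ac)
  thus ?thesis unfolding osc_le_def using C(1) by (intro exI[of _ "2 powr (1/p) * C"] conjI exI[of _ "1/4"]) auto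
qed

lemma osc_le_cong:
  assumes "osc_le \<sigma> p h" "\<And>l. 0 < l \<Longrightarrow> l \<le> 1/4 \<Longrightarrow> h l = h' l" shows "osc_le \<sigma> p h'"
proof -
  obtain C l0 where C: "C > 0" "l0 > 0" "\<And>l N. 0 < l \<Longrightarrow> l \<le> l0 \<Longrightarrow> 1/l \<le> real N \<Longrightarrow> Lp_norm p (qsum (osc_coeff \<sigma> l) {1..N}) \<le> C * h l"
    using assms(1) unfolding osc_le_def by blast
  have "Lp_norm p (qsum (osc_coeff \<sigma> l) {1..N}) \<le> C * h' l" if l: "0 < l" "l \<le> min l0 (1/4)" "1/l \<le> real N" for l N
    using C(3)[of l N] assms(2)[of l] l by simp
  moreover have "min l0 (1/4) > 0" using C(2) by simp
  ultimately show ?thesis unfolding osc_le_def using C(1) by blast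
qed

text \<open>For p \<ge> 2 truncation suffices. For p < 2 the mass of |f|^2 might sit on a small set;
  an upper bound of the same order for the 3-norm excludes this.\<close>

lemma osc_ge_of_L2:
  assumes p: "p > 0" and h: "\<And>l. 0 < l \<Longrightarrow> l \<le> 1/4 \<Longrightarrow> h l > 0" and le3: "osc_le \<sigma> 3 h"
    and c: "c > 0" and L2: "\<And>l N. 0 < l \<Longrightarrow> l \<le> 1/64 \<Longrightarrow> 1/l \<le> real N \<Longrightarrow> (c * h l)^2 \<le> integral {0..1} (\<lambda>x. (cmod (qsum (osc_coeff \<sigma> l) {1..N} x))^2)"
  shows "osc_ge \<sigma> p h"
proof -
  obtain C l0 where C: "C > 0" "l0 > 0" "\<And>l N. 0 < l \<Longrightarrow> l \<le> l0 \<Longrightarrow> 1/l \<le> real N \<Longrightarrow> Lp_norm 3 (qsum (osc_coeff \<sigma> l) {1..N}) \<le> C * h l"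
    using le3 unfolding osc_le_def by blast
  show ?thesis
  proof (cases "p \<ge> 2")
    case True
    have "c/2 * h l \<le> Lp_norm p (qsum (osc_coeff \<sigma> l) {1..N})" if l: "0 < l" "l \<le> 1/64" "1/l \<le> real N" for l N
      using Lp_norm_ge_L2[OF True continuous_qsum _ L2[OF l]] c h[of l] l by simp
    thus ?thesis unfolding osc_ge_def using c by (intro exI[of _ "c/2"] conjI exI[of _ "1/64"]) auto
  next
    case False
    define K where "K = C / c"
    have K: "K > 0" using C c by (simp add: K_def)
    obtain c' where c': "c' > 0" "\<And>f A. continuous_on UNIV f \<Longrightarrow> A > 0 \<Longrightarrow> A^2 \<le> integral {0..1} (\<lambda>x. (cmod (f x))^2)
     \<Longrightarrow> Lp_norm 3 f \<le> K * A \<Longrightarrow> c' * A \<le> Lp_norm p f"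
      using Lp_norm_ge_L2_interpolation[OF p _ K] False by (metis not_le)
    have "(c' * c) * h l \<le> Lp_norm p (qsum (osc_coeff \<sigma> l) {1..N})" if l: "0 < l" "l \<le> min l0 (1/64)" "1/l \<le> real N" for l N
    proof -
      have "c' * (c * h l) \<le> Lp_norm p (qsum (osc_coeff \<sigma> l) {1..N})"
      proof (rule c'(2)[OF continuous_qsum])
        show "c * h l > 0" using c h[of l] l by simp
        show "(c * h l)^2 \<le> integral {0..1} (\<lambda>x. (cmod (qsum (osc_coeff \<sigma> l) {1..N} x))^2)" using l by (intro L2) auto
        show "Lp_norm 3 (qsum (osc_coeff \<sigma> l) {1..N}) \<le> K * (c * h l)" using C(3)[of l N] l c by (simp add: K_def)
      qed
      thus ?thesis by (simp add: mult_ac)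
    qed
    thus ?thesis unfolding osc_ge_def using c' c C by (intro exI[of _ "c' * c"] conjI exI[of _ "min l0 (1/64)"]) auto
  qed
qed

lemma osc_ge_fejer:
  assumes "p > 1" shows "osc_ge \<sigma> p (\<lambda>l. l powr (\<sigma> + 1/p - 1/2))"
proof -
  have "(1/64::real) > 0" by simp
  thus ?thesis using osc_fejer_lower[OF assms, of \<sigma>] unfolding osc_ge_def by blast
qed

lemma upper_size_3:
  assumes "0 < l" "l \<le> 1/4"
  shows "\<sigma> < 5/4 \<Longrightarrow> upper_size \<sigma> 3 l = l powr (\<sigma> - 1/4)"
    and "\<sigma> = 5/4 \<Longrightarrow> upper_size \<sigma> 3 l = l * ln (1/l) powr (1/2)"
    and "\<sigma> > 5/4 \<Longrightarrow> upper_size \<sigma> 3 l = l"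
  using ln_inverse_pos[OF assms] by (auto simp: upper_size_def weyl_exp_def weyl_log_def)

lemma osc_le_3:
  assumes "\<sigma> > 1/4"
  shows "\<sigma> < 5/4 \<Longrightarrow> osc_le \<sigma> 3 (\<lambda>l. l powr (\<sigma> - 1/4))"
    and "\<sigma> = 5/4 \<Longrightarrow> osc_le \<sigma> 3 (\<lambda>l. l * ln (1/l) powr (1/2))"
    and "\<sigma> > 5/4 \<Longrightarrow> osc_le \<sigma> 3 (\<lambda>l. l)"
proof -
  have "osc_le \<sigma> 3 (upper_size \<sigma> 3)" using assms by (intro osc_le_upper_size) (auto simp: weyl_exp_def)
  from osc_le_cong[OF this] show "\<sigma> < 5/4 \<Longrightarrow> osc_le \<sigma> 3 (\<lambda>l. l powr (\<sigma> - 1/4))"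
    "\<sigma> = 5/4 \<Longrightarrow> osc_le \<sigma> 3 (\<lambda>l. l * ln (1/l) powr (1/2))" "\<sigma> > 5/4 \<Longrightarrow> osc_le \<sigma> 3 (\<lambda>l. l)"
    using upper_size_3 by simp_all
qed

lemma osc_ge_L2:
  assumes s: "\<sigma> > 1/4" and p: "p > 0"
  shows "\<sigma> < 5/4 \<Longrightarrow> osc_ge \<sigma> p (\<lambda>l. l powr (\<sigma> - 1/4))"
    and "\<sigma> = 5/4 \<Longrightarrow> osc_ge \<sigma> p (\<lambda>l. l * ln (1/l) powr (1/2))"
    and "\<sigma> > 5/4 \<Longrightarrow> osc_ge \<sigma> p (\<lambda>l. l)"
proof -
  obtain c where c: "c > 0" "\<And>l N. 0 < l \<Longrightarrow> l \<le> 1/64 \<Longrightarrow> 1/l \<le> real N \<Longrightarrow>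
     (c * l powr (\<sigma> - 1/4))^2 \<le> integral {0..1} (\<lambda>x. (cmod (qsum (osc_coeff \<sigma> l) {1..N} x))^2)"
    using osc_L2_lower[of \<sigma>] by blast
  show "osc_ge \<sigma> p (\<lambda>l. l powr (\<sigma> - 1/4))" if "\<sigma> < 5/4"
    using osc_le_3(1)[OF s that] c by (intro osc_ge_of_L2[OF p]) auto
  show "osc_ge \<sigma> p (\<lambda>l. l * ln (1/l) powr (1/2))" if "\<sigma> = 5/4"
  proof (rule osc_ge_of_L2[OF p, where c = 1])
    show "osc_le \<sigma> 3 (\<lambda>l. l * ln (1/l) powr (1/2))" using osc_le_3(2)[OF s that] .
    show "0 < l * ln (1/l) powr (1/2)" if "0 < l" "l \<le> 1/4" for l :: real using ln_inverse_pos[OF that] that by simp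
    show "(1 * (l * ln (1/l) powr (1/2)))^2 \<le> integral {0..1} (\<lambda>x. (cmod (qsum (osc_coeff \<sigma> l) {1..N} x))^2)"
      if "0 < l" "l \<le> 1/64" "1/l \<le> real N" for l N
      using osc_L2_lower_log[OF that] unfolding \<open>\<sigma> = 5/4\<close> by (simp only: mult_1)
  qed simp
  show "osc_ge \<sigma> p (\<lambda>l. l)" if "\<sigma> > 5/4"
    using osc_le_3(3)[OF s that] osc_L2_lower_trivial[of _ _ \<sigma>] by (intro osc_ge_of_L2[OF p, where c = 1]) auto
qed

section \<open>The choice of exponents in each range of smoothness\<close>

theorem theorem6p1:
  fixes \<sigma> p :: real
  assumes "p > 0"
    and "p \<le> 4 \<Longrightarrow> \<sigma> > 1/4"
    and "p > 4 \<Longrightarrow> \<sigma> > 1/2 - 1/p"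
  shows
   "(\<sigma> < 5/4 \<longrightarrow>
      (p < 4 \<longrightarrow> simeq0 (\<lambda>l. S_sp \<sigma> p l powr (1/p)) (\<lambda>l. l powr (\<sigma> - 1/4))) \<and>
      (p = 4 \<longrightarrow> simeq0 (\<lambda>l. S_sp \<sigma> p l powr (1/p)) (\<lambda>l. l powr (\<sigma> - 1/4) * ln (1/l) powr (1/4))) \<and>
      (p > 4 \<longrightarrow> simeq0 (\<lambda>l. S_sp \<sigma> p l powr (1/p)) (\<lambda>l. l powr (\<sigma> + 1/p - 1/2)))) \<and>
    (\<sigma> = 5/4 \<longrightarrow>
      (p < 4 \<longrightarrow> simeq0 (\<lambda>l. S_sp \<sigma> p l powr (1/p)) (\<lambda>l. l * ln (1/l) powr (1/2))) \<and>
      (p > 4 \<longrightarrow> simeq0 (\<lambda>l. S_sp \<sigma> p l powr (1/p)) (\<lambda>l. l powr (3/4 + 1/p))) \<and>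
      (p = 4 \<longrightarrow> lesssim0 (\<lambda>l. l * ln (1/l) powr (1/2)) (\<lambda>l. S_sp \<sigma> p l powr (1/p)) \<and>
                 lesssim0 (\<lambda>l. S_sp \<sigma> p l powr (1/p)) (\<lambda>l. l * ln (1/l) powr (3/4)))) \<and>
    (5/4 < \<sigma> \<and> \<sigma> < 3/2 \<longrightarrow>
      (p < 2/(3 - 2*\<sigma>) \<longrightarrow> simeq0 (\<lambda>l. S_sp \<sigma> p l powr (1/p)) (\<lambda>l. l)) \<and>
      (p > 2/(3 - 2*\<sigma>) \<longrightarrow> simeq0 (\<lambda>l. S_sp \<sigma> p l powr (1/p)) (\<lambda>l. l powr (\<sigma> + 1/p - 1/2))) \<and>
      (p = 2/(3 - 2*\<sigma>) \<longrightarrow> lesssim0 (\<lambda>l. l) (\<lambda>l. S_sp \<sigma> p l powr (1/p)) \<and>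
                 lesssim0 (\<lambda>l. S_sp \<sigma> p l powr (1/p)) (\<lambda>l. l * ln (1/l) powr (1/2))) \<and>
      ((p = 2/(3 - 2*\<sigma>) \<and> (\<exists>k::nat. p = real (2*k))) \<longrightarrow>
                 lesssim0 (\<lambda>l. l * ln (1/l) powr (1/p)) (\<lambda>l. S_sp \<sigma> p l powr (1/p)))) \<and>
    (\<sigma> \<ge> 3/2 \<longrightarrow> simeq0 (\<lambda>l. S_sp \<sigma> p l powr (1/p)) (\<lambda>l. l))"
proof -
  note p = assms(1)
  have s14: "\<sigma> > 1/4"
  proof (cases "p \<le> 4")
    case False
    hence "1/p < 1/4" by (simp add: field_simps)
    thus ?thesis using assms(3) False by linarith
  qed (use assms(2) in simp)
  \<comment> \<open>All p < 3 are handled at exponent 3, which has the same \<open>weyl_exp\<close>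
    and no logarithm; from 3 on p itself is used.\<close>
  have wq: "weyl_exp (max p 3) < 2 * \<sigma>"
    using assms(2,3) s14 by (cases "p \<le> 4") (auto simp: weyl_exp_def max_def)
  have ex: "\<exists>f. is_Rs \<sigma> p f" using p wq by (intro is_Rs_exists[of p "max p 3"]) auto
  have w4: "weyl_exp q = 1 - 2/q" "weyl_log q = 0" if "q > 4" for q using that by (auto simp: weyl_exp_def weyl_log_def)
  have lnpos: "0 < ln (1/l)" if "0 < l" "l \<le> 1/4" for l :: real using that by (rule ln_inverse_pos)
  note up = osc_le_imp_lesssim[OF ex p] and lo = osc_ge_imp_lesssim[OF ex p]
  have posA: "0 < l powr e * ln (1/l) powr e'" "0 < l * ln (1/l) powr e'" "0 < l powr e" if "0 < l" "l \<le> 1/4" for l e e' :: real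
    using lnpos[OF that] that by auto
  have sim: "simeq0 (\<lambda>l. S_sp \<sigma> p l powr (1/p)) h" if "\<And>l. 0 < l \<Longrightarrow> l \<le> 1/4 \<Longrightarrow> h l > 0" "osc_le \<sigma> p h" "osc_ge \<sigma> p h" for h
    unfolding simeq0_def using up[OF that(1,2)] lo[OF that(1,3)] by blast
  have big: "osc_le \<sigma> p (\<lambda>l. l powr (\<sigma> + 1/p - 1/2))" if p4: "p > 4" and d: "2/p < 3 - 2*\<sigma>"
  proof (rule osc_le_cong[OF osc_le_upper_size[of p p]])
    fix l :: real assume l: "0 < l" "l \<le> 1/4"
    have e: "\<sigma> - (1 - 2/p)/2 = \<sigma> + 1/p - 1/2" by (simp add: diff_divide_distrib)
    have "2 - 2*\<sigma> + (1 - 2/p) > 0" using d by simp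
    thus "upper_size \<sigma> p l = l powr (\<sigma> + 1/p - 1/2)"
      unfolding upper_size_def w4[OF p4] e using lnpos[OF l] by simp
  qed (use p4 d wq w4[OF p4] in \<open>auto simp: max_def\<close>)
  have crit: "osc_le \<sigma> p (\<lambda>l. l * ln (1/l) powr (1/2))" if p4: "p > 4" and d: "2/p = 3 - 2*\<sigma>"
  proof (rule osc_le_cong[OF osc_le_upper_size[of p p]])
    fix l :: real assume l: "0 < l" "l \<le> 1/4"
    have "2 - 2*\<sigma> + (1 - 2/p) = 0" using d by simp
    thus "upper_size \<sigma> p l = l * ln (1/l) powr (1/2)" unfolding upper_size_def w4[OF p4] by simp
  qed (use p4 wq in \<open>auto simp: max_def\<close>)
  \<comment> \<open>Below the critical exponent the bound l is obtained at some q > 4, where no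
    logarithmic factor occurs; this covers p = 4 as well.\<close>
  have sub: "osc_le \<sigma> p (\<lambda>l. l)" if q: "p \<le> q" "q > 4" "2/q > 3 - 2*\<sigma>" and s: "\<sigma> > 1/2" for q
  proof (rule osc_le_cong[OF osc_le_upper_size[of p q]])
    fix l :: real assume l: "0 < l" "l \<le> 1/4"
    have "2 - 2*\<sigma> + (1 - 2/q) < 0" using q by simp
    thus "upper_size \<sigma> q l = l" unfolding upper_size_def w4[OF q(2)] by simp
  next
    have "2/q > 0" using q(2) by simp
    thus "weyl_exp q < 2 * \<sigma>" unfolding w4[OF q(2)] using s by linarith
  qed (use p q in auto)
  have small: "osc_le \<sigma> p (upper_size \<sigma> (max p 3))" if "p < 4"
    using p wq that by (intro osc_le_upper_size) (auto simp: max_def)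
  have w3: "weyl_exp (max p 3) = 1/2" "weyl_log (max p 3) = 0" if "p < 4"
    using that by (auto simp: weyl_exp_def weyl_log_def max_def)
  have le1: "osc_le \<sigma> p (\<lambda>l. l powr (\<sigma> - 1/4))" if "\<sigma> < 5/4" "p < 4"
    using osc_le_cong[OF small[OF that(2)]] w3[OF that(2)] that(1) lnpos by (force simp: upper_size_def)
  have le2: "osc_le \<sigma> p (\<lambda>l. l * ln (1/l) powr (1/2))" if "\<sigma> = 5/4" "p < 4"
    using osc_le_cong[OF small[OF that(2)]] w3[OF that(2)] that(1) by (force simp: upper_size_def)
  have w44: "weyl_exp 4 = 1/2" "weyl_log 4 = 1/4" by (auto simp: weyl_exp_def weyl_log_def)
  have four: "osc_le \<sigma> p (upper_size \<sigma> 4)" if "p = 4" "\<sigma> \<le> 5/4"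
    using that s14 by (intro osc_le_upper_size) (auto simp: w44)
  have le3: "osc_le \<sigma> p (\<lambda>l. l powr (\<sigma> - 1/4) * ln (1/l) powr (1/4))" if "\<sigma> < 5/4" "p = 4"
    using osc_le_cong[OF four] that by (force simp: upper_size_def w44)
  have le4: "osc_le \<sigma> p (\<lambda>l. l * ln (1/l) powr (3/4))" if "\<sigma> = 5/4" "p = 4"
    using osc_le_cong[OF four] that by (force simp: upper_size_def w44)
  have ge4: "osc_ge \<sigma> p (\<lambda>l. l powr (\<sigma> - 1/4) * ln (1/l) powr (1/4))" if "p = 4"
    using osc_L4_lower[of \<sigma>] unfolding osc_ge_def that .
  have inv4: "2/p < 1/2" if "p > 4" using that by (simp add: field_simps)

  have A: "\<sigma> < 5/4 \<longrightarrow>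
      (p < 4 \<longrightarrow> simeq0 (\<lambda>l. S_sp \<sigma> p l powr (1/p)) (\<lambda>l. l powr (\<sigma> - 1/4))) \<and>
      (p = 4 \<longrightarrow> simeq0 (\<lambda>l. S_sp \<sigma> p l powr (1/p)) (\<lambda>l. l powr (\<sigma> - 1/4) * ln (1/l) powr (1/4))) \<and>
      (p > 4 \<longrightarrow> simeq0 (\<lambda>l. S_sp \<sigma> p l powr (1/p)) (\<lambda>l. l powr (\<sigma> + 1/p - 1/2)))"
  proof (intro impI conjI)
    assume s: "\<sigma> < 5/4"
    show "simeq0 (\<lambda>l. S_sp \<sigma> p l powr (1/p)) (\<lambda>l. l powr (\<sigma> - 1/4))" if "p < 4"
      by (rule sim[OF posA(3) le1[OF s that] osc_ge_L2(1)[OF s14 p s]])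
    show "simeq0 (\<lambda>l. S_sp \<sigma> p l powr (1/p)) (\<lambda>l. l powr (\<sigma> - 1/4) * ln (1/l) powr (1/4))" if "p = 4"
      by (rule sim[OF posA(1) le3[OF s that] ge4[OF that]])
    show "simeq0 (\<lambda>l. S_sp \<sigma> p l powr (1/p)) (\<lambda>l. l powr (\<sigma> + 1/p - 1/2))" if p4: "p > 4"
    proof (rule sim[OF posA(3) big[OF p4] osc_ge_fejer])
      show "2/p < 3 - 2*\<sigma>" using inv4[OF p4] s by linarith
    qed (use p4 in auto)
  qed
  have B: "\<sigma> = 5/4 \<longrightarrow>
      (p < 4 \<longrightarrow> simeq0 (\<lambda>l. S_sp \<sigma> p l powr (1/p)) (\<lambda>l. l * ln (1/l) powr (1/2))) \<and>
      (p > 4 \<longrightarrow> simeq0 (\<lambda>l. S_sp \<sigma> p l powr (1/p)) (\<lambda>l. l powr (3/4 + 1/p))) \<and>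
      (p = 4 \<longrightarrow> lesssim0 (\<lambda>l. l * ln (1/l) powr (1/2)) (\<lambda>l. S_sp \<sigma> p l powr (1/p)) \<and>
                 lesssim0 (\<lambda>l. S_sp \<sigma> p l powr (1/p)) (\<lambda>l. l * ln (1/l) powr (3/4)))"
  proof (intro impI conjI)
    assume s: "\<sigma> = 5/4"
    show "simeq0 (\<lambda>l. S_sp \<sigma> p l powr (1/p)) (\<lambda>l. l * ln (1/l) powr (1/2))" if "p < 4"
      by (rule sim[OF posA(2) le2[OF s that] osc_ge_L2(2)[OF s14 p s]])
    show "simeq0 (\<lambda>l. S_sp \<sigma> p l powr (1/p)) (\<lambda>l. l powr (3/4 + 1/p))" if p4: "p > 4"
    proof -
      have "simeq0 (\<lambda>l. S_sp \<sigma> p l powr (1/p)) (\<lambda>l. l powr (\<sigma> + 1/p - 1/2))"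
      proof (rule sim[OF posA(3) big[OF p4] osc_ge_fejer])
        show "2/p < 3 - 2*\<sigma>" using inv4[OF p4] s by linarith
      qed (use p4 in auto)
      moreover have "\<sigma> + 1/p - 1/2 = 3/4 + 1/p" using s by simp
      ultimately show ?thesis by simp
    qed
    show "lesssim0 (\<lambda>l. l * ln (1/l) powr (1/2)) (\<lambda>l. S_sp \<sigma> p l powr (1/p))"
      by (rule lo[OF posA(2) osc_ge_L2(2)[OF s14 p s]])
    show "lesssim0 (\<lambda>l. S_sp \<sigma> p l powr (1/p)) (\<lambda>l. l * ln (1/l) powr (3/4))" if "p = 4"
      by (rule up[OF posA(2) le4[OF s that]])
  qed
  have C: "5/4 < \<sigma> \<and> \<sigma> < 3/2 \<longrightarrow>
      (p < 2/(3 - 2*\<sigma>) \<longrightarrow> simeq0 (\<lambda>l. S_sp \<sigma> p l powr (1/p)) (\<lambda>l. l)) \<and>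
      (p > 2/(3 - 2*\<sigma>) \<longrightarrow> simeq0 (\<lambda>l. S_sp \<sigma> p l powr (1/p)) (\<lambda>l. l powr (\<sigma> + 1/p - 1/2))) \<and>
      (p = 2/(3 - 2*\<sigma>) \<longrightarrow> lesssim0 (\<lambda>l. l) (\<lambda>l. S_sp \<sigma> p l powr (1/p)) \<and>
                 lesssim0 (\<lambda>l. S_sp \<sigma> p l powr (1/p)) (\<lambda>l. l * ln (1/l) powr (1/2))) \<and>
      ((p = 2/(3 - 2*\<sigma>) \<and> (\<exists>k::nat. p = real (2*k))) \<longrightarrow>
                 lesssim0 (\<lambda>l. l * ln (1/l) powr (1/p)) (\<lambda>l. S_sp \<sigma> p l powr (1/p)))"
  proof (intro impI conjI)
    assume s: "5/4 < \<sigma> \<and> \<sigma> < 3/2"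
    \<comment> \<open>The exponent at which 2 - 2\<sigma> + (1 - 2/p) vanishes; it exceeds 4 because
      \<sigma> > 5/4.\<close>
    define Pc where "Pc = 2/(3 - 2*\<sigma>)"
    have t: "0 < 3 - 2*\<sigma>" "3 - 2*\<sigma> < 1/2" using s by auto
    have Pc: "Pc > 4" "2/Pc = 3 - 2*\<sigma>" using t by (auto simp: Pc_def field_simps)
    have s54: "\<sigma> > 5/4" using s by simp
    have ge1: "osc_ge \<sigma> p (\<lambda>l. l)" by (rule osc_ge_L2(3)[OF s14 p s54])
    show "simeq0 (\<lambda>l. S_sp \<sigma> p l powr (1/p)) (\<lambda>l. l)" if "p < 2/(3 - 2*\<sigma>)"
    proof -
      \<comment> \<open>Strictly between 4 and Pc, and at least p.\<close>
      define q where "q = max p ((4 + Pc)/2)"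
      have q: "p \<le> q" "q > 4" "q < Pc" using that Pc(1) by (auto simp: q_def less_max_iff_disj Pc_def[symmetric])
      have "2/Pc < 2/q" using q Pc(1) by (intro divide_strict_left_mono) auto
      hence "3 - 2*\<sigma> < 2/q" using Pc(2) by simp
      thus ?thesis using sub[OF q(1,2)] s ge1 by (intro sim) auto
    qed
    show "simeq0 (\<lambda>l. S_sp \<sigma> p l powr (1/p)) (\<lambda>l. l powr (\<sigma> + 1/p - 1/2))" if "p > 2/(3 - 2*\<sigma>)"
    proof -
      have pq: "p > Pc" using that by (simp add: Pc_def)
      have p4: "p > 4" using pq Pc(1) by linarith
      have "2/p < 2/Pc" using pq Pc(1) by (intro divide_strict_left_mono) auto
      hence "2/p < 3 - 2*\<sigma>" using Pc(2) by simp
      thus ?thesis using p4 by (intro sim[OF posA(3) big[OF p4] osc_ge_fejer]) auto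
    qed
    show "lesssim0 (\<lambda>l. l) (\<lambda>l. S_sp \<sigma> p l powr (1/p))" by (rule lo[OF _ ge1])
    show "lesssim0 (\<lambda>l. S_sp \<sigma> p l powr (1/p)) (\<lambda>l. l * ln (1/l) powr (1/2))" if "p = 2/(3 - 2*\<sigma>)"
      using Pc that by (intro up[OF posA(2) crit]) (auto simp: Pc_def)
    show "lesssim0 (\<lambda>l. l * ln (1/l) powr (1/p)) (\<lambda>l. S_sp \<sigma> p l powr (1/p))"
      if ev: "p = 2/(3 - 2*\<sigma>) \<and> (\<exists>k::nat. p = real (2*k))"
    proof -
      obtain k :: nat where k: "p = real (2*k)" using ev by blast
      have k0: "k > 0" using k p by (cases k) auto
      have "2/p = 3 - 2*\<sigma>" using ev Pc(2) by (simp add: Pc_def)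
      hence e: "2 - 2*\<sigma> = 1 / real k - 1" using k by simp
      have ge: "osc_ge \<sigma> p (\<lambda>l. l * ln (1/l) powr (1/p))"
        unfolding osc_ge_def k by (rule osc_even_lower[OF k0 e])
      show ?thesis by (rule lo[OF posA(2) ge])
    qed
  qed
  have D: "\<sigma> \<ge> 3/2 \<longrightarrow> simeq0 (\<lambda>l. S_sp \<sigma> p l powr (1/p)) (\<lambda>l. l)"
  proof
    assume s: "\<sigma> \<ge> 3/2"
    have "osc_le \<sigma> p (\<lambda>l. l)"
    \<comment> \<open>Here 3 - 2\<sigma> \<le> 0, so every exponent above 4 is subcritical; 5 is one
      of them.\<close>
    proof (rule sub[of "max p 5"])
      have "2 / max p 5 > 0" by simp
      thus "3 - 2*\<sigma> < 2 / max p 5" using s by linarith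
    qed (use s in auto)
    thus "simeq0 (\<lambda>l. S_sp \<sigma> p l powr (1/p)) (\<lambda>l. l)" using s osc_ge_L2(3)[OF s14 p] by (intro sim) auto
  qed
  show ?thesis using A B C D by blast
qed

end
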